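(* Let $\Gamma=[0,\infty)$ or $\Gamma=(-\infty,0]$, let $p\ge2$ be an integer and let $s\in\mathbb R$ satisfy either ($p=2$ and $s>-\frac12$) or ($p\ge3$ and $s>\frac12-\frac1{2p-4}$). Let $u_0\in H^s_\Gamma(\mathbb R)$ and $u_1\in H^{s-1}_\Gamma(\mathbb R)$. Then, for either choice of sign, there is $T>0$ such that the Cauchy problem $$\partial_t^2u-\partial_x^2u=\pm u^p,\qquad u(x,0)=u_0(x),\quad\partial_tu(x,0)=u_1(x)$$ has a unique distributional solution $u\in\mathcal C([-T,T]:H^s_\Gamma(\mathbb R))\cap\mathcal C^1([-T,T]:H^{s-1}_\Gamma(\mathbb R))$. Moreover, the map $(u_0,u_1)\mapsto u$ is locally Lipschitz continuous.
   Context: Fourier transform $\widehat f(\xi)=\int e^{-2\pi i x\xi}f(x)\,dx$; $\langle\xi\rangle=(1+|\xi|^2)^{1/2}$; $H^s(\mathbb R)=\{f\in\mathcal S'(\mathbb R):\langle\xi\rangle^s\widehat f\in L^2\}$; $H^s_\Gamma(\mathbb R)=\{f\in H^s(\mathbb R):\operatorname{supp}\widehat f\subset\Gamma\}$. The power $u^p$ is understood (at each time $t$) as the $p$-fold Fourier product $\mathcal F^{-1}(\widehat u*\cdots*\widehat u)$, which is well defined for tempered distributions whose Fourier transforms are supported in $\Gamma$. A distributional solution satisfies the equation in the sense of distributions with this product. *)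

theory Defs
  imports "HOL-Analysis.Analysis"
begin

text \<open>Elements of H^s_Gamma(R) are represented by their Fourier transforms
  (Fourier convention: hat f(xi) = integral of exp(-2 pi i x xi) f(x) dx).
  A function F :: real => complex represents an element of H^s_Gamma iff it is
  Borel measurable, the weighted square integral with weight (1+xi^2)^s is finite,
  and F vanishes almost everywhere outside Gamma.\<close>

definition Hs :: "real \<Rightarrow> real set \<Rightarrow> (real \<Rightarrow> complex) set" where
  "Hs s \<Gamma> = {F. F \<in> borel_measurable lborel
      \<and> integrable lborel (\<lambda>\<xi>. (1 + \<xi>\<^sup>2) powr s * (cmod (F \<xi>))\<^sup>2)
      \<and> (AE \<xi> in lborel. \<xi> \<notin> \<Gamma> \<longrightarrow> F \<xi> = 0)}"

definition hsnorm :: "real \<Rightarrow> (real \<Rightarrow> complex) \<Rightarrow> real" where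
  "hsnorm s F = sqrt (LINT \<xi>|lborel. (1 + \<xi>\<^sup>2) powr s * (cmod (F \<xi>))\<^sup>2)"

definition conv :: "(real \<Rightarrow> complex) \<Rightarrow> (real \<Rightarrow> complex) \<Rightarrow> real \<Rightarrow> complex" where
  "conv F G \<xi> = (LINT \<eta>|lborel. F \<eta> * G (\<xi> - \<eta>))"

text \<open>conv_power F n is the (n+1)-fold convolution F * ... * F; hence the Fourier
  transform of u^p is conv_power (hat u) (p - 1).\<close>
primrec conv_power :: "(real \<Rightarrow> complex) \<Rightarrow> nat \<Rightarrow> real \<Rightarrow> complex" where
  "conv_power F 0 = F"
| "conv_power F (Suc n) = conv F (conv_power F n)"

text \<open>Inverse Fourier transform of a test function: the pairing of a distribution
  u with a test function psi is the integral of hat u(xi) times ift psi xi.\<close>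
definition ift :: "(real \<Rightarrow> real) \<Rightarrow> real \<Rightarrow> complex" where
  "ift \<psi> \<xi> = (LINT x|lborel. cis (2 * pi * x * \<xi>) * complex_of_real (\<psi> x))"

definition smooth_family :: "(real \<times> real \<Rightarrow> real) \<Rightarrow> (nat \<Rightarrow> nat \<Rightarrow> real \<times> real \<Rightarrow> real) \<Rightarrow> bool" where
  "smooth_family \<phi> D \<longleftrightarrow> D 0 0 = \<phi> \<and> (\<forall>i j. continuous_on UNIV (D i j))
     \<and> (\<forall>i j x t. ((\<lambda>y. D i j (y, t)) has_real_derivative D (Suc i) j (x, t)) (at x)
                 \<and> ((\<lambda>\<tau>. D i j (x, \<tau>)) has_real_derivative D i (Suc j) (x, t)) (at t))"

definition test_support :: "real \<Rightarrow> (real \<times> real \<Rightarrow> real) \<Rightarrow> bool" where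
  "test_support T \<phi> \<longleftrightarrow> compact (closure {z. \<phi> z \<noteq> 0})
      \<and> closure {z. \<phi> z \<noteq> 0} \<subseteq> UNIV \<times> {-T<..<T}"

text \<open>wave_sol Gamma p sigma s T u0 u1 U V: U t = hat(u(t)) is a distributional solution
  of u_tt - u_xx = sigma u^p on R x (-T,T), with u in C([-T,T]; H^s_Gamma),
  u in C^1([-T,T]; H^{s-1}_Gamma) with time derivative V t = hat(d_t u(t)),
  and initial data u(0) = u0, d_t u(0) = u1 (all on the Fourier side).\<close>
definition wave_sol :: "real set \<Rightarrow> nat \<Rightarrow> real \<Rightarrow> real \<Rightarrow> real \<Rightarrow> (real \<Rightarrow> complex) \<Rightarrow> (real \<Rightarrow> complex)
     \<Rightarrow> (real \<Rightarrow> real \<Rightarrow> complex) \<Rightarrow> (real \<Rightarrow> real \<Rightarrow> complex) \<Rightarrow> bool" where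
  "wave_sol \<Gamma> p \<sigma> s T u0 u1 U V \<longleftrightarrow>
     (\<forall>t\<in>{-T..T}. U t \<in> Hs s \<Gamma> \<and> V t \<in> Hs (s - 1) \<Gamma>)
   \<and> (\<forall>t\<in>{-T..T}. ((\<lambda>\<tau>. hsnorm s (\<lambda>\<xi>. U \<tau> \<xi> - U t \<xi>)) \<longlongrightarrow> 0) (at t within {-T..T}))
   \<and> (\<forall>t\<in>{-T..T}. ((\<lambda>\<tau>. hsnorm (s - 1) (\<lambda>\<xi>. V \<tau> \<xi> - V t \<xi>)) \<longlongrightarrow> 0) (at t within {-T..T}))
   \<and> (\<forall>t\<in>{-T..T}. ((\<lambda>\<tau>. hsnorm (s - 1) (\<lambda>\<xi>. (U \<tau> \<xi> - U t \<xi>) / complex_of_real (\<tau> - t) - V t \<xi>))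
                       \<longlongrightarrow> 0) (at t within {-T..T}))
   \<and> hsnorm s (\<lambda>\<xi>. U 0 \<xi> - u0 \<xi>) = 0
   \<and> hsnorm (s - 1) (\<lambda>\<xi>. V 0 \<xi> - u1 \<xi>) = 0
   \<and> (\<forall>\<phi> D. smooth_family \<phi> D \<and> test_support T \<phi> \<longrightarrow>
        (LBINT t:{-T<..<T}. (LINT \<xi>|lborel. U t \<xi> * ift (\<lambda>x. D 0 2 (x, t) - D 2 0 (x, t)) \<xi>))
      = complex_of_real \<sigma> *
        (LBINT t:{-T<..<T}. (LINT \<xi>|lborel. conv_power (U t) (p - 1) \<xi> * ift (\<lambda>x. \<phi> (x, t)) \<xi>)))"

end

theory Submission
  imports Defs "HOL-Probability.Characteristic_Functions"
begin

text \<open>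
  On a half line \<open>\<bar>\<eta> + \<zeta>\<bar> = \<bar>\<eta>\<bar> + \<bar>\<zeta>\<bar>\<close>, so that in a \<open>p\<close>-fold convolution the output frequency
  is comparable to the largest input frequency and there are no high-high-to-low interactions. The
  derivative lost between \<open>H\<^sup>s\<close> and \<open>H\<^sup>s\<^sup>-\<^sup>1\<close> can then be shared among the \<open>p - 1\<close> smaller
  factors, each of which is put into a weighted \<open>L\<^sup>1\<close> space by Cauchy--Schwarz; this needs only
  \<open>s > 1/2 - 1/(p - 1)\<close> and shows that \<open>u \<mapsto> u\<^sup>p\<close> is locally Lipschitz from \<open>H\<^sup>s\<close> to \<open>H\<^sup>s\<^sup>-\<^sup>1\<close>.

  For existence, the Picard iterates on the Fourier side are dominated, pointwise in the frequency, by
  the increasing iterates of a scalar majorant equation with values in \<open>[0, \<infinity>]\<close>. These stay in a ball of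
  \<open>H\<^sup>s\<close>, so monotone and dominated convergence at almost every frequency yield the solution.

  For uniqueness and Lipschitz dependence, the weak equation of an arbitrary solution is first localised
  in frequency: approximating bounded functions of compact support by inverse Fourier transforms of test
  functions shows that \<open>\<langle>V t, g\<rangle>\<close> is differentiable for all such \<open>g\<close>. Pairing the difference of
  two solutions with explicit solutions of the dual free wave equation gives the energy inequality by
  duality, and a continuity argument bounds every solution a priori.
\<close>

section \<open>Weighted square integrability\<close>

text \<open>The two halves deal with different kinds of objects. An arbitrary solution is only a
  family of representatives \<open>U t\<close>: \<open>wave_sol\<close> provides neither joint
  measurability in time and frequency nor any regularity in time at a fixed frequency. The
  oscillator equation can therefore not be written frequency by frequency, and uniqueness has to
  pass through pairings with a fixed \<open>g\<close>. The Picard limit, by contrast, is built with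
  one null set common to all times, so that at every other frequency it solves an ordinary
  differential equation; no complete function space and no quotient by null sets has to be set up.
  Test functions have compact support in space, so their transforms, unless zero, never have compact
  support in frequency; multipliers with such support can only be reached by approximation.
  Uniqueness concerns solutions of any size, so a short time alone does not close the Lipschitz
  estimate: a bound for every solution must come first. The time \<open>T\<close> depends on the
  data only through their norms, which gives one \<open>T\<close> for a whole neighbourhood.\<close>

text \<open>\<open>wt r x\<close> is \<open>\<langle>x\<rangle>\<close> to the power \<open>2 r\<close>, so \<open>wt s\<close> is the weight of \<open>H\<^sup>s\<close> and \<open>wt (1/2)\<close> is the bracket itself.\<close>

definition wt :: "real \<Rightarrow> real \<Rightarrow> real" where
  "wt r x = (1 + x\<^sup>2) powr r"

lemma one_plus_square_pos: "0 < 1 + (x::real)\<^sup>2"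
  by (simp add: add_pos_nonneg)

lemma wt_pos [simp]: "0 < wt r x"
  using one_plus_square_pos[of x] by (simp add: wt_def)

lemma wt_nonneg [simp]: "0 \<le> wt r x"
  by (simp add: less_imp_le)

lemma wt_measurable [measurable]: "wt r \<in> borel_measurable borel"
  unfolding wt_def by measurable

lemma wt_add: "wt r x * wt q x = wt (r + q) x"
  by (simp add: wt_def powr_add)

lemma wt_power2: "(wt r x)\<^sup>2 = wt (2 * r) x"
  by (simp add: power2_eq_square wt_add)

lemma wt_zero [simp]: "wt 0 x = 1"
  using one_plus_square_pos[of x] by (simp add: wt_def)

lemma wt_mono: "r \<le> q \<Longrightarrow> wt r x \<le> wt q x"
  by (simp add: wt_def powr_mono)

lemma wt_antimono: "\<bar>x\<bar> \<le> \<bar>y\<bar> \<Longrightarrow> r \<le> 0 \<Longrightarrow> wt r y \<le> wt r x"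
  using one_plus_square_pos[of x] unfolding wt_def
  by (intro powr_mono2') (auto simp: abs_le_square_iff)

text \<open>For two frequencies of equal sign, the larger one \<open>y\<close> and the sum
  \<open>x\<close> satisfy these hypotheses, and then 1 + x^2 is at most 4 (1 + y^2). For negative
  \<open>r\<close> monotonicity alone suffices; the absolute value in the exponent gives one
  constant for both signs of \<open>r\<close>.\<close>

lemma wt_comparable:
  assumes "\<bar>y\<bar> \<le> \<bar>x\<bar>" "\<bar>x\<bar> \<le> 2 * \<bar>y\<bar>"
  shows "wt r x \<le> 4 powr \<bar>r\<bar> * wt r y"
proof (cases "0 \<le> r")
  case True
  have "x\<^sup>2 \<le> (2 * y)\<^sup>2"
    using assms(2) by (subst abs_le_square_iff[symmetric]) (auto simp: abs_mult)
  then have "1 + x\<^sup>2 \<le> 4 * (1 + y\<^sup>2)" by (simp add: power_mult_distrib)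
  then have "wt r x \<le> (4 * (1 + y\<^sup>2)) powr r"
    unfolding wt_def using True by (intro powr_mono2) auto
  also have "\<dots> = 4 powr \<bar>r\<bar> * wt r y"
    using True powr_mult[of 4 "1 + y\<^sup>2" r] by (simp add: wt_def)
  finally show ?thesis .
next
  case False
  have "wt r x \<le> wt r y" using wt_antimono[of y x r] assms False by simp
  also have "\<dots> \<le> 4 powr \<bar>r\<bar> * wt r y"
    using mult_right_mono[OF ge_one_powr_ge_zero[of 4 "\<bar>r\<bar>"], of "wt r y"] by simp
  finally show ?thesis .
qed

lemma wt_half_le: "wt (1/2) x \<le> 1 + \<bar>x\<bar>"
proof -
  have "wt (1/2) x = sqrt (1 + x\<^sup>2)" by (simp add: wt_def powr_half_sqrt)
  also have "\<dots> \<le> 1 + \<bar>x\<bar>"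
    by (rule real_le_lsqrt) (auto simp: power2_eq_square algebra_simps abs_mult_self_eq)
  finally show ?thesis .
qed

lemma abs_le_wt_half: "\<bar>x\<bar> \<le> wt (1/2) x"
proof -
  have "\<bar>x\<bar> = sqrt (x\<^sup>2)" by simp
  also have "\<dots> \<le> sqrt (1 + x\<^sup>2)" by (rule real_sqrt_le_mono) simp
  finally show ?thesis by (simp add: wt_def powr_half_sqrt)
qed

text \<open>The comparison 1 + x^2 \<ge> (1 + x)^2 / 2 on the positive half line leads to a power of
  1 + x with an explicit primitive; evenness supplies the other half.\<close>

lemma nn_integral_wt_finite:
  assumes "r > 1/2"
  shows "(\<integral>\<^sup>+x. ennreal (wt (-r) x) \<partial>lborel) < \<infinity>"
proof -
  let ?f = "\<lambda>x::real. 2 powr r * (1 + x) powr (- (2 * r))"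
  let ?F = "\<lambda>x::real. 2 powr r * (1 + x) powr (1 - 2 * r) / (1 - 2 * r)"
  have le: "wt (-r) x \<le> ?f x" if "0 \<le> x" for x
  proof -
    have "(1 + x)\<^sup>2 / 2 \<le> 1 + x\<^sup>2"
      using sum_squares_bound[of 1 x] by (simp add: power2_eq_square algebra_simps)
    moreover have "0 < (1 + x)\<^sup>2 / 2" using that by simp
    ultimately have "wt (-r) x \<le> ((1 + x)\<^sup>2 / 2) powr (-r)"
      unfolding wt_def using assms by (intro powr_mono2') auto
    also have "\<dots> = ((1 + x)\<^sup>2) powr (-r) * 2 powr r"
      by (simp add: powr_divide powr_minus_divide)
    also have "((1 + x)\<^sup>2) powr (-r) = (1 + x) powr (- (2 * r))"
      using that by (simp add: powr_powr flip: powr_numeral)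
    finally show ?thesis by (simp add: mult.commute)
  qed
  have half: "(\<integral>\<^sup>+x. ennreal (?f x) * indicator {0..} x \<partial>lborel) = 0 - ?F 0"
  proof (rule nn_integral_FTC_atLeast)
    show "DERIV ?F x :> ?f x" if "0 \<le> x" for x
    proof -
      have "((\<lambda>x. (1 + x) powr (1 - 2 * r)) has_real_derivative (1 - 2 * r) * (1 + x) powr (1 - 2 * r - 1) * 1) (at x)"
        using that by (intro DERIV_fun_powr derivative_eq_intros) auto
      from DERIV_cdivide[OF DERIV_cmult[OF this, of "2 powr r"], of "1 - 2 * r"]
      show ?thesis by (rule DERIV_cong) (use assms in simp)
    qed
    have "((\<lambda>x::real. (1 + x) powr (1 - 2 * r)) \<longlongrightarrow> 0) at_top"
      by (rule tendsto_neg_powr) (use assms in \<open>auto intro: filterlim_tendsto_add_at_top tendsto_const filterlim_ident\<close>)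
    then have "(?F \<longlongrightarrow> 2 powr r * 0 / (1 - 2 * r)) at_top"
      by (intro tendsto_intros) (use assms in auto)
    then show "(?F \<longlongrightarrow> 0) at_top" by simp
  qed (auto intro!: mult_nonneg_nonneg)
  have pos: "(\<integral>\<^sup>+x. ennreal (wt (-r) x) * indicator {0..} x \<partial>lborel) < \<infinity>"
  proof -
    have "(\<integral>\<^sup>+x. ennreal (wt (-r) x) * indicator {0..} x \<partial>lborel)
        \<le> (\<integral>\<^sup>+x. ennreal (?f x) * indicator {0..} x \<partial>lborel)"
      by (intro nn_integral_mono) (auto simp: indicator_def intro!: ennreal_leI le)
    also have "\<dots> < \<infinity>" unfolding half by (simp add: ennreal_less_top)
    finally show ?thesis .
  qed
  have "(\<integral>\<^sup>+x. ennreal (wt (-r) x) * indicator {..0} x \<partial>lborel)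
      = (\<integral>\<^sup>+x. ennreal (wt (-r) x) * indicator {0..} x \<partial>lborel)"
    by (subst nn_integral_real_affine[where c="-1" and t=0])
       (auto simp: wt_def indicator_def intro!: nn_integral_cong)
  moreover have "(\<integral>\<^sup>+x. ennreal (wt (-r) x) \<partial>lborel)
      \<le> (\<integral>\<^sup>+x. ennreal (wt (-r) x) * indicator {0..} x + ennreal (wt (-r) x) * indicator {..0} x \<partial>lborel)"
    by (intro nn_integral_mono) (auto simp: indicator_def)
  ultimately show ?thesis using pos
    by (subst (asm) nn_integral_add) (auto simp: less_top[symmetric] top_unique)
qed

lemma ennreal_le_if_power2_le:
  assumes "a\<^sup>2 \<le> ennreal (b\<^sup>2)" "0 \<le> b"
  shows "a \<le> ennreal b"
proof (cases a)
  case (real r)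
  then show ?thesis using assms by (simp add: ennreal_power power2_le_iff_abs_le)
next
  case top
  then show ?thesis using assms by (simp add: power2_eq_square top_unique)
qed

text \<open>A bound instead of a norm: the function may take the value \<infinity>, no integrability
  has to be carried along, and \<open>B\<close> is real, so that bounds obey ordinary arithmetic.
  The norm in question is that of H^r on the Fourier side.\<close>

definition bd :: "real \<Rightarrow> (real \<Rightarrow> ennreal) \<Rightarrow> real \<Rightarrow> bool" where
  "bd r f B \<longleftrightarrow> f \<in> borel_measurable borel \<and> 0 \<le> B
     \<and> (\<integral>\<^sup>+x. ennreal (wt r x) * (f x)\<^sup>2 \<partial>lborel) \<le> ennreal (B\<^sup>2)"

lemma bd_measurable: "bd r f B \<Longrightarrow> f \<in> borel_measurable borel"
  and bd_nonneg: "bd r f B \<Longrightarrow> 0 \<le> B"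
  and bd_integral: "bd r f B \<Longrightarrow> (\<integral>\<^sup>+x. ennreal (wt r x) * (f x)\<^sup>2 \<partial>lborel) \<le> ennreal (B\<^sup>2)"
  by (auto simp: bd_def)

text \<open>Cauchy-Schwarz after each factor has received half of its weight; the two halves cancel
  pointwise. This is the duality between the indices \<open>r\<close> and \<open>-r\<close>.\<close>

lemma bd_pairing:
  assumes "bd r f B" "bd (-r) g C"
  shows "(\<integral>\<^sup>+x. f x * g x \<partial>lborel) \<le> ennreal (B * C)"
proof (rule ennreal_le_if_power2_le)
  note [measurable] = assms[THEN bd_measurable]
  have "(\<integral>\<^sup>+x. f x * g x \<partial>lborel)
      = (\<integral>\<^sup>+x. (ennreal (wt (r/2) x) * f x) * (ennreal (wt (-r/2) x) * g x) \<partial>lborel)"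
  proof (intro nn_integral_cong)
    fix x
    have "ennreal (wt (r/2) x) * ennreal (wt (-r/2) x) = 1"
      by (simp add: wt_add flip: ennreal_mult)
    then show "f x * g x = (ennreal (wt (r/2) x) * f x) * (ennreal (wt (-r/2) x) * g x)"
      by (metis (no_types, lifting) mult.assoc mult.left_commute mult.right_neutral)
  qed
  also have "\<dots>\<^sup>2 \<le> (\<integral>\<^sup>+x. (ennreal (wt (r/2) x) * f x)\<^sup>2 \<partial>lborel)
      * (\<integral>\<^sup>+x. (ennreal (wt (-r/2) x) * g x)\<^sup>2 \<partial>lborel)"
    by (intro Cauchy_Schwarz_nn_integral) auto
  also have "\<dots> = (\<integral>\<^sup>+x. ennreal (wt r x) * (f x)\<^sup>2 \<partial>lborel)
      * (\<integral>\<^sup>+x. ennreal (wt (-r) x) * (g x)\<^sup>2 \<partial>lborel)"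
    by (simp add: power_mult_distrib ennreal_power wt_power2)
  also have "\<dots> \<le> ennreal (B\<^sup>2) * ennreal (C\<^sup>2)"
    by (intro mult_mono assms[THEN bd_integral]) auto
  finally show "(\<integral>\<^sup>+x. f x * g x \<partial>lborel)\<^sup>2 \<le> ennreal ((B * C)\<^sup>2)"
    by (simp add: power_mult_distrib ennreal_mult)
  show "0 \<le> B * C" using assms[THEN bd_nonneg] by simp
qed

lemma bd_mono:
  assumes "bd r g B" "f \<in> borel_measurable borel" "AE x in lborel. f x \<le> g x" "B \<le> C" "q \<le> r"
  shows "bd q f C"
proof -
  have "(\<integral>\<^sup>+x. ennreal (wt q x) * (f x)\<^sup>2 \<partial>lborel) \<le> (\<integral>\<^sup>+x. ennreal (wt r x) * (g x)\<^sup>2 \<partial>lborel)"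
  proof (intro nn_integral_mono_AE, use assms(3) in eventually_elim)
    fix x assume "f x \<le> g x"
    then show "ennreal (wt q x) * (f x)\<^sup>2 \<le> ennreal (wt r x) * (g x)\<^sup>2"
      using assms(5) by (intro mult_mono power_mono ennreal_leI wt_mono) auto
  qed
  also have "\<dots> \<le> ennreal (C\<^sup>2)"
    using bd_integral[OF assms(1)] bd_nonneg[OF assms(1)] assms(4)
    by (elim order_trans) (auto intro!: ennreal_leI power_mono)
  finally show ?thesis using assms bd_nonneg[OF assms(1)] by (auto simp: bd_def)
qed

lemma bd_weight:
  assumes "bd r f B"
  shows "bd (r - 2 * q) (\<lambda>x. ennreal (wt q x) * f x) B"
proof -
  have "ennreal (wt (r - 2 * q) x) * (ennreal (wt q x) * f x)\<^sup>2 = ennreal (wt r x) * (f x)\<^sup>2" for x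
    by (simp add: power_mult_distrib ennreal_power wt_power2 wt_add flip: ennreal_mult mult.assoc)
  then show ?thesis using assms by (auto simp: bd_def)
qed

lemma bd_cmult:
  assumes "bd r f B" "0 \<le> c"
  shows "bd r (\<lambda>x. ennreal c * f x) (c * B)"
proof -
  note [measurable] = assms(1)[THEN bd_measurable]
  have "(\<integral>\<^sup>+x. ennreal (wt r x) * (ennreal c * f x)\<^sup>2 \<partial>lborel)
     = ennreal (c\<^sup>2) * (\<integral>\<^sup>+x. ennreal (wt r x) * (f x)\<^sup>2 \<partial>lborel)"
    using assms(2) by (subst nn_integral_cmult[symmetric])
      (auto simp: power_mult_distrib ennreal_power algebra_simps intro!: nn_integral_cong)
  also have "\<dots> \<le> ennreal (c\<^sup>2) * ennreal (B\<^sup>2)"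
    by (intro mult_left_mono assms(1)[THEN bd_integral]) auto
  finally show ?thesis using assms bd_nonneg[OF assms(1)]
    by (auto simp: bd_def power_mult_distrib ennreal_mult)
qed

text \<open>Minkowski's inequality: multiplication by the full weight moves \<open>g\<close> to the
  dual index \<open>-r\<close>, so the cross term of the square is a pairing.\<close>

lemma bd_add:
  assumes "bd r f B" "bd r g C"
  shows "bd r (\<lambda>x. f x + g x) (B + C)"
proof -
  note [measurable] = assms[THEN bd_measurable]
  have "bd (-r) (\<lambda>x. ennreal (wt r x) * g x) C"
    using bd_weight[OF assms(2), of r] by simp
  from bd_pairing[OF assms(1) this]
  have cross: "(\<integral>\<^sup>+x. f x * (ennreal (wt r x) * g x) \<partial>lborel) \<le> ennreal (B * C)" .
  have "(\<integral>\<^sup>+x. ennreal (wt r x) * (f x + g x)\<^sup>2 \<partial>lborel)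
     = (\<integral>\<^sup>+x. (ennreal (wt r x) * (f x)\<^sup>2 + 2 * (f x * (ennreal (wt r x) * g x))) + ennreal (wt r x) * (g x)\<^sup>2 \<partial>lborel)"
    by (intro nn_integral_cong) (simp add: power2_sum algebra_simps)
  also have "\<dots> = ((\<integral>\<^sup>+x. ennreal (wt r x) * (f x)\<^sup>2 \<partial>lborel)
      + 2 * (\<integral>\<^sup>+x. f x * (ennreal (wt r x) * g x) \<partial>lborel))
      + (\<integral>\<^sup>+x. ennreal (wt r x) * (g x)\<^sup>2 \<partial>lborel)"
    by (simp add: nn_integral_add nn_integral_cmult)
  also have "\<dots> \<le> (ennreal (B\<^sup>2) + 2 * ennreal (B * C)) + ennreal (C\<^sup>2)"
    by (intro add_mono mult_left_mono cross assms[THEN bd_integral]) auto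
  also have "\<dots> = ennreal ((B + C)\<^sup>2)"
    using assms[THEN bd_nonneg]
    by (simp add: power2_sum algebra_simps ennreal_plus[symmetric] ennreal_mult del: ennreal_plus)
       (simp add: ennreal_mult[symmetric] ennreal_plus[symmetric] algebra_simps
          flip: ennreal_numeral del: ennreal_plus)
  finally show ?thesis using assms[THEN bd_nonneg] by (auto simp: bd_def)
qed

lemma bd_finite_AE:
  assumes "bd r f B"
  shows "AE x in lborel. f x < \<infinity>"
proof -
  note [measurable] = assms[THEN bd_measurable]
  have "(\<integral>\<^sup>+x. ennreal (wt r x) * (f x)\<^sup>2 \<partial>lborel) \<noteq> \<infinity>"
    using bd_integral[OF assms] by (metis ennreal_neq_top infinity_ennreal_def top.extremum_uniqueI)
  then have "AE x in lborel. ennreal (wt r x) * (f x)\<^sup>2 \<noteq> \<infinity>"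
    by (intro nn_integral_PInf_AE) auto
  then show ?thesis
  proof eventually_elim
    case (elim x)
    show ?case
    proof (rule ccontr)
      assume "\<not> f x < \<infinity>"
      then have "f x = top" by (simp flip: top.not_eq_extremum)
      moreover have "ennreal (wt r x) \<noteq> 0" by (simp add: ennreal_eq_0_iff not_le)
      ultimately show False using elim by (simp add: power2_eq_square ennreal_mult_eq_top_iff)
    qed
  qed
qed

section \<open>Convolution powers on a half line\<close>

definition nconv :: "(real \<Rightarrow> ennreal) \<Rightarrow> (real \<Rightarrow> ennreal) \<Rightarrow> real \<Rightarrow> ennreal" where
  "nconv f g \<xi> = (\<integral>\<^sup>+\<eta>. f \<eta> * g (\<xi> - \<eta>) \<partial>lborel)"

primrec npow :: "(real \<Rightarrow> ennreal) \<Rightarrow> nat \<Rightarrow> real \<Rightarrow> ennreal" where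
  "npow f 0 = f"
| "npow f (Suc n) = nconv f (npow f n)"

lemma nconv_measurable [measurable (raw)]:
  assumes [measurable]: "f \<in> borel_measurable borel" "g \<in> borel_measurable borel"
  shows "nconv f g \<in> borel_measurable borel"
  unfolding nconv_def by measurable

lemma npow_measurable [measurable (raw)]:
  assumes [measurable]: "f \<in> borel_measurable borel"
  shows "npow f n \<in> borel_measurable borel"
  by (induction n) auto

lemma npow_measurable_compose [measurable (raw)]:
  "f \<in> borel_measurable borel \<Longrightarrow> h \<in> borel_measurable M \<Longrightarrow> (\<lambda>x. npow f n (h x)) \<in> borel_measurable M"
  by (rule measurable_compose[where g="npow f n"]) auto

lemma nconv_mono:
  assumes "\<And>x. f x \<le> f' x" "\<And>x. g x \<le> g' x"
  shows "nconv f g \<xi> \<le> nconv f' g' \<xi>"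
  unfolding nconv_def by (intro nn_integral_mono mult_mono assms) auto

lemma npow_mono: "(\<And>x. f x \<le> g x) \<Longrightarrow> npow f n \<xi> \<le> npow g n \<xi>"
  by (induction n arbitrary: \<xi>) (auto intro!: nconv_mono)

lemma nn_integral_reflect:
  fixes \<xi> :: real
  assumes [measurable]: "f \<in> borel_measurable borel"
  shows "(\<integral>\<^sup>+x. f (\<xi> - x) \<partial>lborel) = (\<integral>\<^sup>+x. f x \<partial>lborel)"
  by (subst (2) nn_integral_real_affine[where c="-1" and t=\<xi>]) auto

lemma nn_integral_translate:
  fixes \<eta> :: real
  assumes [measurable]: "f \<in> borel_measurable borel"
  shows "(\<integral>\<^sup>+x. f (x - \<eta>) \<partial>lborel) = (\<integral>\<^sup>+x. f x \<partial>lborel)"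
  by (subst (2) nn_integral_real_affine[where c=1 and t="-\<eta>"]) auto

lemma AE_reflect:
  assumes "AE x in lborel. P (x::real)"
  shows "AE x in lborel. P (\<xi> - x)"
proof -
  from assms obtain N where N: "{x. \<not> P x} \<subseteq> N" "N \<in> null_sets lborel"
    by (auto simp: eventually_ae_filter)
  then have [measurable]: "N \<in> sets borel" by auto
  have "AE x in lborel. x \<notin> N" using N(2) by (rule AE_not_in)
  then have "AE x in lborel. \<xi> + (-1) * x \<notin> N"
    by (intro AE_borel_affine) auto
  then show ?thesis by eventually_elim (use N in auto)
qed

lemma nconv_commute:
  assumes [measurable]: "f \<in> borel_measurable borel" "g \<in> borel_measurable borel"
  shows "nconv f g \<xi> = nconv g f \<xi>"
  unfolding nconv_def
  by (subst nn_integral_reflect[symmetric, where \<xi>=\<xi>]) (auto simp: mult.commute)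

lemma nn_integral_nconv:
  assumes [measurable]: "f \<in> borel_measurable borel" "g \<in> borel_measurable borel"
  shows "(\<integral>\<^sup>+\<xi>. nconv f g \<xi> \<partial>lborel) = (\<integral>\<^sup>+x. f x \<partial>lborel) * (\<integral>\<^sup>+x. g x \<partial>lborel)"
proof -
  have "(\<integral>\<^sup>+\<xi>. nconv f g \<xi> \<partial>lborel) = (\<integral>\<^sup>+\<eta>. (\<integral>\<^sup>+\<xi>. f \<eta> * g (\<xi> - \<eta>) \<partial>lborel) \<partial>lborel)"
    unfolding nconv_def by (rule lborel_pair.Fubini') measurable
  also have "\<dots> = (\<integral>\<^sup>+\<eta>. f \<eta> * (\<integral>\<^sup>+x. g x \<partial>lborel) \<partial>lborel)"
    by (simp add: nn_integral_cmult nn_integral_translate)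
  also have "\<dots> = (\<integral>\<^sup>+x. f x \<partial>lborel) * (\<integral>\<^sup>+x. g x \<partial>lborel)"
    by (rule nn_integral_multc) auto
  finally show ?thesis .
qed

text \<open>Cauchy-Schwarz for the measure with density \<open>f\<close>, applied to
  \<open>g\<close> and the constant 1, bounds the square of the convolution by the mass of
  \<open>f\<close> times the convolution of \<open>f\<close> with the square of \<open>g\<close>.
  What remains is Tonelli, so infinite values do no harm.\<close>

lemma nconv_Young:
  assumes [measurable]: "f \<in> borel_measurable borel" "g \<in> borel_measurable borel"
  shows "(\<integral>\<^sup>+\<xi>. (nconv f g \<xi>)\<^sup>2 \<partial>lborel) \<le> (\<integral>\<^sup>+x. f x \<partial>lborel)\<^sup>2 * (\<integral>\<^sup>+x. (g x)\<^sup>2 \<partial>lborel)"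
proof -
  have "(nconv f g \<xi>)\<^sup>2 \<le> (\<integral>\<^sup>+x. f x \<partial>lborel) * nconv f (\<lambda>x. (g x)\<^sup>2) \<xi>" for \<xi>
    using Cauchy_Schwarz_nn_integral[of "\<lambda>\<eta>. g (\<xi> - \<eta>)" "density lborel f" "\<lambda>_. 1"]
    by (simp add: nconv_def nn_integral_density emeasure_density mult.commute)
  then have "(\<integral>\<^sup>+\<xi>. (nconv f g \<xi>)\<^sup>2 \<partial>lborel)
     \<le> (\<integral>\<^sup>+\<xi>. (\<integral>\<^sup>+x. f x \<partial>lborel) * nconv f (\<lambda>x. (g x)\<^sup>2) \<xi> \<partial>lborel)"
    by (intro nn_integral_mono)
  also have "\<dots> = (\<integral>\<^sup>+x. f x \<partial>lborel)\<^sup>2 * (\<integral>\<^sup>+x. (g x)\<^sup>2 \<partial>lborel)"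
    by (simp add: nn_integral_cmult nn_integral_nconv power2_eq_square mult.assoc)
  finally show ?thesis .
qed

section \<open>Supports in a half line and the multilinear estimate\<close>

definition half_line :: "real set \<Rightarrow> bool" where
  "half_line \<Gamma> \<longleftrightarrow> \<Gamma> = {0..} \<or> \<Gamma> = {..0}"

lemma half_line_measurable: "half_line \<Gamma> \<Longrightarrow> \<Gamma> \<in> sets borel"
  by (auto simp: half_line_def)

definition supp_in :: "real set \<Rightarrow> (real \<Rightarrow> ennreal) \<Rightarrow> bool" where
  "supp_in \<Gamma> f \<longleftrightarrow> (AE x in lborel. x \<notin> \<Gamma> \<longrightarrow> f x = 0)"

text \<open>The geometry of the half line enters here: for almost every \<open>\<eta>\<close> either
  the integrand vanishes or both frequencies lie in \<Gamma>, where absolute values add. A weighted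
  bound on a convolution thus reduces to a pointwise bound on pairs of frequencies; \<open>c\<close>
  stands for the weight at the output frequency.\<close>

lemma nconv_cong_supp:
  assumes \<Gamma>: "half_line \<Gamma>" and f: "supp_in \<Gamma> f" and g: "supp_in \<Gamma> g"
    and le: "\<And>\<eta> \<zeta>. \<eta> \<in> \<Gamma> \<Longrightarrow> \<zeta> \<in> \<Gamma> \<Longrightarrow> \<bar>\<eta> + \<zeta>\<bar> = \<bar>\<eta>\<bar> + \<bar>\<zeta>\<bar> \<Longrightarrow> \<eta> + \<zeta> = \<xi> \<Longrightarrow> c * (f \<eta> * g \<zeta>) \<le> h \<eta>"
    and [measurable]: "f \<in> borel_measurable borel" "g \<in> borel_measurable borel"
  shows "c * nconv f g \<xi> \<le> (\<integral>\<^sup>+\<eta>. h \<eta> \<partial>lborel)"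
proof -
  have "c * nconv f g \<xi> = (\<integral>\<^sup>+\<eta>. c * (f \<eta> * g (\<xi> - \<eta>)) \<partial>lborel)"
    unfolding nconv_def by (rule nn_integral_cmult[symmetric]) measurable
  also have "\<dots> \<le> (\<integral>\<^sup>+\<eta>. h \<eta> \<partial>lborel)"
  proof (rule nn_integral_mono_AE)
    show "AE \<eta> in lborel. c * (f \<eta> * g (\<xi> - \<eta>)) \<le> h \<eta>"
      using f[unfolded supp_in_def] AE_reflect[OF g[unfolded supp_in_def], of \<xi>]
    proof eventually_elim
      case (elim \<eta>)
      show ?case
      proof (cases "\<eta> \<in> \<Gamma> \<and> \<xi> - \<eta> \<in> \<Gamma>")
        case True
        then have "\<bar>\<eta> + (\<xi> - \<eta>)\<bar> = \<bar>\<eta>\<bar> + \<bar>\<xi> - \<eta>\<bar>"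
          using \<Gamma> by (auto simp: half_line_def)
        then show ?thesis using True le[of \<eta> "\<xi> - \<eta>"] by simp
      next
        case False
        then show ?thesis using elim by auto
      qed
    qed
  qed
  finally show ?thesis .
qed

lemma supp_in_nconv:
  assumes \<Gamma>: "half_line \<Gamma>" and f: "supp_in \<Gamma> f" and g: "supp_in \<Gamma> g"
    and [measurable]: "f \<in> borel_measurable borel" "g \<in> borel_measurable borel"
  shows "supp_in \<Gamma> (nconv f g)"
  unfolding supp_in_def
proof (intro AE_I2 impI)
  fix \<xi> assume "\<xi> \<notin> \<Gamma>"
  have "1 * nconv f g \<xi> \<le> (\<integral>\<^sup>+\<eta>. (\<lambda>_::real. 0) \<eta> \<partial>lborel)"
    by (rule nconv_cong_supp[OF \<Gamma> f g]) (use \<Gamma> \<open>\<xi> \<notin> \<Gamma>\<close> in \<open>auto simp: half_line_def\<close>)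
  then show "nconv f g \<xi> = 0" by simp
qed

lemma supp_in_npow:
  assumes "half_line \<Gamma>" "supp_in \<Gamma> f" "f \<in> borel_measurable borel"
  shows "supp_in \<Gamma> (npow f n)"
  using assms by (induction n) (auto intro!: supp_in_nconv npow_measurable)

text \<open>\<open>a\<close> is half of the exponent \<open>1/(p - 1)\<close> by which each factor of the product may be weakened:
  the total gain of one derivative in \<open>H\<^sup>s\<^sup>-\<^sup>1\<close> is shared evenly among all factors but the largest.\<close>

definition ctrl :: "real set \<Rightarrow> real \<Rightarrow> real \<Rightarrow> nat \<Rightarrow> (real \<Rightarrow> ennreal) \<Rightarrow> real \<Rightarrow> bool" where
  "ctrl \<Gamma> s a n f B \<longleftrightarrow> supp_in \<Gamma> f \<and> bd (s - 2 * a * real n) f B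
     \<and> (\<integral>\<^sup>+x. ennreal (wt (- a * real (Suc n)) x) * f x \<partial>lborel) \<le> ennreal B"

lemma ctrl_measurable: "ctrl \<Gamma> s a n f B \<Longrightarrow> f \<in> borel_measurable borel"
  by (auto simp: ctrl_def bd_def)

lemma bd_nconv_L1:
  assumes [measurable]: "f \<in> borel_measurable borel" and g: "bd 0 g B"
    and f: "(\<integral>\<^sup>+x. f x \<partial>lborel) \<le> ennreal A" and "0 \<le> A"
  shows "bd 0 (nconv f g) (A * B)"
proof -
  note [measurable] = bd_measurable[OF g]
  have "(\<integral>\<^sup>+\<xi>. (nconv f g \<xi>)\<^sup>2 \<partial>lborel) \<le> (\<integral>\<^sup>+x. f x \<partial>lborel)\<^sup>2 * (\<integral>\<^sup>+x. (g x)\<^sup>2 \<partial>lborel)"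
    by (rule nconv_Young) auto
  also have "\<dots> \<le> (ennreal A)\<^sup>2 * ennreal (B\<^sup>2)"
    using bd_integral[OF g] f by (intro mult_mono power_mono) auto
  finally show ?thesis using assms bd_nonneg[OF g]
    by (auto simp: bd_def power_mult_distrib ennreal_mult ennreal_power)
qed

text \<open>The two norms in \<open>ctrl\<close> are needed together for the induction. In the L^2
  bound the larger input frequency, comparable to the output, carries the L^2 weight, while the
  smaller one is measured in weighted L^1, and Young's inequality applies. In the L^1 bound the
  weights have negative exponents, so the weight at the sum is at most the product of the weights at
  the two inputs.\<close>

lemma ctrl_nconv:
  assumes \<Gamma>: "half_line \<Gamma>" and a: "0 \<le> a" and f: "ctrl \<Gamma> s a 0 f A" and g: "ctrl \<Gamma> s a n g B"
  defines "C \<equiv> 4 powr \<bar>(s - 2 * a * real n)/2\<bar> + 4 powr \<bar>s/2\<bar> + 1"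
  shows "ctrl \<Gamma> s a (Suc n) (nconv f g) (C * A * B)"
proof -
  note fm[measurable] = ctrl_measurable[OF f] and gm[measurable] = ctrl_measurable[OF g]
  have sf: "supp_in \<Gamma> f" and sg: "supp_in \<Gamma> g" using f g by (auto simp: ctrl_def)
  have bf: "bd s f A" and bg: "bd (s - 2 * a * real n) g B" using f g by (auto simp: ctrl_def)
  have AB: "0 \<le> A" "0 \<le> B" using bf bg by (auto simp: bd_def)
  define k l where "k x = ennreal (wt (-a) x) * f x" and "l x = ennreal (wt (- a * real (Suc n)) x) * g x" for x
  define F G where "F x = ennreal (wt (s/2) x) * f x" and "G x = ennreal (wt ((s - 2 * a * real n)/2) x) * g x" for x
  have [measurable]: "k \<in> borel_measurable borel" "l \<in> borel_measurable borel"
    "F \<in> borel_measurable borel" "G \<in> borel_measurable borel"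
    unfolding k_def l_def F_def G_def by measurable
  have ik: "(\<integral>\<^sup>+x. k x \<partial>lborel) \<le> ennreal A" and il: "(\<integral>\<^sup>+x. l x \<partial>lborel) \<le> ennreal B"
    using f g by (auto simp: ctrl_def k_def l_def)
  have bF: "bd 0 F A" using bd_weight[OF bf, of "s/2"] by (simp add: F_def[abs_def])
  have "s - 2 * a * real n - 2 * ((s - 2 * a * real n)/2) = 0" by (simp add: field_simps)
  then have bG: "bd 0 G B" using bd_weight[OF bg, of "(s - 2 * a * real n)/2"]
    by (simp only: G_def[abs_def])
  \<comment> \<open>The summand 1 of \<open>C\<close> serves the L^1 bound; the other two come from
    \<open>wt_comparable\<close> in the two cases of the L^2 bound.\<close>
  have C: "1 \<le> C" "4 powr \<bar>(s - 2 * a * real n)/2\<bar> \<le> C" "4 powr \<bar>s/2\<bar> \<le> C"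
    using powr_ge_zero[of 4 "\<bar>(s - 2 * a * real n)/2\<bar>"] powr_ge_zero[of 4 "\<bar>s/2\<bar>"]
    unfolding C_def by linarith+
  have "(\<integral>\<^sup>+\<xi>. ennreal (wt (- a * real (Suc (Suc n))) \<xi>) * nconv f g \<xi> \<partial>lborel) \<le> (\<integral>\<^sup>+\<xi>. nconv k l \<xi> \<partial>lborel)"
  proof (rule nn_integral_mono)
    fix \<xi>
    show "ennreal (wt (- a * real (Suc (Suc n))) \<xi>) * nconv f g \<xi> \<le> nconv k l \<xi>"
      unfolding nconv_def[of k l]
    proof (rule nconv_cong_supp[OF \<Gamma> sf sg])
      fix \<eta> \<zeta> assume *: "\<bar>\<eta> + \<zeta>\<bar> = \<bar>\<eta>\<bar> + \<bar>\<zeta>\<bar>" "\<eta> + \<zeta> = \<xi>"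
      have "wt (- a * real (Suc (Suc n))) \<xi> = wt (-a) \<xi> * wt (- a * real (Suc n)) \<xi>"
        unfolding wt_add by (rule arg_cong[where f="\<lambda>r. wt r \<xi>"]) (simp add: algebra_simps)
      also have "\<dots> \<le> wt (-a) \<eta> * wt (- a * real (Suc n)) \<zeta>"
        using * a by (intro mult_mono wt_antimono) auto
      finally have "ennreal (wt (- a * real (Suc (Suc n))) \<xi>) \<le> ennreal (wt (-a) \<eta>) * ennreal (wt (- a * real (Suc n)) \<zeta>)"
        by (subst ennreal_mult[symmetric]) (auto intro!: ennreal_leI)
      then have "ennreal (wt (- a * real (Suc (Suc n))) \<xi>) * (f \<eta> * g \<zeta>)
          \<le> (ennreal (wt (-a) \<eta>) * ennreal (wt (- a * real (Suc n)) \<zeta>)) * (f \<eta> * g \<zeta>)"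
        by (rule mult_right_mono) simp
      also have "\<dots> = k \<eta> * l (\<xi> - \<eta>)"
        using *(2) by (auto simp: k_def l_def ac_simps)
      finally show "ennreal (wt (- a * real (Suc (Suc n))) \<xi>) * (f \<eta> * g \<zeta>) \<le> k \<eta> * l (\<xi> - \<eta>)" .
    qed measurable
  qed
  also have "\<dots> \<le> ennreal A * ennreal B"
    by (subst nn_integral_nconv) (auto intro!: mult_mono ik il)
  also have "\<dots> \<le> ennreal (C * A * B)"
  proof -
    have "A * B \<le> C * (A * B)" using mult_right_mono[OF C(1), of "A * B"] AB by simp
    then show ?thesis using AB by (auto simp: mult.assoc intro!: ennreal_leI simp flip: ennreal_mult)
  qed
  finally have 1: "(\<integral>\<^sup>+\<xi>. ennreal (wt (- a * real (Suc (Suc n))) \<xi>) * nconv f g \<xi> \<partial>lborel) \<le> ennreal (C * A * B)" .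
  let ?r = "(s - 2 * a * real (Suc n)) / 2"
  have pt: "ennreal (wt ?r \<xi>) * nconv f g \<xi>
      \<le> ennreal (4 powr \<bar>(s - 2 * a * real n)/2\<bar>) * nconv k G \<xi> + ennreal (4 powr \<bar>s/2\<bar>) * nconv F l \<xi>" for \<xi>
  proof -
    have "ennreal (wt ?r \<xi>) * nconv f g \<xi> \<le> (\<integral>\<^sup>+\<eta>. ennreal (4 powr \<bar>(s - 2 * a * real n)/2\<bar>) * (k \<eta> * G (\<xi> - \<eta>))
      + ennreal (4 powr \<bar>s/2\<bar>) * (F \<eta> * l (\<xi> - \<eta>)) \<partial>lborel)"
    proof (rule nconv_cong_supp[OF \<Gamma> sf sg])
      fix \<eta> \<zeta> assume *: "\<bar>\<eta> + \<zeta>\<bar> = \<bar>\<eta>\<bar> + \<bar>\<zeta>\<bar>" "\<eta> + \<zeta> = \<xi>"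
      then have z: "\<xi> - \<eta> = \<zeta>" by simp
      let ?A = "ennreal (4 powr \<bar>(s - 2 * a * real n)/2\<bar>) * (k \<eta> * G \<zeta>)"
      let ?B = "ennreal (4 powr \<bar>s/2\<bar>) * (F \<eta> * l \<zeta>)"
      have "ennreal (wt ?r \<xi>) * (f \<eta> * g \<zeta>) \<le> ?A + ?B"
      \<comment> \<open>The larger frequency is at least half of the output. Either way the
        exponents left for the two factors add up to that of the output: (s - 2 a n)/2 and -a, or
        s/2 and -a (n + 1).\<close>
      proof (cases "\<bar>\<eta>\<bar> \<le> \<bar>\<zeta>\<bar>")
        case True
        have "wt ?r \<xi> = wt ((s - 2 * a * real n)/2) \<xi> * wt (-a) \<xi>"
          by (simp add: wt_add algebra_simps add_divide_distrib diff_divide_distrib)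
        also have "\<dots> \<le> (4 powr \<bar>(s - 2 * a * real n)/2\<bar> * wt ((s - 2 * a * real n)/2) \<zeta>) * wt (-a) \<eta>"
          using * a True by (intro mult_mono wt_antimono wt_comparable) auto
        finally have "ennreal (wt ?r \<xi>) * (f \<eta> * g \<zeta>)
          \<le> ennreal ((4 powr \<bar>(s - 2 * a * real n)/2\<bar> * wt ((s - 2 * a * real n)/2) \<zeta>) * wt (-a) \<eta>) * (f \<eta> * g \<zeta>)"
          by (intro mult_right_mono ennreal_leI) auto
        also have "\<dots> = ?A"
          by (simp add: ennreal_mult k_def G_def ac_simps)
        also have "\<dots> \<le> ?A + ?B" by simp
        finally show ?thesis .
      next
        case False
        have "wt ?r \<xi> = wt (s/2) \<xi> * wt (- a * real (Suc n)) \<xi>"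
          by (simp add: wt_add algebra_simps add_divide_distrib diff_divide_distrib)
        also have "\<dots> \<le> (4 powr \<bar>s/2\<bar> * wt (s/2) \<eta>) * wt (- a * real (Suc n)) \<zeta>"
          using * a False by (intro mult_mono wt_antimono wt_comparable) auto
        finally have "ennreal (wt ?r \<xi>) * (f \<eta> * g \<zeta>)
          \<le> ennreal ((4 powr \<bar>s/2\<bar> * wt (s/2) \<eta>) * wt (- a * real (Suc n)) \<zeta>) * (f \<eta> * g \<zeta>)"
          by (intro mult_right_mono ennreal_leI) auto
        also have "\<dots> = ?B"
          by (simp add: ennreal_mult F_def l_def ac_simps)
        also have "\<dots> \<le> ?A + ?B" by simp
        finally show ?thesis .
      qed
      then show "ennreal (wt ?r \<xi>) * (f \<eta> * g \<zeta>) \<le> ennreal (4 powr \<bar>(s - 2 * a * real n)/2\<bar>) * (k \<eta> * G (\<xi> - \<eta>))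
      + ennreal (4 powr \<bar>s/2\<bar>) * (F \<eta> * l (\<xi> - \<eta>))" using z by simp
    qed measurable
    also have "\<dots> = ennreal (4 powr \<bar>(s - 2 * a * real n)/2\<bar>) * nconv k G \<xi> + ennreal (4 powr \<bar>s/2\<bar>) * nconv F l \<xi>"
      by (simp add: nn_integral_add nn_integral_cmult nconv_def)
    finally show ?thesis .
  qed
  have "bd 0 (\<lambda>\<xi>. ennreal (4 powr \<bar>(s - 2 * a * real n)/2\<bar>) * nconv k G \<xi> + ennreal (4 powr \<bar>s/2\<bar>) * nconv F l \<xi>)
     (4 powr \<bar>(s - 2 * a * real n)/2\<bar> * (A * B) + 4 powr \<bar>s/2\<bar> * (B * A))"
  proof (intro bd_add bd_cmult)
    show "bd 0 (nconv k G) (A * B)" using AB by (intro bd_nconv_L1 bG ik) auto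
    \<comment> \<open>\<open>bd_nconv_L1\<close> expects the L^1 factor first, hence the exchange of
      factors.\<close>
    have "bd 0 (nconv l F) (B * A)" using AB by (intro bd_nconv_L1 bF il) auto
    also have "nconv l F = nconv F l" by (intro ext nconv_commute) auto
    finally show "bd 0 (nconv F l) (B * A)" .
  qed auto
  then have "bd 0 (\<lambda>\<xi>. ennreal (wt ?r \<xi>) * nconv f g \<xi>) (C * A * B)"
  proof (rule bd_mono)
    show "4 powr \<bar>(s - 2 * a * real n)/2\<bar> * (A * B) + 4 powr \<bar>s/2\<bar> * (B * A) \<le> C * A * B"
      using AB unfolding C_def by (simp add: algebra_simps)
    show "AE \<xi> in lborel. ennreal (wt ?r \<xi>) * nconv f g \<xi>
      \<le> ennreal (4 powr \<bar>(s - 2 * a * real n)/2\<bar>) * nconv k G \<xi> + ennreal (4 powr \<bar>s/2\<bar>) * nconv F l \<xi>"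
      by (intro AE_I2 pt)
  qed auto
  moreover have "0 - 2 * - ?r = s - 2 * a * real (Suc n)" by (simp add: field_simps)
  ultimately
  have "bd (s - 2 * a * real (Suc n)) (\<lambda>\<xi>. ennreal (wt (- ?r) \<xi>) * (ennreal (wt ?r \<xi>) * nconv f g \<xi>)) (C * A * B)"
    using bd_weight[of 0 _ "C * A * B" "- ?r"] by (simp only:)
  also have "(\<lambda>\<xi>. ennreal (wt (- ?r) \<xi>) * (ennreal (wt ?r \<xi>) * nconv f g \<xi>)) = nconv f g"
    by (simp add: mult.assoc[symmetric] wt_add del: mult.assoc flip: ennreal_mult)
  finally have 2: "bd (s - 2 * a * real (Suc n)) (nconv f g) (C * A * B)" .
  show ?thesis unfolding ctrl_def using 1 2 supp_in_nconv[OF \<Gamma> sf sg] by auto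
qed

lemma supp_in_le:
  assumes "supp_in \<Gamma> g" "\<And>x. f x \<le> g x"
  shows "supp_in \<Gamma> f"
proof -
  have "f x = 0" if "g x = 0" for x using assms(2)[of x] that by simp
  then show ?thesis using assms(1) unfolding supp_in_def by (auto elim!: eventually_mono)
qed

lemma supp_in_add:
  assumes "supp_in \<Gamma> f" "supp_in \<Gamma> g"
  shows "supp_in \<Gamma> (\<lambda>x. f x + g x)"
  using assms unfolding supp_in_def by eventually_elim auto

lemma ctrl_le:
  assumes g: "ctrl \<Gamma> s a n g B" and f: "f \<in> borel_measurable borel" and le: "\<And>x. f x \<le> g x" and "B \<le> C"
  shows "ctrl \<Gamma> s a n f C"
proof -
  have 1: "supp_in \<Gamma> g" "bd (s - 2 * a * real n) g B"
    "(\<integral>\<^sup>+x. ennreal (wt (- a * real (Suc n)) x) * g x \<partial>lborel) \<le> ennreal B"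
    using g by (auto simp: ctrl_def)
  have "bd (s - 2 * a * real n) f C"
    by (rule bd_mono[OF 1(2) f AE_I2[OF le] \<open>B \<le> C\<close> order_refl])
  moreover have "supp_in \<Gamma> f" by (rule supp_in_le[OF 1(1) le])
  moreover have "(\<integral>\<^sup>+x. ennreal (wt (- a * real (Suc n)) x) * f x \<partial>lborel) \<le> ennreal C"
  proof -
    have "(\<integral>\<^sup>+x. ennreal (wt (- a * real (Suc n)) x) * f x \<partial>lborel)
      \<le> (\<integral>\<^sup>+x. ennreal (wt (- a * real (Suc n)) x) * g x \<partial>lborel)"
      by (intro nn_integral_mono mult_left_mono le) simp
    also note 1(3)
    also have "ennreal B \<le> ennreal C" using \<open>B \<le> C\<close> by (rule ennreal_leI)
    finally show ?thesis .
  qed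
  ultimately show ?thesis by (simp only: ctrl_def)
qed

lemma ctrl_add:
  assumes "ctrl \<Gamma> s a n f A" "ctrl \<Gamma> s a n g B"
  shows "ctrl \<Gamma> s a n (\<lambda>x. f x + g x) (A + B)"
proof -
  note [measurable] = assms[THEN ctrl_measurable]
  have "(\<integral>\<^sup>+x. ennreal (wt (- a * real (Suc n)) x) * (f x + g x) \<partial>lborel)
    = (\<integral>\<^sup>+x. ennreal (wt (- a * real (Suc n)) x) * f x \<partial>lborel)
     + (\<integral>\<^sup>+x. ennreal (wt (- a * real (Suc n)) x) * g x \<partial>lborel)"
    unfolding distrib_left by (rule nn_integral_add) auto
  also have "\<dots> \<le> ennreal A + ennreal B"
    using assms by (intro add_mono) (auto simp: ctrl_def)
  also have "\<dots> = ennreal (A + B)"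
    using assms by (subst ennreal_plus) (auto simp: ctrl_def bd_def)
  finally show ?thesis using assms unfolding ctrl_def by (auto intro: bd_add supp_in_add)
qed

text \<open>Cauchy-Schwarz against \<open>wt (- a)\<close>: this weight lies in the dual space of
  index \<open>-s\<close> because the bracket to the power -2 (s + 2 a) is integrable. This is where
  the lower bound on \<open>s\<close> enters the nonlinear estimate. Taking \<open>C \<ge> 1\<close>
  lets the same constant serve the L^2 part.\<close>

lemma ctrl_base:
  assumes "s + 2 * a > 1/2"
  shows "\<exists>C\<ge>1. \<forall>f B. bd s f B \<longrightarrow> supp_in \<Gamma> f \<longrightarrow> ctrl \<Gamma> s a 0 f (C * B)"
proof -
  define I where "I = (\<integral>\<^sup>+x. ennreal (wt (-(s + 2 * a)) x) \<partial>lborel)"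
  have "I < \<infinity>" unfolding I_def using assms by (rule nn_integral_wt_finite)
  then obtain c where c: "I = ennreal c" "0 \<le> c" by (cases I) auto
  define C where "C = max 1 (sqrt c)"
  have "c \<le> C\<^sup>2"
    using c(2) power_mono[of "sqrt c" C 2] by (simp add: C_def)
  then have bdw: "bd (-s) (\<lambda>x. ennreal (wt (-a) x)) C"
    unfolding bd_def using c
    by (auto simp: C_def[symmetric] I_def ennreal_power wt_power2 wt_add algebra_simps
        intro!: ennreal_leI simp flip: ennreal_mult) (simp add: C_def)
  have "1 \<le> C" by (simp add: C_def)
  moreover have "ctrl \<Gamma> s a 0 f (C * B)" if f: "bd s f B" "supp_in \<Gamma> f" for f B
  proof -
    have "(\<integral>\<^sup>+x. f x * ennreal (wt (-a) x) \<partial>lborel) \<le> ennreal (B * C)"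
      by (rule bd_pairing[OF f(1) bdw])
    moreover have "B \<le> C * B"
      using mult_right_mono[OF \<open>1 \<le> C\<close> bd_nonneg[OF f(1)]] by simp
    moreover have "bd s f (C * B)"
      using f(1) bd_measurable[OF f(1)] \<open>B \<le> C * B\<close> by (auto intro: bd_mono)
    ultimately show ?thesis using f
      by (auto simp: ctrl_def mult.commute)
  qed
  ultimately show ?thesis by blast
qed

section \<open>Complex convolution powers and their differences\<close>

definition cn :: "(real \<Rightarrow> complex) \<Rightarrow> real \<Rightarrow> ennreal" where
  "cn F x = ennreal (cmod (F x))"

lemma cn_measurable [measurable (raw)]:
  assumes [measurable]: "F \<in> borel_measurable borel"
  shows "cn F \<in> borel_measurable borel"
  unfolding cn_def by measurable

lemma cn_measurable_compose [measurable (raw)]: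
  "F \<in> borel_measurable borel \<Longrightarrow> h \<in> borel_measurable M \<Longrightarrow> (\<lambda>x. cn F (h x)) \<in> borel_measurable M"
  by (rule measurable_compose[where g="cn F"]) auto

text \<open>True without any integrability: if the difference is integrable, then \<open>f\<close>
  and \<open>g\<close> are integrable together or not at all, and in the latter case both integrals
  have the default value 0; if it is not, the right-hand side is infinite. Convolutions can thus be
  compared before they are known to converge.\<close>

lemma norm_diff_integral_le:
  fixes f g :: "'a \<Rightarrow> 'b::{banach, second_countable_topology}"
  assumes [measurable]: "f \<in> borel_measurable M" "g \<in> borel_measurable M"
  shows "ennreal (norm (integral\<^sup>L M f - integral\<^sup>L M g)) \<le> (\<integral>\<^sup>+x. ennreal (norm (f x - g x)) \<partial>M)"
proof (cases "integrable M (\<lambda>x. f x - g x)")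
  case True
  show ?thesis
  proof (cases "integrable M f")
    case f: True
    then have "integrable M (\<lambda>x. f x - (f x - g x))" using True by (rule Bochner_Integration.integrable_diff)
    then have "integral\<^sup>L M f - integral\<^sup>L M g = (\<integral>x. f x - g x \<partial>M)" using f by simp
    then show ?thesis using integral_norm_bound_ennreal[OF True] by simp
  next
    case f: False
    have "\<not> integrable M g"
    proof
      assume "integrable M g"
      from Bochner_Integration.integrable_add[OF True this] show False using f by simp
    qed
    then show ?thesis using f by (simp add: not_integrable_integral_eq)
  qed
next
  case False
  then have "(\<integral>\<^sup>+x. ennreal (norm (f x - g x)) \<partial>M) = \<infinity>"
    by (auto simp: integrable_iff_bounded simp flip: top.not_eq_extremum)
  then show ?thesis by simp
qed

lemma norm_integral_le_nn:
  fixes f :: "'a \<Rightarrow> 'b::{banach, second_countable_topology}"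
  assumes "f \<in> borel_measurable M"
  shows "ennreal (norm (integral\<^sup>L M f)) \<le> (\<integral>\<^sup>+x. ennreal (norm (f x)) \<partial>M)"
  using norm_diff_integral_le[OF assms, of "\<lambda>_. 0"] by simp

lemma conv_measurable [measurable (raw)]:
  assumes [measurable]: "F \<in> borel_measurable borel" "G \<in> borel_measurable borel"
  shows "conv F G \<in> borel_measurable borel"
  unfolding conv_def by measurable

lemma conv_power_measurable [measurable (raw)]:
  assumes [measurable]: "F \<in> borel_measurable borel"
  shows "conv_power F n \<in> borel_measurable borel"
  by (induction n) auto

text \<open>The splitting F P - G Q = (F - G) P + G (P - Q) under the integral sign;
  \<open>norm_diff_integral_le\<close> spares all convergence questions.\<close>

lemma cn_conv_diff_le:
  assumes [measurable]: "F \<in> borel_measurable borel" "G \<in> borel_measurable borel"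
    "P \<in> borel_measurable borel" "Q \<in> borel_measurable borel"
  shows "cn (\<lambda>\<xi>. conv F P \<xi> - conv G Q \<xi>) \<xi>
      \<le> nconv (cn (\<lambda>\<xi>. F \<xi> - G \<xi>)) (cn P) \<xi> + nconv (cn G) (cn (\<lambda>\<xi>. P \<xi> - Q \<xi>)) \<xi>"
proof -
  have "cn (\<lambda>\<xi>. conv F P \<xi> - conv G Q \<xi>) \<xi>
      \<le> (\<integral>\<^sup>+\<eta>. ennreal (cmod (F \<eta> * P (\<xi> - \<eta>) - G \<eta> * Q (\<xi> - \<eta>))) \<partial>lborel)"
    unfolding cn_def conv_def by (rule norm_diff_integral_le) measurable
  also have "\<dots> \<le> (\<integral>\<^sup>+\<eta>. cn (\<lambda>\<xi>. F \<xi> - G \<xi>) \<eta> * cn P (\<xi> - \<eta>) + cn G \<eta> * cn (\<lambda>\<xi>. P \<xi> - Q \<xi>) (\<xi> - \<eta>) \<partial>lborel)"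
  proof (rule nn_integral_mono)
    fix \<eta>
    have "F \<eta> * P (\<xi> - \<eta>) - G \<eta> * Q (\<xi> - \<eta>) = (F \<eta> - G \<eta>) * P (\<xi> - \<eta>) + G \<eta> * (P (\<xi> - \<eta>) - Q (\<xi> - \<eta>))"
      by (simp add: algebra_simps)
    then have "cmod (F \<eta> * P (\<xi> - \<eta>) - G \<eta> * Q (\<xi> - \<eta>))
       \<le> cmod (F \<eta> - G \<eta>) * cmod (P (\<xi> - \<eta>)) + cmod (G \<eta>) * cmod (P (\<xi> - \<eta>) - Q (\<xi> - \<eta>))"
      by (metis norm_mult norm_triangle_ineq)
    then show "ennreal (cmod (F \<eta> * P (\<xi> - \<eta>) - G \<eta> * Q (\<xi> - \<eta>)))
      \<le> cn (\<lambda>\<xi>. F \<xi> - G \<xi>) \<eta> * cn P (\<xi> - \<eta>) + cn G \<eta> * cn (\<lambda>\<xi>. P \<xi> - Q \<xi>) (\<xi> - \<eta>)"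
      by (simp add: cn_def ennreal_leI flip: ennreal_mult ennreal_plus)
  qed
  also have "\<dots> = nconv (cn (\<lambda>\<xi>. F \<xi> - G \<xi>)) (cn P) \<xi> + nconv (cn G) (cn (\<lambda>\<xi>. P \<xi> - Q \<xi>)) \<xi>"
    unfolding nconv_def by (rule nn_integral_add) measurable
  finally show ?thesis .
qed

lemma cn_conv_le:
  assumes [measurable]: "F \<in> borel_measurable borel" "G \<in> borel_measurable borel"
  shows "cn (conv F G) \<xi> \<le> nconv (cn F) (cn G) \<xi>"
proof -
  have "cn (conv F G) \<xi> \<le> (\<integral>\<^sup>+\<eta>. ennreal (cmod (F \<eta> * G (\<xi> - \<eta>))) \<partial>lborel)"
    unfolding cn_def conv_def by (rule norm_integral_le_nn) measurable
  then show ?thesis by (simp add: nconv_def cn_def norm_mult ennreal_mult)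
qed

lemma cn_conv_power_le:
  assumes [measurable]: "F \<in> borel_measurable borel" and "\<And>x. cn F x \<le> m x"
  shows "cn (conv_power F n) \<xi> \<le> npow m n \<xi>"
proof (induction n arbitrary: \<xi>)
  case (Suc n)
  have "cn (conv_power F (Suc n)) \<xi> \<le> nconv (cn F) (cn (conv_power F n)) \<xi>"
    by (simp add: cn_conv_le)
  also have "\<dots> \<le> npow m (Suc n) \<xi>" using Suc assms(2) by (auto intro!: nconv_mono)
  finally show ?case .
qed (use assms in auto)

text \<open>Stated additively, so that infinite values need no separate treatment.\<close>

lemma conv_power_majorant:
  assumes [measurable]: "F \<in> borel_measurable borel" "G \<in> borel_measurable borel"
      "m \<in> borel_measurable borel" "m' \<in> borel_measurable borel"
    and le: "\<And>x. cn (\<lambda>x. F x - G x) x + m x \<le> m' x" "\<And>x. cn G x \<le> m x" "\<And>x. cn F x \<le> m' x"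
  shows "cn (\<lambda>\<xi>. conv_power F n \<xi> - conv_power G n \<xi>) \<xi> + npow m n \<xi> \<le> npow m' n \<xi>"
proof (induction n arbitrary: \<xi>)
  case (Suc n)
  let ?P = "conv_power F n" and ?Q = "conv_power G n"
  let ?d = "cn (\<lambda>x. F x - G x)" and ?e = "cn (\<lambda>x. ?P x - ?Q x)"
  have "cn (\<lambda>\<xi>. conv F ?P \<xi> - conv G ?Q \<xi>) \<xi> + nconv m (npow m n) \<xi>
     \<le> (nconv ?d (cn ?P) \<xi> + nconv (cn G) ?e \<xi>) + nconv m (npow m n) \<xi>"
    by (intro add_right_mono cn_conv_diff_le) measurable
  also have "\<dots> = (\<integral>\<^sup>+\<eta>. (?d \<eta> * cn ?P (\<xi> - \<eta>) + cn G \<eta> * ?e (\<xi> - \<eta>)) + m \<eta> * npow m n (\<xi> - \<eta>) \<partial>lborel)"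
    unfolding nconv_def by (simp add: nn_integral_add)
  also have "\<dots> \<le> (\<integral>\<^sup>+\<eta>. m' \<eta> * npow m' n (\<xi> - \<eta>) \<partial>lborel)"
  proof (rule nn_integral_mono)
    fix \<eta>
    let ?z = "\<xi> - \<eta>"
    \<comment> \<open>Bounding \<open>?P\<close> by the larger majorant and \<open>G\<close> by the
      smaller one lets the induction hypothesis absorb the second and third terms; what is left is
      \<open>?d + m\<close> times one common factor.\<close>
    have "(?d \<eta> * cn ?P ?z + cn G \<eta> * ?e ?z) + m \<eta> * npow m n ?z
      \<le> (?d \<eta> * npow m' n ?z + m \<eta> * ?e ?z) + m \<eta> * npow m n ?z"
      using le(2) cn_conv_power_le[of F m' n ?z] le(3)
      by (intro add_mono mult_mono) auto
    also have "\<dots> = ?d \<eta> * npow m' n ?z + m \<eta> * (?e ?z + npow m n ?z)"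
      by (simp add: algebra_simps)
    also have "\<dots> \<le> ?d \<eta> * npow m' n ?z + m \<eta> * npow m' n ?z"
      by (intro add_mono mult_left_mono Suc.IH) auto
    also have "\<dots> = (?d \<eta> + m \<eta>) * npow m' n ?z" by (simp add: algebra_simps)
    also have "\<dots> \<le> m' \<eta> * npow m' n ?z" by (intro mult_right_mono le) auto
    finally show "(?d \<eta> * cn ?P ?z + cn G \<eta> * ?e ?z) + m \<eta> * npow m n ?z \<le> m' \<eta> * npow m' n ?z" .
  qed
  finally show ?case by (simp add: nconv_def)
qed (use le in auto)

text \<open>Each further factor costs \<open>2 * a\<close> in the L^2 index. The constant is
  independent of \<open>f\<close> and \<open>B\<close>, which lets the existence time depend on the
  size of the data alone.\<close>

lemma npow_ctrl:
  assumes \<Gamma>: "half_line \<Gamma>" and a: "0 \<le> a" "s + 2 * a > 1/2"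
  shows "\<exists>K\<ge>1. \<forall>f B. bd s f B \<longrightarrow> supp_in \<Gamma> f \<longrightarrow> ctrl \<Gamma> s a n (npow f n) (K * B ^ Suc n)"
proof (induction n)
  case 0
  then show ?case using ctrl_base[OF a(2), of \<Gamma>] by simp
next
  case (Suc n)
  then obtain K where K: "K \<ge> 1" "\<And>f B. bd s f B \<Longrightarrow> supp_in \<Gamma> f \<Longrightarrow> ctrl \<Gamma> s a n (npow f n) (K * B ^ Suc n)"
    by blast
  from ctrl_base[OF a(2), of \<Gamma>] obtain C where C: "C \<ge> 1"
    "\<And>f B. bd s f B \<Longrightarrow> supp_in \<Gamma> f \<Longrightarrow> ctrl \<Gamma> s a 0 f (C * B)" by blast
  define D where "D = 4 powr \<bar>(s - 2 * a * real n)/2\<bar> + 4 powr \<bar>s/2\<bar> + 1"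
  have D: "D \<ge> 1" unfolding D_def by simp
  have "D * C * K \<ge> 1 * 1 * 1" using C(1) K(1) D by (intro mult_mono) auto
  moreover have "ctrl \<Gamma> s a (Suc n) (npow f (Suc n)) ((D * C * K) * B ^ Suc (Suc n))"
    if "bd s f B" "supp_in \<Gamma> f" for f B
  proof -
    have "D * (C * B) * (K * B ^ Suc n) = (D * C * K) * B ^ Suc (Suc n)" by (simp add: ac_simps)
    then show ?thesis
      using ctrl_nconv[OF \<Gamma> a(1) C(2)[OF that] K(2)[OF that], folded D_def] by (simp only: npow.simps)
  qed
  ultimately show ?case by (intro exI[of _ "D * C * K"]) auto
qed

text \<open>Of the two terms of \<open>cn_conv_diff_le\<close>, the first carries the difference in
  its leading factor and needs only the power estimate; the second carries it in the remaining power
  and needs the induction hypothesis. The two summands of the new constant correspond to these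
  terms.\<close>

lemma conv_power_diff_ctrl:
  assumes \<Gamma>: "half_line \<Gamma>" and a: "0 \<le> a" "s + 2 * a > 1/2"
  shows "\<exists>K\<ge>1. \<forall>F G R d. F \<in> borel_measurable borel \<longrightarrow> G \<in> borel_measurable borel
    \<longrightarrow> supp_in \<Gamma> (cn F) \<longrightarrow> supp_in \<Gamma> (cn G) \<longrightarrow> bd s (cn F) R \<longrightarrow> bd s (cn G) R
    \<longrightarrow> bd s (cn (\<lambda>x. F x - G x)) d
    \<longrightarrow> ctrl \<Gamma> s a n (cn (\<lambda>x. conv_power F n x - conv_power G n x)) (K * R ^ n * d)"
proof -
  have sd: "supp_in \<Gamma> (cn (\<lambda>x. F x - G x))" if "supp_in \<Gamma> (cn F)" "supp_in \<Gamma> (cn G)" for F G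
    using that unfolding supp_in_def by eventually_elim (auto simp: cn_def)
  from ctrl_base[OF a(2), of \<Gamma>] obtain C where C: "C \<ge> 1"
    "\<And>f B. bd s f B \<Longrightarrow> supp_in \<Gamma> f \<Longrightarrow> ctrl \<Gamma> s a 0 f (C * B)" by blast
  show ?thesis
  proof (induction n)
    case 0
    show ?case using C sd by (intro exI[of _ C]) auto
  next
    case (Suc n)
    then obtain K where K: "K \<ge> 1" and KK: "\<And>F G R d. F \<in> borel_measurable borel \<Longrightarrow> G \<in> borel_measurable borel
      \<Longrightarrow> supp_in \<Gamma> (cn F) \<Longrightarrow> supp_in \<Gamma> (cn G) \<Longrightarrow> bd s (cn F) R \<Longrightarrow> bd s (cn G) R
      \<Longrightarrow> bd s (cn (\<lambda>x. F x - G x)) d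
      \<Longrightarrow> ctrl \<Gamma> s a n (cn (\<lambda>x. conv_power F n x - conv_power G n x)) (K * R ^ n * d)"
      by blast
    from npow_ctrl[OF \<Gamma> a, of n] obtain L where L: "L \<ge> 1"
      "\<And>f B. bd s f B \<Longrightarrow> supp_in \<Gamma> f \<Longrightarrow> ctrl \<Gamma> s a n (npow f n) (L * B ^ Suc n)" by blast
    define D where "D = 4 powr \<bar>(s - 2 * a * real n)/2\<bar> + 4 powr \<bar>s/2\<bar> + 1"
    have D: "D \<ge> 1" unfolding D_def by simp
    have "1 * 1 * 1 + 0 \<le> D * C * L + D * C * K" using C(1) K(1) D L(1) by (intro add_mono mult_mono) auto
    then have 0: "1 \<le> D * C * L + D * C * K" by simp
    have "ctrl \<Gamma> s a (Suc n) (cn (\<lambda>x. conv_power F (Suc n) x - conv_power G (Suc n) x))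
        ((D * C * L + D * C * K) * R ^ Suc n * d)"
      if [measurable]: "F \<in> borel_measurable borel" "G \<in> borel_measurable borel"
      and s: "supp_in \<Gamma> (cn F)" "supp_in \<Gamma> (cn G)" and b: "bd s (cn F) R" "bd s (cn G) R"
        "bd s (cn (\<lambda>x. F x - G x)) d" for F G R d
    proof -
      let ?P = "conv_power F n" and ?Q = "conv_power G n"
      have P: "ctrl \<Gamma> s a n (cn ?P) (L * R ^ Suc n)"
        by (rule ctrl_le[OF L(2)[OF b(1) s(1)]]) (auto intro: cn_conv_power_le)
      have 1: "ctrl \<Gamma> s a (Suc n) (nconv (cn (\<lambda>x. F x - G x)) (cn ?P)) (D * (C * d) * (L * R ^ Suc n))"
        unfolding D_def by (intro ctrl_nconv[OF \<Gamma> a(1)] C(2) b sd s P)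
      have 2: "ctrl \<Gamma> s a (Suc n) (nconv (cn G) (cn (\<lambda>x. ?P x - ?Q x))) (D * (C * R) * (K * R ^ n * d))"
        unfolding D_def by (intro ctrl_nconv[OF \<Gamma> a(1)] C(2) b s KK) auto
      show ?thesis
      proof (rule ctrl_le[OF ctrl_add[OF 1 2]])
        show "cn (\<lambda>x. conv_power F (Suc n) x - conv_power G (Suc n) x) x
          \<le> nconv (cn (\<lambda>x. F x - G x)) (cn ?P) x + nconv (cn G) (cn (\<lambda>x. ?P x - ?Q x)) x" for x
          unfolding conv_power.simps by (rule cn_conv_diff_le) auto
        have "D * (C * d) * (L * R ^ Suc n) + D * (C * R) * (K * R ^ n * d) = (D * C * L + D * C * K) * R ^ Suc n * d"
          by (simp add: algebra_simps)
        then show "D * (C * d) * (L * R ^ Suc n) + D * (C * R) * (K * R ^ n * d) \<le> (D * C * L + D * C * K) * R ^ Suc n * d"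
          by (rule eq_refl)
      qed measurable
    qed
    then show ?case by (intro exI[of _ "D * C * L + D * C * K"] conjI allI impI 0)
  qed
qed

section \<open>Sobolev norms\<close>

lemma nn_integral_wt_cn:
  "(\<integral>\<^sup>+x. ennreal (wt s x) * (cn F x)\<^sup>2 \<partial>lborel) = (\<integral>\<^sup>+x. ennreal ((1 + x\<^sup>2) powr s * (cmod (F x))\<^sup>2) \<partial>lborel)"
  by (intro nn_integral_cong) (simp add: cn_def ennreal_power ennreal_mult wt_def)

lemma hsnorm_nonneg [simp]: "0 \<le> hsnorm s F"
  by (simp add: hsnorm_def)

lemma supp_in_UNIV [simp]: "supp_in UNIV f"
  by (simp add: supp_in_def)

lemma supp_in_cn: "supp_in \<Gamma> (cn F) \<longleftrightarrow> (AE x in lborel. x \<notin> \<Gamma> \<longrightarrow> F x = 0)"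
  by (simp add: supp_in_def cn_def)

lemma HsI:
  assumes "F \<in> borel_measurable borel" "bd s (cn F) B" "supp_in \<Gamma> (cn F)"
  shows "F \<in> Hs s \<Gamma>"
proof -
  note [measurable] = assms(1)
  have "integrable lborel (\<lambda>\<xi>. (1 + \<xi>\<^sup>2) powr s * (cmod (F \<xi>))\<^sup>2)"
  proof (rule integrableI_bounded)
    show "(\<integral>\<^sup>+x. ennreal (norm ((1 + x\<^sup>2) powr s * (cmod (F x))\<^sup>2)) \<partial>lborel) < \<infinity>"
      using bd_integral[OF assms(2)] by (simp add: nn_integral_wt_cn order_le_less_trans)
  qed measurable
  then show ?thesis using assms by (auto simp: Hs_def supp_in_cn)
qed

lemma Hs_measurable: "F \<in> Hs s \<Gamma> \<Longrightarrow> F \<in> borel_measurable borel"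
  by (simp add: Hs_def)

lemma Hs_supp: "F \<in> Hs s \<Gamma> \<Longrightarrow> supp_in \<Gamma> (cn F)"
  by (simp add: Hs_def supp_in_cn)

lemma bd_hsnorm:
  assumes "F \<in> Hs s \<Gamma>"
  shows "bd s (cn F) (hsnorm s F)"
proof -
  note [measurable] = Hs_measurable[OF assms]
  have i: "integrable lborel (\<lambda>\<xi>. (1 + \<xi>\<^sup>2) powr s * (cmod (F \<xi>))\<^sup>2)"
    using assms by (simp add: Hs_def)
  have "(\<integral>\<^sup>+x. ennreal (wt s x) * (cn F x)\<^sup>2 \<partial>lborel) = ennreal (LINT \<xi>|lborel. (1 + \<xi>\<^sup>2) powr s * (cmod (F \<xi>))\<^sup>2)"
    unfolding nn_integral_wt_cn by (rule nn_integral_eq_integral[OF i]) simp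
  also have "\<dots> = ennreal ((hsnorm s F)\<^sup>2)"
    unfolding hsnorm_def by (subst real_sqrt_pow2) (auto intro!: Bochner_Integration.integral_nonneg)
  finally show ?thesis by (simp add: bd_def)
qed

text \<open>\<open>hsnorm\<close> takes the default value 0 when its integral diverges, whereas
  \<open>bd\<close> detects infinity. Membership in \<open>Hs\<close> excludes the default value,
  and only then can bounds be carried in both directions.\<close>

lemma hsnorm_le_iff_bd:
  assumes "F \<in> Hs s \<Gamma>"
  shows "bd s (cn F) B \<longleftrightarrow> hsnorm s F \<le> B"
proof
  note [measurable] = Hs_measurable[OF assms]
  assume B: "bd s (cn F) B"
  have "integrable lborel (\<lambda>\<xi>. (1 + \<xi>\<^sup>2) powr s * (cmod (F \<xi>))\<^sup>2)"
    using assms by (simp add: Hs_def)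
  from nn_integral_eq_integral[OF this] bd_integral[OF B]
  have "(LINT \<xi>|lborel. (1 + \<xi>\<^sup>2) powr s * (cmod (F \<xi>))\<^sup>2) \<le> B\<^sup>2"
    by (simp add: nn_integral_wt_cn)
  then show "hsnorm s F \<le> B"
    unfolding hsnorm_def using bd_nonneg[OF B] by (intro real_le_lsqrt)
next
  assume "hsnorm s F \<le> B"
  then show "bd s (cn F) B"
    using bd_mono[OF bd_hsnorm[OF assms], of "cn F" B s] Hs_measurable[OF assms] by auto
qed

lemma hsnorm_le: "F \<in> borel_measurable borel \<Longrightarrow> bd s (cn F) B \<Longrightarrow> hsnorm s F \<le> B"
  using hsnorm_le_iff_bd[OF HsI[of F s B UNIV]] by simp

lemma Hs_mono: "F \<in> Hs s \<Gamma> \<Longrightarrow> q \<le> s \<Longrightarrow> F \<in> Hs q \<Gamma>"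
  by (rule HsI[OF Hs_measurable bd_mono[OF bd_hsnorm] Hs_supp]) (auto dest: Hs_measurable)

lemma hsnorm_mono: "F \<in> Hs s \<Gamma> \<Longrightarrow> q \<le> s \<Longrightarrow> hsnorm q F \<le> hsnorm s F"
  by (rule hsnorm_le[OF Hs_measurable bd_mono[OF bd_hsnorm]]) (auto dest: Hs_measurable)

lemma
  assumes "F \<in> Hs s \<Gamma>" "G \<in> Hs s \<Gamma>"
  shows Hs_add: "(\<lambda>x. F x + G x) \<in> Hs s \<Gamma>"
    and hsnorm_triangle: "hsnorm s (\<lambda>x. F x + G x) \<le> hsnorm s F + hsnorm s G"
proof -
  note [measurable] = assms[THEN Hs_measurable]
  have b: "bd s (cn (\<lambda>x. F x + G x)) (hsnorm s F + hsnorm s G)"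
    by (rule bd_mono[OF bd_add[OF assms[THEN bd_hsnorm]]])
       (auto simp: cn_def norm_triangle_ineq intro!: ennreal_leI simp flip: ennreal_plus)
  have "supp_in \<Gamma> (cn (\<lambda>x. F x + G x))"
    using assms[THEN Hs_supp] unfolding supp_in_cn by eventually_elim auto
  with b show "(\<lambda>x. F x + G x) \<in> Hs s \<Gamma>" by (auto intro: HsI)
  show "hsnorm s (\<lambda>x. F x + G x) \<le> hsnorm s F + hsnorm s G"
    by (rule hsnorm_le[OF _ b]) measurable
qed

lemma
  assumes "F \<in> Hs s \<Gamma>"
  shows Hs_cmult: "(\<lambda>x. c * F x) \<in> Hs s \<Gamma>"
    and hsnorm_cmult_le: "hsnorm s (\<lambda>x. c * F x) \<le> cmod c * hsnorm s F"
proof -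
  note [measurable] = assms[THEN Hs_measurable]
  have "cn (\<lambda>x. c * F x) = (\<lambda>x. ennreal (cmod c) * cn F x)"
    by (auto simp: cn_def norm_mult ennreal_mult)
  then have b: "bd s (cn (\<lambda>x. c * F x)) (cmod c * hsnorm s F)"
    using bd_cmult[OF bd_hsnorm[OF assms], of "cmod c"] by simp
  have "supp_in \<Gamma> (cn (\<lambda>x. c * F x))"
    using assms[THEN Hs_supp] unfolding supp_in_cn by eventually_elim auto
  with b show "(\<lambda>x. c * F x) \<in> Hs s \<Gamma>" by (auto intro: HsI)
  show "hsnorm s (\<lambda>x. c * F x) \<le> cmod c * hsnorm s F"
    by (rule hsnorm_le[OF _ b]) measurable
qed

lemma hsnorm_minus_commute: "hsnorm s (\<lambda>x. F x - G x) = hsnorm s (\<lambda>x. G x - F x)"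
  by (simp add: hsnorm_def norm_minus_commute)

lemma
  assumes "F \<in> Hs s \<Gamma>" "G \<in> Hs s \<Gamma>"
  shows Hs_diff: "(\<lambda>x. F x - G x) \<in> Hs s \<Gamma>"
    and hsnorm_diff_le: "hsnorm s (\<lambda>x. F x - G x) \<le> hsnorm s F + hsnorm s G"
proof -
  have 1: "(\<lambda>x. - 1 * G x) \<in> Hs s \<Gamma>" by (rule Hs_cmult[OF assms(2)])
  show "(\<lambda>x. F x - G x) \<in> Hs s \<Gamma>" using Hs_add[OF assms(1) 1] by simp
  have "hsnorm s (\<lambda>x. - 1 * G x) = hsnorm s G" by (simp add: hsnorm_def)
  then show "hsnorm s (\<lambda>x. F x - G x) \<le> hsnorm s F + hsnorm s G"
    using hsnorm_triangle[OF assms(1) 1] by simp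
qed

lemma hsnorm_le_diff:
  assumes "F \<in> Hs s \<Gamma>" "G \<in> Hs s \<Gamma>"
  shows "hsnorm s F \<le> hsnorm s G + hsnorm s (\<lambda>x. F x - G x)"
  using hsnorm_triangle[OF assms(2) Hs_diff[OF assms]] by simp

lemma hsnorm_abs_diff_le:
  assumes "F \<in> Hs s \<Gamma>" "G \<in> Hs s \<Gamma>"
  shows "\<bar>hsnorm s F - hsnorm s G\<bar> \<le> hsnorm s (\<lambda>x. F x - G x)"
  using hsnorm_le_diff[OF assms] hsnorm_le_diff[OF assms(2,1)] hsnorm_minus_commute[of s F G] by linarith

lemma hsnorm_zero_AE:
  assumes "F \<in> Hs s \<Gamma>" "hsnorm s F = 0"
  shows "AE x in lborel. F x = 0"
proof -
  note [measurable] = assms(1)[THEN Hs_measurable]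
  have "(\<integral>\<^sup>+x. ennreal (wt s x) * (cn F x)\<^sup>2 \<partial>lborel) = 0"
    using bd_integral[OF bd_hsnorm[OF assms(1)]] assms(2) by simp
  then have "AE x in lborel. ennreal (wt s x) * (cn F x)\<^sup>2 = 0"
    by (subst (asm) nn_integral_0_iff_AE) auto
  then show ?thesis by eventually_elim (simp add: cn_def ennreal_eq_0_iff not_le[THEN iffD2, OF wt_pos])
qed

lemma hsnorm_cong_AE:
  assumes "AE x in lborel. F x = G x" "F \<in> borel_measurable borel" "G \<in> borel_measurable borel"
  shows "hsnorm s F = hsnorm s G"
proof -
  note [measurable] = assms(2,3)
  have "(LINT \<xi>|lborel. (1 + \<xi>\<^sup>2) powr s * (cmod (F \<xi>))\<^sup>2) = (LINT \<xi>|lborel. (1 + \<xi>\<^sup>2) powr s * (cmod (G \<xi>))\<^sup>2)"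
    by (rule integral_cong_AE) (use assms(1) in auto)
  then show ?thesis by (simp add: hsnorm_def)
qed

lemma
  assumes "F \<in> Hs r \<Gamma>" "g \<in> Hs (-r) \<Delta>"
  shows pairing_integrable: "integrable lborel (\<lambda>\<xi>. F \<xi> * g \<xi>)"
    and pairing_le: "cmod (LINT \<xi>|lborel. F \<xi> * g \<xi>) \<le> hsnorm r F * hsnorm (-r) g"
proof -
  note [measurable] = assms[THEN Hs_measurable]
  have "(\<integral>\<^sup>+x. ennreal (norm (F x * g x)) \<partial>lborel) = (\<integral>\<^sup>+x. cn F x * cn g x \<partial>lborel)"
    by (simp add: cn_def norm_mult ennreal_mult)
  also have "\<dots> \<le> ennreal (hsnorm r F * hsnorm (-r) g)"
    by (rule bd_pairing[OF assms[THEN bd_hsnorm]])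
  finally have *: "(\<integral>\<^sup>+x. ennreal (norm (F x * g x)) \<partial>lborel) \<le> ennreal (hsnorm r F * hsnorm (-r) g)" .
  then show i: "integrable lborel (\<lambda>\<xi>. F \<xi> * g \<xi>)"
    by (intro integrableI_bounded) (auto intro: order_le_less_trans)
  have "ennreal (cmod (LINT \<xi>|lborel. F \<xi> * g \<xi>)) \<le> ennreal (hsnorm r F * hsnorm (-r) g)"
    using integral_norm_bound_ennreal[OF i] * by (rule order_trans)
  then show "cmod (LINT \<xi>|lborel. F \<xi> * g \<xi>) \<le> hsnorm r F * hsnorm (-r) g"
    by (simp add: ennreal_le_iff)
qed

text \<open>Upgrades convergence at almost every frequency to convergence in norm. It yields the
  time regularity of the Picard limit as well as the convergence of the approximating
  multipliers.\<close>

lemma hsnorm_tendsto_0: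
  fixes F :: "nat \<Rightarrow> real \<Rightarrow> complex"
  assumes [measurable]: "\<And>n. F n \<in> borel_measurable borel"
    and m: "bd s m B" and le: "\<And>n. AE x in lborel. cn (F n) x \<le> m x"
    and lim: "AE x in lborel. (\<lambda>n. F n x) \<longlonglongrightarrow> 0"
  shows "(\<lambda>n. hsnorm s (F n)) \<longlonglongrightarrow> 0"
proof -
  note [measurable] = bd_measurable[OF m]
  have "(\<lambda>n. \<integral>\<^sup>+x. ennreal (wt s x) * (cn (F n) x)\<^sup>2 \<partial>lborel) \<longlonglongrightarrow> (\<integral>\<^sup>+x. 0 \<partial>(lborel::real measure))"
  proof (rule nn_integral_dominated_convergence[where w="\<lambda>x. ennreal (wt s x) * (m x)\<^sup>2"])
    show "AE x in lborel. ennreal (wt s x) * (cn (F j) x)\<^sup>2 \<le> ennreal (wt s x) * (m x)\<^sup>2" for j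
      using le[of j] by eventually_elim (auto intro!: mult_left_mono power_mono)
    show "(\<integral>\<^sup>+x. ennreal (wt s x) * (m x)\<^sup>2 \<partial>lborel) < \<infinity>"
      using bd_integral[OF m] by (simp add: order_le_less_trans)
    show "AE x in lborel. (\<lambda>i. ennreal (wt s x) * (cn (F i) x)\<^sup>2) \<longlonglongrightarrow> 0"
      using lim
    proof eventually_elim
      case (elim x)
      then have "(\<lambda>i. wt s x * (cmod (F i x))\<^sup>2) \<longlonglongrightarrow> wt s x * (cmod 0)\<^sup>2" by (intro tendsto_intros)
      then have "(\<lambda>i. ennreal (wt s x * (cmod (F i x))\<^sup>2)) \<longlonglongrightarrow> ennreal 0"
        by (intro tendsto_ennrealI) simp
      then show ?case by (simp add: cn_def ennreal_power ennreal_mult)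
    qed
  qed measurable
  then have lim0: "(\<lambda>n. \<integral>\<^sup>+x. ennreal (wt s x) * (cn (F n) x)\<^sup>2 \<partial>lborel) \<longlonglongrightarrow> ennreal 0" by simp
  have H: "F n \<in> Hs s UNIV" for n
    by (rule HsI[OF _ bd_mono[OF m _ le order_refl order_refl]]) auto
  have "(\<integral>\<^sup>+x. ennreal (wt s x) * (cn (F n) x)\<^sup>2 \<partial>lborel) = ennreal ((hsnorm s (F n))\<^sup>2)" for n
  proof -
    have "integrable lborel (\<lambda>\<xi>. (1 + \<xi>\<^sup>2) powr s * (cmod (F n \<xi>))\<^sup>2)"
      using H[of n] by (simp add: Hs_def)
    from nn_integral_eq_integral[OF this] show ?thesis
      unfolding hsnorm_def by (subst real_sqrt_pow2) (auto simp: nn_integral_wt_cn intro!: Bochner_Integration.integral_nonneg)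
  qed
  with lim0 have "(\<lambda>n. ennreal ((hsnorm s (F n))\<^sup>2)) \<longlonglongrightarrow> ennreal 0" by simp
  then have "(\<lambda>n. (hsnorm s (F n))\<^sup>2) \<longlonglongrightarrow> 0" by (subst (asm) tendsto_ennreal_iff) auto
  then have "(\<lambda>n. sqrt ((hsnorm s (F n))\<^sup>2)) \<longlonglongrightarrow> sqrt 0" by (intro tendsto_intros)
  then show ?thesis by simp
qed

section \<open>Smooth functions and the Fourier transform\<close>

text \<open>A smooth function is carried along with the sequence of all its derivatives.\<close>

definition smooth1 :: "(nat \<Rightarrow> real \<Rightarrow> 'a::real_normed_vector) \<Rightarrow> bool" where
  "smooth1 D \<longleftrightarrow> (\<forall>n x. (D n has_vector_derivative D (Suc n) x) (at x))"

lemma smooth1_continuous: "smooth1 D \<Longrightarrow> continuous_on A (D n)"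
  unfolding smooth1_def
  by (meson continuous_at_imp_continuous_on has_vector_derivative_continuous)

text \<open>Leibniz's formula is the witness for the sequence of derivatives; passing from
  \<open>n\<close> to \<open>Suc n\<close> is Pascal's rule after a shift of the summation
  index.\<close>

lemma smooth1_mult:
  fixes F G :: "nat \<Rightarrow> real \<Rightarrow> 'a::real_normed_field"
  assumes F: "smooth1 F" and G: "smooth1 G"
  shows "smooth1 (\<lambda>n x. \<Sum>k\<le>n. of_nat (n choose k) * (F k x * G (n - k) x))"
  unfolding smooth1_def
proof (intro allI)
  fix n x
  have d: "((\<lambda>x. \<Sum>k\<le>n. of_nat (n choose k) * (F k x * G (n - k) x)) has_vector_derivative
      (\<Sum>k\<le>n. of_nat (n choose k) * (F k x * G (Suc (n - k)) x + F (Suc k) x * G (n - k) x))) (at x)"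
    using F G unfolding smooth1_def
    by (intro has_vector_derivative_sum has_vector_derivative_mult_right has_vector_derivative_mult) auto
  have "(\<Sum>k\<le>Suc n. of_nat (Suc n choose k) * (F k x * G (Suc n - k) x))
      = (\<Sum>k\<le>n. of_nat (n choose k) * (F k x * G (Suc (n - k)) x))
        + (\<Sum>k\<le>n. of_nat (n choose k) * (F (Suc k) x * G (n - k) x))"
  proof -
    have "(\<Sum>k\<le>Suc n. of_nat (Suc n choose k) * (F k x * G (Suc n - k) x))
       = F 0 x * G (Suc n) x + (\<Sum>k\<le>n. of_nat (Suc n choose Suc k) * (F (Suc k) x * G (n - k) x))"
      by (subst sum.atMost_Suc_shift) simp
    also have "(\<Sum>k\<le>n. of_nat (Suc n choose Suc k) * (F (Suc k) x * G (n - k) x))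
       = (\<Sum>k\<le>n. of_nat (n choose k) * (F (Suc k) x * G (n - k) x))
        + (\<Sum>k\<le>n. of_nat (n choose Suc k) * (F (Suc k) x * G (n - k) x))"
      by (simp add: sum.distrib[symmetric] algebra_simps)
    also have "F 0 x * G (Suc n) x + (\<dots>) = (\<Sum>k\<le>n. of_nat (n choose k) * (F (Suc k) x * G (n - k) x))
        + (F 0 x * G (Suc n) x + (\<Sum>k\<le>n. of_nat (n choose Suc k) * (F (Suc k) x * G (n - k) x)))"
      by simp
    also have "F 0 x * G (Suc n) x + (\<Sum>k\<le>n. of_nat (n choose Suc k) * (F (Suc k) x * G (n - k) x))
       = (\<Sum>k\<le>Suc n. of_nat (n choose k) * (F k x * G (Suc n - k) x))"
      by (subst sum.atMost_Suc_shift) simp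
    also have "\<dots> = (\<Sum>k\<le>n. of_nat (n choose k) * (F k x * G (Suc n - k) x))"
      by simp
    also have "\<dots> = (\<Sum>k\<le>n. of_nat (n choose k) * (F k x * G (Suc (n - k)) x))"
      by (intro sum.cong) (auto simp: Suc_diff_le)
    finally show ?thesis by (simp add: add.commute)
  qed
  also have "\<dots> = (\<Sum>k\<le>n. of_nat (n choose k) * (F k x * G (Suc (n - k)) x + F (Suc k) x * G (n - k) x))"
    by (simp add: sum.distrib[symmetric] algebra_simps)
  finally show "((\<lambda>x. \<Sum>k\<le>n. of_nat (n choose k) * (F k x * G (n - k) x)) has_vector_derivative
      (\<Sum>k\<le>Suc n. of_nat (Suc n choose k) * (F k x * G (Suc n - k) x))) (at x)"
    using d by simp
qed

lemma smooth1_affine: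
  fixes F :: "nat \<Rightarrow> real \<Rightarrow> 'a::real_normed_vector"
  assumes "smooth1 F"
  shows "smooth1 (\<lambda>n x. (c ^ n) *\<^sub>R F n (b + c * x))"
  unfolding smooth1_def
proof (intro allI)
  fix n x
  have "((F n \<circ> (\<lambda>x. b + c * x)) has_vector_derivative c *\<^sub>R F (Suc n) (b + c * x)) (at x)"
    by (rule vector_diff_chain_at)
       (use assms in \<open>auto simp: smooth1_def has_real_derivative_iff_has_vector_derivative[symmetric] intro!: derivative_eq_intros\<close>)
  from bounded_linear.has_vector_derivative[OF bounded_linear_scaleR_right this, of "c ^ n"]
  show "((\<lambda>x. c ^ n *\<^sub>R F n (b + c * x)) has_vector_derivative c ^ Suc n *\<^sub>R F (Suc n) (b + c * x)) (at x)"
    by (simp add: o_def mult.commute)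
qed

section \<open>A smooth bump function\<close>

definition flat_exp :: "real poly \<Rightarrow> real \<Rightarrow> real" where
  "flat_exp P x = (if x \<le> 0 then 0 else poly P (1/x) * exp (- (1/x)))"

lemma poly_mult_exp_tendsto_0: "((\<lambda>y::real. poly P y * exp (- y)) \<longlongrightarrow> 0) at_top"
proof -
  have "((\<lambda>y. \<Sum>i\<le>degree P. coeff P i * (y ^ i / exp y)) \<longlongrightarrow> (\<Sum>i\<le>degree P. coeff P i * 0)) at_top"
    by (intro tendsto_intros tendsto_power_div_exp_0)
  then show ?thesis
    by (simp add: poly_altdef sum_distrib_right sum_divide_distrib exp_minus field_simps)
qed

text \<open>These functions form a class containing exp(-1/x) and closed under differentiation. With
  y = 1/x one has dy/dx = -y^2, so P(y) exp(-y) has derivative y^2 (P(y) - P'(y)) exp(-y), whose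
  polynomial is the one displayed. At the origin the exponential beats every power of y.\<close>

lemma flat_exp_deriv:
  "(flat_exp P has_real_derivative flat_exp ([:0,0,1:] * (P - pderiv P)) x) (at x)"
proof -
  consider "x > 0" | "x < 0" | "x = 0" by linarith
  then show ?thesis
  proof cases
    case 1
    have "((\<lambda>x. poly P (1/x) * exp (- (1/x))) has_real_derivative
        flat_exp ([:0,0,1:] * (P - pderiv P)) x) (at x)"
      using 1
      by (auto intro!: derivative_eq_intros DERIV_chain2[OF poly_DERIV]
          simp: flat_exp_def field_simps power2_eq_square)
    then show ?thesis
      by (rule has_field_derivative_transform_within_open[where S="{0<..}"])
         (use 1 in \<open>auto simp: flat_exp_def\<close>)
  next
    case 2
    have "((\<lambda>x. 0) has_real_derivative flat_exp ([:0,0,1:] * (P - pderiv P)) x) (at x)"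
      using 2 by (simp add: flat_exp_def)
    then show ?thesis
      by (rule has_field_derivative_transform_within_open[where S="{..<0}"])
         (use 2 in \<open>auto simp: flat_exp_def\<close>)
  next
    case 3
    have "((\<lambda>h. flat_exp P h / h) \<longlongrightarrow> 0) (at_left 0)"
      by (rule tendsto_eventually) (auto simp: eventually_at_filter flat_exp_def intro!: always_eventually)
    moreover have "((\<lambda>h. flat_exp P h / h) \<longlongrightarrow> 0) (at_right 0)"
    proof -
      have "((\<lambda>h. poly ([:0,1:] * P) (inverse h) * exp (- inverse h)) \<longlongrightarrow> 0) (at_right 0)"
        by (rule filterlim_compose[OF poly_mult_exp_tendsto_0 filterlim_inverse_at_top_right])
      then show ?thesis
        by (rule Lim_transform_eventually)
           (auto simp: eventually_at_filter flat_exp_def field_simps intro!: always_eventually)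
    qed
    ultimately have "((\<lambda>h. flat_exp P h / h) \<longlongrightarrow> 0) (at 0)"
      by (simp add: filterlim_at_split)
    then show ?thesis using 3 by (simp add: DERIV_def flat_exp_def)
  qed
qed

primrec flat_poly :: "nat \<Rightarrow> real poly" where
  "flat_poly 0 = 1"
| "flat_poly (Suc n) = [:0,0,1:] * (flat_poly n - pderiv (flat_poly n))"

lemma exists_bump:
  "\<exists>\<beta> :: nat \<Rightarrow> real \<Rightarrow> real. smooth1 \<beta> \<and> (\<forall>n x. 1 \<le> \<bar>x\<bar> \<longrightarrow> \<beta> n x = 0)
     \<and> (\<forall>x. 0 \<le> \<beta> 0 x) \<and> (\<forall>x. \<bar>x\<bar> < 1 \<longrightarrow> 0 < \<beta> 0 x)"
proof -
  define E where "E n = flat_exp (flat_poly n)" for n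
  have E: "smooth1 E"
    unfolding smooth1_def E_def
    by (simp only: flat_poly.simps has_real_derivative_iff_has_vector_derivative[symmetric] flat_exp_deriv simp_thms)
  \<comment> \<open>The bump is E(1 + x) E(1 - x); the trivial factors are kept to match
    \<open>smooth1_affine\<close>.\<close>
  define F G where "F n x = (1 ^ n) *\<^sub>R E n (1 + 1 * x)" and "G n x = ((-1) ^ n) *\<^sub>R E n (1 + (-1) * x)" for n x
  have F: "smooth1 F" and G: "smooth1 G"
    unfolding F_def[abs_def] G_def[abs_def] by (intro smooth1_affine E)+
  define \<beta> where "\<beta> n x = (\<Sum>k\<le>n. of_nat (n choose k) * (F k x * G (n - k) x))" for n x
  have "smooth1 \<beta>" unfolding \<beta>_def[abs_def] by (rule smooth1_mult[OF F G])
  moreover have "\<beta> n x = 0" if "1 \<le> \<bar>x\<bar>" for n x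
  proof -
    have "F k x * G j x = 0" for k j
      using that by (auto simp: F_def G_def E_def flat_exp_def)
    then show ?thesis unfolding \<beta>_def by (intro sum.neutral) simp
  qed
  moreover have "0 \<le> \<beta> 0 x" "\<bar>x\<bar> < 1 \<Longrightarrow> 0 < \<beta> 0 x" for x
    by (auto simp: \<beta>_def F_def G_def E_def flat_exp_def)
  ultimately show ?thesis by blast
qed

section \<open>Calculus for compactly supported functions\<close>

lemma deriv_zero_outside:
  fixes f f' :: "real \<Rightarrow> 'a::real_normed_vector"
  assumes "(f has_vector_derivative f' x) (at x)" "a < \<bar>x\<bar>" "\<And>y. a < \<bar>y\<bar> \<Longrightarrow> f y = 0"
  shows "f' x = 0"
proof -
  have "open {y::real. a < \<bar>y\<bar>}"
    by (intro open_Collect_less continuous_intros)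
  then have "((\<lambda>_. 0) has_vector_derivative f' x) (at x)"
    using assms by (intro has_vector_derivative_transform_within_open[OF assms(1)]) auto
  then show ?thesis
    by (rule vector_derivative_unique_at) (rule has_vector_derivative_const)
qed

lemma compact_support_integrable:
  fixes f :: "real \<Rightarrow> 'a::{banach, second_countable_topology}"
  assumes "continuous_on UNIV f" "\<And>x. a < \<bar>x\<bar> \<Longrightarrow> f x = 0"
  shows "integrable lborel f"
proof -
  have "continuous_on {-a..a} f" using assms(1) continuous_on_subset by blast
  then have "set_integrable lborel {-a..a} f"
    by (rule borel_integrable_atLeastAtMost')
  then have "integrable lborel (\<lambda>x. indicator {-a..a} x *\<^sub>R f x)" by (simp add: set_integrable_def)
  moreover have "(\<lambda>x. indicator {-a..a} x *\<^sub>R f x) = f"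
    using assms(2) by (auto simp: indicator_def fun_eq_iff abs_le_iff not_le)
  ultimately show ?thesis by simp
qed

lemma integral_compact_deriv_eq_0:
  fixes f f' :: "real \<Rightarrow> 'a::euclidean_space"
  assumes d: "\<And>x. (f has_vector_derivative f' x) (at x)" and "continuous_on UNIV f'"
    and z: "\<And>x. a < \<bar>x\<bar> \<Longrightarrow> f x = 0"
  shows "(LINT x|lborel. f' x) = 0"
proof -
  \<comment> \<open>Both endpoints lie strictly beyond \<open>a\<close> in modulus, whatever the
    sign of \<open>a\<close>.\<close>
  let ?b = "\<bar>a\<bar> + 1"
  have "(LINT x|lborel. indicator {-?b..?b} x *\<^sub>R f' x) = f ?b - f (- ?b)"
    by (rule integral_FTC_Icc)
       (use assms in \<open>auto intro: has_vector_derivative_at_within continuous_on_subset\<close>)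
  also have "\<dots> = 0" using z[of ?b] z[of "- ?b"] by simp
  also have "(\<lambda>x. indicator {-?b..?b} x *\<^sub>R f' x) = f'"
  proof
    fix x
    show "indicator {-?b..?b} x *\<^sub>R f' x = f' x"
      using deriv_zero_outside[of f f' x a, OF d _ z] by (cases "a < \<bar>x\<bar>") (auto simp: indicator_def)
  qed
  finally show ?thesis .
qed

lemma has_vector_derivative_iff_quotient:
  fixes f :: "real \<Rightarrow> 'a::real_normed_vector"
  shows "(f has_vector_derivative D) (at t within S)
    \<longleftrightarrow> ((\<lambda>\<tau>. (1 / (\<tau> - t)) *\<^sub>R (f \<tau> - f t)) \<longlongrightarrow> D) (at t within S)"
proof -
  let ?g = "\<lambda>\<tau>. (1 / norm (\<tau> - t)) *\<^sub>R (f \<tau> - (f t + (\<tau> - t) *\<^sub>R D))"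
  let ?q = "\<lambda>\<tau>. (1 / (\<tau> - t)) *\<^sub>R (f \<tau> - f t) - D"
  have eq: "norm (?g \<tau>) = norm (?q \<tau>)" if "\<tau> \<noteq> t" for \<tau>
  proof -
    have "?q \<tau> = (1 / (\<tau> - t)) *\<^sub>R (f \<tau> - (f t + (\<tau> - t) *\<^sub>R D))"
      using that by (simp add: diff_diff_add[symmetric] scaleR_diff_right[of _ "f \<tau> - f t"])
    then show ?thesis by simp
  qed
  have "(f has_vector_derivative D) (at t within S) \<longleftrightarrow> ((\<lambda>\<tau>. norm (?g \<tau>)) \<longlongrightarrow> 0) (at t within S)"
    unfolding has_vector_derivative_def has_derivative_within tendsto_norm_zero_iff
    by (simp add: bounded_linear_scaleR_left)
  also have "\<dots> \<longleftrightarrow> ((\<lambda>\<tau>. norm (?q \<tau>)) \<longlongrightarrow> 0) (at t within S)"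
    by (rule filterlim_cong) (use eq in \<open>auto simp: eventually_at_filter intro!: always_eventually\<close>)
  also have "\<dots> \<longleftrightarrow> ((\<lambda>\<tau>. (1 / (\<tau> - t)) *\<^sub>R (f \<tau> - f t)) \<longlongrightarrow> D) (at t within S)"
    unfolding tendsto_norm_zero_iff by (rule LIM_zero_iff)
  finally show ?thesis .
qed

lemma has_vector_derivative_norm_bound:
  fixes f :: "real \<Rightarrow> 'a::real_normed_vector"
  assumes "convex S" "\<And>x. x \<in> S \<Longrightarrow> (f has_vector_derivative f' x) (at x within S)"
    "\<And>x. x \<in> S \<Longrightarrow> norm (f' x) \<le> B" "x \<in> S" "y \<in> S"
  shows "norm (f x - f y) \<le> B * \<bar>x - y\<bar>"
proof -
  have "norm (f x - f y) \<le> B * norm (x - y)"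
  proof (rule differentiable_bound[OF assms(1) _ _ assms(4,5)])
    fix z assume z: "z \<in> S"
    show "(f has_derivative (\<lambda>h. h *\<^sub>R f' z)) (at z within S)"
      using assms(2)[OF z] by (simp add: has_vector_derivative_def)
    show "onorm (\<lambda>h. h *\<^sub>R f' z) \<le> B"
      using assms(3)[OF z] by (intro onorm_le) (auto intro: mult_right_mono simp: mult.commute[of _ "norm (f' z)"])
  qed
  then show ?thesis by simp
qed

text \<open>Dominated convergence of the difference quotients along sequences; the mean value
  inequality turns the bound on the derivative into the dominating function.\<close>

lemma has_vector_derivative_under_integral:
  fixes f f' :: "real \<Rightarrow> 'b \<Rightarrow> complex"
  assumes d: "\<And>t x. ((\<lambda>t. f t x) has_vector_derivative f' t x) (at t)"
    and i: "\<And>t. integrable M (f t)" and [measurable]: "\<And>t. f' t \<in> borel_measurable M"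
    and B: "integrable M B" "\<And>t x. norm (f' t x) \<le> B x"
  shows "((\<lambda>t. LINT x|M. f t x) has_vector_derivative (LINT x|M. f' t x)) (at t)"
  unfolding has_vector_derivative_iff_quotient tendsto_at_iff_sequentially
proof (intro allI impI)
  have [measurable]: "f t \<in> borel_measurable M" for t using i by auto
  fix h :: "nat \<Rightarrow> real" assume h: "\<forall>i. h i \<in> UNIV - {t}" "h \<longlonglongrightarrow> t"
  have "(\<lambda>n. LINT x|M. (1 / (h n - t)) *\<^sub>R (f (h n) x - f t x)) \<longlonglongrightarrow> (LINT x|M. f' t x)"
  proof (rule integral_dominated_convergence[where w=B])
    show "AE x in M. (\<lambda>n. (1 / (h n - t)) *\<^sub>R (f (h n) x - f t x)) \<longlonglongrightarrow> f' t x"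
    proof (rule AE_I2)
      fix x
      show "(\<lambda>n. (1 / (h n - t)) *\<^sub>R (f (h n) x - f t x)) \<longlonglongrightarrow> f' t x"
        using d[of x t, unfolded has_vector_derivative_iff_quotient tendsto_at_iff_sequentially] h
        by (auto simp: o_def)
    qed
    show "AE x in M. norm ((1 / (h n - t)) *\<^sub>R (f (h n) x - f t x)) \<le> B x" for n
    proof (rule AE_I2)
      fix x
      have "norm (f (h n) x - f t x) \<le> B x * \<bar>h n - t\<bar>"
        by (rule has_vector_derivative_norm_bound[of UNIV "\<lambda>t. f t x" "\<lambda>t. f' t x"]) (use d B(2) in auto)
      then show "norm ((1 / (h n - t)) *\<^sub>R (f (h n) x - f t x)) \<le> B x"
        using h(1) by (simp add: divide_le_eq del: scaleR_diff_right scaleR_right_diff_distrib)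
    qed
  qed (use B in auto)
  then show "((\<lambda>\<tau>. (1 / (\<tau> - t)) *\<^sub>R ((LINT x|M. f \<tau> x) - (LINT x|M. f t x))) \<circ> h) \<longlonglongrightarrow> (LINT x|M. f' t x)"
    using i by (simp add: o_def)
qed

section \<open>Inverse Fourier transforms of compactly supported functions\<close>

definition iftc :: "(real \<Rightarrow> complex) \<Rightarrow> real \<Rightarrow> complex" where
  "iftc f \<xi> = (LINT x|lborel. cis (2 * pi * x * \<xi>) * f x)"

lemma ift_eq_iftc: "ift \<psi> = iftc (\<lambda>x. complex_of_real (\<psi> x))"
  by (simp add: fun_eq_iff ift_def iftc_def)

lemma cis_continuous [continuous_intros]: "continuous_on S f \<Longrightarrow> continuous_on S (\<lambda>x. cis (f x))"
  unfolding cis_conv_exp by (intro continuous_intros)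

lemma cis_borel_measurable [measurable]: "cis \<in> borel_measurable borel"
  by (intro borel_measurable_continuous_onI continuous_intros)

lemma cis_vector_derivative:
  "((\<lambda>x. cis (c * x)) has_vector_derivative (\<i> * complex_of_real c * cis (c * x))) (at x within S)"
proof -
  have "((\<lambda>x. exp (\<i> * complex_of_real c * complex_of_real x)) has_vector_derivative
     (\<i> * complex_of_real c * exp (\<i> * complex_of_real c * complex_of_real x))) (at x within S)"
    by (rule has_vector_derivative_real_field) (auto intro!: derivative_eq_intros)
  then show ?thesis by (simp add: cis_conv_exp mult.assoc)
qed

lemma iftc_measurable [measurable]:
  assumes [measurable]: "f \<in> borel_measurable borel"
  shows "iftc f \<in> borel_measurable borel"
  unfolding iftc_def by measurable

lemma integrable_cis_mult:
  assumes "integrable lborel f" "h \<in> borel_measurable borel"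
  shows "integrable lborel (\<lambda>x. cis (h x) * f x)"
  using assms
  by (intro Bochner_Integration.integrable_bound[OF assms(1)]) (auto simp: norm_mult)

lemma iftc_bound:
  assumes "integrable lborel f"
  shows "cmod (iftc f \<xi>) \<le> (LINT x|lborel. cmod (f x))"
proof -
  have "cmod (iftc f \<xi>) \<le> (LINT x|lborel. cmod (cis (2 * pi * x * \<xi>) * f x))"
    unfolding iftc_def by (rule integral_norm_bound)
  then show ?thesis by (simp add: norm_mult)
qed

text \<open>Integration by parts in the form that the derivative of the compactly supported product
  with the exponential has integral 0.\<close>

lemma iftc_deriv:
  assumes d: "\<And>x. (f has_vector_derivative f' x) (at x)" and c: "continuous_on UNIV f'"
    and z: "\<And>x. a < \<bar>x\<bar> \<Longrightarrow> f x = 0"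
  shows "iftc f' \<xi> = - (\<i> * complex_of_real (2 * pi * \<xi>)) * iftc f \<xi>"
proof -
  let ?c = "\<i> * complex_of_real (2 * pi * \<xi>)"
  have cf: "continuous_on UNIV f"
    using d by (meson continuous_at_imp_continuous_on has_vector_derivative_continuous)
  have z': "f' x = 0" if "a < \<bar>x\<bar>" for x using deriv_zero_outside[of f f' x a, OF d that z] .
  have 0: "(LINT x|lborel. cis (2 * pi * x * \<xi>) * f' x + ?c * (cis (2 * pi * x * \<xi>) * f x)) = 0"
  proof (rule integral_compact_deriv_eq_0[where f="\<lambda>x. cis (2 * pi * x * \<xi>) * f x" and a=a])
    fix x
    have "((\<lambda>x. cis (2 * pi * x * \<xi>)) has_vector_derivative (?c * cis (2 * pi * x * \<xi>))) (at x)"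
      using cis_vector_derivative[of "2 * pi * \<xi>" x UNIV] by (simp add: ac_simps)
    from has_vector_derivative_mult[OF this d]
    show "((\<lambda>x. cis (2 * pi * x * \<xi>) * f x) has_vector_derivative
        (cis (2 * pi * x * \<xi>) * f' x + ?c * (cis (2 * pi * x * \<xi>) * f x))) (at x)"
      by (simp only: mult.assoc)
  qed (use z in \<open>auto intro!: continuous_intros c cf\<close>)
  have "integrable lborel (\<lambda>x. cis (2 * pi * x * \<xi>) * f' x)" "integrable lborel (\<lambda>x. cis (2 * pi * x * \<xi>) * f x)"
    using compact_support_integrable[OF c z'] compact_support_integrable[OF cf z]
    by (auto intro!: integrable_cis_mult)
  then have "iftc f' \<xi> + ?c * iftc f \<xi> = 0"
    unfolding iftc_def using 0
    by (subst (asm) Bochner_Integration.integral_add) (auto simp del: of_real_mult)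
  then show ?thesis by (simp add: eq_neg_iff_add_eq_0)
qed

text \<open>Two derivatives multiply the transform by (2 \<pi> \<xi>)^2 up to sign, which gains one
  factor 1 + \<xi>^2. The order \<open>n\<close> is left arbitrary in the induction because the step
  uses the hypothesis at \<open>n\<close> and at \<open>n + 2\<close>.\<close>

lemma iftc_decay:
  fixes f :: "nat \<Rightarrow> real \<Rightarrow> complex"
  assumes f: "smooth1 f" and z: "\<And>n x. a < \<bar>x\<bar> \<Longrightarrow> f n x = 0"
  shows "\<exists>C\<ge>0. \<forall>\<xi>. cmod (iftc (f n) \<xi>) \<le> C * wt (- real k) \<xi>"
proof (induction k arbitrary: n)
  case 0
  show ?case
    using iftc_bound[OF compact_support_integrable[OF smooth1_continuous[OF f] z]]
    by (intro exI[of _ "LINT x|lborel. cmod (f n x)"]) auto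
next
  case (Suc k)
  obtain C where C: "C \<ge> 0" "\<And>\<xi>. cmod (iftc (f n) \<xi>) \<le> C * wt (- real k) \<xi>" using Suc[of n] by blast
  obtain D where D: "D \<ge> 0" "\<And>\<xi>. cmod (iftc (f (Suc (Suc n))) \<xi>) \<le> D * wt (- real k) \<xi>"
    using Suc[of "Suc (Suc n)"] by blast
  have step: "iftc (f (Suc m)) \<xi> = - (\<i> * complex_of_real (2 * pi * \<xi>)) * iftc (f m) \<xi>" for m \<xi>
    by (rule iftc_deriv[OF _ smooth1_continuous[OF f] z]) (use f in \<open>simp add: smooth1_def\<close>)
  have "cmod (iftc (f n) \<xi>) \<le> (C + D) * wt (- real (Suc k)) \<xi>" for \<xi>
  proof -
    have "iftc (f (Suc (Suc n))) \<xi> = - (\<i> * complex_of_real (2 * pi * \<xi>)) * (- (\<i> * complex_of_real (2 * pi * \<xi>)) * iftc (f n) \<xi>)"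
      by (simp only: step[of "Suc n"] step[of n])
    then have "cmod (iftc (f (Suc (Suc n))) \<xi>) = (2 * pi * \<xi>)\<^sup>2 * cmod (iftc (f n) \<xi>)"
      by (simp add: norm_mult power2_eq_square abs_mult ac_simps)
    moreover have "\<xi>\<^sup>2 \<le> (2 * pi * \<xi>)\<^sup>2"
    proof -
      have "1 \<le> (2 * pi)\<^sup>2" using pi_ge_two by (intro one_le_power) simp
      then show ?thesis using mult_right_mono[of 1 "(2 * pi)\<^sup>2" "\<xi>\<^sup>2"] by (simp add: power_mult_distrib)
    qed
    ultimately have "\<xi>\<^sup>2 * cmod (iftc (f n) \<xi>) \<le> D * wt (- real k) \<xi>"
      using D(2)[of \<xi>] mult_right_mono[of "\<xi>\<^sup>2" "(2 * pi * \<xi>)\<^sup>2" "cmod (iftc (f n) \<xi>)"] by simp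
    then have "(1 + \<xi>\<^sup>2) * cmod (iftc (f n) \<xi>) \<le> (C + D) * wt (- real k) \<xi>"
      using C(2)[of \<xi>] by (simp add: algebra_simps)
    then have "wt (-1) \<xi> * ((1 + \<xi>\<^sup>2) * cmod (iftc (f n) \<xi>)) \<le> wt (-1) \<xi> * ((C + D) * wt (- real k) \<xi>)"
      by (rule mult_left_mono) simp
    moreover have "wt (-1) \<xi> * (1 + \<xi>\<^sup>2) = 1"
      using one_plus_square_pos[of \<xi>] by (simp add: wt_def powr_minus)
    ultimately show ?thesis
      by (simp add: mult.assoc[symmetric] wt_add) (simp add: wt_add mult.commute mult.left_commute)
  qed
  then show ?case using C(1) D(1) by (intro exI[of _ "C + D"]) auto
qed

section \<open>Gaussians and Fourier inversion at the origin\<close>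

lemma
  fixes h :: "real \<Rightarrow> real \<Rightarrow> complex" and f g :: "real \<Rightarrow> real"
  assumes [measurable]: "case_prod h \<in> borel_measurable (borel \<Otimes>\<^sub>M borel)"
    and f: "integrable lborel f" and g: "integrable lborel g"
    and le: "\<And>x y. cmod (h x y) \<le> f x * g y"
  shows integrable_dominated_pair: "integrable (lborel \<Otimes>\<^sub>M lborel) (case_prod h)"
    and Fubini_dominated: "(LINT y|lborel. LINT x|lborel. h x y) = (LINT x|lborel. LINT y|lborel. h x y)"
proof -
  have [measurable]: "f \<in> borel_measurable borel" "g \<in> borel_measurable borel" using f g by auto
  have "(\<integral>\<^sup>+z. ennreal (norm (case_prod h z)) \<partial>(lborel \<Otimes>\<^sub>M lborel))
     \<le> (\<integral>\<^sup>+z. ennreal \<bar>f (fst z)\<bar> * ennreal \<bar>g (snd z)\<bar> \<partial>(lborel \<Otimes>\<^sub>M lborel))"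
  proof (rule nn_integral_mono)
    fix z :: "real \<times> real"
    have "norm (case_prod h z) \<le> \<bar>f (fst z)\<bar> * \<bar>g (snd z)\<bar>"
      using le[of "fst z" "snd z"] abs_ge_self[of "f (fst z) * g (snd z)"] by (simp add: split_beta abs_mult)
    then show "ennreal (norm (case_prod h z)) \<le> ennreal \<bar>f (fst z)\<bar> * ennreal \<bar>g (snd z)\<bar>"
      by (simp add: ennreal_leI flip: ennreal_mult)
  qed
  also have "\<dots> = (\<integral>\<^sup>+x. \<integral>\<^sup>+y. ennreal \<bar>f x\<bar> * ennreal \<bar>g y\<bar> \<partial>lborel \<partial>lborel)"
    by (subst lborel.nn_integral_fst[symmetric]) (auto simp: measurable_split_conv)
  also have "\<dots> = (\<integral>\<^sup>+x. ennreal \<bar>f x\<bar> \<partial>lborel) * (\<integral>\<^sup>+y. ennreal \<bar>g y\<bar> \<partial>lborel)"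
    by (simp add: nn_integral_cmult nn_integral_multc)
  also have "\<dots> < \<infinity>"
    using f g by (auto simp: integrable_iff_bounded ennreal_mult_less_top)
  finally show i: "integrable (lborel \<Otimes>\<^sub>M lborel) (case_prod h)"
    by (intro integrableI_bounded) (auto simp: measurable_lborel1 cong: measurable_cong_sets sets_pair_measure_cong)
  show "(LINT y|lborel. LINT x|lborel. h x y) = (LINT x|lborel. LINT y|lborel. h x y)"
    by (rule lborel_pair.Fubini_integral[OF i])
qed

lemma integrable_wt: "r > 1/2 \<Longrightarrow> integrable lborel (wt (- r))"
  using nn_integral_wt_finite[of r] by (intro integrableI_bounded) auto

text \<open>Up to normalisation this is the characteristic function of the standard normal
  distribution.\<close>

lemma gaussian_fourier:
  "(LINT y|lborel. cis (t * y) * complex_of_real (exp (- y\<^sup>2 / 2))) = complex_of_real (sqrt (2 * pi) * exp (- t\<^sup>2 / 2))"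
proof -
  have "complex_of_real (exp (- t\<^sup>2 / 2)) = (LINT y|std_normal_distribution. iexp (t * y))"
    using char_std_normal_distribution by (simp add: char_def fun_eq_iff)
  also have "\<dots> = (LINT y|lborel. std_normal_density y *\<^sub>R iexp (t * y))"
    by (rule integral_density) auto
  also have "\<dots> = (LINT y|lborel. complex_of_real (1 / sqrt (2 * pi)) * (cis (t * y) * complex_of_real (exp (- y\<^sup>2 / 2))))"
    by (intro Bochner_Integration.integral_cong refl)
       (simp add: std_normal_density_def cis_conv_exp scaleR_conv_of_real)
  finally have "complex_of_real (exp (- t\<^sup>2 / 2))
     = complex_of_real (1 / sqrt (2 * pi)) * (LINT y|lborel. cis (t * y) * complex_of_real (exp (- y\<^sup>2 / 2)))"
    by simp
  then show ?thesis by (simp add: field_simps)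
qed

lemma integrable_gaussian: "integrable lborel (\<lambda>y::real. exp (- y\<^sup>2 / 2))"
proof -
  have "integrable lborel (\<lambda>y. sqrt (2 * pi) * std_normal_density y)" by simp
  then show ?thesis by (simp add: std_normal_density_def)
qed

text \<open>Fourier inversion at the origin, tested against Gaussians of growing width.\<close>

lemma integral_iftc_bump_nonzero:
  fixes \<beta> :: "nat \<Rightarrow> real \<Rightarrow> real"
  assumes \<beta>: "smooth1 \<beta>" and z: "\<And>n x. 1 \<le> \<bar>x\<bar> \<Longrightarrow> \<beta> n x = 0"
    and pos: "0 < \<beta> 0 0" and X: "integrable lborel (iftc (\<lambda>x. complex_of_real (\<beta> 0 x)))"
  shows "(LINT \<xi>|lborel. iftc (\<lambda>x. complex_of_real (\<beta> 0 x)) \<xi>) \<noteq> 0"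
proof
  let ?b = "\<lambda>x. complex_of_real (\<beta> 0 x)"
  let ?X = "iftc ?b"
  define e where "e n = 1 / real (Suc n)" for n
  have e: "e n > 0" for n by (simp add: e_def)
  have e0: "e \<longlonglongrightarrow> 0" unfolding e_def by (rule LIMSEQ_Suc[OF lim_1_over_n])
  have cb: "continuous_on UNIV (\<beta> 0)" by (rule smooth1_continuous[OF \<beta>])
  then have [measurable]: "\<beta> 0 \<in> borel_measurable borel" by (rule borel_measurable_continuous_onI)
  have ib: "integrable lborel ?b"
    by (rule compact_support_integrable[of _ 1]) (auto intro!: continuous_intros cb simp: z)
  obtain B where B: "\<And>x. \<bar>\<beta> 0 x\<bar> \<le> B"
  proof -
    have "compact (\<beta> 0 ` {-1..1})" by (intro compact_continuous_image continuous_on_subset[OF cb]) auto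
    then obtain B where B: "\<forall>y\<in>\<beta> 0 ` {-1..1}. norm y \<le> B" using compact_imp_bounded bounded_iff by blast
    have "\<bar>\<beta> 0 x\<bar> \<le> max B 0" for x
    proof (cases "\<bar>x\<bar> \<le> 1")
      case True then have "\<beta> 0 x \<in> \<beta> 0 ` {-1..1}" by (intro imageI) (simp add: abs_le_iff)
      then have "norm (\<beta> 0 x) \<le> B" using B by blast
      then show ?thesis by simp
    qed (simp add: z)
    then show ?thesis using that by blast
  qed
  define L where "L n = (LINT \<xi>|lborel. ?X \<xi> * complex_of_real (exp (- (e n * \<xi>)\<^sup>2 / 2)))" for n
  have lim1: "L \<longlonglongrightarrow> (LINT \<xi>|lborel. ?X \<xi>)"
    unfolding L_def
  proof (rule integral_dominated_convergence[where w="\<lambda>\<xi>. cmod (?X \<xi>)"])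
    show "AE \<xi> in lborel. (\<lambda>n. ?X \<xi> * complex_of_real (exp (- (e n * \<xi>)\<^sup>2 / 2))) \<longlonglongrightarrow> ?X \<xi>"
    proof (rule AE_I2)
      fix \<xi>
      have "(\<lambda>n. ?X \<xi> * complex_of_real (exp (- (e n * \<xi>)\<^sup>2 / 2))) \<longlonglongrightarrow> ?X \<xi> * complex_of_real (exp (- (0 * \<xi>)\<^sup>2 / 2))"
        by (intro tendsto_intros e0) simp
      then show "(\<lambda>n. ?X \<xi> * complex_of_real (exp (- (e n * \<xi>)\<^sup>2 / 2))) \<longlonglongrightarrow> ?X \<xi>" by simp
    qed
  qed (use X in \<open>auto simp: norm_mult mult_left_le\<close>)
  \<comment> \<open>Fubini moves the Gaussian onto \<beta>: its transform has width proportional to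
    \<open>e n\<close>, and rescaling by \<open>e n\<close> shows that only values of \<beta> near
    the origin matter in the limit.\<close>
  have Ln: "L n = complex_of_real (sqrt (2 * pi) * (LINT y|lborel. \<beta> 0 (e n * y) * exp (- (2 * pi * y)\<^sup>2 / 2)))" for n
  proof -
    let ?g = "\<lambda>\<xi>. complex_of_real (exp (- (e n * \<xi>)\<^sup>2 / 2))"
    have "integrable lborel (\<lambda>\<xi>. exp (- (0 + e n * \<xi>)\<^sup>2 / 2))"
      using e[of n] by (intro lborel_integrable_real_affine[OF integrable_gaussian]) simp
    then have ig: "integrable lborel (\<lambda>\<xi>. complex_of_real (exp (- (e n * \<xi>)\<^sup>2 / 2)))"
      by (intro integrable_of_real) simp
    have "L n = (LINT \<xi>|lborel. (LINT x|lborel. cis (2 * pi * x * \<xi>) * ?b x * ?g \<xi>))"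
      by (simp add: L_def iftc_def)
    also have "\<dots> = (LINT x|lborel. (LINT \<xi>|lborel. cis (2 * pi * x * \<xi>) * ?b x * ?g \<xi>))"
      by (rule Fubini_dominated[where f="\<lambda>x. cmod (?b x)" and g="\<lambda>\<xi>. cmod (?g \<xi>)"])
         (use ib[THEN integrable_norm] ig[THEN integrable_norm] in \<open>auto simp: norm_mult\<close>)
    also have "\<dots> = (LINT x|lborel. ?b x * complex_of_real (sqrt (2 * pi) / e n * exp (- (2 * pi * (x / e n))\<^sup>2 / 2)))"
    proof (intro Bochner_Integration.integral_cong refl)
      fix x
      have "(LINT \<xi>|lborel. cis (2 * pi * x * \<xi>) * ?g \<xi>)
         = (1 / e n) *\<^sub>R (LINT y|lborel. cis (2 * pi * x / e n * y) * complex_of_real (exp (- y\<^sup>2 / 2)))"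
        using e[of n] by (subst lborel_integral_real_affine[where c="1 / e n" and t=0]) (auto simp: field_simps)
      also have "\<dots> = complex_of_real (sqrt (2 * pi) / e n * exp (- (2 * pi * (x / e n))\<^sup>2 / 2))"
        by (subst gaussian_fourier) (simp add: scaleR_conv_of_real)
      finally show "(LINT \<xi>|lborel. cis (2 * pi * x * \<xi>) * ?b x * ?g \<xi>)
         = ?b x * complex_of_real (sqrt (2 * pi) / e n * exp (- (2 * pi * (x / e n))\<^sup>2 / 2))"
        by (simp add: mult.assoc mult.left_commute[of _ "?b x"])
    qed
    also have "\<dots> = complex_of_real (LINT x|lborel. \<beta> 0 x * (sqrt (2 * pi) / e n * exp (- (2 * pi * (x / e n))\<^sup>2 / 2)))"
      by (simp only: of_real_mult[symmetric] integral_complex_of_real)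
    also have "(LINT x|lborel. \<beta> 0 x * (sqrt (2 * pi) / e n * exp (- (2 * pi * (x / e n))\<^sup>2 / 2)))
       = e n * (LINT y|lborel. \<beta> 0 (e n * y) * (sqrt (2 * pi) / e n * exp (- (2 * pi * y)\<^sup>2 / 2)))"
      using e[of n] by (subst lborel_integral_real_affine[where c="e n" and t=0]) auto
    also have "\<dots> = sqrt (2 * pi) * (LINT y|lborel. \<beta> 0 (e n * y) * exp (- (2 * pi * y)\<^sup>2 / 2))"
      using e[of n] by (simp add: field_simps)
    finally show ?thesis .
  qed
  have ig: "integrable lborel (\<lambda>y. exp (- (2 * pi * y)\<^sup>2 / 2))"
    using lborel_integrable_real_affine[OF integrable_gaussian, of "2 * pi" 0] by simp
  \<comment> \<open>The limit is a positive multiple of \<open>\<beta> 0 0\<close>, which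
    contradicts the assumption that the integral vanishes.\<close>
  have "(\<lambda>n. LINT y|lborel. \<beta> 0 (e n * y) * exp (- (2 * pi * y)\<^sup>2 / 2))
      \<longlonglongrightarrow> (LINT y|lborel. \<beta> 0 0 * exp (- (2 * pi * y)\<^sup>2 / 2))"
  proof (rule integral_dominated_convergence[where w="\<lambda>y. B * exp (- (2 * pi * y)\<^sup>2 / 2)"])
    show "AE y in lborel. (\<lambda>n. \<beta> 0 (e n * y) * exp (- (2 * pi * y)\<^sup>2 / 2)) \<longlonglongrightarrow> \<beta> 0 0 * exp (- (2 * pi * y)\<^sup>2 / 2)"
    proof (rule AE_I2)
      fix y :: real
      have "(\<lambda>n. e n * y) \<longlonglongrightarrow> 0 * y" by (intro tendsto_intros e0)
      moreover have "isCont (\<beta> 0) (0 * y)" using cb by (simp add: continuous_on_eq_continuous_at)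
      ultimately have "(\<lambda>n. \<beta> 0 (e n * y)) \<longlonglongrightarrow> \<beta> 0 (0 * y)" by (rule isCont_tendsto_compose[rotated])
      then show "(\<lambda>n. \<beta> 0 (e n * y) * exp (- (2 * pi * y)\<^sup>2 / 2)) \<longlonglongrightarrow> \<beta> 0 0 * exp (- (2 * pi * y)\<^sup>2 / 2)"
        by (intro tendsto_intros) simp
    qed
  qed (use ig B in \<open>auto simp: abs_mult intro!: mult_right_mono\<close>)
  then have "(\<lambda>n. L n) \<longlonglongrightarrow> complex_of_real (sqrt (2 * pi) * (LINT y|lborel. \<beta> 0 0 * exp (- (2 * pi * y)\<^sup>2 / 2)))"
    unfolding Ln by (intro tendsto_intros)
  from LIMSEQ_unique[OF this lim1] have eq: "(LINT \<xi>|lborel. ?X \<xi>) = complex_of_real (sqrt (2 * pi) * (LINT y|lborel. \<beta> 0 0 * exp (- (2 * pi * y)\<^sup>2 / 2)))"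
    by simp
  assume "(LINT \<xi>|lborel. ?X \<xi>) = 0"
  with eq have "(LINT y|lborel. \<beta> 0 0 * exp (- (2 * pi * y)\<^sup>2 / 2)) = 0"
    by (simp only: of_real_eq_0_iff mult_eq_0_iff real_sqrt_eq_zero_cancel_iff) simp
  then have "AE y in (lborel::real measure). \<beta> 0 0 * exp (- (2 * pi * y)\<^sup>2 / 2) = 0"
    using pos ig by (subst (asm) integral_nonneg_eq_0_iff_AE) auto
  then have "AE y in (lborel::real measure). False" using pos by simp
  then show False by (simp add: ae_filter_eq_bot_iff)
qed

section \<open>The oscillator at a fixed frequency\<close>

text \<open>The fundamental solution of the oscillator of frequency \<xi>, continued by its limit
  \<open>t\<close> at \<xi> = 0.\<close>

definition sprop :: "real \<Rightarrow> real \<Rightarrow> real" where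
  "sprop t \<xi> = (if \<xi> = 0 then t else sin (2 * pi * \<xi> * t) / (2 * pi * \<xi>))"

lemma sprop_measurable [measurable (raw)]:
  assumes [measurable]: "f \<in> borel_measurable M" "g \<in> borel_measurable M"
  shows "(\<lambda>x. sprop (f x) (g x)) \<in> borel_measurable M"
  unfolding sprop_def by measurable

lemma sprop_sin: "2 * pi * \<xi> * sprop t \<xi> = sin (2 * pi * \<xi> * t)"
  by (simp add: sprop_def)

lemma abs_sprop_le: "\<bar>sprop t \<xi>\<bar> \<le> \<bar>t\<bar>"
proof (cases "\<xi> = 0")
  case False
  have "\<bar>sin (2 * pi * \<xi> * t)\<bar> \<le> \<bar>2 * pi * \<xi> * t\<bar>" by (rule abs_sin_x_le_abs_x)
  then show ?thesis using False by (simp add: sprop_def abs_mult field_simps)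
qed (simp add: sprop_def)

text \<open>The gain of one derivative by the wave propagator. For low frequencies the bound |t| is
  used, for high ones the bound 1/|\<xi>|; adding the two avoids a case distinction.\<close>

lemma abs_sprop_weight: "\<bar>sprop t \<xi>\<bar> \<le> (\<bar>t\<bar> + 1) * wt (-1/2) \<xi>"
proof -
  have "\<bar>\<xi>\<bar> * \<bar>sprop t \<xi>\<bar> \<le> 1"
  proof -
    have "\<bar>2 * pi * \<xi> * sprop t \<xi>\<bar> \<le> 1" unfolding sprop_sin by (rule abs_sin_le_one)
    then have "(2 * pi) * (\<bar>\<xi>\<bar> * \<bar>sprop t \<xi>\<bar>) \<le> 1" by (simp add: abs_mult ac_simps)
    moreover have "1 * (\<bar>\<xi>\<bar> * \<bar>sprop t \<xi>\<bar>) \<le> (2 * pi) * (\<bar>\<xi>\<bar> * \<bar>sprop t \<xi>\<bar>)"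
      using pi_ge_two by (intro mult_right_mono) auto
    ultimately show ?thesis by simp
  qed
  then have "(1 + \<bar>\<xi>\<bar>) * \<bar>sprop t \<xi>\<bar> \<le> \<bar>t\<bar> + 1" using abs_sprop_le[of t \<xi>] by (simp add: algebra_simps)
  moreover have "wt (1/2) \<xi> * \<bar>sprop t \<xi>\<bar> \<le> (1 + \<bar>\<xi>\<bar>) * \<bar>sprop t \<xi>\<bar>"
    by (intro mult_right_mono wt_half_le) auto
  ultimately have "wt (1/2) \<xi> * \<bar>sprop t \<xi>\<bar> \<le> \<bar>t\<bar> + 1" by linarith
  then have "wt (-1/2) \<xi> * (wt (1/2) \<xi> * \<bar>sprop t \<xi>\<bar>) \<le> wt (-1/2) \<xi> * (\<bar>t\<bar> + 1)"
    by (rule mult_left_mono) simp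
  moreover have "wt (-1/2) \<xi> * (wt (1/2) \<xi> * \<bar>sprop t \<xi>\<bar>) = \<bar>sprop t \<xi>\<bar>"
    unfolding mult.assoc[symmetric] wt_add by simp
  ultimately show ?thesis by (simp only: mult.commute[of "\<bar>t\<bar> + 1"])
qed

lemma sprop_diff: "sprop (t - \<tau>) \<xi> = sprop t \<xi> * cos (2 * pi * \<xi> * \<tau>) - cos (2 * pi * \<xi> * t) * sprop \<tau> \<xi>"
  by (simp add: sprop_def right_diff_distrib sin_diff diff_divide_distrib)

lemma sprop_deriv: "((\<lambda>t. sprop t \<xi>) has_real_derivative cos (2 * pi * \<xi> * t)) (at t within S)"
proof (cases "\<xi> = 0")
  case False
  have "((\<lambda>t. sin (2 * pi * \<xi> * t) / (2 * pi * \<xi>)) has_real_derivative cos (2 * pi * \<xi> * t)) (at t within S)"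
    using False by (auto intro!: derivative_eq_intros)
  then show ?thesis using False by (simp add: sprop_def)
qed (simp add: sprop_def)

text \<open>The signed indicator of the interval between \<open>0\<close> and \<open>t\<close>; the half-open choice makes
  increments of it exact indicators.\<close>

definition kern :: "real \<Rightarrow> real \<Rightarrow> real" where
  "kern t \<tau> = indicator {0<..t} \<tau> - indicator {t<..0} \<tau>"

lemma kern_eq: "kern t \<tau> = (if 0 < \<tau> \<and> \<tau> \<le> t then 1 else if t < \<tau> \<and> \<tau> \<le> 0 then -1 else 0)"
  by (auto simp: kern_def)

lemma kern_measurable [measurable (raw)]:
  assumes [measurable]: "f \<in> borel_measurable M" "g \<in> borel_measurable M"
  shows "(\<lambda>x. kern (f x) (g x)) \<in> borel_measurable M"
  unfolding kern_eq by measurable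

lemma kern_diff: "t \<le> u \<Longrightarrow> kern u \<tau> - kern t \<tau> = indicator {t<..u} \<tau>"
  by (auto simp: kern_def indicator_def)

lemma kern_nonzero: "kern t \<tau> \<noteq> 0 \<Longrightarrow> \<bar>\<tau>\<bar> \<le> \<bar>t\<bar> \<and> \<bar>t - \<tau>\<bar> \<le> \<bar>t\<bar>"
  by (auto simp: kern_eq split: if_splits)

lemma nn_integral_kern: "(\<integral>\<^sup>+\<tau>. ennreal \<bar>kern t \<tau>\<bar> \<partial>lborel) = ennreal \<bar>t\<bar>"
proof (cases "0 \<le> t")
  case True
  then have "(\<lambda>\<tau>. ennreal \<bar>kern t \<tau>\<bar>) = indicator {0<..t}"
    by (auto simp: kern_def indicator_def fun_eq_iff)
  then show ?thesis using True by simp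
next
  case False
  then have "(\<lambda>\<tau>. ennreal \<bar>kern t \<tau>\<bar>) = indicator {t<..0}"
    by (auto simp: kern_def indicator_def fun_eq_iff)
  then show ?thesis using False by simp
qed

lemma integrable_kern: "integrable lborel (kern t)"
proof (rule integrableI_bounded)
  show "(\<integral>\<^sup>+\<tau>. ennreal (norm (kern t \<tau>)) \<partial>lborel) < \<infinity>"
    using nn_integral_kern[of t] by simp
qed measurable

lemma integrable_kern_mult:
  fixes h :: "real \<Rightarrow> complex"
  assumes [measurable]: "h \<in> borel_measurable borel" and H: "\<And>\<tau>. \<bar>\<tau>\<bar> \<le> \<bar>t\<bar> \<Longrightarrow> cmod (h \<tau>) \<le> H"
  shows "integrable lborel (\<lambda>\<tau>. complex_of_real (kern t \<tau>) * h \<tau>)"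
proof (rule Bochner_Integration.integrable_bound[of _ "\<lambda>\<tau>. H * kern t \<tau>"])
  show "integrable lborel (\<lambda>\<tau>. H * kern t \<tau>)" using integrable_kern by simp
  show "AE \<tau> in lborel. norm (complex_of_real (kern t \<tau>) * h \<tau>) \<le> norm (H * kern t \<tau>)"
  proof (rule AE_I2)
    fix \<tau>
    show "norm (complex_of_real (kern t \<tau>) * h \<tau>) \<le> norm (H * kern t \<tau>)"
    proof (cases "kern t \<tau> = 0")
      case False
      then have "cmod (h \<tau>) \<le> \<bar>H\<bar>" using H[of \<tau>] kern_nonzero by fastforce
      then show ?thesis by (simp add: norm_mult abs_mult mult.commute mult_right_mono)
    qed simp
  qed
qed measurable

lemma kern_integral_bound:
  fixes h :: "real \<Rightarrow> complex"
  assumes [measurable]: "h \<in> borel_measurable borel" and H: "\<And>\<tau>. \<bar>\<tau>\<bar> \<le> \<bar>t\<bar> \<Longrightarrow> cmod (h \<tau>) \<le> H" "0 \<le> H"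
  shows "cmod (LINT \<tau>|lborel. complex_of_real (kern t \<tau>) * h \<tau>) \<le> \<bar>t\<bar> * H"
proof -
  have "ennreal (cmod (LINT \<tau>|lborel. complex_of_real (kern t \<tau>) * h \<tau>))
     \<le> (\<integral>\<^sup>+\<tau>. ennreal (cmod (complex_of_real (kern t \<tau>) * h \<tau>)) \<partial>lborel)"
    by (rule norm_integral_le_nn) measurable
  also have "\<dots> \<le> (\<integral>\<^sup>+\<tau>. ennreal \<bar>kern t \<tau>\<bar> * ennreal H \<partial>lborel)"
  proof (rule nn_integral_mono)
    fix \<tau>
    have "cmod (complex_of_real (kern t \<tau>) * h \<tau>) \<le> \<bar>kern t \<tau>\<bar> * H"
    proof (cases "kern t \<tau> = 0")
      case False
      then have "cmod (h \<tau>) \<le> H" using H(1)[of \<tau>] kern_nonzero by blast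
      then show ?thesis by (simp add: norm_mult mult_left_mono)
    qed simp
    then show "ennreal (cmod (complex_of_real (kern t \<tau>) * h \<tau>)) \<le> ennreal \<bar>kern t \<tau>\<bar> * ennreal H"
      using H(2) by (simp add: ennreal_leI flip: ennreal_mult)
  qed
  also have "\<dots> = ennreal (\<bar>t\<bar> * H)"
    using H(2) by (simp add: nn_integral_multc nn_integral_kern ennreal_mult)
  finally show ?thesis using H(2) by simp
qed

lemma kern_integral_diff:
  fixes h :: "real \<Rightarrow> complex"
  assumes [measurable]: "h \<in> borel_measurable borel"
    and H: "\<And>\<tau>. \<bar>\<tau>\<bar> \<le> T \<Longrightarrow> cmod (h \<tau>) \<le> H" and "-T \<le> t" "t \<le> u" "u \<le> T"
  shows "(LINT \<tau>|lborel. complex_of_real (kern u \<tau>) * h \<tau>) - (LINT \<tau>|lborel. complex_of_real (kern t \<tau>) * h \<tau>)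
     = (LINT \<tau>|lborel. indicator {t<..u} \<tau> *\<^sub>R h \<tau>)"
proof -
  have "(LINT \<tau>|lborel. complex_of_real (kern u \<tau>) * h \<tau>) - (LINT \<tau>|lborel. complex_of_real (kern t \<tau>) * h \<tau>)
     = (LINT \<tau>|lborel. complex_of_real (kern u \<tau>) * h \<tau> - complex_of_real (kern t \<tau>) * h \<tau>)"
    using assms by (intro Bochner_Integration.integral_diff[symmetric] integrable_kern_mult[where H=H]) auto
  also have "\<dots> = (LINT \<tau>|lborel. indicator {t<..u} \<tau> *\<^sub>R h \<tau>)"
    using kern_diff[OF \<open>t \<le> u\<close>]
    by (intro Bochner_Integration.integral_cong refl)
       (simp add: scaleR_conv_of_real flip: left_diff_distrib of_real_diff)
  finally show ?thesis .
qed

lemma kern_integral_continuous: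
  fixes h :: "real \<Rightarrow> complex"
  assumes [measurable]: "h \<in> borel_measurable borel"
    and H: "\<And>\<tau>. \<bar>\<tau>\<bar> \<le> T \<Longrightarrow> cmod (h \<tau>) \<le> H" "0 \<le> H"
  shows "continuous_on {-T..T} (\<lambda>t. LINT \<tau>|lborel. complex_of_real (kern t \<tau>) * h \<tau>)"
proof -
  let ?I = "\<lambda>t. LINT \<tau>|lborel. complex_of_real (kern t \<tau>) * h \<tau>"
  have le: "cmod (?I u - ?I t) \<le> H * (u - t)" if "-T \<le> t" "t \<le> u" "u \<le> T" for t u
  proof -
    have eq: "?I u - ?I t = (LINT \<tau>|lborel. indicator {t<..u} \<tau> *\<^sub>R h \<tau>)"
      by (rule kern_integral_diff[where T=T and H=H]) (use that H(1) in auto)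
    have "ennreal (cmod (?I u - ?I t)) \<le> (\<integral>\<^sup>+\<tau>. ennreal (cmod (indicator {t<..u} \<tau> *\<^sub>R h \<tau>)) \<partial>lborel)"
      unfolding eq by (rule norm_integral_le_nn) measurable
    also have "\<dots> \<le> (\<integral>\<^sup>+\<tau>. ennreal H * indicator {t<..u} \<tau> \<partial>lborel)"
      using that by (intro nn_integral_mono) (auto simp: indicator_def intro!: ennreal_leI H)
    also have "\<dots> = ennreal (H * (u - t))"
      using that H(2) by (simp add: nn_integral_cmult ennreal_mult)
    finally show ?thesis using that H(2) by simp
  qed
  have "cmod (?I u - ?I t) \<le> H * \<bar>u - t\<bar>" if "t \<in> {-T..T}" "u \<in> {-T..T}" for t u
    using le[of t u] le[of u t] that by (cases "t \<le> u") (auto simp: norm_minus_commute)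
  then have "H-lipschitz_on {-T..T} ?I"
    using H(2) by (auto simp: lipschitz_on_def dist_norm)
  then show ?thesis by (rule lipschitz_on_continuous_on)
qed

lemma kern_integral_deriv:
  fixes h :: "real \<Rightarrow> complex"
  assumes [measurable]: "h \<in> borel_measurable borel" and c: "continuous_on {-T..T} h" and t: "t \<in> {-T..T}"
  shows "((\<lambda>t. LINT \<tau>|lborel. complex_of_real (kern t \<tau>) * h \<tau>) has_vector_derivative h t) (at t within {-T..T})"
proof -
  let ?I = "\<lambda>t. LINT \<tau>|lborel. complex_of_real (kern t \<tau>) * h \<tau>"
  have "compact (h ` {-T..T})" by (intro compact_continuous_image c) auto
  then obtain H where "\<forall>y\<in>h ` {-T..T}. norm y \<le> H" using compact_imp_bounded bounded_iff by blast
  then have H: "cmod (h \<tau>) \<le> H" if "\<bar>\<tau>\<bar> \<le> T" for \<tau> using that by (auto simp: abs_le_iff)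
  \<comment> \<open>Rewriting the signed integral as a constant plus an ordinary integral from
    \<open>-T\<close> brings it into the form of the fundamental theorem; the two differ at the
    single point \<open>-T\<close>.\<close>
  have I: "?I (-T) + integral {-T..u} h = ?I u" if "u \<in> {-T..T}" for u
  proof -
    have "?I u - ?I (-T) = (LINT \<tau>|lborel. indicator {-T<..u} \<tau> *\<^sub>R h \<tau>)"
      using that by (intro kern_integral_diff[where T=T and H=H] H) auto
    also have "\<dots> = (LINT \<tau>|lborel. indicator {-T..u} \<tau> *\<^sub>R h \<tau>)"
    proof (rule integral_cong_AE)
      have "AE \<tau> in lborel. \<tau> \<noteq> -T" by (rule AE_lborel_singleton)
      then show "AE \<tau> in lborel. indicator {-T<..u} \<tau> *\<^sub>R h \<tau> = indicator {-T..u} \<tau> *\<^sub>R h \<tau>"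
        by eventually_elim (auto simp: indicator_def)
    qed measurable
    also have "\<dots> = integral {-T..u} h"
    proof -
      have "set_integrable lborel {-T..u} h"
        using that by (intro borel_integrable_atLeastAtMost' continuous_on_subset[OF c]) auto
      from set_borel_integral_eq_integral(2)[OF this] show ?thesis
        by (simp add: set_lebesgue_integral_def)
    qed
    finally show ?thesis by (simp add: algebra_simps)
  qed
  have "((\<lambda>u. ?I (-T) + integral {-T..u} h) has_vector_derivative 0 + h t) (at t within {-T..T})"
    by (intro has_vector_derivative_add has_vector_derivative_const integral_has_vector_derivative c t)
  then have "((\<lambda>u. ?I (-T) + integral {-T..u} h) has_vector_derivative h t) (at t within {-T..T})" by simp
  then show ?thesis
    by (rule has_vector_derivative_transform[rotated -1]) (use I t in auto)
qed

lemma of_real_vector_derivative: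
  "(f has_real_derivative D) (at t within S) \<Longrightarrow>
    ((\<lambda>x. complex_of_real (f x)) has_vector_derivative complex_of_real D) (at t within S)"
  by (simp add: has_real_derivative_iff_has_vector_derivative has_vector_derivative_of_real)

text \<open>Variation of constants for \<open>u'' + (2 \<pi> \<xi>)\<^sup>2 u = \<sigma> h\<close> at a fixed frequency \<open>\<xi>\<close>.\<close>

definition duh_cos :: "real \<Rightarrow> (real \<Rightarrow> complex) \<Rightarrow> real \<Rightarrow> complex" where
  "duh_cos \<xi> h t = (LINT \<tau>|lborel. complex_of_real (kern t \<tau>) * (complex_of_real (cos (2 * pi * \<xi> * \<tau>)) * h \<tau>))"

definition duh_sin :: "real \<Rightarrow> (real \<Rightarrow> complex) \<Rightarrow> real \<Rightarrow> complex" where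
  "duh_sin \<xi> h t = (LINT \<tau>|lborel. complex_of_real (kern t \<tau>) * (complex_of_real (sprop \<tau> \<xi>) * h \<tau>))"

definition osc :: "real \<Rightarrow> real \<Rightarrow> complex \<Rightarrow> complex \<Rightarrow> (real \<Rightarrow> complex) \<Rightarrow> real \<Rightarrow> complex" where
  "osc \<sigma> \<xi> c0 c1 h t = complex_of_real (cos (2 * pi * \<xi> * t)) * c0 + complex_of_real (sprop t \<xi>) * c1
     + complex_of_real \<sigma> * (complex_of_real (sprop t \<xi>) * duh_cos \<xi> h t
         - complex_of_real (cos (2 * pi * \<xi> * t)) * duh_sin \<xi> h t)"

definition osc' :: "real \<Rightarrow> real \<Rightarrow> complex \<Rightarrow> complex \<Rightarrow> (real \<Rightarrow> complex) \<Rightarrow> real \<Rightarrow> complex" where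
  "osc' \<sigma> \<xi> c0 c1 h t = - complex_of_real (2 * pi * \<xi> * sin (2 * pi * \<xi> * t)) * c0
     + complex_of_real (cos (2 * pi * \<xi> * t)) * c1
     + complex_of_real \<sigma> * (complex_of_real (cos (2 * pi * \<xi> * t)) * duh_cos \<xi> h t
         + complex_of_real (2 * pi * \<xi> * sin (2 * pi * \<xi> * t)) * duh_sin \<xi> h t)"

text \<open>The addition theorem separates \<open>t\<close> from \<open>\<tau>\<close> in the
  kernel. The time derivative of the Duhamel term then needs only the product rule and derivatives
  of integrals whose integrands do not involve \<open>t\<close>.\<close>

lemma duhamel_eq:
  assumes [measurable]: "h \<in> borel_measurable borel"
    and H: "\<And>\<tau>. \<bar>\<tau>\<bar> \<le> \<bar>t\<bar> \<Longrightarrow> cmod (h \<tau>) \<le> H"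
  shows "(LINT \<tau>|lborel. complex_of_real (kern t \<tau> * sprop (t - \<tau>) \<xi>) * h \<tau>)
    = complex_of_real (sprop t \<xi>) * duh_cos \<xi> h t - complex_of_real (cos (2 * pi * \<xi> * t)) * duh_sin \<xi> h t"
proof -
  have 0: "0 \<le> H" using H[of 0] norm_ge_zero[of "h 0"] by linarith
  have i1: "integrable lborel (\<lambda>\<tau>. complex_of_real (kern t \<tau>) * (complex_of_real (cos (2 * pi * \<xi> * \<tau>)) * h \<tau>))"
  proof (rule integrable_kern_mult)
    show "cmod (complex_of_real (cos (2 * pi * \<xi> * \<tau>)) * h \<tau>) \<le> 1 * H" if "\<bar>\<tau>\<bar> \<le> \<bar>t\<bar>" for \<tau>
      unfolding norm_mult by (intro mult_mono H that) auto
  qed measurable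
  have i2: "integrable lborel (\<lambda>\<tau>. complex_of_real (kern t \<tau>) * (complex_of_real (sprop \<tau> \<xi>) * h \<tau>))"
  proof (rule integrable_kern_mult)
    show "cmod (complex_of_real (sprop \<tau> \<xi>) * h \<tau>) \<le> \<bar>t\<bar> * H" if "\<bar>\<tau>\<bar> \<le> \<bar>t\<bar>" for \<tau>
      unfolding norm_mult using abs_sprop_le[of \<tau> \<xi>] that by (intro mult_mono H that) auto
  qed measurable
  have "(LINT \<tau>|lborel. complex_of_real (kern t \<tau> * sprop (t - \<tau>) \<xi>) * h \<tau>)
    = (LINT \<tau>|lborel. complex_of_real (sprop t \<xi>) * (complex_of_real (kern t \<tau>) * (complex_of_real (cos (2 * pi * \<xi> * \<tau>)) * h \<tau>))
        - complex_of_real (cos (2 * pi * \<xi> * t)) * (complex_of_real (kern t \<tau>) * (complex_of_real (sprop \<tau> \<xi>) * h \<tau>)))"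
    unfolding sprop_diff by (intro Bochner_Integration.integral_cong refl) (simp add: algebra_simps)
  also have "\<dots> = complex_of_real (sprop t \<xi>) * duh_cos \<xi> h t - complex_of_real (cos (2 * pi * \<xi> * t)) * duh_sin \<xi> h t"
    unfolding duh_cos_def duh_sin_def using i1 i2
    by (subst Bochner_Integration.integral_diff) auto
  finally show ?thesis .
qed

text \<open>The algebra behind \<open>osc'_deriv\<close>, with \<open>w\<close> for the angular
  frequency, \<open>c\<close> and \<open>s\<close> for cosine and sine, \<open>S\<close> for
  \<open>sprop\<close>, and \<open>C\<close>, \<open>D\<close> for the two Duhamel integrals. The
  contributions of \<open>h\<close> combine through the sum of squares.\<close>

lemma osc_algebra:
  fixes w S c s :: complex
  assumes "w * S = s" "c * c + s * s = 1"
  shows "- (w * w * c) * c0 + - (w * s) * c1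
      + a * ((c * (c * h) + - (w * s) * C) + (w * s * (S * h) + w * w * c * D))
    = - (w * w) * (c * c0 + S * c1 + a * (S * C - c * D)) + a * h"
proof -
  have "- (w * w * c) * c0 + - (w * (w * S)) * c1
      + a * ((c * (c * h) + - (w * (w * S)) * C) + (w * (w * S) * (S * h) + w * w * c * D))
    = - (w * w) * (c * c0 + S * c1 + a * (S * C - c * D)) + a * h * (c * c + (w * S) * (w * S))"
    by (simp add: algebra_simps)
  then show ?thesis unfolding assms by simp
qed

context
  fixes h :: "real \<Rightarrow> complex" and T H \<sigma> \<xi> :: real
  assumes h [measurable]: "h \<in> borel_measurable borel"
    and H: "\<And>\<tau>. \<bar>\<tau>\<bar> \<le> T \<Longrightarrow> cmod (h \<tau>) \<le> H" and H0: "0 \<le> H" and T0: "0 < T"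
begin

lemma duh_cos_continuous: "continuous_on {-T..T} (duh_cos \<xi> h)"
  unfolding duh_cos_def[abs_def]
proof (rule kern_integral_continuous)
  show "cmod (complex_of_real (cos (2 * pi * \<xi> * \<tau>)) * h \<tau>) \<le> 1 * H" if "\<bar>\<tau>\<bar> \<le> T" for \<tau>
    unfolding norm_mult by (intro mult_mono H that) auto
qed (use H0 in auto)

lemma duh_sin_continuous: "continuous_on {-T..T} (duh_sin \<xi> h)"
  unfolding duh_sin_def[abs_def]
proof (rule kern_integral_continuous)
  show "cmod (complex_of_real (sprop \<tau> \<xi>) * h \<tau>) \<le> T * H" if "\<bar>\<tau>\<bar> \<le> T" for \<tau>
    unfolding norm_mult using abs_sprop_le[of \<tau> \<xi>] that by (intro mult_mono H that) auto
qed (use H0 T0 in auto)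

lemma osc_continuous: "continuous_on {-T..T} (osc \<sigma> \<xi> c0 c1 h)"
proof -
  have "continuous_on {-T..T} (\<lambda>t. sprop t \<xi>)"
    using sprop_deriv by (meson DERIV_continuous_on)
  then show ?thesis unfolding osc_def[abs_def]
    by (intro continuous_intros duh_cos_continuous duh_sin_continuous)
qed

text \<open>No power of \<xi> falls on the forcing: the factor 2 \<pi> \<xi> turns
  \<open>sprop\<close> inside \<open>duh_sin\<close> into a sine, which is bounded by 1. Hence the
  velocity has the same index H^(s-1) as the nonlinearity.\<close>

lemma osc'_bound:
  assumes "\<bar>t\<bar> \<le> T" "T \<le> 1" "\<bar>\<sigma>\<bar> \<le> 1"
  shows "cmod (osc' \<sigma> \<xi> c0 c1 h t) \<le> \<bar>2 * pi * \<xi>\<bar> * cmod c0 + cmod c1 + 2 * H"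
proof -
  have b1: "cmod (duh_cos \<xi> h t) \<le> 1 * H"
  proof -
    have "cmod (duh_cos \<xi> h t) \<le> \<bar>t\<bar> * (1 * H)"
      unfolding duh_cos_def
    proof (rule kern_integral_bound)
      show "cmod (complex_of_real (cos (2 * pi * \<xi> * \<tau>)) * h \<tau>) \<le> 1 * H" if "\<bar>\<tau>\<bar> \<le> \<bar>t\<bar>" for \<tau>
        unfolding norm_mult using that assms by (intro mult_mono H) auto
    qed (use H0 in auto)
    also have "\<dots> \<le> 1 * (1 * H)" using assms H0 by (intro mult_right_mono) auto
    finally show ?thesis by simp
  qed
  have b2: "cmod (complex_of_real (2 * pi * \<xi>) * duh_sin \<xi> h t) \<le> 1 * H"
  proof -
    have "complex_of_real (2 * pi * \<xi>) * duh_sin \<xi> h t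
      = (LINT \<tau>|lborel. complex_of_real (kern t \<tau>) * (complex_of_real (sin (2 * pi * \<xi> * \<tau>)) * h \<tau>))"
      unfolding duh_sin_def sprop_sin[symmetric]
      by (subst integral_mult_right_zero[symmetric]) (simp add: ac_simps)
    also have "cmod \<dots> \<le> \<bar>t\<bar> * (1 * H)"
    proof (rule kern_integral_bound)
      show "cmod (complex_of_real (sin (2 * pi * \<xi> * \<tau>)) * h \<tau>) \<le> 1 * H" if "\<bar>\<tau>\<bar> \<le> \<bar>t\<bar>" for \<tau>
        unfolding norm_mult using that assms by (intro mult_mono H) auto
    qed (use H0 in auto)
    also have "\<dots> \<le> 1 * (1 * H)" using assms H0 by (intro mult_right_mono) auto
    finally show ?thesis by simp
  qed
  let ?c = "2 * pi * \<xi>"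
  have "cmod (osc' \<sigma> \<xi> c0 c1 h t) \<le> cmod (- complex_of_real (?c * sin (?c * t)) * c0)
     + cmod (complex_of_real (cos (?c * t)) * c1)
     + cmod (complex_of_real \<sigma> * (complex_of_real (cos (?c * t)) * duh_cos \<xi> h t
         + complex_of_real (?c * sin (?c * t)) * duh_sin \<xi> h t))"
    unfolding osc'_def by (intro order_trans[OF norm_triangle_ineq] add_mono norm_triangle_ineq order_refl)
  also have "\<dots> \<le> \<bar>?c\<bar> * cmod c0 + 1 * cmod c1 + 1 * (1 * H + 1 * H)"
  proof (intro add_mono)
    have "\<bar>?c\<bar> * \<bar>sin (?c * t)\<bar> \<le> \<bar>?c\<bar> * 1" by (intro mult_left_mono) auto
    then show "cmod (- complex_of_real (?c * sin (?c * t)) * c0) \<le> \<bar>?c\<bar> * cmod c0"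
      unfolding norm_mult norm_minus_cancel norm_of_real abs_mult[of ?c] by (intro mult_right_mono) auto
    show "cmod (complex_of_real (cos (?c * t)) * c1) \<le> 1 * cmod c1"
      unfolding norm_mult by (intro mult_right_mono) auto
    have "cmod (complex_of_real (cos (?c * t)) * duh_cos \<xi> h t) \<le> 1 * (1 * H)"
      unfolding norm_mult[of "complex_of_real (cos (?c * t))"] by (intro mult_mono b1) auto
    moreover have "cmod (complex_of_real (?c * sin (?c * t)) * duh_sin \<xi> h t) \<le> 1 * (1 * H)"
    proof -
      have "complex_of_real (?c * sin (?c * t)) * duh_sin \<xi> h t
          = complex_of_real (sin (?c * t)) * (complex_of_real ?c * duh_sin \<xi> h t)" by simp
      then show ?thesis using b2 unfolding norm_mult[of "complex_of_real (sin (?c * t))"]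
        by (simp only: norm_mult[of "complex_of_real (sin (?c * t))"]) (intro mult_mono, auto)
    qed
    ultimately have "cmod (complex_of_real (cos (?c * t)) * duh_cos \<xi> h t
         + complex_of_real (?c * sin (?c * t)) * duh_sin \<xi> h t) \<le> 1 * H + 1 * H"
      using norm_triangle_mono by fastforce
    then show "cmod (complex_of_real \<sigma> * (complex_of_real (cos (?c * t)) * duh_cos \<xi> h t
         + complex_of_real (?c * sin (?c * t)) * duh_sin \<xi> h t)) \<le> 1 * (1 * H + 1 * H)"
      unfolding norm_mult[of "complex_of_real \<sigma>"] using assms by (intro mult_mono) auto
  qed
  finally show ?thesis by simp
qed

context
  assumes hc: "continuous_on {-T..T} h"
begin

lemma duh_cos_deriv:
  "t \<in> {-T..T} \<Longrightarrow> (duh_cos \<xi> h has_vector_derivative complex_of_real (cos (2 * pi * \<xi> * t)) * h t) (at t within {-T..T})"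
  unfolding duh_cos_def[abs_def]
  by (rule kern_integral_deriv) (auto intro!: continuous_intros hc)

lemma duh_sin_deriv:
  "t \<in> {-T..T} \<Longrightarrow> (duh_sin \<xi> h has_vector_derivative complex_of_real (sprop t \<xi>) * h t) (at t within {-T..T})"
  unfolding duh_sin_def[abs_def]
  by (rule kern_integral_deriv) (use sprop_deriv in \<open>auto intro!: continuous_intros hc DERIV_continuous_on\<close>)

lemma cos_deriv: "((\<lambda>t. complex_of_real (cos (2 * pi * \<xi> * t))) has_vector_derivative
     complex_of_real (- (2 * pi * \<xi> * sin (2 * pi * \<xi> * t)))) (at t within S)"
  by (rule of_real_vector_derivative) (auto intro!: derivative_eq_intros)

lemma sin_deriv: "((\<lambda>t. complex_of_real (2 * pi * \<xi> * sin (2 * pi * \<xi> * t))) has_vector_derivative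
     complex_of_real ((2 * pi * \<xi>)\<^sup>2 * cos (2 * pi * \<xi> * t))) (at t within S)"
  by (rule of_real_vector_derivative) (auto intro!: derivative_eq_intros simp: power2_eq_square)

lemma osc_deriv:
  assumes t: "t \<in> {-T..T}"
  shows "(osc \<sigma> \<xi> c0 c1 h has_vector_derivative osc' \<sigma> \<xi> c0 c1 h t) (at t within {-T..T})"
  unfolding osc_def[abs_def]
  apply (rule has_vector_derivative_eq_rhs)
   apply (rule has_vector_derivative_add has_vector_derivative_diff has_vector_derivative_mult
      cos_deriv of_real_vector_derivative[OF sprop_deriv] duh_cos_deriv[OF t] duh_sin_deriv[OF t]
      has_vector_derivative_const)+
  apply (simp add: osc'_def algebra_simps)
  done

lemma osc'_deriv:
  assumes t: "t \<in> {-T..T}"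
  shows "(osc' \<sigma> \<xi> c0 c1 h has_vector_derivative
     (- complex_of_real ((2 * pi * \<xi>)\<^sup>2) * osc \<sigma> \<xi> c0 c1 h t + complex_of_real \<sigma> * h t)) (at t within {-T..T})"
proof -
  let ?c = "complex_of_real (cos (2 * pi * \<xi> * t))" and ?s = "complex_of_real (sin (2 * pi * \<xi> * t))"
  let ?S = "complex_of_real (sprop t \<xi>)" and ?w = "complex_of_real (2 * pi * \<xi>)"
  let ?C = "duh_cos \<xi> h t" and ?D = "duh_sin \<xi> h t"
  have "?w * ?S = ?s" using sprop_sin[of \<xi> t] by (metis of_real_mult)
  moreover have "?c * ?c + ?s * ?s = 1"
    by (metis of_real_1 of_real_add of_real_mult power2_eq_square sin_cos_squared_add2)
  moreover have "(osc' \<sigma> \<xi> c0 c1 h has_vector_derivative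
      (- (?w * ?w * ?c) * c0 + - (?w * ?s) * c1
       + complex_of_real \<sigma> * ((?c * (?c * h t) + - (?w * ?s) * ?C) + (?w * ?s * (?S * h t) + ?w * ?w * ?c * ?D)))) (at t within {-T..T})"
    unfolding osc'_def[abs_def]
    apply (rule has_vector_derivative_eq_rhs)
     apply (rule has_vector_derivative_add has_vector_derivative_minus has_vector_derivative_mult
        cos_deriv sin_deriv duh_cos_deriv[OF t] duh_sin_deriv[OF t] has_vector_derivative_const)+
    apply (simp add: power2_eq_square algebra_simps)
    done
  moreover have "- (?w * ?w * ?c) * c0 + - (?w * ?s) * c1
       + complex_of_real \<sigma> * ((?c * (?c * h t) + - (?w * ?s) * ?C) + (?w * ?s * (?S * h t) + ?w * ?w * ?c * ?D))
     = - complex_of_real ((2 * pi * \<xi>)\<^sup>2) * osc \<sigma> \<xi> c0 c1 h t + complex_of_real \<sigma> * h t"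
    if "?w * ?S = ?s" "?c * ?c + ?s * ?s = 1"
    unfolding osc_def using osc_algebra[OF that, of c0 c1 "complex_of_real \<sigma>" "h t" ?C ?D]
    by (simp only: power2_eq_square of_real_mult)
  ultimately show ?thesis by simp
qed

end

end

section \<open>Picard iteration with a majorant\<close>

text \<open>The factor \<open>P\<close> is known to converge only where its majorant
  \<open>n\<close> is finite. Since the convolution of the majorants is finite at \<xi>, for almost
  every \<eta> an infinite value of \<open>n (\<xi> - \<eta>)\<close> forces
  \<open>m \<eta> = 0\<close>; then all \<open>F k \<eta>\<close> vanish and so does the
  limit.\<close>

lemma conv_tendsto:
  fixes F P :: "nat \<Rightarrow> real \<Rightarrow> complex"
  assumes [measurable]: "\<And>k. F k \<in> borel_measurable borel" "G \<in> borel_measurable borel"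
      "\<And>k. P k \<in> borel_measurable borel" "Q \<in> borel_measurable borel"
      "m \<in> borel_measurable borel" "n \<in> borel_measurable borel"
    and Fm: "\<And>k x. cn (F k) x \<le> m x" and Pn: "\<And>k x. cn (P k) x \<le> n x"
    and FG: "AE x in lborel. (\<lambda>k. F k x) \<longlonglongrightarrow> G x"
    and PQ: "AE x in lborel. n x < \<infinity> \<longrightarrow> (\<lambda>k. P k x) \<longlonglongrightarrow> Q x"
    and fin: "nconv m n \<xi> < \<infinity>"
  shows "(\<lambda>k. conv (F k) (P k) \<xi>) \<longlonglongrightarrow> conv G Q \<xi>"
proof -
  define w where "w \<eta> = enn2real (m \<eta> * n (\<xi> - \<eta>))" for \<eta>
  have fin': "AE \<eta> in lborel. m \<eta> * n (\<xi> - \<eta>) \<noteq> \<infinity>"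
    by (rule nn_integral_PInf_AE) (use fin in \<open>auto simp: nconv_def\<close>)
  have w: "integrable lborel w"
  proof (rule integrableI_bounded)
    have "(\<integral>\<^sup>+\<eta>. ennreal (norm (w \<eta>)) \<partial>lborel) \<le> nconv m n \<xi>"
      unfolding nconv_def w_def by (intro nn_integral_mono) (auto simp: ennreal_enn2real_if)
    then show "(\<integral>\<^sup>+\<eta>. ennreal (norm (w \<eta>)) \<partial>lborel) < \<infinity>" using fin by (rule order_le_less_trans)
  qed (unfold w_def[abs_def], measurable)
  show ?thesis unfolding conv_def
  proof (rule integral_dominated_convergence[where w=w])
    show "AE \<eta> in lborel. (\<lambda>k. F k \<eta> * P k (\<xi> - \<eta>)) \<longlonglongrightarrow> G \<eta> * Q (\<xi> - \<eta>)"
      using fin' FG AE_reflect[OF PQ, of \<xi>]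
    proof eventually_elim
      case (elim \<eta>)
      show ?case
      proof (cases "n (\<xi> - \<eta>) < \<infinity>")
        case True
        then show ?thesis using elim(2,3) by (intro tendsto_mult) auto
      next
        case False
        then have "n (\<xi> - \<eta>) = top" by (simp flip: top.not_eq_extremum)
        then have "m \<eta> = 0" using elim(1) by (auto simp: ennreal_mult_eq_top_iff)
        then have F0: "F k \<eta> = 0" for k using Fm[of k \<eta>] by (simp add: cn_def)
        then have "(\<lambda>k. F k \<eta>) \<longlonglongrightarrow> 0" by simp
        then have "G \<eta> = 0" using elim(2) LIMSEQ_unique by blast
        then show ?thesis using F0 by simp
      qed
    qed
    show "AE \<eta> in lborel. norm (F k \<eta> * P k (\<xi> - \<eta>)) \<le> w \<eta>" for k
      using fin'
    proof eventually_elim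
      case (elim \<eta>)
      have "ennreal (norm (F k \<eta> * P k (\<xi> - \<eta>))) = cn (F k) \<eta> * cn (P k) (\<xi> - \<eta>)"
        by (simp add: cn_def norm_mult ennreal_mult)
      also have "\<dots> \<le> m \<eta> * n (\<xi> - \<eta>)" by (intro mult_mono Fm Pn) auto
      finally show ?case using elim unfolding w_def
        by (metis enn2real_ennreal enn2real_mono norm_ge_zero infinity_ennreal_def top.not_eq_extremum)
    qed
  qed (use w in auto)
qed

text \<open>The function itself converges only almost everywhere; after one convolution convergence
  holds at each frequency where the majorant is finite. Hence the index \<open>Suc j\<close>, and
  the finiteness condition at the single point \<xi>.\<close>

lemma conv_power_tendsto:
  fixes F :: "nat \<Rightarrow> real \<Rightarrow> complex"
  assumes [measurable]: "\<And>k. F k \<in> borel_measurable borel" "G \<in> borel_measurable borel" "m \<in> borel_measurable borel"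
    and Fm: "\<And>k x. cn (F k) x \<le> m x"
    and FG: "AE x in lborel. (\<lambda>k. F k x) \<longlonglongrightarrow> G x"
    and fin: "npow m (Suc j) \<xi> < \<infinity>"
  shows "(\<lambda>k. conv_power (F k) (Suc j) \<xi>) \<longlonglongrightarrow> conv_power G (Suc j) \<xi>"
  using fin
proof (induction j arbitrary: \<xi>)
  case 0
  show ?case unfolding conv_power.simps
    by (rule conv_tendsto[where m=m and n=m]) (use 0 Fm FG in \<open>auto elim: eventually_mono\<close>)
next
  case (Suc j)
  show ?case unfolding conv_power.simps(2)[of _ "Suc j"]
    by (rule conv_tendsto[where m=m and n="npow m (Suc j)"])
       (use Suc.prems Suc.IH Fm FG cn_conv_power_le[OF _ Fm] in \<open>auto simp del: conv_power.simps npow.simps simp: npow.simps(2)[of _ "Suc j"]\<close>)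
qed

lemma measurable_pair_compose:
  assumes "case_prod F \<in> borel_measurable (borel \<Otimes>\<^sub>M borel)" "f \<in> borel_measurable M" "g \<in> borel_measurable M"
  shows "(\<lambda>x. F (f x) (g x)) \<in> borel_measurable M"
  using measurable_compose[OF measurable_Pair[OF assms(2,3)] assms(1)] by simp

lemma conv_measurable_pair:
  fixes F G :: "real \<Rightarrow> real \<Rightarrow> complex"
  assumes F: "case_prod F \<in> borel_measurable (borel \<Otimes>\<^sub>M borel)"
    and G: "case_prod G \<in> borel_measurable (borel \<Otimes>\<^sub>M borel)"
  shows "(\<lambda>(t, \<xi>). conv (F t) (G t) \<xi>) \<in> borel_measurable (borel \<Otimes>\<^sub>M borel)"
proof -
  note [measurable (raw)] = measurable_pair_compose[OF F] measurable_pair_compose[OF G]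
  show ?thesis unfolding conv_def split_beta by measurable
qed

lemma conv_power_measurable_pair:
  fixes F :: "real \<Rightarrow> real \<Rightarrow> complex"
  assumes F: "case_prod F \<in> borel_measurable (borel \<Otimes>\<^sub>M borel)"
  shows "(\<lambda>(t, \<xi>). conv_power (F t) n \<xi>) \<in> borel_measurable (borel \<Otimes>\<^sub>M borel)"
proof (induction n)
  case (Suc n)
  then show ?case using conv_measurable_pair[OF F, of "\<lambda>t. conv_power (F t) n"] by simp
qed (use F in simp)

text \<open>The inequality for \<open>R\<close> says that the majorant iteration maps the ball of
  radius \<open>R\<close> into itself. Its factors 2 come from |t| + 1 \<le> 2 in
  \<open>abs_sprop_weight\<close>, and its factor \<open>T\<close> from the time integral of the
  kernel.\<close>

locale picard =
  fixes \<Gamma> :: "real set" and s \<sigma> T R K :: real and q :: nat and v0 v1 :: "real \<Rightarrow> complex"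
  assumes \<Gamma>: "half_line \<Gamma>" and q: "1 \<le> q" and T: "0 < T" "T \<le> 1" and \<sigma>: "\<bar>\<sigma>\<bar> \<le> 1"
    and v0: "v0 \<in> Hs s \<Gamma>" and v1: "v1 \<in> Hs (s - 1) \<Gamma>"
    and K: "\<And>f B. bd s f B \<Longrightarrow> supp_in \<Gamma> f \<Longrightarrow> bd (s - 1) (npow f q) (K * B ^ Suc q)"
    and R: "hsnorm s v0 + 2 * hsnorm (s - 1) v1 + 2 * T * (K * R ^ Suc q) \<le> R" and R0: "0 \<le> R"
begin

definition a0 :: "real \<Rightarrow> complex" where "a0 \<xi> = indicator \<Gamma> \<xi> * v0 \<xi>"
definition a1 :: "real \<Rightarrow> complex" where "a1 \<xi> = indicator \<Gamma> \<xi> * v1 \<xi>"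

definition A :: "real \<Rightarrow> ennreal" where
  "A \<xi> = cn a0 \<xi> + ennreal 2 * (ennreal (wt (-1/2) \<xi>) * cn a1 \<xi>)"

text \<open>Independent of time: the propagator is bounded uniformly on [-T, T] by 2
  \<open>wt (-1/2)\<close>, and the signed indicator has mass at most \<open>T\<close>, so the
  Duhamel integral becomes multiplication by a weight.\<close>

primrec maj :: "nat \<Rightarrow> real \<Rightarrow> ennreal" where
  "maj 0 = (\<lambda>\<xi>. 0)"
| "maj (Suc n) = (\<lambda>\<xi>. A \<xi> + ennreal (2 * T) * (ennreal (wt (-1/2) \<xi>) * npow (maj n) q \<xi>))"

text \<open>The value 0 outside [-T, T] makes the comparison with \<open>maj\<close> valid for all
  real times, so no time restriction has to be carried through the inductions.\<close>

primrec itr :: "nat \<Rightarrow> real \<Rightarrow> real \<Rightarrow> complex" where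
  "itr 0 = (\<lambda>t \<xi>. 0)"
| "itr (Suc n) = (\<lambda>t \<xi>. if \<bar>t\<bar> \<le> T
     then complex_of_real (cos (2 * pi * \<xi> * t)) * a0 \<xi> + complex_of_real (sprop t \<xi>) * a1 \<xi>
       + complex_of_real \<sigma> * (LINT \<tau>|lborel. complex_of_real (kern t \<tau> * sprop (t - \<tau>) \<xi>) * conv_power (itr n \<tau>) q \<xi>)
     else 0)"

lemma [measurable]: "\<Gamma> \<in> sets borel" using half_line_measurable[OF \<Gamma>] .
lemma v0_measurable [measurable]: "v0 \<in> borel_measurable borel" using v0 by (rule Hs_measurable)
lemma v1_measurable [measurable]: "v1 \<in> borel_measurable borel" using v1 by (rule Hs_measurable)
lemma a0_measurable [measurable]: "a0 \<in> borel_measurable borel" unfolding a0_def[abs_def] by measurable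
lemma a1_measurable [measurable]: "a1 \<in> borel_measurable borel" unfolding a1_def[abs_def] by measurable
lemma A_measurable [measurable]: "A \<in> borel_measurable borel" unfolding A_def[abs_def] by measurable
lemma maj_measurable [measurable]: "maj n \<in> borel_measurable borel" by (induction n) auto

lemma a0_AE: "AE \<xi> in lborel. a0 \<xi> = v0 \<xi>"
  using Hs_supp[OF v0] unfolding supp_in_cn by eventually_elim (auto simp: a0_def indicator_def)
lemma a1_AE: "AE \<xi> in lborel. a1 \<xi> = v1 \<xi>"
  using Hs_supp[OF v1] unfolding supp_in_cn by eventually_elim (auto simp: a1_def indicator_def)

lemma bd_a0: "bd s (cn a0) (hsnorm s v0)"
  by (rule bd_mono[OF bd_hsnorm[OF v0]]) (auto simp: a0_def cn_def indicator_def)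
lemma bd_a1: "bd (s - 1) (cn a1) (hsnorm (s - 1) v1)"
  by (rule bd_mono[OF bd_hsnorm[OF v1]]) (auto simp: a1_def cn_def indicator_def)

lemma bd_gain: "bd (s - 1) f B \<Longrightarrow> bd s (\<lambda>\<xi>. ennreal (wt (-1/2) \<xi>) * f \<xi>) B"
  using bd_weight[of "s - 1" f B "-1/2"] by simp

lemma bd_A: "bd s A (hsnorm s v0 + 2 * hsnorm (s - 1) v1)"
  unfolding A_def[abs_def] by (intro bd_add bd_a0 bd_cmult bd_gain bd_a1) auto

lemma supp_A: "supp_in \<Gamma> A"
  by (auto simp: supp_in_def A_def a0_def a1_def cn_def)

lemma maj_mono: "maj n \<xi> \<le> maj (Suc n) \<xi>"
proof (induction n arbitrary: \<xi>)
  case (Suc n)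
  then show ?case by (auto intro!: add_mono mult_left_mono npow_mono simp del: maj.simps(2) simp: maj.simps(2)[of "Suc n"] maj.simps(2)[of n])
qed simp

lemma incseq_maj: "incseq (\<lambda>n. maj n \<xi>)"
  by (rule incseq_SucI) (rule maj_mono)

lemma maj_bd: "bd s (maj n) R \<and> supp_in \<Gamma> (maj n)"
proof (induction n)
  case 0
  show ?case using R0 by (auto simp: bd_def supp_in_def)
next
  case (Suc n)
  then have n: "bd s (maj n) R" "supp_in \<Gamma> (maj n)" by auto
  have "bd s (maj (Suc n)) (hsnorm s v0 + 2 * hsnorm (s - 1) v1 + 2 * T * (K * R ^ Suc q))"
    unfolding maj.simps by (intro bd_add bd_A bd_cmult bd_gain K n) (use T in auto)
  then have "bd s (maj (Suc n)) R"
    by (rule bd_mono) (use R in auto)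
  moreover have "supp_in \<Gamma> (maj (Suc n))"
    using supp_A supp_in_npow[OF \<Gamma> n(2) maj_measurable, of q] unfolding supp_in_def
    by eventually_elim auto
  ultimately show ?case by simp
qed

text \<open>Joint measurability is what the induction needs, because the next iterate integrates
  over time with the frequency as a parameter.\<close>

lemma itr_measurable_pair: "case_prod (itr n) \<in> borel_measurable (borel \<Otimes>\<^sub>M borel)"
proof (induction n)
  case (Suc n)
  let ?k = "\<lambda>z \<tau>. complex_of_real (kern (fst z) \<tau> * sprop (fst z - \<tau>) (snd z))"
  let ?D = "\<lambda>z. LINT \<tau>|lborel. ?k z \<tau> * conv_power (itr n \<tau>) q (snd z)"
  have "(\<lambda>z. conv_power (itr n (snd z)) q (snd (fst z))) \<in> borel_measurable ((borel \<Otimes>\<^sub>M borel) \<Otimes>\<^sub>M lborel)"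
    by (rule measurable_pair_compose[OF conv_power_measurable_pair[OF Suc, of q]]) measurable
  then have "(\<lambda>z. ?k (fst z) (snd z) * conv_power (itr n (snd z)) q (snd (fst z))) \<in> borel_measurable ((borel \<Otimes>\<^sub>M borel) \<Otimes>\<^sub>M lborel)"
    by (rule borel_measurable_times[rotated]) measurable
  then have D: "?D \<in> borel_measurable (borel \<Otimes>\<^sub>M borel)"
    by (intro lborel.borel_measurable_lebesgue_integral) (simp only: case_prod_beta')
  have "(\<lambda>z. complex_of_real (cos (2 * pi * snd z * fst z)) * a0 (snd z) + complex_of_real (sprop (fst z) (snd z)) * a1 (snd z)
      + complex_of_real \<sigma> * ?D z) \<in> borel_measurable (borel \<Otimes>\<^sub>M borel)"
    by (intro borel_measurable_add borel_measurable_times D) measurable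
  then have "(\<lambda>z. if \<bar>fst z\<bar> \<le> T then complex_of_real (cos (2 * pi * snd z * fst z)) * a0 (snd z) + complex_of_real (sprop (fst z) (snd z)) * a1 (snd z)
      + complex_of_real \<sigma> * ?D z else 0) \<in> borel_measurable (borel \<Otimes>\<^sub>M borel)"
    by (rule measurable_If) (simp, measurable)
  then show ?case unfolding itr.simps case_prod_beta' .
qed (simp add: case_prod_beta')

lemma itr_measurable [measurable]: "itr n t \<in> borel_measurable borel"
  by (rule measurable_pair_compose[OF itr_measurable_pair[of n], where f="\<lambda>_. t" and g="\<lambda>x. x"]) measurable

lemma conv_power_itr_measurable [measurable]: "(\<lambda>\<tau>. conv_power (itr n \<tau>) j \<xi>) \<in> borel_measurable borel"
  by (rule measurable_pair_compose[OF conv_power_measurable_pair[OF itr_measurable_pair[of n], of j],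
      where f="\<lambda>x. x" and g="\<lambda>_. \<xi>"]) measurable

lemma sprop_le: "\<bar>t\<bar> \<le> T \<Longrightarrow> \<bar>sprop t \<xi>\<bar> \<le> 2 * wt (-1/2) \<xi>"
proof -
  assume "\<bar>t\<bar> \<le> T"
  then have "(\<bar>t\<bar> + 1) * wt (-1/2) \<xi> \<le> 2 * wt (-1/2) \<xi>" using T by (intro mult_right_mono) auto
  then show ?thesis using abs_sprop_weight[of t \<xi>] by linarith
qed

text \<open>Neither integral need converge and \<open>e\<close> may be infinite, so the estimate is
  available at every frequency before anything is known to be finite.\<close>

lemma duhamel_diff_le:
  fixes h h' :: "real \<Rightarrow> complex"
  assumes [measurable]: "h \<in> borel_measurable borel" "h' \<in> borel_measurable borel"
    and t: "\<bar>t\<bar> \<le> T" and e: "\<And>\<tau>. ennreal (cmod (h \<tau> - h' \<tau>)) \<le> e"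
  shows "ennreal (cmod ((LINT \<tau>|lborel. complex_of_real (kern t \<tau> * sprop (t - \<tau>) \<xi>) * h \<tau>)
       - (LINT \<tau>|lborel. complex_of_real (kern t \<tau> * sprop (t - \<tau>) \<xi>) * h' \<tau>)))
     \<le> ennreal (2 * T) * (ennreal (wt (-1/2) \<xi>) * e)"
proof -
  let ?k = "\<lambda>\<tau>. complex_of_real (kern t \<tau> * sprop (t - \<tau>) \<xi>)"
  have "ennreal (cmod ((LINT \<tau>|lborel. ?k \<tau> * h \<tau>) - (LINT \<tau>|lborel. ?k \<tau> * h' \<tau>)))
    \<le> (\<integral>\<^sup>+\<tau>. ennreal (cmod (?k \<tau> * h \<tau> - ?k \<tau> * h' \<tau>)) \<partial>lborel)"
    by (rule norm_diff_integral_le) measurable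
  also have "\<dots> \<le> (\<integral>\<^sup>+\<tau>. ennreal \<bar>kern t \<tau>\<bar> * (ennreal (2 * wt (-1/2) \<xi>) * e) \<partial>lborel)"
  proof (rule nn_integral_mono)
    fix \<tau>
    show "ennreal (cmod (?k \<tau> * h \<tau> - ?k \<tau> * h' \<tau>)) \<le> ennreal \<bar>kern t \<tau>\<bar> * (ennreal (2 * wt (-1/2) \<xi>) * e)"
    proof (cases "kern t \<tau> = 0")
      case False
      then have "\<bar>t - \<tau>\<bar> \<le> T" using kern_nonzero[OF False] t by linarith
      then have "ennreal \<bar>sprop (t - \<tau>) \<xi>\<bar> \<le> ennreal (2 * wt (-1/2) \<xi>)" by (intro ennreal_leI sprop_le)
      then have "ennreal \<bar>kern t \<tau>\<bar> * (ennreal \<bar>sprop (t - \<tau>) \<xi>\<bar> * ennreal (cmod (h \<tau> - h' \<tau>)))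
         \<le> ennreal \<bar>kern t \<tau>\<bar> * (ennreal (2 * wt (-1/2) \<xi>) * e)"
        by (intro mult_mono e order_refl) auto
      moreover have "?k \<tau> * h \<tau> - ?k \<tau> * h' \<tau> = ?k \<tau> * (h \<tau> - h' \<tau>)" by (simp add: algebra_simps)
      moreover have "ennreal (cmod (?k \<tau> * (h \<tau> - h' \<tau>)))
          = ennreal \<bar>kern t \<tau>\<bar> * (ennreal \<bar>sprop (t - \<tau>) \<xi>\<bar> * ennreal (cmod (h \<tau> - h' \<tau>)))"
        unfolding norm_mult norm_of_real abs_mult by (simp add: ennreal_mult mult.assoc)
      ultimately show ?thesis by simp
    qed simp
  qed
  also have "\<dots> = ennreal \<bar>t\<bar> * (ennreal (2 * wt (-1/2) \<xi>) * e)"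
    by (subst nn_integral_multc) (auto simp: nn_integral_kern)
  also have "\<dots> \<le> ennreal T * (ennreal (2 * wt (-1/2) \<xi>) * e)"
    using t by (intro mult_right_mono ennreal_leI) auto
  also have "\<dots> = ennreal (2 * T) * (ennreal (wt (-1/2) \<xi>) * e)"
    using T by (simp add: ennreal_mult ac_simps)
  finally show ?thesis .
qed

lemma itr_le_maj: "cn (itr n t) \<xi> \<le> maj n \<xi>"
proof (induction n arbitrary: t \<xi>)
  case (Suc n)
  show ?case
  proof (cases "\<bar>t\<bar> \<le> T")
    case True
    let ?D = "LINT \<tau>|lborel. complex_of_real (kern t \<tau> * sprop (t - \<tau>) \<xi>) * conv_power (itr n \<tau>) q \<xi>"
    have D: "ennreal (cmod ?D) \<le> ennreal (2 * T) * (ennreal (wt (-1/2) \<xi>) * npow (maj n) q \<xi>)"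
      using duhamel_diff_le[of "\<lambda>\<tau>. conv_power (itr n \<tau>) q \<xi>" "\<lambda>_. 0" t "npow (maj n) q \<xi>" \<xi>] True
        cn_conv_power_le[OF itr_measurable Suc, where \<xi>=\<xi> and n=q] by (simp add: cn_def)
    have "cmod (itr (Suc n) t \<xi>) \<le> cmod (complex_of_real (cos (2 * pi * \<xi> * t)) * a0 \<xi>)
       + cmod (complex_of_real (sprop t \<xi>) * a1 \<xi>) + cmod (complex_of_real \<sigma> * ?D)"
      using True by (auto intro!: order_trans[OF norm_triangle_ineq] add_mono norm_triangle_ineq)
    also have "\<dots> \<le> 1 * cmod (a0 \<xi>) + 2 * wt (-1/2) \<xi> * cmod (a1 \<xi>) + 1 * cmod ?D"
      unfolding norm_mult norm_of_real using \<sigma> sprop_le[OF True]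
      by (intro add_mono mult_right_mono) auto
    finally have "cn (itr (Suc n) t) \<xi> \<le> ennreal (1 * cmod (a0 \<xi>) + 2 * wt (-1/2) \<xi> * cmod (a1 \<xi>) + 1 * cmod ?D)"
      unfolding cn_def by (rule ennreal_leI)
    also have "\<dots> = A \<xi> + ennreal (cmod ?D)"
      by (simp add: A_def cn_def ennreal_plus ennreal_mult mult.assoc)
    also have "\<dots> \<le> maj (Suc n) \<xi>" unfolding maj.simps by (intro add_left_mono D)
    finally show ?thesis .
  qed (simp add: cn_def)
qed (simp add: cn_def)

text \<open>Consecutive iterates differ by at most the increment of the majorant, in additive form
  because the increment may be of the form infinity minus infinity. The induction step feeds
  \<open>conv_power_majorant\<close> into \<open>duhamel_diff_le\<close>.\<close>

lemma itr_diff_le_maj: "cn (\<lambda>\<xi>. itr (Suc n) t \<xi> - itr n t \<xi>) \<xi> + maj n \<xi> \<le> maj (Suc n) \<xi>"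
proof (induction n arbitrary: t \<xi>)
  case 0
  show ?case using itr_le_maj[of 1 t \<xi>] by (simp add: cn_def)
next
  case (Suc n)
  show ?case
  proof (cases "\<bar>t\<bar> \<le> T")
    case True
    let ?D = "\<lambda>n. LINT \<tau>|lborel. complex_of_real (kern t \<tau> * sprop (t - \<tau>) \<xi>) * conv_power (itr n \<tau>) q \<xi>"
    define a b where "a = npow (maj n) q \<xi>" and "b = npow (maj (Suc n)) q \<xi>"
    have ab: "a \<le> b" unfolding a_def b_def by (intro npow_mono maj_mono)
    have le: "ennreal (cmod (conv_power (itr (Suc n) \<tau>) q \<xi> - conv_power (itr n \<tau>) q \<xi>)) + a \<le> b" for \<tau>
      using conv_power_majorant[of "itr (Suc n) \<tau>" "itr n \<tau>" "maj n" "maj (Suc n)" q \<xi>] Suc itr_le_maj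
      by (simp only: a_def b_def cn_def itr_measurable maj_measurable simp_thms)
    define c where "c = ennreal (2 * T) * ennreal (wt (-1/2) \<xi>)"
    have m1: "maj (Suc n) \<xi> = A \<xi> + c * a" and m2: "maj (Suc (Suc n)) \<xi> = A \<xi> + c * b"
      by (simp_all add: c_def a_def b_def mult.assoc)
    show ?thesis
    \<comment> \<open>If the nonlinear term is already infinite here, so is the next majorant, its
      coefficient \<open>c\<close> being nonzero; otherwise \<open>b - a\<close> is a genuine
      difference.\<close>
    proof (cases "a = top")
      case True
      then have "b = top" using ab by (simp add: top_unique)
      moreover have "c \<noteq> 0" using T by (simp add: c_def ennreal_eq_0_iff not_le)
      ultimately show ?thesis unfolding m2 by (simp add: ennreal_mult_eq_top_iff)
    next
      case False
      have "ennreal (cmod (conv_power (itr (Suc n) \<tau>) q \<xi> - conv_power (itr n \<tau>) q \<xi>)) \<le> b - a" for \<tau>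
        using le[of \<tau>] by (simp only: ennreal_le_minus_iff simp_thms)
      from duhamel_diff_le[OF _ _ True this, where \<xi>=\<xi>]
      have d1: "ennreal (cmod (?D (Suc n) - ?D n)) \<le> c * (b - a)" by (simp add: c_def mult.assoc del: itr.simps)
      have d2: "itr (Suc (Suc n)) t \<xi> - itr (Suc n) t \<xi> = complex_of_real \<sigma> * (?D (Suc n) - ?D n)"
        using \<open>\<bar>t\<bar> \<le> T\<close> unfolding itr.simps(2)[of "Suc n"] itr.simps(2)[of n] by (simp add: algebra_simps del: itr.simps)
      have d3: "ennreal (cmod (complex_of_real \<sigma> * (?D (Suc n) - ?D n))) \<le> ennreal (cmod (?D (Suc n) - ?D n))"
        unfolding norm_mult norm_of_real using \<sigma> mult_right_mono[of "\<bar>\<sigma>\<bar>" 1] by (intro ennreal_leI) auto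
      have "cn (\<lambda>\<xi>. itr (Suc (Suc n)) t \<xi> - itr (Suc n) t \<xi>) \<xi> \<le> c * (b - a)"
        unfolding cn_def d2 by (rule order_trans[OF d3 d1])
      then have "cn (\<lambda>\<xi>. itr (Suc (Suc n)) t \<xi> - itr (Suc n) t \<xi>) \<xi> + maj (Suc n) \<xi> \<le> c * (b - a) + (A \<xi> + c * a)"
        unfolding m1 by (rule add_right_mono)
      also have "\<dots> = A \<xi> + c * ((b - a) + a)" by (simp add: algebra_simps)
      also have "\<dots> = maj (Suc (Suc n)) \<xi>" unfolding m2 using ab by (simp add: diff_add_cancel_ennreal)
      finally show ?thesis .
    qed
  next
    case False
    then show ?thesis using maj_mono[of "Suc n" \<xi>] unfolding itr.simps(2)[of "Suc n"] itr.simps(2)[of n] by (simp add: cn_def del: itr.simps maj.simps)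
  qed
qed

lemma itr_diff_le_maj': "cn (\<lambda>\<xi>. itr (n + k) t \<xi> - itr n t \<xi>) \<xi> + maj n \<xi> \<le> maj (n + k) \<xi>"
proof (induction k)
  case (Suc k)
  have "cmod (itr (n + Suc k) t \<xi> - itr n t \<xi>) \<le> cmod (itr (Suc (n + k)) t \<xi> - itr (n + k) t \<xi>) + cmod (itr (n + k) t \<xi> - itr n t \<xi>)"
    unfolding add_Suc_right by (rule order_trans[OF eq_refl norm_triangle_ineq]) (simp del: itr.simps)
  then have "cn (\<lambda>\<xi>. itr (n + Suc k) t \<xi> - itr n t \<xi>) \<xi>
     \<le> cn (\<lambda>\<xi>. itr (Suc (n + k)) t \<xi> - itr (n + k) t \<xi>) \<xi> + cn (\<lambda>\<xi>. itr (n + k) t \<xi> - itr n t \<xi>) \<xi>"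
    by (simp add: cn_def ennreal_leI flip: ennreal_plus del: itr.simps)
  then have "cn (\<lambda>\<xi>. itr (n + Suc k) t \<xi> - itr n t \<xi>) \<xi> + maj n \<xi>
     \<le> cn (\<lambda>\<xi>. itr (Suc (n + k)) t \<xi> - itr (n + k) t \<xi>) \<xi> + (cn (\<lambda>\<xi>. itr (n + k) t \<xi> - itr n t \<xi>) \<xi> + maj n \<xi>)"
    unfolding add.assoc[symmetric, where c="maj n \<xi>"] by (rule add_right_mono)
  also have "\<dots> \<le> cn (\<lambda>\<xi>. itr (Suc (n + k)) t \<xi> - itr (n + k) t \<xi>) \<xi> + maj (n + k) \<xi>"
    by (intro add_left_mono Suc)
  also have "\<dots> \<le> maj (n + Suc k) \<xi>" using itr_diff_le_maj[of "n + k" t \<xi>] by (simp del: itr.simps maj.simps)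
  finally show ?case .
qed (simp add: cn_def)

end

lemma hsnorm_tendsto_0_within:
  fixes F :: "real \<Rightarrow> real \<Rightarrow> complex"
  assumes [measurable]: "\<And>\<tau>. \<tau> \<in> S \<Longrightarrow> F \<tau> \<in> borel_measurable borel"
    and m: "bd r m B" and le: "\<And>\<tau>. \<tau> \<in> S - {t} \<Longrightarrow> AE x in lborel. cn (F \<tau>) x \<le> m x"
    and lim: "AE x in lborel. ((\<lambda>\<tau>. F \<tau> x) \<longlongrightarrow> 0) (at t within S)"
  shows "((\<lambda>\<tau>. hsnorm r (F \<tau>)) \<longlongrightarrow> 0) (at t within S)"
  unfolding tendsto_at_iff_sequentially
proof (intro allI impI)
  fix X assume X: "\<forall>i. X i \<in> S - {t}" "X \<longlonglongrightarrow> t"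
  have "(\<lambda>n. hsnorm r (F (X n))) \<longlonglongrightarrow> 0"
  proof (rule hsnorm_tendsto_0[OF _ m])
    show "AE x in lborel. (\<lambda>n. F (X n) x) \<longlonglongrightarrow> 0"
      using lim by eventually_elim (use X in \<open>auto simp: tendsto_at_iff_sequentially o_def\<close>)
  qed (use X le in auto)
  then show "((\<lambda>\<tau>. hsnorm r (F \<tau>)) \<circ> X) \<longlonglongrightarrow> 0" by (simp add: o_def)
qed

lemma hsnorm_eq_0:
  assumes "AE x in lborel. F x = 0" "F \<in> borel_measurable borel"
  shows "hsnorm s F = 0"
  using hsnorm_cong_AE[OF assms(1) assms(2), of s] by (simp add: hsnorm_def)

lemma kern_0 [simp]: "kern 0 \<tau> = 0"
  by (simp add: kern_def)

lemma osc_0: "osc \<sigma> \<xi> c0 c1 h 0 = c0" and osc'_0: "osc' \<sigma> \<xi> c0 c1 h 0 = c1"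
  by (simp_all add: osc_def osc'_def duh_cos_def duh_sin_def sprop_def)

section \<open>The limit of the iterates and its regularity\<close>

context picard
begin

definition M :: "real \<Rightarrow> ennreal" where "M \<xi> = (SUP n. maj n \<xi>)"

lemma M_measurable [measurable]: "M \<in> borel_measurable borel"
  unfolding M_def[abs_def] by measurable

lemma maj_tendsto: "(\<lambda>n. maj n \<xi>) \<longlonglongrightarrow> M \<xi>"
  unfolding M_def by (rule LIMSEQ_SUP[OF incseq_maj])

lemma maj_le_M: "maj n \<xi> \<le> M \<xi>"
  unfolding M_def by (rule SUP_upper) simp

text \<open>Fatou's lemma along the increasing sequence, whose members all satisfy the same bound
  \<open>R\<close>.\<close>

lemma bd_M: "bd s M R"
proof -
  have lim: "(\<lambda>n. ennreal (wt s \<xi>) * (maj n \<xi>)\<^sup>2) \<longlonglongrightarrow> ennreal (wt s \<xi>) * (M \<xi>)\<^sup>2" for \<xi>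
    unfolding power2_eq_square
    by (intro ennreal_tendsto_cmult tendsto_mult_ennreal maj_tendsto) auto
  have "(\<integral>\<^sup>+\<xi>. ennreal (wt s \<xi>) * (M \<xi>)\<^sup>2 \<partial>lborel) = (\<integral>\<^sup>+\<xi>. liminf (\<lambda>n. ennreal (wt s \<xi>) * (maj n \<xi>)\<^sup>2) \<partial>lborel)"
    by (intro nn_integral_cong lim_imp_Liminf[symmetric] lim) simp
  also have "\<dots> \<le> liminf (\<lambda>n. \<integral>\<^sup>+\<xi>. ennreal (wt s \<xi>) * (maj n \<xi>)\<^sup>2 \<partial>lborel)"
    by (rule nn_integral_liminf) measurable
  also have "\<dots> \<le> liminf (\<lambda>n::nat. ennreal (R\<^sup>2))"
    using maj_bd by (intro Liminf_mono always_eventually) (auto simp: bd_def)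
  also have "\<dots> = ennreal (R\<^sup>2)" by (simp add: Liminf_const)
  finally show ?thesis using R0 by (auto simp: bd_def)
qed

lemma supp_M: "supp_in \<Gamma> M"
proof -
  have "AE \<xi> in lborel. \<forall>n. \<xi> \<notin> \<Gamma> \<longrightarrow> maj n \<xi> = 0"
    using maj_bd by (subst AE_all_countable) (auto simp: supp_in_def)
  then show ?thesis unfolding supp_in_def by eventually_elim (auto simp: M_def)
qed

lemma bd_N: "bd (s - 1) (npow M q) (K * R ^ Suc q)"
  by (rule K[OF bd_M supp_M])

text \<open>One exceptional set for all times. The two conditions do not involve \<open>t\<close>,
  so on \<open>Z\<close> limits, continuity and derivatives in time can be taken at a fixed
  frequency.\<close>

definition Z :: "real set" where "Z = {\<xi>. M \<xi> < \<infinity> \<and> npow M q \<xi> < \<infinity>}"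

lemma Z_sets [measurable]: "Z \<in> sets borel"
  unfolding Z_def by measurable

lemma AE_Z: "AE \<xi> in lborel. \<xi> \<in> Z"
  using bd_finite_AE[OF bd_M] bd_finite_AE[OF bd_N] unfolding Z_def by eventually_elim auto

text \<open>The increments are dominated by those of a convergent real sequence, namely the majorant
  at a frequency where its supremum is finite.\<close>

lemma itr_convergent:
  assumes "\<xi> \<in> Z"
  shows "convergent (\<lambda>n. itr n t \<xi>)"
proof -
  have fin: "M \<xi> < \<infinity>" using assms by (simp add: Z_def)
  then have finn: "maj n \<xi> < \<infinity>" for n using maj_le_M[of n \<xi>] by (rule order_le_less_trans[rotated])
  define b where "b n = enn2real (maj n \<xi>)" for n
  have mb: "maj n \<xi> = ennreal (b n)" and b0: "0 \<le> b n" for n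
    using finn[of n] by (auto simp: b_def)
  have "b \<longlonglongrightarrow> enn2real (M \<xi>)"
    unfolding b_def by (rule tendsto_enn2real) (use fin maj_tendsto[of \<xi>] in auto)
  then have "Cauchy b" by (rule LIMSEQ_imp_Cauchy)
  have le: "cmod (itr (n + k) t \<xi> - itr n t \<xi>) \<le> \<bar>b (n + k) - b n\<bar>" for n k
  proof -
    have "ennreal (cmod (itr (n + k) t \<xi> - itr n t \<xi>) + b n) \<le> ennreal (b (n + k))"
      using itr_diff_le_maj'[of n k t \<xi>] b0[of n] unfolding mb cn_def by (simp add: ennreal_plus)
    then show ?thesis using b0[of "n + k"] by (simp add: ennreal_le_iff)
  qed
  have le': "dist (itr l t \<xi>) (itr n t \<xi>) \<le> dist (b l) (b n)" for l n
  proof (cases "n \<le> l")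
    case True
    then show ?thesis using le[of n "l - n"] by (simp add: dist_norm)
  next
    case False
    then show ?thesis using le[of l "n - l"] by (simp add: dist_norm norm_minus_commute abs_minus_commute)
  qed
  have "Cauchy (\<lambda>n. itr n t \<xi>)"
    using \<open>Cauchy b\<close> le' unfolding Cauchy_def by (meson order_le_less_trans)
  then show ?thesis by (rule Cauchy_convergent)
qed

definition U :: "real \<Rightarrow> real \<Rightarrow> complex" where
  "U t \<xi> = (if \<xi> \<in> Z then lim (\<lambda>n. itr n t \<xi>) else 0)"

lemma itr_tendsto: "\<xi> \<in> Z \<Longrightarrow> (\<lambda>n. itr n t \<xi>) \<longlonglongrightarrow> U t \<xi>"
  using itr_convergent[of \<xi> t] by (simp add: U_def convergent_LIMSEQ_iff)

lemma U_le: "cn (U t) \<xi> \<le> M \<xi>"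
proof (cases "\<xi> \<in> Z")
  case True
  have "(\<lambda>n. cn (itr n t) \<xi>) \<longlonglongrightarrow> cn (U t) \<xi>"
    unfolding cn_def by (intro tendsto_ennrealI tendsto_norm itr_tendsto True)
  then show ?thesis
    by (rule LIMSEQ_le_const2) (use order_trans[OF itr_le_maj maj_le_M] in auto)
qed (simp add: U_def cn_def)

lemma U_measurable_pair: "case_prod U \<in> borel_measurable (borel \<Otimes>\<^sub>M borel)"
proof (rule borel_measurable_LIMSEQ_metric)
  show "(\<lambda>z. if snd z \<in> Z then itr n (fst z) (snd z) else 0) \<in> borel_measurable (borel \<Otimes>\<^sub>M borel)" for n
    using itr_measurable_pair[of n, unfolded case_prod_beta'] by (rule measurable_If) (simp, measurable)
  show "(\<lambda>n. if snd z \<in> Z then itr n (fst z) (snd z) else 0) \<longlonglongrightarrow> case_prod U z" for z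
    using itr_tendsto[of "snd z" "fst z"] by (cases "snd z \<in> Z") (simp_all add: case_prod_beta' U_def)
qed

lemma U_measurable [measurable]: "U t \<in> borel_measurable borel"
  by (rule measurable_pair_compose[OF U_measurable_pair, where f="\<lambda>_. t" and g="\<lambda>x. x"]) measurable

definition N :: "real \<Rightarrow> real \<Rightarrow> complex" where "N t \<xi> = conv_power (U t) q \<xi>"

lemma N_measurable_pair: "case_prod N \<in> borel_measurable (borel \<Otimes>\<^sub>M borel)"
  using conv_power_measurable_pair[OF U_measurable_pair, of q] by (simp only: N_def[abs_def])

lemma N_measurable_t [measurable]: "(\<lambda>\<tau>. N \<tau> \<xi>) \<in> borel_measurable borel"
  by (rule measurable_pair_compose[OF N_measurable_pair, where f="\<lambda>x. x" and g="\<lambda>_. \<xi>"]) measurable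

lemma N_measurable [measurable]: "N t \<in> borel_measurable borel"
  by (rule measurable_pair_compose[OF N_measurable_pair, where f="\<lambda>_. t" and g="\<lambda>x. x"]) measurable

lemma N_le: "cn (N t) \<xi> \<le> npow M q \<xi>"
  using cn_conv_power_le[OF U_measurable U_le, of t q \<xi>] by (simp add: cn_def N_def)

definition HN :: "real \<Rightarrow> real" where "HN \<xi> = enn2real (npow M q \<xi>)"

lemma HN_nonneg [simp]: "0 \<le> HN \<xi>" by (simp add: HN_def)

lemma ennreal_HN: "\<xi> \<in> Z \<Longrightarrow> ennreal (HN \<xi>) = npow M q \<xi>"
  by (simp add: HN_def Z_def)

lemma N_le_HN: "\<xi> \<in> Z \<Longrightarrow> cmod (N t \<xi>) \<le> HN \<xi>"
  using N_le[of t \<xi>] by (simp add: cn_def flip: ennreal_HN)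

lemma conv_power_limit:
  assumes "\<xi> \<in> Z" "\<And>k. F k \<in> borel_measurable borel" "G \<in> borel_measurable borel"
    "\<And>k x. cn (F k) x \<le> M x" "\<And>x. x \<in> Z \<Longrightarrow> (\<lambda>k. F k x) \<longlonglongrightarrow> G x"
  shows "(\<lambda>k. conv_power (F k) q \<xi>) \<longlonglongrightarrow> conv_power G q \<xi>"
proof -
  have j: "q = Suc (q - 1)" using q by simp
  have "npow M (Suc (q - 1)) \<xi> < \<infinity>" unfolding j[symmetric] using assms(1) by (simp add: Z_def)
  moreover have "AE x in lborel. (\<lambda>k. F k x) \<longlonglongrightarrow> G x"
    using AE_Z by eventually_elim (rule assms(5))
  ultimately have "(\<lambda>k. conv_power (F k) (Suc (q - 1)) \<xi>) \<longlonglongrightarrow> conv_power G (Suc (q - 1)) \<xi>"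
    by (intro conv_power_tendsto[OF assms(2,3) M_measurable assms(4)])
  then show ?thesis unfolding j[symmetric] .
qed

lemma N_tendsto: "\<xi> \<in> Z \<Longrightarrow> (\<lambda>n. conv_power (itr n \<tau>) q \<xi>) \<longlonglongrightarrow> N \<tau> \<xi>"
  unfolding N_def
  by (rule conv_power_limit) (use itr_tendsto order_trans[OF itr_le_maj maj_le_M] in auto)

text \<open>Dominated convergence of the time integral at one frequency, with
  \<open>HN \<xi>\<close> bounding the nonlinear terms of all iterates, takes the place of a
  contraction estimate.\<close>

lemma U_eq_osc:
  assumes \<xi>: "\<xi> \<in> Z" and t: "\<bar>t\<bar> \<le> T"
  shows "U t \<xi> = osc \<sigma> \<xi> (a0 \<xi>) (a1 \<xi>) (\<lambda>\<tau>. N \<tau> \<xi>) t"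
proof -
  let ?k = "\<lambda>\<tau>. complex_of_real (kern t \<tau> * sprop (t - \<tau>) \<xi>)"
  have "(\<lambda>n. LINT \<tau>|lborel. ?k \<tau> * conv_power (itr n \<tau>) q \<xi>) \<longlonglongrightarrow> (LINT \<tau>|lborel. ?k \<tau> * N \<tau> \<xi>)"
  proof (rule integral_dominated_convergence[where w="\<lambda>\<tau>. \<bar>kern t \<tau>\<bar> * (2 * wt (-1/2) \<xi> * HN \<xi>)"])
    show "integrable lborel (\<lambda>\<tau>. \<bar>kern t \<tau>\<bar> * (2 * wt (-1/2) \<xi> * HN \<xi>))"
      using integrable_kern[of t] by (intro integrable_mult_left integrable_abs)
    show "AE \<tau> in lborel. (\<lambda>n. ?k \<tau> * conv_power (itr n \<tau>) q \<xi>) \<longlonglongrightarrow> ?k \<tau> * N \<tau> \<xi>"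
      by (intro AE_I2 tendsto_mult tendsto_const N_tendsto \<xi>)
    show "AE \<tau> in lborel. norm (?k \<tau> * conv_power (itr n \<tau>) q \<xi>) \<le> \<bar>kern t \<tau>\<bar> * (2 * wt (-1/2) \<xi> * HN \<xi>)" for n
    proof (rule AE_I2)
      fix \<tau>
      show "norm (?k \<tau> * conv_power (itr n \<tau>) q \<xi>) \<le> \<bar>kern t \<tau>\<bar> * (2 * wt (-1/2) \<xi> * HN \<xi>)"
      proof (cases "kern t \<tau> = 0")
        case False
        then have "\<bar>t - \<tau>\<bar> \<le> T" using kern_nonzero[OF False] t by linarith
        then have "\<bar>sprop (t - \<tau>) \<xi>\<bar> \<le> 2 * wt (-1/2) \<xi>" by (rule sprop_le)
        moreover have "cn (conv_power (itr n \<tau>) q) \<xi> \<le> npow M q \<xi>"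
          by (rule cn_conv_power_le) (use order_trans[OF itr_le_maj maj_le_M] in auto)
        then have "cmod (conv_power (itr n \<tau>) q \<xi>) \<le> HN \<xi>"
          by (simp add: cn_def flip: ennreal_HN[OF \<xi>])
        ultimately show ?thesis unfolding norm_mult norm_of_real abs_mult mult.assoc[of "\<bar>kern t \<tau>\<bar>"]
          by (intro mult_left_mono mult_mono) auto
      qed simp
    qed
  qed measurable
  then have "(\<lambda>n. itr (Suc n) t \<xi>) \<longlonglongrightarrow> complex_of_real (cos (2 * pi * \<xi> * t)) * a0 \<xi> + complex_of_real (sprop t \<xi>) * a1 \<xi>
       + complex_of_real \<sigma> * (LINT \<tau>|lborel. ?k \<tau> * N \<tau> \<xi>)"
    using t by (auto intro!: tendsto_intros)
  from LIMSEQ_unique[OF LIMSEQ_Suc[OF itr_tendsto[OF \<xi>]] this]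
  have "U t \<xi> = complex_of_real (cos (2 * pi * \<xi> * t)) * a0 \<xi> + complex_of_real (sprop t \<xi>) * a1 \<xi>
       + complex_of_real \<sigma> * (LINT \<tau>|lborel. ?k \<tau> * N \<tau> \<xi>)" .
  then show ?thesis unfolding osc_def
    by (subst (asm) duhamel_eq[where H="HN \<xi>"]) (auto intro: N_le_HN[OF \<xi>])
qed

lemma U_continuous:
  assumes "\<xi> \<in> Z"
  shows "continuous_on {-T..T} (\<lambda>t. U t \<xi>)"
proof (rule continuous_on_eq)
  show "continuous_on {-T..T} (osc \<sigma> \<xi> (a0 \<xi>) (a1 \<xi>) (\<lambda>\<tau>. N \<tau> \<xi>))"
    by (rule osc_continuous[where H="HN \<xi>"]) (use N_le_HN[OF assms] T in auto)
qed (auto simp: U_eq_osc[OF assms])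

text \<open>Continuity in time of \<open>U\<close> at almost every frequency passes through the
  convolutions, because the majorant \<open>M\<close> is the same at all times.\<close>

lemma N_continuous:
  assumes "\<xi> \<in> Z"
  shows "continuous_on {-T..T} (\<lambda>t. N t \<xi>)"
  unfolding continuous_on_sequentially N_def
proof (intro allI ballI impI, elim conjE)
  fix X t assume t: "t \<in> {-T..T}" and X: "\<forall>n. X n \<in> {-T..T}" "X \<longlonglongrightarrow> t"
  have "(\<lambda>k. conv_power (U (X k)) q \<xi>) \<longlonglongrightarrow> conv_power (U t) q \<xi>"
  proof (rule conv_power_limit[OF assms])
    fix x assume "x \<in> Z"
    then show "(\<lambda>k. U (X k) x) \<longlonglongrightarrow> U t x"
      using U_continuous[of x] t X unfolding continuous_on_sequentially by (auto simp: o_def)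
  qed (auto intro: U_le)
  then show "((\<lambda>t. conv_power (U t) q \<xi>) \<circ> X) \<longlonglongrightarrow> conv_power (U t) q \<xi>" by (simp add: o_def)
qed

definition V :: "real \<Rightarrow> real \<Rightarrow> complex" where
  "V t \<xi> = (if \<xi> \<in> Z then osc' \<sigma> \<xi> (a0 \<xi>) (a1 \<xi>) (\<lambda>\<tau>. N \<tau> \<xi>) t else 0)"

lemma V_measurable [measurable]: "V t \<in> borel_measurable borel"
proof -
  have n: "(\<lambda>z. N (snd z) (fst z)) \<in> borel_measurable (borel \<Otimes>\<^sub>M lborel)"
    by (rule measurable_pair_compose[OF N_measurable_pair]) measurable
  have d1: "(\<lambda>\<xi>. duh_cos \<xi> (\<lambda>\<tau>. N \<tau> \<xi>) t) \<in> borel_measurable borel"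
    unfolding duh_cos_def
    by (rule lborel.borel_measurable_lebesgue_integral, unfold case_prod_beta')
       (intro borel_measurable_times n, measurable)
  have d2: "(\<lambda>\<xi>. duh_sin \<xi> (\<lambda>\<tau>. N \<tau> \<xi>) t) \<in> borel_measurable borel"
    unfolding duh_sin_def
    by (rule lborel.borel_measurable_lebesgue_integral, unfold case_prod_beta')
       (intro borel_measurable_times n, measurable)
 have "(\<lambda>\<xi>. osc' \<sigma> \<xi> (a0 \<xi>) (a1 \<xi>) (\<lambda>\<tau>. N \<tau> \<xi>) t) \<in> borel_measurable borel"
    unfolding osc'_def
    by (intro borel_measurable_add borel_measurable_times borel_measurable_uminus d1 d2; measurable)
  then show ?thesis unfolding V_def[abs_def]
    by (rule measurable_If) (simp, measurable)
qed

lemma U_deriv: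
  assumes "\<xi> \<in> Z" "t \<in> {-T..T}"
  shows "((\<lambda>t. U t \<xi>) has_vector_derivative V t \<xi>) (at t within {-T..T})"
proof (rule has_vector_derivative_transform)
  show "(osc \<sigma> \<xi> (a0 \<xi>) (a1 \<xi>) (\<lambda>\<tau>. N \<tau> \<xi>) has_vector_derivative V t \<xi>) (at t within {-T..T})"
    unfolding V_def using assms(1)
    by (simp, intro osc_deriv[where H="HN \<xi>"]) (use N_le_HN[OF assms(1)] T N_continuous assms in auto)
qed (use assms in \<open>auto simp: U_eq_osc[OF assms(1)]\<close>)

lemma V_deriv:
  assumes "\<xi> \<in> Z" "t \<in> {-T..T}"
  shows "((\<lambda>t. V t \<xi>) has_vector_derivative
     (- complex_of_real ((2 * pi * \<xi>)\<^sup>2) * U t \<xi> + complex_of_real \<sigma> * N t \<xi>)) (at t within {-T..T})"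
proof -
  have "(osc' \<sigma> \<xi> (a0 \<xi>) (a1 \<xi>) (\<lambda>\<tau>. N \<tau> \<xi>) has_vector_derivative
    (- complex_of_real ((2 * pi * \<xi>)\<^sup>2) * osc \<sigma> \<xi> (a0 \<xi>) (a1 \<xi>) (\<lambda>\<tau>. N \<tau> \<xi>) t + complex_of_real \<sigma> * N t \<xi>)) (at t within {-T..T})"
    by (intro osc'_deriv[where H="HN \<xi>"]) (use N_le_HN[OF assms(1)] T N_continuous assms in auto)
  moreover have "U t \<xi> = osc \<sigma> \<xi> (a0 \<xi>) (a1 \<xi>) (\<lambda>\<tau>. N \<tau> \<xi>) t"
    using assms by (intro U_eq_osc) auto
  moreover have "(\<lambda>t. V t \<xi>) = osc' \<sigma> \<xi> (a0 \<xi>) (a1 \<xi>) (\<lambda>\<tau>. N \<tau> \<xi>)"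
    using assms(1) by (simp add: V_def fun_eq_iff)
  ultimately show ?thesis by (simp only:)
qed

text \<open>\<open>osc'_bound\<close> with the frequency replaced by the bracket
  \<open>wt (1/2)\<close> and the nonlinearity by its majorant; again independent of time.\<close>

definition Vm :: "real \<Rightarrow> ennreal" where
  "Vm \<xi> = (ennreal (2 * pi) * (ennreal (wt (1/2) \<xi>) * cn a0 \<xi>) + cn a1 \<xi>) + ennreal 2 * npow M q \<xi>"

lemma bd_Vm: "bd (s - 1) Vm ((2 * pi * hsnorm s v0 + hsnorm (s - 1) v1) + 2 * (K * R ^ Suc q))"
  unfolding Vm_def[abs_def] using bd_weight[OF bd_a0, of "1/2"]
  by (intro bd_add bd_cmult bd_a1 bd_N) auto

lemma V_le:
  assumes "t \<in> {-T..T}"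
  shows "cn (V t) \<xi> \<le> Vm \<xi>"
proof (cases "\<xi> \<in> Z")
  case True
  have "cmod (V t \<xi>) \<le> \<bar>2 * pi * \<xi>\<bar> * cmod (a0 \<xi>) + cmod (a1 \<xi>) + 2 * HN \<xi>"
    using True assms T \<sigma> by (auto simp: V_def intro!: osc'_bound[where T=T] N_le_HN)
  also have "\<bar>2 * pi * \<xi>\<bar> * cmod (a0 \<xi>) \<le> (2 * pi) * (wt (1/2) \<xi> * cmod (a0 \<xi>))"
    unfolding mult.assoc[symmetric] abs_mult using abs_le_wt_half[of \<xi>]
    by (intro mult_right_mono mult_mono) auto
  finally have "ennreal (cmod (V t \<xi>)) \<le> ennreal ((2 * pi) * (wt (1/2) \<xi> * cmod (a0 \<xi>)) + cmod (a1 \<xi>) + 2 * HN \<xi>)"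
    by (intro ennreal_leI) simp
  then show ?thesis
    by (simp add: cn_def Vm_def ennreal_HN[OF True, symmetric] ennreal_plus ennreal_mult)
qed (simp add: V_def cn_def)

lemma U_in_Hs: "U t \<in> Hs s \<Gamma>"
  by (rule HsI[OF U_measurable bd_mono[OF bd_M]]) (auto intro: U_le supp_in_le[OF supp_M])

lemma V_in_Hs:
  assumes "t \<in> {-T..T}"
  shows "V t \<in> Hs (s - 1) \<Gamma>"
proof (rule HsI[OF V_measurable bd_mono[OF bd_Vm]])
  have "supp_in \<Gamma> Vm"
    using supp_in_npow[OF \<Gamma> supp_M M_measurable, of q] unfolding supp_in_def
    by eventually_elim (auto simp: Vm_def a0_def a1_def cn_def)
  then show "supp_in \<Gamma> (cn (V t))" by (rule supp_in_le) (rule V_le[OF assms])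
qed (auto intro: V_le[OF assms])

lemma U_cont_Hs:
  assumes "t \<in> {-T..T}"
  shows "((\<lambda>\<tau>. hsnorm s (\<lambda>\<xi>. U \<tau> \<xi> - U t \<xi>)) \<longlongrightarrow> 0) (at t within {-T..T})"
proof (rule hsnorm_tendsto_0_within[OF _ bd_add[OF bd_M bd_M]])
  show "AE \<xi> in lborel. cn (\<lambda>\<xi>. U \<tau> \<xi> - U t \<xi>) \<xi> \<le> M \<xi> + M \<xi>" for \<tau>
  proof (rule AE_I2)
    fix \<xi>
    have "cn (\<lambda>\<xi>. U \<tau> \<xi> - U t \<xi>) \<xi> \<le> cn (U \<tau>) \<xi> + cn (U t) \<xi>"
      unfolding cn_def by (simp add: norm_triangle_ineq4 ennreal_leI flip: ennreal_plus)
    also have "\<dots> \<le> M \<xi> + M \<xi>" by (intro add_mono U_le)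
    finally show "cn (\<lambda>\<xi>. U \<tau> \<xi> - U t \<xi>) \<xi> \<le> M \<xi> + M \<xi>" .
  qed
  show "AE \<xi> in lborel. ((\<lambda>\<tau>. U \<tau> \<xi> - U t \<xi>) \<longlongrightarrow> 0) (at t within {-T..T})"
    using AE_Z
  proof eventually_elim
    case (elim \<xi>)
    then show ?case using U_continuous[OF elim] assms by (auto simp: continuous_on_def intro!: LIM_zero)
  qed
qed measurable

lemma V_cont_Hs:
  assumes "t \<in> {-T..T}"
  shows "((\<lambda>\<tau>. hsnorm (s - 1) (\<lambda>\<xi>. V \<tau> \<xi> - V t \<xi>)) \<longlongrightarrow> 0) (at t within {-T..T})"
proof (rule hsnorm_tendsto_0_within[OF _ bd_add[OF bd_Vm bd_Vm]])
  show "AE \<xi> in lborel. cn (\<lambda>\<xi>. V \<tau> \<xi> - V t \<xi>) \<xi> \<le> Vm \<xi> + Vm \<xi>" if "\<tau> \<in> {-T..T} - {t}" for \<tau>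
  proof (rule AE_I2)
    fix \<xi>
    have "cn (\<lambda>\<xi>. V \<tau> \<xi> - V t \<xi>) \<xi> \<le> cn (V \<tau>) \<xi> + cn (V t) \<xi>"
      unfolding cn_def by (simp add: norm_triangle_ineq4 ennreal_leI flip: ennreal_plus)
    also have "\<dots> \<le> Vm \<xi> + Vm \<xi>" using that assms by (intro add_mono V_le) auto
    finally show "cn (\<lambda>\<xi>. V \<tau> \<xi> - V t \<xi>) \<xi> \<le> Vm \<xi> + Vm \<xi>" .
  qed
  show "AE \<xi> in lborel. ((\<lambda>\<tau>. V \<tau> \<xi> - V t \<xi>) \<longlongrightarrow> 0) (at t within {-T..T})"
    using AE_Z
  proof eventually_elim
    case (elim \<xi>)
    have "continuous (at t within {-T..T}) (\<lambda>t. V t \<xi>)"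
      using V_deriv[OF elim assms] by (rule has_vector_derivative_continuous)
    then show ?case by (auto simp: continuous_within intro!: LIM_zero)
  qed
qed measurable

text \<open>By the mean value inequality in time at fixed frequency, the majorant of
  \<open>V\<close> also bounds the difference quotients of \<open>U\<close>, which gives domination
  by twice \<open>Vm\<close>.\<close>

lemma U_diff_Hs:
  assumes t: "t \<in> {-T..T}"
  shows "((\<lambda>\<tau>. hsnorm (s - 1) (\<lambda>\<xi>. (U \<tau> \<xi> - U t \<xi>) / complex_of_real (\<tau> - t) - V t \<xi>)) \<longlongrightarrow> 0) (at t within {-T..T})"
proof (rule hsnorm_tendsto_0_within[OF _ bd_add[OF bd_Vm bd_Vm]])
  have eq: "(U \<tau> \<xi> - U t \<xi>) / complex_of_real (\<tau> - t) = (1 / (\<tau> - t)) *\<^sub>R (U \<tau> \<xi> - U t \<xi>)" for \<tau> \<xi>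
    by (simp add: scaleR_conv_of_real)
  show "AE \<xi> in lborel. cn (\<lambda>\<xi>. (U \<tau> \<xi> - U t \<xi>) / complex_of_real (\<tau> - t) - V t \<xi>) \<xi> \<le> Vm \<xi> + Vm \<xi>"
    if \<tau>: "\<tau> \<in> {-T..T} - {t}" for \<tau>
    using AE_Z
  proof eventually_elim
    case (elim \<xi>)
    have q: "ennreal (cmod ((U \<tau> \<xi> - U t \<xi>) / complex_of_real (\<tau> - t))) \<le> Vm \<xi>"
    proof (cases "Vm \<xi> = top")
      case False
      then obtain v where v: "Vm \<xi> = ennreal v" "0 \<le> v" by (cases "Vm \<xi>") auto
      have "cmod (V x \<xi>) \<le> v" if "x \<in> {-T..T}" for x
        using V_le[OF that, of \<xi>] v by (simp add: cn_def)
      then have "cmod (U \<tau> \<xi> - U t \<xi>) \<le> v * \<bar>\<tau> - t\<bar>"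
        using U_deriv[OF elim] \<tau> t by (intro has_vector_derivative_norm_bound[where S="{-T..T}" and f="\<lambda>t. U t \<xi>"]) auto
      then have "cmod ((U \<tau> \<xi> - U t \<xi>) / complex_of_real (\<tau> - t)) \<le> v"
        using \<tau> by (simp add: norm_divide divide_le_eq flip: of_real_diff)
      then show ?thesis unfolding v by (rule ennreal_leI)
    qed simp
    have "cn (\<lambda>\<xi>. (U \<tau> \<xi> - U t \<xi>) / complex_of_real (\<tau> - t) - V t \<xi>) \<xi>
       \<le> ennreal (cmod ((U \<tau> \<xi> - U t \<xi>) / complex_of_real (\<tau> - t))) + cn (V t) \<xi>"
      unfolding cn_def by (simp add: norm_triangle_ineq4 ennreal_leI flip: ennreal_plus)
    also have "\<dots> \<le> Vm \<xi> + Vm \<xi>" by (intro add_mono q V_le t)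
    finally show ?case .
  qed
  show "AE \<xi> in lborel. ((\<lambda>\<tau>. (U \<tau> \<xi> - U t \<xi>) / complex_of_real (\<tau> - t) - V t \<xi>) \<longlongrightarrow> 0) (at t within {-T..T})"
    using AE_Z
  proof eventually_elim
    case (elim \<xi>)
    from U_deriv[OF elim t] show ?case
      unfolding has_vector_derivative_iff_quotient eq by (rule LIM_zero)
  qed
qed measurable

lemma U_initial: "hsnorm s (\<lambda>\<xi>. U 0 \<xi> - v0 \<xi>) = 0"
proof (rule hsnorm_eq_0)
  show "AE \<xi> in lborel. U 0 \<xi> - v0 \<xi> = 0"
    using AE_Z a0_AE by eventually_elim (use T in \<open>auto simp: U_eq_osc osc_0\<close>)
qed measurable

lemma V_initial: "hsnorm (s - 1) (\<lambda>\<xi>. V 0 \<xi> - v1 \<xi>) = 0"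
proof (rule hsnorm_eq_0)
  show "AE \<xi> in lborel. V 0 \<xi> - v1 \<xi> = 0"
    using AE_Z a1_AE by eventually_elim (auto simp: V_def osc'_0)
qed measurable

end

section \<open>The weak equation for the Picard limit\<close>

lemma bd_wt:
  assumes "2 * b - r > 1/2"
  shows "\<exists>C. bd r (\<lambda>x. ennreal (wt (- b) x)) C"
proof -
  have "(\<integral>\<^sup>+x. ennreal (wt r x) * (ennreal (wt (- b) x))\<^sup>2 \<partial>lborel) = (\<integral>\<^sup>+x. ennreal (wt (- (2 * b - r)) x) \<partial>lborel)"
    by (intro nn_integral_cong) (simp add: ennreal_power wt_power2 wt_add flip: ennreal_mult)
  also have "\<dots> < \<infinity>" by (rule nn_integral_wt_finite[OF assms])
  finally obtain c where c: "(\<integral>\<^sup>+x. ennreal (wt r x) * (ennreal (wt (- b) x))\<^sup>2 \<partial>lborel) = ennreal c" "0 \<le> c"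
    by (cases "\<integral>\<^sup>+x. ennreal (wt r x) * (ennreal (wt (- b) x))\<^sup>2 \<partial>lborel") auto
  then have "bd r (\<lambda>x. ennreal (wt (- b) x)) (sqrt c)" by (simp add: bd_def)
  then show ?thesis by blast
qed

text \<open>\<open>wave_sol\<close> integrates over the open interval, while continuity and the
  fundamental theorem live on the closed one.\<close>

lemma set_integral_Ioo_eq_Icc:
  fixes f :: "real \<Rightarrow> complex"
  assumes "set_integrable lborel {a..b} f"
  shows "(LBINT t:{a<..<b}. f t) = (LBINT t:{a..b}. f t)"
  unfolding set_lebesgue_integral_def
proof (rule integral_cong_AE)
  have m: "(\<lambda>t. indicator {a..b} t *\<^sub>R f t) \<in> borel_measurable lborel"
    using assms by (auto simp: set_integrable_def)
  then show "(\<lambda>t. indicator {a..b} t *\<^sub>R f t) \<in> borel_measurable lborel" .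
  have "(\<lambda>t. indicator {a<..<b} t *\<^sub>R (indicator {a..b} t *\<^sub>R f t)) \<in> borel_measurable lborel"
    by (intro borel_measurable_scaleR m) measurable
  also have "(\<lambda>t. indicator {a<..<b} t *\<^sub>R (indicator {a..b} t *\<^sub>R f t)) = (\<lambda>t. indicator {a<..<b} t *\<^sub>R f t)"
    by (auto simp: indicator_def fun_eq_iff)
  finally show "(\<lambda>t. indicator {a<..<b} t *\<^sub>R f t) \<in> borel_measurable lborel" .
  have "AE t in lborel. t \<noteq> a" "AE t in lborel. t \<noteq> b" by (rule AE_lborel_singleton)+
  then show "AE t in lborel. indicator {a<..<b} t *\<^sub>R f t = indicator {a..b} t *\<^sub>R f t"
    by eventually_elim (auto simp: indicator_def)
qed

section \<open>Test functions and their partial Fourier transforms\<close>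

locale test_fun =
  fixes \<phi> :: "real \<times> real \<Rightarrow> real" and D :: "nat \<Rightarrow> nat \<Rightarrow> real \<times> real \<Rightarrow> real" and T :: real
  assumes sf: "smooth_family \<phi> D" and ts: "test_support T \<phi>"
begin

abbreviation "supp \<equiv> closure {z. \<phi> z \<noteq> 0}"

lemma D_cont: "continuous_on A (D i j)"
  using sf unfolding smooth_family_def by (meson continuous_on_subset subset_UNIV)

lemma D_dx: "((\<lambda>y. D i j (y, t)) has_real_derivative D (Suc i) j (x, t)) (at x)"
  and D_dt: "((\<lambda>\<tau>. D i j (x, \<tau>)) has_real_derivative D i (Suc j) (x, t)) (at t)"
  using sf unfolding smooth_family_def by blast+

text \<open>The complement of the support is open, so on each axis-parallel line through one of its
  points the function vanishes nearby and its derivative is 0. The \<open>x\<close> derivatives are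
  treated before the mixed ones because differentiation is available in one variable at a
  time.\<close>

lemma D_zero: "z \<notin> supp \<Longrightarrow> D i j z = 0"
proof -
  have base: "D i 0 z = 0" if "z \<notin> supp" for i z
    using that
  proof (induction i arbitrary: z)
    case 0
    then have "\<phi> z = 0" using closure_subset[of "{z. \<phi> z \<noteq> 0}"] by auto
    then show ?case using sf by (simp add: smooth_family_def)
  next
    case (Suc i)
    obtain x t where z: "z = (x, t)" by (cases z)
    have "open ((\<lambda>y. (y, t)) -` (- supp))"
      by (intro open_vimage continuous_intros) auto
    then have "((\<lambda>_. 0) has_real_derivative D (Suc i) 0 (x, t)) (at x)"
      by (rule has_field_derivative_transform_within_open[OF D_dx]) (use Suc z in auto)
    then show ?case unfolding z by (rule DERIV_unique) simp
  qed
  assume "z \<notin> supp"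
  then show ?thesis
  proof (induction j arbitrary: z)
    case 0 then show ?case by (rule base)
  next
    case (Suc j)
    obtain x t where z: "z = (x, t)" by (cases z)
    have "open ((\<lambda>\<tau>. (x, \<tau>)) -` (- supp))"
      by (intro open_vimage continuous_intros) auto
    then have "((\<lambda>_. 0) has_real_derivative D i (Suc j) (x, t)) (at t)"
      by (rule has_field_derivative_transform_within_open[OF D_dt]) (use Suc z in auto)
    then show ?case unfolding z by (rule DERIV_unique) simp
  qed
qed

lemma D_edge: "T \<le> \<bar>t\<bar> \<Longrightarrow> D i j (x, t) = 0"
proof (rule D_zero)
  have "supp \<subseteq> UNIV \<times> {-T<..<T}" using ts by (simp add: test_support_def)
  then have "t \<in> {-T<..<T}" if "(x, t) \<in> supp" using that by blast
  moreover assume "T \<le> \<bar>t\<bar>"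
  ultimately show "(x, t) \<notin> supp" by auto
qed

lemma D_compact: "\<exists>a. \<forall>i j x t. a < \<bar>x\<bar> \<longrightarrow> D i j (x, t) = 0"
proof -
  have "bounded supp" using ts compact_imp_bounded by (auto simp: test_support_def)
  then obtain a where a: "\<And>z. z \<in> supp \<Longrightarrow> norm z \<le> a" by (auto simp: bounded_iff)
  have "D i j (x, t) = 0" if "a < \<bar>x\<bar>" for i j x t
  proof (rule D_zero)
    show "(x, t) \<notin> supp" using a[of "(x, t)"] that norm_fst_le[of x t] by auto
  qed
  then show ?thesis by blast
qed

lemma D_bounded: "\<exists>C\<ge>0. \<forall>z. \<bar>D i j z\<bar> \<le> C"
proof -
  have "compact (D i j ` supp)"
    using ts by (intro compact_continuous_image D_cont) (auto simp: test_support_def)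
  then obtain C where C: "\<forall>y\<in>D i j ` supp. norm y \<le> C" using compact_imp_bounded bounded_iff by blast
  have "\<bar>D i j z\<bar> \<le> max C 0" for z
    using C D_zero[of z i j] by (cases "z \<in> supp") (auto simp: le_max_iff_disj)
  then show ?thesis by (intro exI[of _ "max C 0"]) auto
qed

definition FD :: "nat \<Rightarrow> nat \<Rightarrow> real \<Rightarrow> real \<Rightarrow> complex" where
  "FD i j t \<xi> = ift (\<lambda>x. D i j (x, t)) \<xi>"

lemma FD_iftc: "FD i j t = iftc (\<lambda>x. complex_of_real (D i j (x, t)))"
  by (simp add: FD_def fun_eq_iff ift_eq_iftc)

lemma Dx_cont: "continuous_on A (\<lambda>x. complex_of_real (D i j (x, t)))"
  by (intro continuous_intros continuous_on_compose2[OF D_cont[of UNIV]]) auto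

lemma FD_Suc: "FD (Suc i) j t \<xi> = - (\<i> * complex_of_real (2 * pi * \<xi>)) * FD i j t \<xi>"
proof -
  obtain a where a: "\<And>i j x t. a < \<bar>x\<bar> \<Longrightarrow> D i j (x, t) = 0" using D_compact by blast
  show ?thesis unfolding FD_iftc
    by (rule iftc_deriv[OF of_real_vector_derivative[OF D_dx] Dx_cont, of a]) (simp add: a)
qed

lemma FD_2: "FD (Suc (Suc i)) j t \<xi> = - complex_of_real ((2 * pi * \<xi>)\<^sup>2) * FD i j t \<xi>"
proof -
  have "FD (Suc (Suc i)) j t \<xi> = (\<i> * \<i>) * (complex_of_real (2 * pi * \<xi>) * complex_of_real (2 * pi * \<xi>)) * FD i j t \<xi>"
    unfolding FD_Suc by (simp only: mult_minus_left mult_minus_right minus_minus ac_simps)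
  then show ?thesis by (simp add: power2_eq_square)
qed

lemma FD_integrable: "integrable lborel (\<lambda>x. complex_of_real (D i j (x, t)))"
proof -
  obtain a where a: "\<And>i j x t. a < \<bar>x\<bar> \<Longrightarrow> D i j (x, t) = 0" using D_compact by blast
  then show ?thesis by (intro compact_support_integrable[of _ a] Dx_cont) auto
qed

lemma FD_dt: "((\<lambda>t. FD i j t \<xi>) has_vector_derivative FD i (Suc j) t \<xi>) (at t)"
proof -
  obtain a where a: "\<And>i j x t. a < \<bar>x\<bar> \<Longrightarrow> D i j (x, t) = 0" using D_compact by blast
  obtain C where C: "C \<ge> 0" "\<And>z. \<bar>D i (Suc j) z\<bar> \<le> C" using D_bounded by blast
  show ?thesis unfolding FD_iftc iftc_def
  proof (rule has_vector_derivative_under_integral[where B="\<lambda>x. C * indicator {-a..a} x"])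
    show "((\<lambda>t. cis (2 * pi * x * \<xi>) * complex_of_real (D i j (x, t))) has_vector_derivative
        cis (2 * pi * x * \<xi>) * complex_of_real (D i (Suc j) (x, t))) (at t)" for x t
      by (intro has_vector_derivative_mult_right of_real_vector_derivative D_dt)
    show "integrable lborel (\<lambda>x. cis (2 * pi * x * \<xi>) * complex_of_real (D i j (x, t)))" for t
      by (rule integrable_cis_mult[OF FD_integrable]) measurable
    show "(\<lambda>x. cis (2 * pi * x * \<xi>) * complex_of_real (D i (Suc j) (x, t))) \<in> borel_measurable lborel" for t
      using integrable_cis_mult[OF FD_integrable, of "\<lambda>x. 2 * pi * x * \<xi>"] by auto
    show "integrable lborel (\<lambda>x. C * indicator {-a..a} x)"
      by (intro integrable_mult_right integrable_real_indicator) (auto simp: emeasure_lborel_Icc_eq)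
    show "norm (cis (2 * pi * x * \<xi>) * complex_of_real (D i (Suc j) (x, t))) \<le> C * indicator {-a..a} x" for t x
      using C(2)[of "(x, t)"] C(1) a[of x i "Suc j" t] by (cases "a < \<bar>x\<bar>") (auto simp: norm_mult abs_le_iff not_less)
  qed
qed

text \<open>Two derivatives in \<open>x\<close> yield the weight, and uniformity in time follows
  from common bounds on support and size. One factor \<open>wt (-1)\<close> is enough decay to pair
  with H^(s-1) when s > -1/2.\<close>

lemma FD_bound: "\<exists>C\<ge>0. \<forall>t \<xi>. cmod (FD i j t \<xi>) \<le> C * wt (-1) \<xi>"
proof -
  obtain a where a: "\<And>i j x t. a < \<bar>x\<bar> \<Longrightarrow> D i j (x, t) = 0" using D_compact by blast
  have bnd: "\<exists>B\<ge>0. \<forall>t \<xi>. cmod (FD i j t \<xi>) \<le> B" for i j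
  proof -
    obtain C where C: "C \<ge> 0" "\<And>z. \<bar>D i j z\<bar> \<le> C" using D_bounded by blast
    have "cmod (FD i j t \<xi>) \<le> (LINT x|lborel. C * indicator {-a..a} x)" for t \<xi>
    proof -
      have "cmod (FD i j t \<xi>) \<le> (LINT x|lborel. cmod (complex_of_real (D i j (x, t))))"
        unfolding FD_iftc by (rule iftc_bound[OF FD_integrable])
      also have "\<dots> \<le> (LINT x|lborel. C * indicator {-a..a} x)"
      proof (rule integral_mono)
        show "integrable lborel (\<lambda>x. cmod (complex_of_real (D i j (x, t))))"
          by (rule integrable_norm[OF FD_integrable])
        show "integrable lborel (\<lambda>x. C * indicator {-a..a} x)"
      by (intro integrable_mult_right integrable_real_indicator) (auto simp: emeasure_lborel_Icc_eq)
        show "cmod (complex_of_real (D i j (x, t))) \<le> C * indicator {-a..a} x" for x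
          using C(2)[of "(x, t)"] C(1) a[of x i j t] by (cases "a < \<bar>x\<bar>") (auto simp: abs_le_iff not_less)
      qed
      finally show ?thesis .
    qed
    moreover have "0 \<le> (LINT x|lborel. C * indicator {-a..a} x)" using C(1) by (intro Bochner_Integration.integral_nonneg) auto
    ultimately show ?thesis by blast
  qed
  obtain B where B: "B \<ge> 0" "\<And>t \<xi>. cmod (FD i j t \<xi>) \<le> B" using bnd by blast
  obtain B' where B': "B' \<ge> 0" "\<And>t \<xi>. cmod (FD (Suc (Suc i)) j t \<xi>) \<le> B'" using bnd by blast
  have "cmod (FD i j t \<xi>) \<le> (B + B') * wt (-1) \<xi>" for t \<xi>
  proof -
    have "(2 * pi * \<xi>)\<^sup>2 * cmod (FD i j t \<xi>) \<le> B'"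
      using B'(2)[of t \<xi>] unfolding FD_2 norm_mult norm_minus_cancel norm_of_real by simp
    moreover have "\<xi>\<^sup>2 \<le> (2 * pi * \<xi>)\<^sup>2"
    proof -
      have "1 \<le> (2 * pi)\<^sup>2" using pi_ge_two by (intro one_le_power) simp
      then show ?thesis using mult_right_mono[of 1 "(2 * pi)\<^sup>2" "\<xi>\<^sup>2"] by (simp add: power_mult_distrib)
    qed
    then have "\<xi>\<^sup>2 * cmod (FD i j t \<xi>) \<le> (2 * pi * \<xi>)\<^sup>2 * cmod (FD i j t \<xi>)" by (rule mult_right_mono) simp
    ultimately have "(1 + \<xi>\<^sup>2) * cmod (FD i j t \<xi>) \<le> B + B'"
      using B(2)[of t \<xi>] unfolding distrib_right by linarith
    moreover have "wt (-1) \<xi> = 1 / (1 + \<xi>\<^sup>2)"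
      using one_plus_square_pos[of \<xi>] by (simp add: wt_def powr_minus_divide)
    moreover from calculation(1) have "cmod (FD i j t \<xi>) \<le> (B + B') / (1 + \<xi>\<^sup>2)"
      using one_plus_square_pos[of \<xi>] by (simp add: pos_le_divide_eq mult.commute)
    ultimately show ?thesis by simp
  qed
  then show ?thesis using B(1) B'(1) by (intro exI[of _ "B + B'"]) auto
qed

lemma FD_measurable_pair: "case_prod (FD i j) \<in> borel_measurable (borel \<Otimes>\<^sub>M borel)"
proof -
  have "D i j \<in> borel_measurable borel" by (rule borel_measurable_continuous_onI[OF D_cont])
  then have D: "D i j \<in> borel_measurable (borel \<Otimes>\<^sub>M borel)" by (simp add: borel_prod)
  have "(\<lambda>z. D i j (snd z, fst (fst z))) \<in> borel_measurable ((borel \<Otimes>\<^sub>M borel) \<Otimes>\<^sub>M lborel)"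
    by (rule measurable_compose[OF _ D]) measurable
  from measurable_compose[OF this borel_measurable_of_real]
  have "(\<lambda>z. cis (2 * pi * snd z * snd (fst z)) * complex_of_real (D i j (snd z, fst (fst z)))) \<in> borel_measurable ((borel \<Otimes>\<^sub>M borel) \<Otimes>\<^sub>M lborel)"
    by (rule borel_measurable_times[rotated]) measurable
  then have "(\<lambda>z. LINT x|lborel. cis (2 * pi * x * snd z) * complex_of_real (D i j (x, fst z))) \<in> borel_measurable (borel \<Otimes>\<^sub>M borel)"
    by (intro lborel.borel_measurable_lebesgue_integral) (simp only: case_prod_beta')
  then show ?thesis unfolding FD_iftc iftc_def case_prod_beta' .
qed

lemma FD_edge: "T \<le> \<bar>t\<bar> \<Longrightarrow> FD i j t \<xi> = 0"
  by (simp add: FD_iftc iftc_def D_edge)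

end

section \<open>Exchange of integrals and the weak equation\<close>

context picard
begin

text \<open>Fubini with a product majorant: the indicator in time, and in frequency \<open>m\<close>
  times \<open>wt (-1)\<close>, integrable by duality. Since \<open>enn2real\<close> sends infinity
  to 0, \<open>F\<close> is required to vanish where \<open>m\<close> is infinite.\<close>

lemma weak_integrable:
  assumes F: "case_prod F \<in> borel_measurable (borel \<Otimes>\<^sub>M borel)" and G: "case_prod G \<in> borel_measurable (borel \<Otimes>\<^sub>M borel)"
    and m: "bd r m B" "\<And>t \<xi>. cn (F t) \<xi> \<le> m \<xi>" and fin: "\<And>t \<xi>. m \<xi> = \<infinity> \<Longrightarrow> F t \<xi> = 0"
    and C: "0 \<le> C" "\<And>t \<xi>. cmod (G t \<xi>) \<le> C * wt (-1) \<xi>" and r: "2 + r > 1/2"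
  shows "(LBINT t:{-T<..<T}. (LINT \<xi>|lborel. F t \<xi> * G t \<xi>)) = (LINT \<xi>|lborel. (LBINT t:{-T<..<T}. F t \<xi> * G t \<xi>))"
proof -
  note [measurable] = bd_measurable[OF m(1)]
  obtain E where E: "bd (-r) (\<lambda>x. ennreal (wt (-1) x)) E" using bd_wt[of 1 "-r"] r by auto
  have "(\<integral>\<^sup>+\<xi>. ennreal (norm (enn2real (m \<xi>) * wt (-1) \<xi>)) \<partial>lborel) \<le> (\<integral>\<^sup>+\<xi>. m \<xi> * ennreal (wt (-1) \<xi>) \<partial>lborel)"
    by (intro nn_integral_mono) (auto simp: ennreal_mult ennreal_enn2real_if intro!: mult_right_mono)
  also have "\<dots> \<le> ennreal (B * E)" by (rule bd_pairing[OF m(1) E])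
  finally have i: "integrable lborel (\<lambda>\<xi>. enn2real (m \<xi>) * wt (-1) \<xi>)"
    by (intro integrableI_bounded) (auto intro: order_le_less_trans)
  define h where "h t \<xi> = indicator {-T<..<T} t *\<^sub>R (F t \<xi> * G t \<xi>)" for t \<xi>
  have hm: "case_prod h \<in> borel_measurable (borel \<Otimes>\<^sub>M borel)"
    using F G unfolding h_def case_prod_beta'
    by (intro borel_measurable_scaleR borel_measurable_times) measurable
  have hle: "cmod (h t \<xi>) \<le> indicator {-T<..<T} t * (C * (enn2real (m \<xi>) * wt (-1) \<xi>))" for t \<xi>
  proof -
    have "cmod (F t \<xi>) \<le> enn2real (m \<xi>)"
    proof (cases "m \<xi> = \<infinity>")
      case False
      then have "ennreal (cmod (F t \<xi>)) \<le> ennreal (enn2real (m \<xi>))"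
        using m(2)[of t \<xi>] by (simp add: cn_def ennreal_enn2real_if)
      then show ?thesis by simp
    qed (simp add: fin)
    then have "cmod (F t \<xi>) * cmod (G t \<xi>) \<le> enn2real (m \<xi>) * (C * wt (-1) \<xi>)"
      by (intro mult_mono C) auto
    then show ?thesis by (auto simp: h_def indicator_def norm_mult ac_simps)
  qed
  have "(LINT \<xi>|lborel. LINT t|lborel. h t \<xi>) = (LINT t|lborel. LINT \<xi>|lborel. h t \<xi>)"
    by (rule Fubini_dominated[OF hm _ _ hle])
       (use i T in \<open>auto intro!: integrable_real_indicator\<close>)
  then show ?thesis by (simp add: h_def set_lebesgue_integral_def)
qed

lemma weak_equation:
  assumes s: "s > -1/2" and sf: "smooth_family \<phi> D" and ts: "test_support T \<phi>"
  shows "(LBINT t:{-T<..<T}. (LINT \<xi>|lborel. U t \<xi> * ift (\<lambda>x. D 0 2 (x, t) - D 2 0 (x, t)) \<xi>))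
      = complex_of_real \<sigma> * (LBINT t:{-T<..<T}. (LINT \<xi>|lborel. conv_power (U t) q \<xi> * ift (\<lambda>x. \<phi> (x, t)) \<xi>))"
proof -
  interpret test_fun \<phi> D T using sf ts by unfold_locales
  have two: "2 = Suc (Suc 0)" by simp
  have \<phi>: "ift (\<lambda>x. \<phi> (x, t)) = FD 0 0 t" for t
    using sf by (simp add: FD_def fun_eq_iff smooth_family_def)
  have ift2: "ift (\<lambda>x. D 0 2 (x, t) - D 2 0 (x, t)) \<xi> = FD 0 2 t \<xi> - FD 2 0 t \<xi>" for t \<xi>
    unfolding FD_iftc ift_eq_iftc iftc_def of_real_diff right_diff_distrib
    by (intro Bochner_Integration.integral_diff integrable_cis_mult FD_integrable) measurable
  define G where "G t \<xi> = FD 0 2 t \<xi> - FD 2 0 t \<xi>" for t \<xi>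
  obtain C1 where C1: "C1 \<ge> 0" "\<And>t \<xi>. cmod (FD 0 2 t \<xi>) \<le> C1 * wt (-1) \<xi>" using FD_bound by blast
  obtain C2 where C2: "C2 \<ge> 0" "\<And>t \<xi>. cmod (FD 2 0 t \<xi>) \<le> C2 * wt (-1) \<xi>" using FD_bound by blast
  obtain C0 where C0: "C0 \<ge> 0" "\<And>t \<xi>. cmod (FD 0 0 t \<xi>) \<le> C0 * wt (-1) \<xi>" using FD_bound by blast
  have Gm: "case_prod G \<in> borel_measurable (borel \<Otimes>\<^sub>M borel)"
    using FD_measurable_pair[of 0 2] FD_measurable_pair[of 2 0] unfolding G_def case_prod_beta'
    by (rule borel_measurable_diff)
  have Gle: "cmod (G t \<xi>) \<le> (C1 + C2) * wt (-1) \<xi>" for t \<xi>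
    unfolding G_def using norm_triangle_ineq4[of "FD 0 2 t \<xi>" "FD 2 0 t \<xi>"] C1(2)[of t \<xi>] C2(2)[of t \<xi>]
    by (simp add: distrib_right)
  have A: "(LBINT t:{-T<..<T}. (LINT \<xi>|lborel. U t \<xi> * G t \<xi>)) = (LINT \<xi>|lborel. (LBINT t:{-T<..<T}. U t \<xi> * G t \<xi>))"
    by (rule weak_integrable[OF U_measurable_pair Gm bd_M U_le _ _ Gle])
       (use s C1 C2 in \<open>auto simp: U_def Z_def\<close>)
  \<comment> \<open>Setting the nonlinearity to 0 off \<open>Z\<close> meets the vanishing condition
    of \<open>weak_integrable\<close>; at each time only a null set of frequencies changes, so all
    pairings are the same.\<close>
  define N' where "N' t \<xi> = (if \<xi> \<in> Z then N t \<xi> else 0)" for t \<xi>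
  have N'm: "case_prod N' \<in> borel_measurable (borel \<Otimes>\<^sub>M borel)"
    unfolding N'_def case_prod_beta' using N_measurable_pair[unfolded case_prod_beta']
    by (rule measurable_If) (simp, measurable)
  have B: "(LBINT t:{-T<..<T}. (LINT \<xi>|lborel. N' t \<xi> * FD 0 0 t \<xi>)) = (LINT \<xi>|lborel. (LBINT t:{-T<..<T}. N' t \<xi> * FD 0 0 t \<xi>))"
    by (rule weak_integrable[OF N'm FD_measurable_pair bd_N _ _ C0])
       (use s N_le in \<open>auto simp: N'_def Z_def cn_def\<close>)
  have NN': "(LINT \<xi>|lborel. N t \<xi> * FD 0 0 t \<xi>) = (LINT \<xi>|lborel. N' t \<xi> * FD 0 0 t \<xi>)" for t
  proof (rule integral_cong_AE)
    have f: "FD 0 0 t \<in> borel_measurable borel"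
      by (rule measurable_pair_compose[OF FD_measurable_pair, where f="\<lambda>_. t" and g="\<lambda>x. x"]) measurable
    have n: "N' t \<in> borel_measurable borel"
      by (rule measurable_pair_compose[OF N'm, where f="\<lambda>_. t" and g="\<lambda>x. x"]) measurable
    show "(\<lambda>\<xi>. N t \<xi> * FD 0 0 t \<xi>) \<in> borel_measurable lborel" "(\<lambda>\<xi>. N' t \<xi> * FD 0 0 t \<xi>) \<in> borel_measurable lborel"
      using f n by (auto intro!: borel_measurable_times)
    show "AE \<xi> in lborel. N t \<xi> * FD 0 0 t \<xi> = N' t \<xi> * FD 0 0 t \<xi>"
      using AE_Z by eventually_elim (simp add: N'_def)
  qed
  have inner: "(LBINT t:{-T<..<T}. U t \<xi> * G t \<xi>) = complex_of_real \<sigma> * (LBINT t:{-T<..<T}. N' t \<xi> * FD 0 0 t \<xi>)" for \<xi>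
  proof (cases "\<xi> \<in> Z")
    case True
    let ?w = "complex_of_real ((2 * pi * \<xi>)\<^sup>2)"
    have cF: "continuous_on {-T..T} (\<lambda>t. FD i j t \<xi>)" for i j
      by (intro continuous_at_imp_continuous_on ballI has_vector_derivative_continuous[OF FD_dt])
    \<comment> \<open>The derivative of \<open>U * FD 0 1 - V * FD 0 0\<close> in time. The two
      terms with \<open>V\<close> cancel, and \<open>FD_2\<close> turns the term with
      \<open>U\<close> into the spatial derivative in \<open>G\<close>.\<close>
    let ?g = "\<lambda>t. U t \<xi> * FD 0 2 t \<xi> + V t \<xi> * FD 0 1 t \<xi>
        - (V t \<xi> * FD 0 1 t \<xi> + (- ?w * U t \<xi> + complex_of_real \<sigma> * N t \<xi>) * FD 0 0 t \<xi>)"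
    have geq: "?g t = U t \<xi> * G t \<xi> - complex_of_real \<sigma> * (N' t \<xi> * FD 0 0 t \<xi>)" for t
    proof -
      have "FD 2 0 t \<xi> = - ?w * FD 0 0 t \<xi>" by (rule FD_2[of 0 0 t \<xi>, folded two])
      then show ?thesis using True by (simp add: G_def N'_def algebra_simps)
    qed
    have cg: "continuous_on {-T..T} ?g"
    proof -
      have "continuous_on {-T..T} (\<lambda>t. V t \<xi>)"
        using V_deriv[OF True] by (meson continuous_on_eq_continuous_within has_vector_derivative_continuous)
      then show ?thesis by (intro continuous_intros cF U_continuous[OF True] N_continuous[OF True])
    qed
    have "(LINT t|lborel. indicator {-T..T} t *\<^sub>R ?g t)
        = (U T \<xi> * FD 0 1 T \<xi> - V T \<xi> * FD 0 0 T \<xi>) - (U (-T) \<xi> * FD 0 1 (-T) \<xi> - V (-T) \<xi> * FD 0 0 (-T) \<xi>)"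
    proof (rule integral_FTC_Icc[OF _ _ cg])
      fix t assume "-T \<le> t" "t \<le> T"
      then have t: "t \<in> {-T..T}" by simp
      have F: "((\<lambda>t. FD 0 0 t \<xi>) has_vector_derivative FD 0 1 t \<xi>) (at t within {-T..T})"
        "((\<lambda>t. FD 0 1 t \<xi>) has_vector_derivative FD 0 2 t \<xi>) (at t within {-T..T})"
        using FD_dt[of 0 0 \<xi> t] FD_dt[of 0 1 \<xi> t] by (auto simp: numeral_2_eq_2 intro: has_vector_derivative_at_within)
      show "((\<lambda>t. U t \<xi> * FD 0 1 t \<xi> - V t \<xi> * FD 0 0 t \<xi>) has_vector_derivative ?g t) (at t within {-T..T})"
        by (intro has_vector_derivative_diff has_vector_derivative_mult U_deriv[OF True t] V_deriv[OF True t] F)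
    qed (use T in auto)
    also have "\<dots> = 0" using T by (simp add: FD_edge)
    finally have 0: "(LINT t|lborel. indicator {-T..T} t *\<^sub>R ?g t) = 0" .
    have si: "set_integrable lborel {-T..T} (\<lambda>t. U t \<xi> * G t \<xi>)" "set_integrable lborel {-T..T} (\<lambda>t. N' t \<xi> * FD 0 0 t \<xi>)"
      using True unfolding G_def N'_def
      by (auto intro!: borel_integrable_atLeastAtMost' continuous_intros cF U_continuous N_continuous)
    have "(LBINT t:{-T..T}. U t \<xi> * G t \<xi>) - complex_of_real \<sigma> * (LBINT t:{-T..T}. N' t \<xi> * FD 0 0 t \<xi>)
      = (LBINT t:{-T..T}. U t \<xi> * G t \<xi> - complex_of_real \<sigma> * (N' t \<xi> * FD 0 0 t \<xi>))"
      using si by (simp add: set_integral_diff(2) set_integrable_mult_right)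
    also have "\<dots> = 0" using 0 unfolding geq set_lebesgue_integral_def .
    finally show ?thesis by (simp add: set_integral_Ioo_eq_Icc si)
  qed (simp add: U_def N'_def)
  have "(LBINT t:{-T<..<T}. (LINT \<xi>|lborel. U t \<xi> * ift (\<lambda>x. D 0 2 (x, t) - D 2 0 (x, t)) \<xi>))
     = (LINT \<xi>|lborel. complex_of_real \<sigma> * (LBINT t:{-T<..<T}. N' t \<xi> * FD 0 0 t \<xi>))"
    unfolding ift2 G_def[symmetric] A inner ..
  also have "\<dots> = complex_of_real \<sigma> * (LBINT t:{-T<..<T}. (LINT \<xi>|lborel. N' t \<xi> * FD 0 0 t \<xi>))"
    unfolding B by simp
  finally show ?thesis unfolding \<phi> N_def[symmetric] NN' .
qed

lemma picard_wave_sol: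
  assumes "s > -1/2"
  shows "wave_sol \<Gamma> (Suc q) \<sigma> s T v0 v1 U V"
  unfolding wave_sol_def
  using U_in_Hs V_in_Hs U_cont_Hs V_cont_Hs U_diff_Hs U_initial V_initial weak_equation[OF assms] by simp

end

section \<open>Duality pairing and the du Bois-Reymond lemma\<close>

lemma nonlinear_estimates:
  assumes \<Gamma>: "half_line \<Gamma>" and q: "1 \<le> q" and s: "s > 1/2 - 1 / real q"
  shows "\<exists>K\<ge>1. (\<forall>f B. bd s f B \<longrightarrow> supp_in \<Gamma> f \<longrightarrow> bd (s - 1) (npow f q) (K * B ^ Suc q))
    \<and> (\<forall>F G R. F \<in> Hs s \<Gamma> \<longrightarrow> G \<in> Hs s \<Gamma> \<longrightarrow> hsnorm s F \<le> R \<longrightarrow> hsnorm s G \<le> R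
        \<longrightarrow> hsnorm (s - 1) (\<lambda>x. conv_power F q x - conv_power G q x) \<le> K * R ^ q * hsnorm s (\<lambda>x. F x - G x))"
proof -
  \<comment> \<open>With this choice 2 a q = 1: the \<open>q\<close> convolutions together cost
    exactly the derivative between H^s and H^(s-1).\<close>
  define a where "a = 1 / (2 * real q)"
  have a: "0 \<le> a" "s + 2 * a > 1/2" using q s by (auto simp: a_def field_simps)
  have sa: "s - 2 * a * real q = s - 1" using q by (simp add: a_def)
  from npow_ctrl[OF \<Gamma> a, of q] obtain K1 where K1: "K1 \<ge> 1"
    "\<And>f B. bd s f B \<Longrightarrow> supp_in \<Gamma> f \<Longrightarrow> ctrl \<Gamma> s a q (npow f q) (K1 * B ^ Suc q)" by blast
  from conv_power_diff_ctrl[OF \<Gamma> a, of q] obtain K2 where K2: "K2 \<ge> 1"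
    "\<And>F G R d. F \<in> borel_measurable borel \<Longrightarrow> G \<in> borel_measurable borel
    \<Longrightarrow> supp_in \<Gamma> (cn F) \<Longrightarrow> supp_in \<Gamma> (cn G) \<Longrightarrow> bd s (cn F) R \<Longrightarrow> bd s (cn G) R
    \<Longrightarrow> bd s (cn (\<lambda>x. F x - G x)) d
    \<Longrightarrow> ctrl \<Gamma> s a q (cn (\<lambda>x. conv_power F q x - conv_power G q x)) (K2 * R ^ q * d)" by blast
  have "bd (s - 1) (npow f q) (max K1 K2 * B ^ Suc q)" if f: "bd s f B" "supp_in \<Gamma> f" for f B
  proof -
    have 1: "bd (s - 1) (npow f q) (K1 * B ^ Suc q)" using K1(2)[OF f] by (simp only: ctrl_def sa)
    have "K1 * B ^ Suc q \<le> max K1 K2 * B ^ Suc q"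
      using bd_nonneg[OF f(1)] by (intro mult_right_mono zero_le_power) auto
    then show ?thesis by (intro bd_mono[OF 1 bd_measurable[OF 1]]) auto
  qed
  moreover have "hsnorm (s - 1) (\<lambda>x. conv_power F q x - conv_power G q x) \<le> max K1 K2 * R ^ q * hsnorm s (\<lambda>x. F x - G x)"
    if F: "F \<in> Hs s \<Gamma>" and G: "G \<in> Hs s \<Gamma>" and R: "hsnorm s F \<le> R" "hsnorm s G \<le> R" for F G R
  proof -
    note [measurable] = Hs_measurable[OF F] Hs_measurable[OF G]
    have "ctrl \<Gamma> s a q (cn (\<lambda>x. conv_power F q x - conv_power G q x)) (K2 * R ^ q * hsnorm s (\<lambda>x. F x - G x))"
      using R by (intro K2(2) Hs_supp[OF F] Hs_supp[OF G] bd_hsnorm[OF Hs_diff[OF F G]])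
        (auto simp: hsnorm_le_iff_bd[OF F] hsnorm_le_iff_bd[OF G])
    then have "hsnorm (s - 1) (\<lambda>x. conv_power F q x - conv_power G q x) \<le> K2 * R ^ q * hsnorm s (\<lambda>x. F x - G x)"
      by (intro hsnorm_le) (auto simp: ctrl_def sa)
    also have "\<dots> \<le> max K1 K2 * R ^ q * hsnorm s (\<lambda>x. F x - G x)"
      using order_trans[OF hsnorm_nonneg R(1)] by (intro mult_right_mono zero_le_power) auto
    finally show ?thesis .
  qed
  ultimately show ?thesis using K1(1) by (intro exI[of _ "max K1 K2"]) auto
qed

definition pr :: "(real \<Rightarrow> complex) \<Rightarrow> (real \<Rightarrow> complex) \<Rightarrow> complex" where
  "pr F g = (LINT \<xi>|lborel. F \<xi> * g \<xi>)"

lemma pr_le: "F \<in> Hs r \<Gamma> \<Longrightarrow> g \<in> Hs (-r) \<Delta> \<Longrightarrow> cmod (pr F g) \<le> hsnorm r F * hsnorm (-r) g"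
  unfolding pr_def by (rule pairing_le)

lemma pr_diff_left:
  "F \<in> Hs r \<Gamma> \<Longrightarrow> G \<in> Hs r \<Gamma> \<Longrightarrow> g \<in> Hs (-r) \<Delta> \<Longrightarrow> pr (\<lambda>\<xi>. F \<xi> - G \<xi>) g = pr F g - pr G g"
  unfolding pr_def left_diff_distrib by (intro Bochner_Integration.integral_diff pairing_integrable)

lemma pr_diff_right:
  "F \<in> Hs r \<Gamma> \<Longrightarrow> g \<in> Hs (-r) \<Delta> \<Longrightarrow> h \<in> Hs (-r) \<Delta> \<Longrightarrow> pr F (\<lambda>\<xi>. g \<xi> - h \<xi>) = pr F g - pr F h"
  unfolding pr_def right_diff_distrib by (intro Bochner_Integration.integral_diff pairing_integrable)

lemma pr_add_right:
  "F \<in> Hs r \<Gamma> \<Longrightarrow> g \<in> Hs (-r) \<Delta> \<Longrightarrow> h \<in> Hs (-r) \<Delta> \<Longrightarrow> pr F (\<lambda>\<xi>. g \<xi> + h \<xi>) = pr F g + pr F h"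
  unfolding pr_def distrib_left by (intro Bochner_Integration.integral_add pairing_integrable)

lemma pr_cmult_left: "pr (\<lambda>\<xi>. c * F \<xi>) g = c * pr F g"
  unfolding pr_def by (simp add: mult.assoc)

lemma pr_cmult_right: "pr F (\<lambda>\<xi>. c * g \<xi>) = c * pr F g"
  unfolding pr_def by (simp add: mult.left_commute)

lemma pr_continuous:
  assumes W: "\<And>t. t \<in> S \<Longrightarrow> W t \<in> Hs r \<Gamma>"
    and c: "\<And>t. t \<in> S \<Longrightarrow> ((\<lambda>\<tau>. hsnorm r (\<lambda>\<xi>. W \<tau> \<xi> - W t \<xi>)) \<longlongrightarrow> 0) (at t within S)"
    and g: "g \<in> Hs (-r) \<Delta>"
  shows "continuous_on S (\<lambda>t. pr (W t) g)"
  unfolding continuous_on_def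
proof
  fix t assume t: "t \<in> S"
  have "((\<lambda>\<tau>. pr (W \<tau>) g - pr (W t) g) \<longlongrightarrow> 0) (at t within S)"
  proof (rule Lim_null_comparison)
    show "\<forall>\<^sub>F \<tau> in at t within S. cmod (pr (W \<tau>) g - pr (W t) g) \<le> hsnorm r (\<lambda>\<xi>. W \<tau> \<xi> - W t \<xi>) * hsnorm (-r) g"
      unfolding eventually_at_filter
    proof (intro always_eventually allI impI)
      fix \<tau> assume "\<tau> \<in> S"
      then show "cmod (pr (W \<tau>) g - pr (W t) g) \<le> hsnorm r (\<lambda>\<xi>. W \<tau> \<xi> - W t \<xi>) * hsnorm (-r) g"
        using pr_le[OF Hs_diff[OF W W] g, of \<tau> t] t by (simp add: pr_diff_left[OF W W g])
    qed
    show "((\<lambda>\<tau>. hsnorm r (\<lambda>\<xi>. W \<tau> \<xi> - W t \<xi>) * hsnorm (-r) g) \<longlongrightarrow> 0) (at t within S)"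
      using tendsto_mult_right[OF c[OF t], of "hsnorm (-r) g"] by simp
  qed
  then show "((\<lambda>\<tau>. pr (W \<tau>) g) \<longlongrightarrow> pr (W t) g) (at t within S)" by (rule LIM_zero_cancel)
qed

lemma hsnorm_continuous:
  assumes W: "\<And>t. t \<in> S \<Longrightarrow> W t \<in> Hs r \<Gamma>"
    and c: "\<And>t. t \<in> S \<Longrightarrow> ((\<lambda>\<tau>. hsnorm r (\<lambda>\<xi>. W \<tau> \<xi> - W t \<xi>)) \<longlongrightarrow> 0) (at t within S)"
  shows "continuous_on S (\<lambda>t. hsnorm r (W t))"
  unfolding continuous_on_def
proof
  fix t assume t: "t \<in> S"
  have "((\<lambda>\<tau>. hsnorm r (W \<tau>) - hsnorm r (W t)) \<longlongrightarrow> 0) (at t within S)"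
  proof (rule Lim_null_comparison[OF _ c[OF t]])
    show "\<forall>\<^sub>F \<tau> in at t within S. norm (hsnorm r (W \<tau>) - hsnorm r (W t)) \<le> hsnorm r (\<lambda>\<xi>. W \<tau> \<xi> - W t \<xi>)"
      unfolding eventually_at_filter
      using hsnorm_abs_diff_le[OF W W, of _ t] t by (auto intro!: always_eventually)
  qed
  then show "((\<lambda>\<tau>. hsnorm r (W \<tau>)) \<longlongrightarrow> hsnorm r (W t)) (at t within S)" by (rule LIM_zero_cancel)
qed

section \<open>Weak derivatives in time\<close>

definition time_test :: "real \<Rightarrow> (nat \<Rightarrow> real \<Rightarrow> real) \<Rightarrow> bool" where
  "time_test T \<theta> \<longleftrightarrow> smooth1 \<theta> \<and> (\<exists>T'<T. \<forall>n t. T' < \<bar>t\<bar> \<longrightarrow> \<theta> n t = 0)"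

lemma smooth1_diff: "smooth1 F \<Longrightarrow> smooth1 G \<Longrightarrow> smooth1 (\<lambda>n x. F n x - G n x)"
  unfolding smooth1_def by (auto intro!: has_vector_derivative_diff)

lemma has_vector_derivative_within_Icc_interior:
  assumes "(f has_vector_derivative D) (at x within {a..b})" "a < x" "x < (b::real)"
  shows "(f has_vector_derivative D) (at x)"
  using assms at_within_interior[of x "{a..b}"] by simp

text \<open>The primitive is constant on either side of the bump, so the difference of two
  translates has compact support while its derivative is a difference of two bumps. Such differences
  are the test functions in \<open>du_Bois_Reymond\<close>.\<close>

lemma bump_primitive:
  fixes \<beta> :: "nat \<Rightarrow> real \<Rightarrow> real"
  assumes \<beta>: "smooth1 \<beta>" and z: "\<And>n x. 1 \<le> \<bar>x\<bar> \<Longrightarrow> \<beta> n x = 0"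
  shows "\<exists>P. smooth1 P \<and> (\<forall>n. P (Suc n) = \<beta> n) \<and> (\<forall>x\<ge>1. P 0 x = P 0 1) \<and> (\<forall>x\<le>-1. P 0 x = P 0 (-1))"
proof -
  let ?b = "\<lambda>x. complex_of_real (\<beta> 0 x)"
  define Q where "Q x = (LINT \<tau>|lborel. complex_of_real (kern x \<tau>) * ?b \<tau>)" for x
  have cb: "continuous_on A ?b" for A
    by (intro continuous_intros smooth1_continuous[OF \<beta>])
  then have [measurable]: "?b \<in> borel_measurable borel" by (intro borel_measurable_continuous_onI)
  have dQ: "(Q has_vector_derivative ?b x) (at x)" for x
  proof -
    have "(Q has_vector_derivative ?b x) (at x within {-(\<bar>x\<bar> + 1)..\<bar>x\<bar> + 1})"
      unfolding Q_def[abs_def] by (rule kern_integral_deriv) (use cb in auto)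
    then show ?thesis by (rule has_vector_derivative_within_Icc_interior) auto
  qed
  define P where "P n = (case n of 0 \<Rightarrow> (\<lambda>x. Re (Q x)) | Suc m \<Rightarrow> \<beta> m)" for n
  have "(P n has_vector_derivative P (Suc n) x) (at x)" for n x
  proof (cases n)
    case 0
    have "((\<lambda>x. Re (Q x)) has_vector_derivative Re (?b x)) (at x)"
      using bounded_linear.has_vector_derivative[OF bounded_linear_Re dQ] .
    then show ?thesis by (simp add: P_def 0)
  next
    case (Suc m)
    then show ?thesis using \<beta> by (simp add: P_def smooth1_def)
  qed
  then have P: "smooth1 P" by (simp add: smooth1_def)
  have const: "P 0 x = P 0 y" if "x \<le> y" "\<And>u. x \<le> u \<Longrightarrow> u \<le> y \<Longrightarrow> 1 \<le> \<bar>u\<bar>" for x y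
  proof -
    have "norm (P 0 x - P 0 y) \<le> 0 * \<bar>x - y\<bar>"
    proof (rule has_vector_derivative_norm_bound[of "{x..y}" _ "P 1"])
      fix u assume "u \<in> {x..y}"
      then show "norm (P 1 u) \<le> 0" using that z[of u 0] by (simp add: P_def)
      show "(P 0 has_vector_derivative P 1 u) (at u within {x..y})"
        using P unfolding smooth1_def by (metis One_nat_def has_vector_derivative_at_within)
    qed (use that in auto)
    then show ?thesis by simp
  qed
  have c1: "P 0 x = P 0 1" if "x \<ge> 1" for x
    by (rule const[of 1 x, symmetric]) (use that in linarith)+
  have c2: "P 0 x = P 0 (-1)" if "x \<le> -1" for x
    by (rule const[of x "-1"]) (use that in linarith)+
  have PS: "P (Suc n) = \<beta> n" for n by (simp add: P_def)
  show ?thesis by (intro exI[of _ P] conjI allI impI P PS c1 c2)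
qed

lemma vector_derivative_imp_continuous_on:
  assumes "\<And>t. t \<in> S \<Longrightarrow> (f has_vector_derivative f' t) (at t within S)"
  shows "continuous_on S f"
  unfolding continuous_on_eq_continuous_within
  using assms has_vector_derivative_continuous by blast

lemma mollify_limit:
  fixes c :: "real \<Rightarrow> complex" and \<beta> :: "real \<Rightarrow> real"
  assumes b: "continuous_on UNIV \<beta>" "\<And>x. 1 \<le> \<bar>x\<bar> \<Longrightarrow> \<beta> x = 0"
    and c: "continuous_on UNIV c" "\<And>x. cmod (c x) \<le> B" and e: "e \<longlonglongrightarrow> 0"
  shows "(\<lambda>n. LINT z|lborel. complex_of_real (\<beta> z) * c (t + e n * z)) \<longlonglongrightarrow> (LINT z|lborel. complex_of_real (\<beta> z)) * c t"
proof -
  have ib: "integrable lborel (\<lambda>z. complex_of_real (\<beta> z))"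
    by (rule compact_support_integrable[of _ 1]) (auto intro!: continuous_intros b)
  have [measurable]: "c \<in> borel_measurable borel" "\<beta> \<in> borel_measurable borel"
    using b c by (auto intro: borel_measurable_continuous_onI)
  have "(\<lambda>n. LINT z|lborel. complex_of_real (\<beta> z) * c (t + e n * z)) \<longlonglongrightarrow> (LINT z|lborel. complex_of_real (\<beta> z) * c t)"
  proof (rule integral_dominated_convergence[where w="\<lambda>z. cmod (complex_of_real (\<beta> z)) * B"])
    show "integrable lborel (\<lambda>z. cmod (complex_of_real (\<beta> z)) * B)"
      by (intro integrable_mult_left integrable_norm ib)
    show "AE z in lborel. (\<lambda>n. complex_of_real (\<beta> z) * c (t + e n * z)) \<longlonglongrightarrow> complex_of_real (\<beta> z) * c t"
    proof (rule AE_I2)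
      fix z
      have "(\<lambda>n. t + e n * z) \<longlonglongrightarrow> t + 0 * z" by (intro tendsto_intros e)
      moreover have "isCont c (t + 0 * z)" using c(1) by (simp add: continuous_on_eq_continuous_at)
      ultimately have "(\<lambda>n. c (t + e n * z)) \<longlonglongrightarrow> c (t + 0 * z)" by (rule isCont_tendsto_compose[rotated])
      then show "(\<lambda>n. complex_of_real (\<beta> z) * c (t + e n * z)) \<longlonglongrightarrow> complex_of_real (\<beta> z) * c t"
        by (intro tendsto_intros) simp
    qed
    show "AE z in lborel. norm (complex_of_real (\<beta> z) * c (t + e n * z)) \<le> cmod (complex_of_real (\<beta> z)) * B" for n
      unfolding norm_mult by (intro AE_I2 mult_left_mono c) auto
  qed measurable
  then show ?thesis by simp
qed

text \<open>Testing with the difference of two rescaled primitives of a bump shows that the averages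
  of \<open>c\<close> around \<open>t0\<close> and \<open>t1\<close> agree at every small scale; the
  limit gives the values themselves. Endpoints follow by continuity.\<close>

lemma du_Bois_Reymond:
  fixes c :: "real \<Rightarrow> complex"
  assumes T: "0 < T" and c: "continuous_on {-T..T} c"
    and z: "\<And>\<theta>. time_test T \<theta> \<Longrightarrow> (LINT t|lborel. indicator {-T..T} t *\<^sub>R (complex_of_real (\<theta> 1 t) * c t)) = 0"
    and t: "t0 \<in> {-T..T}" "t1 \<in> {-T..T}"
  shows "c t0 = c t1"
proof -
  obtain \<beta> :: "nat \<Rightarrow> real \<Rightarrow> real" where \<beta>: "smooth1 \<beta>" "\<And>n x. 1 \<le> \<bar>x\<bar> \<Longrightarrow> \<beta> n x = 0"
    "\<And>x. 0 \<le> \<beta> 0 x" "\<And>x. \<bar>x\<bar> < 1 \<Longrightarrow> 0 < \<beta> 0 x"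
    using exists_bump by blast
  obtain P where P: "smooth1 P" "\<And>n. P (Suc n) = \<beta> n" "\<And>x. x \<ge> 1 \<Longrightarrow> P 0 x = P 0 1" "\<And>x. x \<le> -1 \<Longrightarrow> P 0 x = P 0 (-1)"
    using bump_primitive[OF \<beta>(1,2)] by blast
  \<comment> \<open>Extension of \<open>c\<close> by its boundary values, bounded and continuous on
    the whole line as \<open>mollify_limit\<close> requires.\<close>
  define cc where "cc t = c (max (-T) (min T t))" for t
  have ccc: "continuous_on UNIV cc"
    unfolding cc_def by (rule continuous_on_compose2[OF c]) (use T in \<open>auto intro!: continuous_intros\<close>)
  have cc: "cc t = c t" if "t \<in> {-T..T}" for t using that by (simp add: cc_def)
  have "compact (c ` {-T..T})" by (intro compact_continuous_image c) auto
  then obtain B where "\<forall>y\<in>c ` {-T..T}. norm y \<le> B" using compact_imp_bounded bounded_iff by blast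
  then have B: "cmod (cc t) \<le> B" for t using T by (auto simp: cc_def)
  have cb: "continuous_on UNIV (\<beta> 0)" by (rule smooth1_continuous[OF \<beta>(1)])
  have I0: "(LINT z|lborel. complex_of_real (\<beta> 0 z)) \<noteq> 0"
  proof
    have ib: "integrable lborel (\<beta> 0)" by (rule compact_support_integrable[OF cb, of 1]) (simp add: \<beta>)
    assume "(LINT z|lborel. complex_of_real (\<beta> 0 z)) = 0"
    then have "(LINT z|lborel. \<beta> 0 z) = 0" by (simp add: integral_complex_of_real)
    then have "AE z in lborel. \<beta> 0 z = 0"
      using ib \<beta>(3) by (subst (asm) integral_nonneg_eq_0_iff_AE) auto
    then have "AE z in lborel. z \<notin> {-1<..<(1::real)}"
    proof eventually_elim
      case (elim z)
      then show ?case using \<beta>(4)[of z] by (auto simp: abs_less_iff)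
    qed
    then have "{-1<..<(1::real)} \<in> null_sets lborel" by (subst AE_iff_null_sets) auto
    then show False by (simp add: null_sets_def)
  qed
  have main: "c t0 = c t1" if t: "t0 \<in> {-T<..<T}" "t1 \<in> {-T<..<T}" for t0 t1
  proof -
    define d where "d = min (min (T - t0) (T + t0)) (min (T - t1) (T + t1))"
    have d: "0 < d" "\<And>x. x = t0 \<or> x = t1 \<Longrightarrow> \<bar>x\<bar> + d \<le> T" using t by (auto simp: d_def)
    \<comment> \<open>The scale is at most d/2, so bumps around \<open>t0\<close> and
      \<open>t1\<close> vanish beyond modulus T - d/2, strictly inside the interval.\<close>
    define e where "e n = d / 2 * (1 / real (Suc n))" for n
    have e0: "e \<longlonglongrightarrow> d / 2 * 0" unfolding e_def by (intro tendsto_intros LIMSEQ_Suc[OF lim_1_over_n])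
    have en: "0 < e n" "e n \<le> d / 2" for n
      using d(1) by (auto simp: e_def field_simps)
    have eq: "(LINT z|lborel. complex_of_real (\<beta> 0 z) * cc (t0 + e n * z)) = (LINT z|lborel. complex_of_real (\<beta> 0 z) * cc (t1 + e n * z))" for n
    proof -
      define \<theta> where "\<theta> k t = (1 / e n) ^ k *\<^sub>R P k (- t1 / e n + 1 / e n * t) - (1 / e n) ^ k *\<^sub>R P k (- t0 / e n + 1 / e n * t)" for k t
      have ar: "- x / e n + 1 / e n * t = (t - x) / e n" for x t by (simp add: diff_divide_distrib)
      have s\<theta>: "smooth1 \<theta>" unfolding \<theta>_def[abs_def] by (intro smooth1_diff smooth1_affine P(1))
      have out: "\<theta> k t = 0" if ht: "T - d / 2 < \<bar>t\<bar>" for k t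
      proof -
        have *: "(1 \<le> (t - t0) / e n \<and> 1 \<le> (t - t1) / e n) \<or> ((t - t0) / e n \<le> -1 \<and> (t - t1) / e n \<le> -1)"
        proof -
          have d2: "\<bar>t0\<bar> + d \<le> T" "\<bar>t1\<bar> + d \<le> T" using d(2) by auto
          consider "T - d / 2 < t" | "t < - (T - d / 2)" using ht by linarith
          then show ?thesis
          proof cases
            case 1
            then have "e n \<le> t - t0" "e n \<le> t - t1" using d2 en(2)[of n] by linarith+
            then show ?thesis using en(1)[of n] by (simp add: le_divide_eq)
          next
            case 2
            then have "t - t0 \<le> - e n" "t - t1 \<le> - e n" using d2 en(2)[of n] by linarith+
            then show ?thesis using en(1)[of n] by (simp add: divide_le_eq)
          qed
        qed
        show ?thesis
        proof (cases k)
          case 0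
          have "P 0 ((t - t0) / e n) = P 0 ((t - t1) / e n)"
            using * P(3)[of "(t - t0) / e n"] P(3)[of "(t - t1) / e n"] P(4)[of "(t - t0) / e n"] P(4)[of "(t - t1) / e n"]
            by argo
          then show ?thesis unfolding \<theta>_def ar 0 by simp
        next
          case (Suc j)
          have "\<beta> j ((t - t0) / e n) = 0" "\<beta> j ((t - t1) / e n) = 0" by (rule \<beta>(2), use * in linarith)+
          then show ?thesis unfolding \<theta>_def ar Suc P(2) by simp
        qed
      qed
      have "time_test T \<theta>" unfolding time_test_def using s\<theta> out d(1) by (auto intro!: exI[of _ "T - d / 2"])
      from z[OF this]
      have 0: "(LINT t|lborel. indicator {-T..T} t *\<^sub>R (complex_of_real (\<theta> 1 t) * c t)) = 0" .
      have \<theta>1: "\<theta> 1 t = (1 / e n) * \<beta> 0 ((t - t1) / e n) - (1 / e n) * \<beta> 0 ((t - t0) / e n)" for t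
        using P(2)[of 0] unfolding \<theta>_def ar by simp
      have "(\<lambda>t. indicator {-T..T} t *\<^sub>R (complex_of_real (\<theta> 1 t) * c t)) = (\<lambda>t. complex_of_real (\<theta> 1 t) * cc t)"
      proof
        fix t show "indicator {-T..T} t *\<^sub>R (complex_of_real (\<theta> 1 t) * c t) = complex_of_real (\<theta> 1 t) * cc t"
          using out[of t 1] d(1) by (cases "t \<in> {-T..T}") (auto simp: cc)
      qed
      with 0 have 1: "(LINT t|lborel. complex_of_real (\<theta> 1 t) * cc t) = 0" by simp
      let ?f = "\<lambda>x t. complex_of_real ((1 / e n) * \<beta> 0 ((t - x) / e n)) * cc t"
      have int: "integrable lborel (?f x)" if "x = t0 \<or> x = t1" for x
      proof (rule compact_support_integrable[of _ T])
        have "continuous_on UNIV (\<lambda>t. \<beta> 0 ((t - x) / e n))"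
          by (rule continuous_on_compose2[OF cb]) (use en[of n] in \<open>auto intro!: continuous_intros\<close>)
        then show "continuous_on UNIV (?f x)" by (intro continuous_intros ccc)
        fix t assume "T < \<bar>t\<bar>"
        then have "e n \<le> \<bar>t - x\<bar>" using d(2)[OF that] d(1) en(2)[of n] by linarith
        then have "1 \<le> \<bar>(t - x) / e n\<bar>" using en(1)[of n] by (simp add: le_divide_eq abs_divide)
        then show "?f x t = 0" by (simp add: \<beta>(2))
      qed
      have "(LINT t|lborel. ?f t1 t) - (LINT t|lborel. ?f t0 t) = (LINT t|lborel. ?f t1 t - ?f t0 t)"
        by (intro Bochner_Integration.integral_diff[symmetric] int) auto
      also have "\<dots> = 0" using 1 unfolding \<theta>1 of_real_diff left_diff_distrib .
      finally have 2: "(LINT t|lborel. ?f t1 t) = (LINT t|lborel. ?f t0 t)" by simp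
      have "(LINT t|lborel. ?f x t) = (LINT z|lborel. complex_of_real (\<beta> 0 z) * cc (x + e n * z))" for x
      proof -
        have "(LINT t|lborel. ?f x t) = \<bar>e n\<bar> *\<^sub>R (LINT z|lborel. ?f x (x + e n * z))"
          using en[of n] by (intro lborel_integral_real_affine) auto
        also have "\<dots> = (LINT z|lborel. \<bar>e n\<bar> *\<^sub>R ?f x (x + e n * z))" by simp
        also have "\<dots> = (LINT z|lborel. complex_of_real (\<beta> 0 z) * cc (x + e n * z))"
          using en[of n] by (intro Bochner_Integration.integral_cong refl) (simp add: scaleR_conv_of_real)
        finally show ?thesis .
      qed
      then show ?thesis using 2 by simp
    qed
    have lim: "(\<lambda>n. LINT z|lborel. complex_of_real (\<beta> 0 z) * cc (x + e n * z)) \<longlonglongrightarrow> (LINT z|lborel. complex_of_real (\<beta> 0 z)) * cc x" for x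
      by (rule mollify_limit[OF cb _ ccc B]) (use e0 \<beta>(2) in auto)
    from LIMSEQ_unique[OF lim[of t0, unfolded eq] lim[of t1]] I0 have "cc t0 = cc t1" by simp
    then show ?thesis using t by (simp add: cc)
  qed
  have "c t = c 0" if "t \<in> {-T..T}" for t
  proof (rule continuous_constant_on_closure[of "{-T<..<T}"])
    show "continuous_on (closure {-T<..<T}) c" using c T by simp
    show "t \<in> closure {-T<..<T}" using that T by simp
    show "c x = c 0" if "x \<in> {-T<..<T}" for x using main[OF that, of 0] T by simp
  qed
  then show ?thesis using t by metis
qed

text \<open>With \<open>H\<close> a primitive of \<open>h\<close>, integration by parts turns the
  weak equation into the statement that b - H annihilates all derivatives of test functions; it is
  therefore constant.\<close>

lemma weak_second_derivative:
  fixes a b h :: "real \<Rightarrow> complex"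
  assumes T: "0 < T" and ab: "\<And>t. t \<in> {-T..T} \<Longrightarrow> (a has_vector_derivative b t) (at t within {-T..T})"
    and b: "continuous_on {-T..T} b" and h: "continuous_on {-T..T} h"
    and weak: "\<And>\<theta>. time_test T \<theta> \<Longrightarrow>
      (LINT t|lborel. indicator {-T..T} t *\<^sub>R (complex_of_real (\<theta> 2 t) * a t - complex_of_real (\<theta> 0 t) * h t)) = 0"
    and t: "t \<in> {-T..T}"
  shows "(b has_vector_derivative h t) (at t within {-T..T})"
proof -
  define H where "H u = integral {-T..u} h" for u
  have H: "(H has_vector_derivative h u) (at u within {-T..T})" if "u \<in> {-T..T}" for u
    unfolding H_def[abs_def] by (rule integral_has_vector_derivative[OF h that])
  have cH: "continuous_on {-T..T} H" and ca: "continuous_on {-T..T} a"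
    by (rule vector_derivative_imp_continuous_on, erule H) (rule vector_derivative_imp_continuous_on, erule ab)
  have const: "b u - H u = b v - H v" if "u \<in> {-T..T}" "v \<in> {-T..T}" for u v
  proof (rule du_Bois_Reymond[OF T _ _ that, of "\<lambda>t. b t - H t"])
    show "continuous_on {-T..T} (\<lambda>t. b t - H t)" by (intro continuous_intros b cH)
    fix \<theta> assume tt: "time_test T \<theta>"
    then have \<theta>: "smooth1 \<theta>" and edge: "\<theta> n T = 0" "\<theta> n (-T) = 0" for n
      using T by (auto simp: time_test_def)
    let ?c = "\<lambda>n t. complex_of_real (\<theta> n t)"
    have c\<theta>: "continuous_on {-T..T} (?c n)" for n by (intro continuous_intros smooth1_continuous[OF \<theta>])
    have d\<theta>: "(?c n has_vector_derivative ?c (Suc n) t) (at t within {-T..T})" for n t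
      using \<theta> by (intro of_real_vector_derivative) (simp add: smooth1_def has_real_derivative_iff_has_vector_derivative has_vector_derivative_at_within)
    \<comment> \<open>The derivative of \<open>\<theta>' a - \<theta> H\<close>, whose boundary
      values vanish. Subtracting the weak equation leaves \<open>\<theta>' (b - H)\<close>.\<close>
    let ?g = "\<lambda>t. (?c 1 t * b t + ?c 2 t * a t) - (?c 0 t * h t + ?c 1 t * H t)"
    have "(LINT t|lborel. indicator {-T..T} t *\<^sub>R ?g t)
       = (?c 1 T * a T - ?c 0 T * H T) - (?c 1 (-T) * a (-T) - ?c 0 (-T) * H (-T))"
    proof (rule integral_FTC_Icc)
      fix t assume "-T \<le> t" "t \<le> T"
      then have t: "t \<in> {-T..T}" by simp
      show "((\<lambda>t. ?c 1 t * a t - ?c 0 t * H t) has_vector_derivative ?g t) (at t within {-T..T})"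
        using d\<theta>[of 0 t] d\<theta>[of 1 t]
        by (intro has_vector_derivative_diff has_vector_derivative_mult ab[OF t] H[OF t]) (auto simp: numeral_2_eq_2)
    qed (use T in \<open>auto intro!: continuous_intros c\<theta> b ca h cH simp del: of_real_mult\<close>)
    also have "\<dots> = 0" by (simp add: edge)
    finally have 0: "(LINT t|lborel. indicator {-T..T} t *\<^sub>R ?g t) = 0" .
    have si: "set_integrable lborel {-T..T} (\<lambda>t. ?c 2 t * a t - ?c 0 t * h t)" "set_integrable lborel {-T..T} ?g"
      by (intro borel_integrable_atLeastAtMost' continuous_intros c\<theta> b ca h cH)+
    have "(LINT t|lborel. indicator {-T..T} t *\<^sub>R (?c 1 t * (b t - H t)))
      = (LINT t|lborel. indicator {-T..T} t *\<^sub>R ?g t - indicator {-T..T} t *\<^sub>R (?c 2 t * a t - ?c 0 t * h t))"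
      by (intro Bochner_Integration.integral_cong refl) (simp add: algebra_simps)
    also have "\<dots> = 0"
      using si 0 weak[OF tt] unfolding set_integrable_def by (subst Bochner_Integration.integral_diff) auto
    finally show "(LINT t|lborel. indicator {-T..T} t *\<^sub>R (?c 1 t * (b t - H t))) = 0" .
  qed
  have "((\<lambda>u. (b t - H t) + H u) has_vector_derivative 0 + h t) (at t within {-T..T})"
    by (intro has_vector_derivative_add has_vector_derivative_const H t)
  then have "((\<lambda>u. (b t - H t) + H u) has_vector_derivative h t) (at t within {-T..T})" by simp
  then show ?thesis
  proof (rule has_vector_derivative_transform[rotated -1])
    show "t \<in> {-T..T}" by (rule t)
    show "b u = (b t - H t) + H u" if "u \<in> {-T..T}" for u using const[OF t that] by (simp add: algebra_simps)
  qed
qed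

section \<open>Localising the weak equation in frequency\<close>

lemma norm_set_integral_le:
  fixes f :: "real \<Rightarrow> complex"
  assumes c: "continuous_on {-T..T} f" and B: "\<And>t. t \<in> {-T..T} \<Longrightarrow> cmod (f t) \<le> B" and "0 \<le> B" "0 < T"
  shows "cmod (LINT t|lborel. indicator {-T..T} t *\<^sub>R f t) \<le> 2 * T * B"
proof -
  have "set_integrable lborel {-T..T} f" by (rule borel_integrable_atLeastAtMost'[OF c])
  then have "(\<lambda>t. indicator {-T..T} t *\<^sub>R f t) \<in> borel_measurable lborel" by (auto simp: set_integrable_def)
  then have "ennreal (cmod (LINT t|lborel. indicator {-T..T} t *\<^sub>R f t)) \<le> (\<integral>\<^sup>+t. ennreal (cmod (indicator {-T..T} t *\<^sub>R f t)) \<partial>lborel)"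
    by (rule norm_integral_le_nn)
  also have "\<dots> \<le> (\<integral>\<^sup>+t. ennreal B * indicator {-T..T} t \<partial>lborel)"
    using B by (intro nn_integral_mono) (auto simp: indicator_def intro!: ennreal_leI)
  also have "\<dots> = ennreal (2 * T * B)"
    using assms by (subst nn_integral_cmult_indicator) (auto simp: mult.commute simp flip: ennreal_mult)
  finally show ?thesis using assms by (simp add: ennreal_le_iff)
qed

text \<open>The threshold 7/2 is the integrability of \<open>wt (r - 4)\<close>, that is 4 - r >
  1/2.\<close>

lemma decay_Hs:
  assumes m: "g \<in> borel_measurable borel" and le: "\<And>\<xi>. cmod (g \<xi>) \<le> C * wt (-2) \<xi>" and r: "r < 7/2"
  shows "g \<in> Hs r UNIV"
proof -
  obtain E where E: "bd r (\<lambda>x. ennreal (wt (-2) x)) E" using bd_wt[of 2 r] r by auto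
  have C: "0 \<le> C" using order_trans[OF norm_ge_zero le[of 0]] by (simp add: wt_def)
  have "bd r (cn g) (C * E)"
  proof (rule bd_mono[OF bd_cmult[OF E C]])
    show "AE x in lborel. cn g x \<le> ennreal C * ennreal (wt (-2) x)"
      using le C by (auto simp: cn_def intro!: ennreal_leI AE_I2 simp flip: ennreal_mult)
  qed (use m in auto)
  then show ?thesis using m by (intro HsI) auto
qed

lemma smooth1_bounded_linear:
  assumes "smooth1 F" "bounded_linear L"
  shows "smooth1 (\<lambda>n x. L (F n x))"
  using assms unfolding smooth1_def by (auto intro: bounded_linear.has_vector_derivative)

text \<open>The Fourier multiplier of minus the second derivative in \<open>x\<close>.\<close>

definition wsq :: "(real \<Rightarrow> complex) \<Rightarrow> real \<Rightarrow> complex" where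
  "wsq g \<xi> = complex_of_real ((2 * pi * \<xi>)\<^sup>2) * g \<xi>"

lemma wsq_measurable [measurable (raw)]:
  "g \<in> borel_measurable borel \<Longrightarrow> wsq g \<in> borel_measurable borel"
  unfolding wsq_def by measurable

lemma
  assumes g: "g \<in> Hs (2 - s) \<Delta>"
  shows wsq_Hs: "wsq g \<in> Hs (-s) \<Delta>" and hsnorm_wsq_le: "hsnorm (-s) (wsq g) \<le> (2 * pi)\<^sup>2 * hsnorm (2 - s) g"
proof -
  note [measurable] = Hs_measurable[OF g]
  have 1: "bd (-s) (\<lambda>x. ennreal (wt 1 x) * cn g x) (hsnorm (2 - s) g)"
    using bd_weight[OF bd_hsnorm[OF g], of 1] by simp
  have le: "cn (wsq g) x \<le> ennreal ((2 * pi)\<^sup>2) * (ennreal (wt 1 x) * cn g x)" for x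
  proof -
    have "(2 * pi)\<^sup>2 * x\<^sup>2 * cmod (g x) \<le> (2 * pi)\<^sup>2 * wt 1 x * cmod (g x)"
      using one_plus_square_pos[of x] by (intro mult_right_mono mult_left_mono) (auto simp: wt_def)
    moreover have "cmod (wsq g x) = (2 * pi)\<^sup>2 * x\<^sup>2 * cmod (g x)"
      unfolding wsq_def norm_mult norm_of_real abs_power2 by (simp add: power_mult_distrib)
    ultimately have "cmod (wsq g x) \<le> (2 * pi)\<^sup>2 * (wt 1 x * cmod (g x))" by (simp only: mult.assoc)
    then show ?thesis unfolding cn_def by (simp add: ennreal_leI flip: ennreal_mult)
  qed
  have 2: "bd (-s) (cn (wsq g)) ((2 * pi)\<^sup>2 * hsnorm (2 - s) g)"
    by (rule bd_mono[OF bd_cmult[OF 1, of "(2 * pi)\<^sup>2"] _ AE_I2[OF le]]) auto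
  have "supp_in \<Delta> (cn (wsq g))"
    using Hs_supp[OF g] unfolding supp_in_cn by eventually_elim (simp add: wsq_def)
  then show "wsq g \<in> Hs (-s) \<Delta>" by (intro HsI[OF _ 2]) measurable
  show "hsnorm (-s) (wsq g) \<le> (2 * pi)\<^sup>2 * hsnorm (2 - s) g" by (rule hsnorm_le[OF _ 2]) measurable
qed

section \<open>Pairings with an arbitrary solution\<close>

locale wsol =
  fixes \<Gamma> :: "real set" and s \<sigma> T K :: real and q :: nat and v0 v1 :: "real \<Rightarrow> complex" and U V :: "real \<Rightarrow> real \<Rightarrow> complex"
  assumes \<Gamma>: "half_line \<Gamma>" and q: "1 \<le> q" and T: "0 < T" and s: "s > -1/2"
    and sol: "wave_sol \<Gamma> (Suc q) \<sigma> s T v0 v1 U V"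
    and K0: "1 \<le> K"
    and K: "\<And>f B. bd s f B \<Longrightarrow> supp_in \<Gamma> f \<Longrightarrow> bd (s - 1) (npow f q) (K * B ^ Suc q)"
    and KL: "\<And>F G R. F \<in> Hs s \<Gamma> \<Longrightarrow> G \<in> Hs s \<Gamma> \<Longrightarrow> hsnorm s F \<le> R \<Longrightarrow> hsnorm s G \<le> R
        \<Longrightarrow> hsnorm (s - 1) (\<lambda>x. conv_power F q x - conv_power G q x) \<le> K * R ^ q * hsnorm s (\<lambda>x. F x - G x)"
begin

abbreviation "I \<equiv> {-T..T}"

lemma UH: "t \<in> I \<Longrightarrow> U t \<in> Hs s \<Gamma>" and VH: "t \<in> I \<Longrightarrow> V t \<in> Hs (s - 1) \<Gamma>"
  and U_cont: "t \<in> I \<Longrightarrow> ((\<lambda>\<tau>. hsnorm s (\<lambda>\<xi>. U \<tau> \<xi> - U t \<xi>)) \<longlongrightarrow> 0) (at t within I)"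
  and V_cont: "t \<in> I \<Longrightarrow> ((\<lambda>\<tau>. hsnorm (s - 1) (\<lambda>\<xi>. V \<tau> \<xi> - V t \<xi>)) \<longlongrightarrow> 0) (at t within I)"
  and U_diff: "t \<in> I \<Longrightarrow> ((\<lambda>\<tau>. hsnorm (s - 1) (\<lambda>\<xi>. (U \<tau> \<xi> - U t \<xi>) / complex_of_real (\<tau> - t) - V t \<xi>)) \<longlongrightarrow> 0) (at t within I)"
  and U_0: "hsnorm s (\<lambda>\<xi>. U 0 \<xi> - v0 \<xi>) = 0" and V_0: "hsnorm (s - 1) (\<lambda>\<xi>. V 0 \<xi> - v1 \<xi>) = 0"
  using sol unfolding wave_sol_def by blast+

lemma weak: "smooth_family \<phi> D \<Longrightarrow> test_support T \<phi> \<Longrightarrow>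
        (LBINT t:{-T<..<T}. (LINT \<xi>|lborel. U t \<xi> * ift (\<lambda>x. D 0 2 (x, t) - D 2 0 (x, t)) \<xi>))
      = complex_of_real \<sigma> *
        (LBINT t:{-T<..<T}. (LINT \<xi>|lborel. conv_power (U t) q \<xi> * ift (\<lambda>x. \<phi> (x, t)) \<xi>))"
  using sol unfolding wave_sol_def by simp

definition N :: "real \<Rightarrow> real \<Rightarrow> complex" where "N t = conv_power (U t) q"

lemma conv_power_Hs:
  assumes F: "F \<in> Hs s \<Gamma>"
  shows "conv_power F q \<in> Hs (s - 1) \<Gamma>" "hsnorm (s - 1) (conv_power F q) \<le> K * hsnorm s F ^ Suc q"
proof -
  note [measurable] = Hs_measurable[OF F]
  have b: "bd (s - 1) (cn (conv_power F q)) (K * hsnorm s F ^ Suc q)"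
    by (rule bd_mono[OF K[OF bd_hsnorm[OF F] Hs_supp[OF F]]]) (auto intro!: AE_I2 cn_conv_power_le)
  have "supp_in \<Gamma> (cn (conv_power F q))"
    by (rule supp_in_le[OF supp_in_npow[OF \<Gamma> Hs_supp[OF F], of q]]) (auto intro: cn_conv_power_le)
  with b show "conv_power F q \<in> Hs (s - 1) \<Gamma>" by (intro HsI) auto
  show "hsnorm (s - 1) (conv_power F q) \<le> K * hsnorm s F ^ Suc q"
    by (rule hsnorm_le[OF _ b]) measurable
qed

lemma NH: "t \<in> I \<Longrightarrow> N t \<in> Hs (s - 1) \<Gamma>"
  unfolding N_def by (rule conv_power_Hs(1)[OF UH])

lemma U_bounded: "\<exists>R\<ge>0. \<forall>t\<in>I. hsnorm s (U t) \<le> R"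
proof -
  have "compact ((\<lambda>t. hsnorm s (U t)) ` I)"
    by (intro compact_continuous_image hsnorm_continuous[OF UH U_cont]) auto
  then obtain R where "\<forall>y\<in>(\<lambda>t. hsnorm s (U t)) ` I. norm y \<le> R" using compact_imp_bounded bounded_iff by blast
  then have "\<forall>t\<in>I. hsnorm s (U t) \<le> R" by auto
  moreover from this have "0 \<le> R" using T order_trans[OF hsnorm_nonneg[of s "U 0"]] by auto
  ultimately show ?thesis by blast
qed

lemma N_cont:
  assumes t: "t \<in> I"
  shows "((\<lambda>\<tau>. hsnorm (s - 1) (\<lambda>\<xi>. N \<tau> \<xi> - N t \<xi>)) \<longlongrightarrow> 0) (at t within I)"
proof -
  obtain R where R: "\<And>t. t \<in> I \<Longrightarrow> hsnorm s (U t) \<le> R" using U_bounded by blast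
  show ?thesis
  proof (rule Lim_null_comparison)
    show "\<forall>\<^sub>F \<tau> in at t within I. norm (hsnorm (s - 1) (\<lambda>\<xi>. N \<tau> \<xi> - N t \<xi>)) \<le> K * R ^ q * hsnorm s (\<lambda>\<xi>. U \<tau> \<xi> - U t \<xi>)"
      unfolding eventually_at_filter N_def
      using KL[OF UH UH R R, of _ t] t by (intro always_eventually allI impI) simp
    show "((\<lambda>\<tau>. K * R ^ q * hsnorm s (\<lambda>\<xi>. U \<tau> \<xi> - U t \<xi>)) \<longlongrightarrow> 0) (at t within I)"
      using tendsto_mult_left[OF U_cont[OF t], of "K * R ^ q"] by simp
  qed
qed

lemma U_pr_deriv:
  assumes t: "t \<in> I" and g: "g \<in> Hs (1 - s) UNIV"
  shows "((\<lambda>\<tau>. pr (U \<tau>) g) has_vector_derivative pr (V t) g) (at t within I)"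
proof -
  have g': "g \<in> Hs (- (s - 1)) UNIV" using g by simp
  have U1: "U \<tau> \<in> Hs (s - 1) \<Gamma>" if "\<tau> \<in> I" for \<tau> using Hs_mono[OF UH[OF that]] by simp
  have "((\<lambda>\<tau>. (1 / (\<tau> - t)) *\<^sub>R (pr (U \<tau>) g - pr (U t) g) - pr (V t) g) \<longlongrightarrow> 0) (at t within I)"
  proof (rule Lim_null_comparison)
    show "\<forall>\<^sub>F \<tau> in at t within I. norm ((1 / (\<tau> - t)) *\<^sub>R (pr (U \<tau>) g - pr (U t) g) - pr (V t) g)
       \<le> hsnorm (s - 1) (\<lambda>\<xi>. (U \<tau> \<xi> - U t \<xi>) / complex_of_real (\<tau> - t) - V t \<xi>) * hsnorm (- (s - 1)) g"
      unfolding eventually_at_filter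
    proof (intro always_eventually allI impI)
      fix \<tau> assume \<tau>: "\<tau> \<in> I"
      let ?c = "complex_of_real (1 / (\<tau> - t))"
      have D: "(\<lambda>\<xi>. U \<tau> \<xi> - U t \<xi>) \<in> Hs (s - 1) \<Gamma>" by (rule Hs_diff[OF U1[OF \<tau>] U1[OF t]])
      have cD: "(\<lambda>\<xi>. ?c * (U \<tau> \<xi> - U t \<xi>)) \<in> Hs (s - 1) \<Gamma>" by (rule Hs_cmult[OF D])
      have eq: "(\<lambda>\<xi>. (U \<tau> \<xi> - U t \<xi>) / complex_of_real (\<tau> - t) - V t \<xi>) = (\<lambda>\<xi>. ?c * (U \<tau> \<xi> - U t \<xi>) - V t \<xi>)"
        by simp
      have "pr (\<lambda>\<xi>. ?c * (U \<tau> \<xi> - U t \<xi>) - V t \<xi>) g = ?c * (pr (U \<tau>) g - pr (U t) g) - pr (V t) g"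
        unfolding pr_diff_left[OF cD VH[OF t] g'] pr_cmult_left pr_diff_left[OF U1[OF \<tau>] U1[OF t] g'] ..
      then have "cmod (?c * (pr (U \<tau>) g - pr (U t) g) - pr (V t) g)
         \<le> hsnorm (s - 1) (\<lambda>\<xi>. ?c * (U \<tau> \<xi> - U t \<xi>) - V t \<xi>) * hsnorm (- (s - 1)) g"
        using pr_le[OF Hs_diff[OF cD VH[OF t]] g'] by simp
      then show "norm ((1 / (\<tau> - t)) *\<^sub>R (pr (U \<tau>) g - pr (U t) g) - pr (V t) g)
       \<le> hsnorm (s - 1) (\<lambda>\<xi>. (U \<tau> \<xi> - U t \<xi>) / complex_of_real (\<tau> - t) - V t \<xi>) * hsnorm (- (s - 1)) g"
        unfolding eq scaleR_conv_of_real .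
    qed
    show "((\<lambda>\<tau>. hsnorm (s - 1) (\<lambda>\<xi>. (U \<tau> \<xi> - U t \<xi>) / complex_of_real (\<tau> - t) - V t \<xi>) * hsnorm (- (s - 1)) g) \<longlongrightarrow> 0) (at t within I)"
      using tendsto_mult_right[OF U_diff[OF t], of "hsnorm (- (s - 1)) g"] by simp
  qed
  then show ?thesis unfolding has_vector_derivative_iff_quotient by (rule LIM_zero_cancel)
qed

text \<open>The right-hand side of the equation paired with \<open>g\<close>, hence the expected
  time derivative of \<open>pr (V t) g\<close>. In \<open>J\<close> below it becomes the integrand
  of the weak equation tested with a product.\<close>

definition h :: "(real \<Rightarrow> complex) \<Rightarrow> real \<Rightarrow> complex" where
  "h g t = complex_of_real \<sigma> * pr (N t) g - pr (U t) (wsq g)"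

definition J :: "(nat \<Rightarrow> real \<Rightarrow> real) \<Rightarrow> (real \<Rightarrow> complex) \<Rightarrow> real \<Rightarrow> complex" where
  "J \<theta> g t = complex_of_real (\<theta> 2 t) * pr (U t) g - complex_of_real (\<theta> 0 t) * h g t"

text \<open>Those \<open>g\<close> for which \<open>\<theta> t * g \<xi>\<close> may replace the inverse Fourier transform of a test function in the weak equation.\<close>

definition good :: "(real \<Rightarrow> complex) \<Rightarrow> bool" where
  "good g \<longleftrightarrow> g \<in> Hs (2 - s) UNIV \<and> (\<forall>\<theta>. time_test T \<theta> \<longrightarrow> (LINT t|lborel. indicator I t *\<^sub>R J \<theta> g t) = 0)"

lemma Hs2:
  assumes "g \<in> Hs (2 - s) UNIV"
  shows "g \<in> Hs (- s) UNIV" "g \<in> Hs (- (s - 1)) UNIV" "g \<in> Hs (1 - s) UNIV"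
  using Hs_mono[OF assms] by simp_all

lemma h_cont:
  assumes g: "g \<in> Hs (2 - s) UNIV"
  shows "continuous_on I (h g)"
  unfolding h_def[abs_def]
  by (intro continuous_intros pr_continuous[OF NH N_cont Hs2(2)[OF g]] pr_continuous[OF UH U_cont wsq_Hs[OF g]])

lemma J_cont:
  assumes g: "g \<in> Hs (2 - s) UNIV" and \<theta>: "time_test T \<theta>"
  shows "continuous_on I (J \<theta> g)"
  using \<theta> unfolding J_def[abs_def] time_test_def
  by (intro continuous_intros pr_continuous[OF UH U_cont Hs2(1)[OF g]] h_cont[OF g] smooth1_continuous) auto

lemma J_integrable:
  assumes "g \<in> Hs (2 - s) UNIV" "time_test T \<theta>"
  shows "integrable lborel (\<lambda>t. indicator I t *\<^sub>R J \<theta> g t)"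
  using borel_integrable_atLeastAtMost'[OF J_cont[OF assms]] by (simp add: set_integrable_def)

lemma J_diff:
  assumes g: "g \<in> Hs (2 - s) UNIV" and g': "g' \<in> Hs (2 - s) UNIV" and t: "t \<in> I"
  shows "J \<theta> (\<lambda>\<xi>. g \<xi> - g' \<xi>) t = J \<theta> g t - J \<theta> g' t"
proof -
  have "wsq (\<lambda>\<xi>. g \<xi> - g' \<xi>) = (\<lambda>\<xi>. wsq g \<xi> - wsq g' \<xi>)" by (simp add: wsq_def fun_eq_iff algebra_simps)
  note w = this
  show ?thesis unfolding J_def h_def w pr_diff_right[OF UH[OF t] Hs2(1)[OF g] Hs2(1)[OF g']]
      pr_diff_right[OF NH[OF t] Hs2(2)[OF g] Hs2(2)[OF g']] pr_diff_right[OF UH[OF t] wsq_Hs[OF g] wsq_Hs[OF g']]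
    by (simp add: algebra_simps)
qed

lemma J_add:
  assumes g: "g \<in> Hs (2 - s) UNIV" and g': "g' \<in> Hs (2 - s) UNIV" and t: "t \<in> I"
  shows "J \<theta> (\<lambda>\<xi>. g \<xi> + g' \<xi>) t = J \<theta> g t + J \<theta> g' t"
proof -
  have "wsq (\<lambda>\<xi>. g \<xi> + g' \<xi>) = (\<lambda>\<xi>. wsq g \<xi> + wsq g' \<xi>)" by (simp add: wsq_def fun_eq_iff algebra_simps)
  note w = this
  show ?thesis unfolding J_def h_def w pr_add_right[OF UH[OF t] Hs2(1)[OF g] Hs2(1)[OF g']]
      pr_add_right[OF NH[OF t] Hs2(2)[OF g] Hs2(2)[OF g']] pr_add_right[OF UH[OF t] wsq_Hs[OF g] wsq_Hs[OF g']]
    by (simp add: algebra_simps)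
qed

lemma J_cmult: "J \<theta> (\<lambda>\<xi>. c * g \<xi>) t = c * J \<theta> g t"
proof -
  have "wsq (\<lambda>\<xi>. c * g \<xi>) = (\<lambda>\<xi>. c * wsq g \<xi>)" by (simp add: wsq_def fun_eq_iff)
  then show ?thesis unfolding J_def h_def by (simp add: pr_cmult_right algebra_simps)
qed

lemma good_add:
  assumes "good g" "good g'"
  shows "good (\<lambda>\<xi>. g \<xi> + g' \<xi>)"
  unfolding good_def
proof (intro conjI allI impI)
  have g: "g \<in> Hs (2 - s) UNIV" "g' \<in> Hs (2 - s) UNIV" using assms by (auto simp: good_def)
  then show "(\<lambda>\<xi>. g \<xi> + g' \<xi>) \<in> Hs (2 - s) UNIV" by (rule Hs_add)
  fix \<theta> assume \<theta>: "time_test T \<theta>"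
  have "(LINT t|lborel. indicator I t *\<^sub>R J \<theta> (\<lambda>\<xi>. g \<xi> + g' \<xi>) t)
     = (LINT t|lborel. indicator I t *\<^sub>R J \<theta> g t + indicator I t *\<^sub>R J \<theta> g' t)"
    by (intro Bochner_Integration.integral_cong refl) (auto simp: indicator_def J_add[OF g])
  also have "\<dots> = 0"
    using assms \<theta> by (subst Bochner_Integration.integral_add[OF J_integrable[OF g(1) \<theta>] J_integrable[OF g(2) \<theta>]]) (auto simp: good_def)
  finally show "(LINT t|lborel. indicator I t *\<^sub>R J \<theta> (\<lambda>\<xi>. g \<xi> + g' \<xi>) t) = 0" .
qed

lemma good_cmult:
  assumes "good g"
  shows "good (\<lambda>\<xi>. c * g \<xi>)"
  unfolding good_def
proof (intro conjI allI impI)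
  show "(\<lambda>\<xi>. c * g \<xi>) \<in> Hs (2 - s) UNIV" using assms by (intro Hs_cmult) (simp add: good_def)
  fix \<theta> assume "time_test T \<theta>"
  then have "(LINT t|lborel. indicator I t *\<^sub>R J \<theta> g t) = 0" using assms by (simp add: good_def)
  moreover have "(LINT t|lborel. indicator I t *\<^sub>R J \<theta> (\<lambda>\<xi>. c * g \<xi>) t) = (LINT t|lborel. c * (indicator I t *\<^sub>R J \<theta> g t))"
    unfolding J_cmult by (simp only: mult_scaleR_right)
  ultimately show "(LINT t|lborel. indicator I t *\<^sub>R J \<theta> (\<lambda>\<xi>. c * g \<xi>) t) = 0"
    by (simp only: integral_mult_right_zero mult_zero_right)
qed

text \<open>Makes \<open>good\<close> closed under limits in H^(2-s). That index is the one at which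
  \<open>wsq g\<close> still lies in H^(-s) and pairs with \<open>U t\<close>.\<close>

lemma J_bound:
  assumes \<theta>: "time_test T \<theta>"
  shows "\<exists>C\<ge>0. \<forall>g t. g \<in> Hs (2 - s) UNIV \<longrightarrow> t \<in> I \<longrightarrow> cmod (J \<theta> g t) \<le> C * hsnorm (2 - s) g"
proof -
  have "\<exists>B\<ge>0. \<forall>t\<in>I. \<bar>\<theta> n t\<bar> \<le> B" for n
  proof -
    have "compact (\<theta> n ` I)" using \<theta> by (intro compact_continuous_image smooth1_continuous) (auto simp: time_test_def)
    then obtain B where "\<forall>y\<in>\<theta> n ` I. norm y \<le> B" using compact_imp_bounded bounded_iff by blast
    then have "\<forall>t\<in>I. \<bar>\<theta> n t\<bar> \<le> max B 0" by (auto simp: le_max_iff_disj)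
    then show ?thesis by (intro exI[of _ "max B 0"]) auto
  qed
  then obtain B where B: "\<And>n. 0 \<le> B n" "\<And>n t. t \<in> I \<Longrightarrow> \<bar>\<theta> n t\<bar> \<le> B n" by metis
  obtain R where R: "R \<ge> 0" "\<And>t. t \<in> I \<Longrightarrow> hsnorm s (U t) \<le> R" using U_bounded by blast
  let ?C = "B 2 * R + B 0 * (\<bar>\<sigma>\<bar> * (K * R ^ Suc q) + R * (2 * pi)\<^sup>2)"
  have "cmod (J \<theta> g t) \<le> ?C * hsnorm (2 - s) g" if g: "g \<in> Hs (2 - s) UNIV" and t: "t \<in> I" for g t
  proof -
    let ?n = "hsnorm (2 - s) g"
    have 1: "cmod (pr (U t) g) \<le> R * ?n"
      by (rule order_trans[OF pr_le[OF UH[OF t] Hs2(1)[OF g]]])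
         (intro mult_mono R(2)[OF t] hsnorm_mono[OF g], use R(1) in auto)
    have "hsnorm (s - 1) (N t) \<le> K * hsnorm s (U t) ^ Suc q"
      unfolding N_def by (rule conv_power_Hs(2)[OF UH[OF t]])
    also have "\<dots> \<le> K * R ^ Suc q" using K0 R(2)[OF t] by (intro mult_left_mono power_mono) auto
    finally have nN: "hsnorm (s - 1) (N t) \<le> K * R ^ Suc q" .
    have 2: "cmod (pr (N t) g) \<le> (K * R ^ Suc q) * ?n"
      by (rule order_trans[OF pr_le[OF NH[OF t] Hs2(2)[OF g]]])
         (intro mult_mono nN hsnorm_mono[OF g], use R(1) K0 in auto)
    have 3: "cmod (pr (U t) (wsq g)) \<le> R * ((2 * pi)\<^sup>2 * ?n)"
      by (rule order_trans[OF pr_le[OF UH[OF t] wsq_Hs[OF g]]])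
         (intro mult_mono R(2)[OF t] hsnorm_wsq_le[OF g], use R(1) in auto)
    have 4: "cmod (h g t) \<le> \<bar>\<sigma>\<bar> * ((K * R ^ Suc q) * ?n) + R * ((2 * pi)\<^sup>2 * ?n)"
      unfolding h_def
    proof (rule order_trans[OF norm_triangle_ineq4], intro add_mono 3)
      show "cmod (complex_of_real \<sigma> * pr (N t) g) \<le> \<bar>\<sigma>\<bar> * ((K * R ^ Suc q) * ?n)"
        unfolding norm_mult norm_of_real by (intro mult_left_mono 2) auto
    qed
    have "cmod (J \<theta> g t) \<le> B 2 * (R * ?n) + B 0 * (\<bar>\<sigma>\<bar> * ((K * R ^ Suc q) * ?n) + R * ((2 * pi)\<^sup>2 * ?n))"
      unfolding J_def
      by (rule order_trans[OF norm_triangle_ineq4], unfold norm_mult norm_of_real, intro add_mono mult_mono B(2)[OF t] 1 4 B(1)) auto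
    also have "\<dots> = ?C * ?n" by (simp add: algebra_simps)
    finally show ?thesis .
  qed
  moreover have "0 \<le> ?C" using B(1)[of 2] B(1)[of 0] R(1) K0 by (intro add_nonneg_nonneg mult_nonneg_nonneg) auto
  ultimately show ?thesis by (intro exI[of _ ?C] conjI allI impI)
qed

lemma good_limit:
  assumes gk: "\<And>k::nat. good (gk k)" and g: "g \<in> Hs (2 - s) UNIV"
    and lim: "(\<lambda>k. hsnorm (2 - s) (\<lambda>\<xi>. gk k \<xi> - g \<xi>)) \<longlonglongrightarrow> 0"
  shows "good g"
  unfolding good_def
proof (intro conjI allI impI g)
  fix \<theta> assume \<theta>: "time_test T \<theta>"
  obtain C where C: "C \<ge> 0" "\<And>g t. g \<in> Hs (2 - s) UNIV \<Longrightarrow> t \<in> I \<Longrightarrow> cmod (J \<theta> g t) \<le> C * hsnorm (2 - s) g"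
    using J_bound[OF \<theta>] by blast
  have gkH: "gk k \<in> Hs (2 - s) UNIV" for k using gk by (simp add: good_def)
  let ?L = "\<lambda>g. LINT t|lborel. indicator I t *\<^sub>R J \<theta> g t"
  have "cmod (?L g) \<le> 2 * T * (C * hsnorm (2 - s) (\<lambda>\<xi>. gk k \<xi> - g \<xi>))" for k
  proof -
    let ?d = "\<lambda>\<xi>. gk k \<xi> - g \<xi>"
    have d: "?d \<in> Hs (2 - s) UNIV" by (rule Hs_diff[OF gkH g])
    have "?L ?d = (LINT t|lborel. indicator I t *\<^sub>R J \<theta> (gk k) t - indicator I t *\<^sub>R J \<theta> g t)"
      by (intro Bochner_Integration.integral_cong refl) (auto simp: indicator_def J_diff[OF gkH g])
    also have "\<dots> = ?L (gk k) - ?L g"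
      by (rule Bochner_Integration.integral_diff[OF J_integrable[OF gkH \<theta>] J_integrable[OF g \<theta>]])
    also have "?L (gk k) = 0" using gk \<theta> by (simp add: good_def)
    finally have "cmod (?L g) = cmod (?L ?d)" by simp
    also have "\<dots> \<le> 2 * T * (C * hsnorm (2 - s) ?d)"
      by (rule norm_set_integral_le[OF J_cont[OF d \<theta>]]) (use C T in \<open>auto intro!: C(2)[OF d]\<close>)
    finally show ?thesis .
  qed
  moreover have "(\<lambda>k. 2 * T * (C * hsnorm (2 - s) (\<lambda>\<xi>. gk k \<xi> - g \<xi>))) \<longlonglongrightarrow> 2 * T * (C * 0)"
    by (intro tendsto_intros lim)
  ultimately have "cmod (?L g) \<le> 2 * T * (C * 0)" by (intro LIMSEQ_le_const) auto
  then show "?L g = 0" by simp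
qed

text \<open>A product of a function of \<open>x\<close> and a function of \<open>t\<close> is an
  admissible test function, and two derivatives in \<open>x\<close> become \<open>- wsq g\<close> on
  the Fourier side. The profile is real because test functions are.\<close>

lemma good_real:
  fixes \<psi> :: "nat \<Rightarrow> real \<Rightarrow> real"
  assumes \<psi>: "smooth1 \<psi>" and z: "\<And>n x. a < \<bar>x\<bar> \<Longrightarrow> \<psi> n x = 0"
  shows "good (iftc (\<lambda>x. complex_of_real (\<psi> 0 x)))"
proof -
  let ?p = "\<lambda>n x. complex_of_real (\<psi> n x)"
  define g where "g = iftc (?p 0)"
  have p: "smooth1 ?p" by (rule smooth1_bounded_linear[OF \<psi> bounded_linear_of_real])
  have pz: "?p n x = 0" if "a < \<bar>x\<bar>" for n x using z[OF that] by simp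
  have [measurable]: "?p n \<in> borel_measurable borel" for n
    by (rule borel_measurable_continuous_onI[OF smooth1_continuous[OF p]])
  have ip: "integrable lborel (?p n)" for n
    by (rule compact_support_integrable[OF smooth1_continuous[OF p] pz])
  obtain C where C: "\<And>\<xi>. cmod (iftc (?p 0) \<xi>) \<le> C * wt (- real 2) \<xi>" using iftc_decay[OF p pz, where n=0 and k=2] by blast
  have gH: "g \<in> Hs (2 - s) UNIV" unfolding g_def by (rule decay_Hs[where C=C]) (use C s in auto)
  have step: "iftc (?p (Suc m)) \<xi> = - (\<i> * complex_of_real (2 * pi * \<xi>)) * iftc (?p m) \<xi>" for m \<xi>
    by (rule iftc_deriv[OF _ smooth1_continuous[OF p] pz]) (use p in \<open>simp add: smooth1_def\<close>)
  have two: "iftc (?p 2) \<xi> = - wsq g \<xi>" for \<xi>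
  proof -
    have "iftc (?p 2) \<xi> = (\<i> * \<i>) * (complex_of_real (2 * pi * \<xi>) * complex_of_real (2 * pi * \<xi>)) * g \<xi>"
      unfolding numeral_2_eq_2 step g_def by (simp only: mult_minus_left mult_minus_right minus_minus ac_simps)
    then show ?thesis by (simp add: wsq_def power2_eq_square)
  qed
  have "(LINT t|lborel. indicator I t *\<^sub>R J \<theta> g t) = 0" if tt: "time_test T \<theta>" for \<theta>
  proof -
    from tt obtain T' where \<theta>: "smooth1 \<theta>" and T': "T' < T" "\<And>n t. T' < \<bar>t\<bar> \<Longrightarrow> \<theta> n t = 0"
      by (auto simp: time_test_def)
    define D where "D i j = (\<lambda>z. \<psi> i (fst z) * \<theta> j (snd z))" for i j
    have sf: "smooth_family (D 0 0) D"
      unfolding smooth_family_def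
    proof (intro conjI allI refl)
      show "continuous_on UNIV (D i j)" for i j
        unfolding D_def
        by (intro continuous_intros continuous_on_compose2[OF smooth1_continuous[OF \<psi>, of UNIV]]
            continuous_on_compose2[OF smooth1_continuous[OF \<theta>, of UNIV]]) auto
      show "((\<lambda>y. D i j (y, t)) has_real_derivative D (Suc i) j (x, t)) (at x)" for i j x t
        using \<psi> unfolding D_def fst_conv snd_conv smooth1_def has_real_derivative_iff_has_vector_derivative[symmetric]
        by (intro DERIV_cmult_right) auto
      show "((\<lambda>\<tau>. D i j (x, \<tau>)) has_real_derivative D i (Suc j) (x, t)) (at t)" for i j x t
        using \<theta> unfolding D_def fst_conv snd_conv smooth1_def has_real_derivative_iff_has_vector_derivative[symmetric]
        by (intro DERIV_cmult) auto
    qed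
    have ts: "test_support T (D 0 0)"
    proof -
      have cl: "closed ({-a..a} \<times> {-T'..T'})" and co: "compact ({-a..a} \<times> {-T'..T'})"
        by (auto intro: closed_Times compact_Times)
      have "{z. D 0 0 z \<noteq> 0} \<subseteq> {-a..a} \<times> {-T'..T'}"
      proof clarify
        fix x t assume "D 0 0 (x, t) \<noteq> 0"
        then have "\<not> a < \<bar>x\<bar>" "\<not> T' < \<bar>t\<bar>" using z T'(2) by (auto simp: D_def)
        then show "x \<in> {-a..a} \<and> t \<in> {-T'..T'}" by auto
      qed
      then have sub: "closure {z. D 0 0 z \<noteq> 0} \<subseteq> {-a..a} \<times> {-T'..T'}" by (rule closure_minimal[OF _ cl])
      then have "compact (closure {z. D 0 0 z \<noteq> 0})" using compact_Int_closed[OF co closed_closure, of "{z. D 0 0 z \<noteq> 0}"] by (simp add: inf.absorb2)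
      then show ?thesis unfolding test_support_def using sub T'(1) by fastforce
    qed
    have e1: "(LINT \<xi>|lborel. U t \<xi> * ift (\<lambda>x. D 0 2 (x, t) - D 2 0 (x, t)) \<xi>)
        = complex_of_real (\<theta> 2 t) * pr (U t) g + complex_of_real (\<theta> 0 t) * pr (U t) (wsq g)" if t: "t \<in> I" for t
    proof -
      have "ift (\<lambda>x. D 0 2 (x, t) - D 2 0 (x, t)) \<xi> = complex_of_real (\<theta> 2 t) * g \<xi> + complex_of_real (\<theta> 0 t) * wsq g \<xi>" for \<xi>
      proof -
        have "ift (\<lambda>x. D 0 2 (x, t) - D 2 0 (x, t)) \<xi>
          = (LINT x|lborel. complex_of_real (\<theta> 2 t) * (cis (2 * pi * x * \<xi>) * ?p 0 x) - complex_of_real (\<theta> 0 t) * (cis (2 * pi * x * \<xi>) * ?p 2 x))"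
          unfolding ift_def D_def by (intro Bochner_Integration.integral_cong refl) (simp add: algebra_simps)
        also have "\<dots> = complex_of_real (\<theta> 2 t) * iftc (?p 0) \<xi> - complex_of_real (\<theta> 0 t) * iftc (?p 2) \<xi>"
          unfolding iftc_def
          by (subst Bochner_Integration.integral_diff) (auto intro!: integrable_mult_right integrable_cis_mult ip)
        finally show ?thesis by (simp add: two g_def)
      qed
      then have "(LINT \<xi>|lborel. U t \<xi> * ift (\<lambda>x. D 0 2 (x, t) - D 2 0 (x, t)) \<xi>)
         = pr (U t) (\<lambda>\<xi>. complex_of_real (\<theta> 2 t) * g \<xi> + complex_of_real (\<theta> 0 t) * wsq g \<xi>)"
        by (simp add: pr_def)
      also have "\<dots> = complex_of_real (\<theta> 2 t) * pr (U t) g + complex_of_real (\<theta> 0 t) * pr (U t) (wsq g)"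
        by (subst pr_add_right[OF UH[OF t] Hs_cmult[OF Hs2(1)[OF gH]] Hs_cmult[OF wsq_Hs[OF gH]]]) (simp add: pr_cmult_right)
      finally show ?thesis .
    qed
    have e2: "(LINT \<xi>|lborel. conv_power (U t) q \<xi> * ift (\<lambda>x. D 0 0 (x, t)) \<xi>) = complex_of_real (\<theta> 0 t) * pr (N t) g" for t
    proof -
      have "ift (\<lambda>x. D 0 0 (x, t)) \<xi> = complex_of_real (\<theta> 0 t) * g \<xi>" for \<xi>
      proof -
        have "ift (\<lambda>x. D 0 0 (x, t)) \<xi> = (LINT x|lborel. complex_of_real (\<theta> 0 t) * (cis (2 * pi * x * \<xi>) * ?p 0 x))"
          unfolding ift_def D_def by (intro Bochner_Integration.integral_cong refl) simp
        then show ?thesis by (simp add: g_def iftc_def)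
      qed
      then show ?thesis by (simp add: pr_def N_def mult.left_commute)
    qed
    let ?A = "\<lambda>t. complex_of_real (\<theta> 2 t) * pr (U t) g + complex_of_real (\<theta> 0 t) * pr (U t) (wsq g)"
    let ?B = "\<lambda>t. complex_of_real (\<theta> 0 t) * pr (N t) g"
    have si1: "set_integrable lborel I ?A"
      by (intro borel_integrable_atLeastAtMost' continuous_intros smooth1_continuous[OF \<theta>]
          pr_continuous[OF UH U_cont Hs2(1)[OF gH]] pr_continuous[OF UH U_cont wsq_Hs[OF gH]])
    have si2: "set_integrable lborel I ?B"
      by (intro borel_integrable_atLeastAtMost' continuous_intros smooth1_continuous[OF \<theta>]
          pr_continuous[OF NH N_cont Hs2(2)[OF gH]])
    note si = si1 si2
    have "(LBINT t:{-T<..<T}. ?A t) = (LBINT t:{-T<..<T}. (LINT \<xi>|lborel. U t \<xi> * ift (\<lambda>x. D 0 2 (x, t) - D 2 0 (x, t)) \<xi>))"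
      by (intro set_lebesgue_integral_cong) (auto simp: e1)
    also have "\<dots> = complex_of_real \<sigma> * (LBINT t:{-T<..<T}. ?B t)"
      using weak[OF sf ts] unfolding e2 .
    finally have "(LBINT t:I. ?A t) = complex_of_real \<sigma> * (LBINT t:I. ?B t)"
      by (simp only: set_integral_Ioo_eq_Icc[OF si(1)] set_integral_Ioo_eq_Icc[OF si(2)])
    then have "(LBINT t:I. ?A t - complex_of_real \<sigma> * ?B t) = 0"
      using si by (subst set_integral_diff(2)) (auto simp: set_integrable_mult_right)
    moreover have "?A t - complex_of_real \<sigma> * ?B t = J \<theta> g t" for t
      by (simp add: J_def h_def algebra_simps)
    ultimately show ?thesis by (simp add: set_lebesgue_integral_def)
  qed
  then show ?thesis unfolding good_def g_def[symmetric] using gH by blast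
qed

text \<open>\<open>good\<close> is closed under complex linear combinations, so real and imaginary
  parts can be treated separately. Complex profiles arise as cut-offs of Fourier transforms.\<close>

lemma good_iftc:
  fixes \<psi> :: "nat \<Rightarrow> real \<Rightarrow> complex"
  assumes \<psi>: "smooth1 \<psi>" and z: "\<And>n x. a < \<bar>x\<bar> \<Longrightarrow> \<psi> n x = 0"
  shows "good (iftc (\<psi> 0))"
proof -
  have i: "integrable lborel (\<psi> 0)" by (rule compact_support_integrable[OF smooth1_continuous[OF \<psi>] z])
  have g1: "good (iftc (\<lambda>x. complex_of_real (Re (\<psi> 0 x))))"
    by (rule good_real[of "\<lambda>n x. Re (\<psi> n x)" a, OF smooth1_bounded_linear[OF \<psi> bounded_linear_Re]]) (simp add: z)
  have g2: "good (iftc (\<lambda>x. complex_of_real (Im (\<psi> 0 x))))"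
    by (rule good_real[of "\<lambda>n x. Im (\<psi> n x)" a, OF smooth1_bounded_linear[OF \<psi> bounded_linear_Im]]) (simp add: z)
  have "iftc (\<psi> 0) = (\<lambda>\<xi>. iftc (\<lambda>x. complex_of_real (Re (\<psi> 0 x))) \<xi> + \<i> * iftc (\<lambda>x. complex_of_real (Im (\<psi> 0 x))) \<xi>)"
  proof
    fix \<xi>
    have i1: "integrable lborel (\<lambda>x. cis (2 * pi * x * \<xi>) * complex_of_real (Re (\<psi> 0 x)))"
      and i2: "integrable lborel (\<lambda>x. \<i> * (cis (2 * pi * x * \<xi>) * complex_of_real (Im (\<psi> 0 x))))"
      using i by (auto intro!: integrable_cis_mult integrable_mult_right)
    have "iftc (\<psi> 0) \<xi> = (LINT x|lborel. cis (2 * pi * x * \<xi>) * complex_of_real (Re (\<psi> 0 x)) + \<i> * (cis (2 * pi * x * \<xi>) * complex_of_real (Im (\<psi> 0 x))))"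
      unfolding iftc_def
      by (intro Bochner_Integration.integral_cong refl) (subst complex_eq[of "\<psi> 0 _"], simp add: algebra_simps)
    then show "iftc (\<psi> 0) \<xi> = iftc (\<lambda>x. complex_of_real (Re (\<psi> 0 x))) \<xi> + \<i> * iftc (\<lambda>x. complex_of_real (Im (\<psi> 0 x))) \<xi>"
      using i1 i2 by (simp add: iftc_def)
  qed
  then show ?thesis using good_add[OF g1 good_cmult[OF g2, of \<i>]] by simp
qed

end

section \<open>Approximating multipliers by transforms of test functions\<close>

lemma wt_nat: "wt (- real k) x = 1 / (1 + x\<^sup>2) ^ k"
  using one_plus_square_pos[of x] by (simp add: wt_def powr_minus_divide powr_realpow)

text \<open>Peetre's inequality for the fourth power of the bracket, uniform in the scale
  \<open>e\<close>. The starting point is that (\<xi> - 2 e z)^2 is nonnegative; squaring the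
  resulting factor 2 gives the constant 4.\<close>

lemma wt_Peetre:
  assumes "\<bar>e\<bar> \<le> 1"
  shows "wt (-2) (\<xi> - e * z) \<le> 4 * wt (-2) \<xi> * wt 2 z"
proof -
  have ez: "(e * z)\<^sup>2 \<le> z\<^sup>2"
    using assms mult_right_mono[of "\<bar>e\<bar>" 1 "\<bar>z\<bar>"] by (subst abs_le_square_iff[symmetric]) (simp add: abs_mult)
  have "\<xi>\<^sup>2 \<le> 2 * (\<xi> - e * z)\<^sup>2 + 2 * (e * z)\<^sup>2"
    using zero_le_power2[of "\<xi> - 2 * (e * z)"] by (simp add: power2_eq_square algebra_simps)
  then have "1 + \<xi>\<^sup>2 \<le> 2 * (1 + (\<xi> - e * z)\<^sup>2) * (1 + (e * z)\<^sup>2)"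
    by (simp add: algebra_simps) (smt (verit) zero_le_mult_iff zero_le_power2)
  also have "\<dots> \<le> 2 * (1 + (\<xi> - e * z)\<^sup>2) * (1 + z\<^sup>2)"
    using ez by (intro mult_left_mono) auto
  finally have 1: "1 + \<xi>\<^sup>2 \<le> 2 * (1 + (\<xi> - e * z)\<^sup>2) * (1 + z\<^sup>2)" .
  have "(1 + \<xi>\<^sup>2)\<^sup>2 \<le> (2 * (1 + (\<xi> - e * z)\<^sup>2) * (1 + z\<^sup>2))\<^sup>2"
    by (rule power_mono[OF 1]) (simp add: add_nonneg_nonneg)
  then have 2: "(1 + \<xi>\<^sup>2)\<^sup>2 \<le> 4 * (1 + (\<xi> - e * z)\<^sup>2)\<^sup>2 * (1 + z\<^sup>2)\<^sup>2"
    unfolding power_mult_distrib[of "2 * (1 + (\<xi> - e * z)\<^sup>2)"] power_mult_distrib[of 2] by simp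
  have w2: "wt (-2) x = 1 / (1 + x\<^sup>2)\<^sup>2" for x using wt_nat[of 2 x] by simp
  have w3: "wt 2 x = (1 + x\<^sup>2)\<^sup>2" for x
    using one_plus_square_pos[of x] by (simp add: wt_def flip: powr_numeral)
  show ?thesis unfolding w2 w3
    using 2 one_plus_square_pos[of \<xi>] one_plus_square_pos[of "\<xi> - e * z"]
    by (simp add: divide_le_eq le_divide_eq field_simps)
qed

lemma compact_support_decay:
  fixes g :: "real \<Rightarrow> complex"
  assumes B: "\<And>x. cmod (g x) \<le> B" and z: "\<And>x. \<rho> < \<bar>x\<bar> \<Longrightarrow> g x = 0"
  shows "cmod (g x) \<le> B * wt 2 \<rho> * wt (-2) x"
proof (cases "\<rho> < \<bar>x\<bar>")
  case True
  have "0 \<le> B" using order_trans[OF norm_ge_zero B] .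
  then show ?thesis by (simp add: z[OF True])
next
  case False
  have "wt (-2) \<rho> \<le> wt (-2) x" using False by (intro wt_antimono) auto
  then have "wt 2 \<rho> * wt (-2) \<rho> \<le> wt 2 \<rho> * wt (-2) x" by (intro mult_left_mono) auto
  then have "1 \<le> wt 2 \<rho> * wt (-2) x" by (simp add: wt_add)
  moreover have "0 \<le> B" using order_trans[OF norm_ge_zero B] .
  ultimately have "B * 1 \<le> B * (wt 2 \<rho> * wt (-2) x)" by (intro mult_left_mono)
  then show ?thesis using B[of x] by (simp add: mult.assoc)
qed

lemma compact_support_bounded:
  fixes g :: "real \<Rightarrow> complex"
  assumes c: "continuous_on UNIV g" and z: "\<And>x. \<rho> < \<bar>x\<bar> \<Longrightarrow> g x = 0"
  shows "\<exists>B. \<forall>x. cmod (g x) \<le> B"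
proof -
  have "compact (g ` {-\<rho>..\<rho>})" by (intro compact_continuous_image continuous_on_subset[OF c]) auto
  then obtain B where B: "\<forall>y\<in>g ` {-\<rho>..\<rho>}. norm y \<le> B" using compact_imp_bounded bounded_iff by blast
  have "cmod (g x) \<le> max B 0" for x
  proof (cases "\<rho> < \<bar>x\<bar>")
    case False
    then have "g x \<in> g ` {-\<rho>..\<rho>}" by (intro imageI) auto
    then have "norm (g x) \<le> B" using B by blast
    then show ?thesis by simp
  qed (simp add: z)
  then show ?thesis by blast
qed

text \<open>Compact support of \<open>g\<close> makes all its moments integrable, and each moment
  dominates one differentiation under the integral.\<close>

lemma fourier_smooth:
  fixes g :: "real \<Rightarrow> complex"
  assumes c: "continuous_on UNIV g" and z: "\<And>x. \<rho> < \<bar>x\<bar> \<Longrightarrow> g x = 0"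
  shows "smooth1 (\<lambda>n x. LINT \<eta>|lborel. cis (- (2 * pi * \<eta>) * x) * ((\<i> * complex_of_real (- (2 * pi * \<eta>))) ^ n * g \<eta>))"
  unfolding smooth1_def
proof (intro allI)
  fix n x
  let ?m = "\<lambda>n \<eta>. (\<i> * complex_of_real (- (2 * pi * \<eta>))) ^ n * g \<eta>"
  have i: "integrable lborel (?m n)" for n
    by (rule compact_support_integrable[of _ \<rho>]) (use z in \<open>auto intro!: continuous_intros c\<close>)
  have [measurable]: "?m n \<in> borel_measurable borel" for n using borel_measurable_integrable[OF i] by simp
  show "((\<lambda>x. LINT \<eta>|lborel. cis (- (2 * pi * \<eta>) * x) * ?m n \<eta>) has_vector_derivative
     (LINT \<eta>|lborel. cis (- (2 * pi * \<eta>) * x) * ?m (Suc n) \<eta>)) (at x)"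
  proof (rule has_vector_derivative_under_integral[where B="\<lambda>\<eta>. cmod (?m (Suc n) \<eta>)"])
    show "((\<lambda>x. cis (- (2 * pi * \<eta>) * x) * ?m n \<eta>) has_vector_derivative cis (- (2 * pi * \<eta>) * x) * ?m (Suc n) \<eta>) (at x)" for x \<eta>
      using has_vector_derivative_mult_left[OF cis_vector_derivative[of "- (2 * pi * \<eta>)" x UNIV], of "?m n \<eta>"]
      by (simp only: power_Suc ac_simps)
    show "integrable lborel (\<lambda>\<eta>. cis (- (2 * pi * \<eta>) * x) * ?m n \<eta>)" for x
      by (rule integrable_cis_mult[OF i]) measurable
    show "(\<lambda>\<eta>. cis (- (2 * pi * \<eta>) * x) * ?m (Suc n) \<eta>) \<in> borel_measurable lborel" for x
      using borel_measurable_integrable[OF integrable_cis_mult[OF i[of "Suc n"], of "\<lambda>\<eta>. - (2 * pi * \<eta>) * x"]] by simp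
    show "integrable lborel (\<lambda>\<eta>. cmod (?m (Suc n) \<eta>))" by (rule integrable_norm[OF i])
    show "norm (cis (- (2 * pi * \<eta>) * x) * ?m (Suc n) \<eta>) \<le> cmod (?m (Suc n) \<eta>)" for x \<eta>
      by (simp only: norm_mult norm_cis mult_1_left order_refl)
  qed
qed

text \<open>Cutting off the Fourier transform of \<open>g\<close> mollifies \<open>g\<close>.\<close>

lemma iftc_cutoff:
  fixes g :: "real \<Rightarrow> complex" and b :: "real \<Rightarrow> complex"
  assumes e: "0 < e" and g: "integrable lborel g" and b: "integrable lborel b"
  shows "iftc (\<lambda>x. b (e * x) * (LINT \<eta>|lborel. cis (- (2 * pi * \<eta>) * x) * g \<eta>)) \<xi>
    = (LINT z|lborel. g (\<xi> - e * z) * iftc b z)"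
proof -
  have [measurable]: "g \<in> borel_measurable borel" "b \<in> borel_measurable borel" using g b by auto
  have be: "integrable lborel (\<lambda>x. b (0 + e * x))" using e by (intro lborel_integrable_real_affine[OF b]) auto
  define H where "H x \<eta> = cis (2 * pi * x * \<xi>) * (b (e * x) * (cis (- (2 * pi * \<eta>) * x) * g \<eta>))" for x \<eta>
  have "iftc (\<lambda>x. b (e * x) * (LINT \<eta>|lborel. cis (- (2 * pi * \<eta>) * x) * g \<eta>)) \<xi> = (LINT x|lborel. LINT \<eta>|lborel. H x \<eta>)"
    unfolding iftc_def H_def by simp
  also have "\<dots> = (LINT \<eta>|lborel. LINT x|lborel. H x \<eta>)"
  proof (rule Fubini_dominated[symmetric, where f="\<lambda>x. cmod (b (e * x))" and g="\<lambda>\<eta>. cmod (g \<eta>)"])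
    show "case_prod H \<in> borel_measurable (borel \<Otimes>\<^sub>M borel)" unfolding H_def case_prod_beta' by measurable
    show "integrable lborel (\<lambda>x. cmod (b (e * x)))" using integrable_norm[OF be] by simp
  qed (auto simp: H_def norm_mult integrable_norm[OF g])
  also have "\<dots> = (LINT \<eta>|lborel. g \<eta> * ((1 / e) *\<^sub>R iftc b ((\<xi> - \<eta>) / e)))"
  proof (intro Bochner_Integration.integral_cong refl)
    fix \<eta>
    have "(LINT x|lborel. H x \<eta>) = (LINT x|lborel. g \<eta> * (cis (2 * pi * x * (\<xi> - \<eta>)) * b (e * x)))"
    proof (intro Bochner_Integration.integral_cong refl)
      fix x
      have "H x \<eta> = (cis (2 * pi * x * \<xi>) * cis (- (2 * pi * \<eta>) * x)) * (b (e * x) * g \<eta>)"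
        unfolding H_def by (simp only: ac_simps)
      also have "cis (2 * pi * x * \<xi>) * cis (- (2 * pi * \<eta>) * x) = cis (2 * pi * x * (\<xi> - \<eta>))"
        unfolding cis_mult by (rule arg_cong[where f=cis]) (simp add: algebra_simps)
      finally show "H x \<eta> = g \<eta> * (cis (2 * pi * x * (\<xi> - \<eta>)) * b (e * x))"
        by (simp only: ac_simps)
    qed
    also have "\<dots> = g \<eta> * (LINT x|lborel. cis (2 * pi * x * (\<xi> - \<eta>)) * b (e * x))" by simp
    also have "(LINT x|lborel. cis (2 * pi * x * (\<xi> - \<eta>)) * b (e * x))
        = \<bar>1 / e\<bar> *\<^sub>R (LINT y|lborel. cis (2 * pi * (0 + 1 / e * y) * (\<xi> - \<eta>)) * b (e * (0 + 1 / e * y)))"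
      using e by (intro lborel_integral_real_affine) auto
    also have "\<dots> = (1 / e) *\<^sub>R iftc b ((\<xi> - \<eta>) / e)"
      using e by (simp add: iftc_def)
    finally show "(LINT x|lborel. H x \<eta>) = g \<eta> * ((1 / e) *\<^sub>R iftc b ((\<xi> - \<eta>) / e))" .
  qed
  \<comment> \<open>Substitution \<open>\<eta> = \<xi> - e z\<close>; the Jacobian cancels the
    factor 1/e.\<close>
  also have "\<dots> = \<bar>- e\<bar> *\<^sub>R (LINT z|lborel. g (\<xi> + - e * z) * ((1 / e) *\<^sub>R iftc b ((\<xi> - (\<xi> + - e * z)) / e)))"
    using e by (intro lborel_integral_real_affine) auto
  also have "\<dots> = (LINT z|lborel. g (\<xi> - e * z) * iftc b z)"
    using e by (simp add: scaleR_conv_of_real)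
  finally show ?thesis .
qed

lemma norm_integral_le_integral:
  fixes f :: "real \<Rightarrow> complex"
  assumes g: "integrable lborel g" and le: "\<And>x. norm (f x) \<le> g x"
  shows "norm (LINT x|lborel. f x) \<le> (LINT x|lborel. g x)"
proof -
  have "0 \<le> (LINT x|lborel. g x)"
    using order_trans[OF norm_ge_zero le] by (intro Bochner_Integration.integral_nonneg)
  moreover have "norm (LINT x|lborel. f x) \<le> (LINT x|lborel. g x)" if "integrable lborel f"
    by (rule order_trans[OF integral_norm_bound integral_mono[OF integrable_norm[OF that] g le]])
  ultimately show ?thesis by (cases "integrable lborel f") (auto simp: not_integrable_integral_eq)
qed

context wsol
begin

lemma bd_decay2: "\<exists>E. bd (2 - s) (\<lambda>x. ennreal (wt (-2) x)) E"
  using bd_wt[of 2 "2 - s"] s by auto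

text \<open>A bump of width 1/e times the Fourier transform of \<open>g\<close> is an admissible
  profile, and its inverse transform is \<open>g\<close> mollified at scale \<open>e\<close> by the
  transform \<open>X\<close> of the bump. Peetre's inequality supplies a majorant uniform in the
  scale, so the mollifications converge in H^(2-s).\<close>

lemma good_Cc:
  fixes g :: "real \<Rightarrow> complex"
  assumes c: "continuous_on UNIV g" and z: "\<And>x. \<rho> < \<bar>x\<bar> \<Longrightarrow> g x = 0"
  shows "good g"
proof -
  obtain \<beta> :: "nat \<Rightarrow> real \<Rightarrow> real" where \<beta>: "smooth1 \<beta>" "\<And>n x. 1 \<le> \<bar>x\<bar> \<Longrightarrow> \<beta> n x = 0"
    "\<And>x. \<bar>x\<bar> < 1 \<Longrightarrow> 0 < \<beta> 0 x"
    using exists_bump by blast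
  let ?b = "\<lambda>n x. complex_of_real (\<beta> n x)"
  have b: "smooth1 ?b" by (rule smooth1_bounded_linear[OF \<beta>(1) bounded_linear_of_real])
  have bz: "?b n x = 0" if "1 < \<bar>x\<bar>" for n x using \<beta>(2)[of x n] that by simp
  have ib: "integrable lborel (?b 0)" by (rule compact_support_integrable[OF smooth1_continuous[OF b] bz])
  have ig: "integrable lborel g" by (rule compact_support_integrable[OF c z])
  have [measurable]: "g \<in> borel_measurable borel" "?b 0 \<in> borel_measurable borel"
    using borel_measurable_integrable[OF ig] borel_measurable_integrable[OF ib] by simp_all
  define X where "X = iftc (?b 0)"
  have [measurable]: "X \<in> borel_measurable borel" unfolding X_def by measurable
  \<comment> \<open>Three factors of decay, because Peetre's inequality spends \<open>wt 2\<close>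
    and the remaining \<open>wt (-1)\<close> is integrable.\<close>
  obtain C where C: "C \<ge> 0" "\<And>\<xi>. cmod (X \<xi>) \<le> C * wt (- 3) \<xi>"
    using iftc_decay[OF b bz, where n=0 and k=3] unfolding X_def by auto
  have iX: "integrable lborel X"
    by (rule Bochner_Integration.integrable_bound[OF integrable_mult_right[OF integrable_wt[of 3], of C]])
       (use C in \<open>auto simp: abs_mult\<close>)
  \<comment> \<open>The mollifications tend to \<open>k * g\<close>. Only
    \<open>k \<noteq> 0\<close> matters, since linearity allows division by \<open>k\<close> at the
    end.\<close>
  define k where "k = (LINT \<xi>|lborel. X \<xi>)"
  have k0: "k \<noteq> 0" unfolding k_def X_def
    by (rule integral_iftc_bump_nonzero[OF \<beta>(1,2)]) (use \<beta>(3)[of 0] iX in \<open>auto simp: X_def\<close>)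
  obtain B where B: "\<And>x. cmod (g x) \<le> B" using compact_support_bounded[OF c z] by blast
  have B0: "0 \<le> B" using order_trans[OF norm_ge_zero B] .
  define G where "G = B * wt 2 \<rho>"
  have G0: "0 \<le> G" using B0 by (simp add: G_def)
  have Gd: "cmod (g x) \<le> G * wt (-2) x" for x unfolding G_def by (rule compact_support_decay[OF B z])
  define e where "e n = 1 / real (Suc n)" for n
  have e: "0 < e n" "e n \<le> 1" for n by (auto simp: e_def)
  have e0: "e \<longlonglongrightarrow> 0" unfolding e_def by (rule LIMSEQ_Suc[OF lim_1_over_n])
  define gh where "gh n x = (LINT \<eta>|lborel. cis (- (2 * pi * \<eta>) * x) * ((\<i> * complex_of_real (- (2 * pi * \<eta>))) ^ n * g \<eta>))" for n x
  have gh: "smooth1 gh" unfolding gh_def[abs_def] by (rule fourier_smooth[OF c z])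
  \<comment> \<open>The Leibniz sequence of derivatives of the product of the rescaled bump and the
    Fourier transform of \<open>g\<close>.\<close>
  define \<psi> where "\<psi> j n x = (\<Sum>i\<le>n. of_nat (n choose i) * ((e j ^ i) *\<^sub>R ?b i (0 + e j * x) * gh (n - i) x))" for j n x
  have \<psi>: "smooth1 (\<psi> j)" for j
    unfolding \<psi>_def[abs_def] by (rule smooth1_mult[OF smooth1_affine[OF b] gh])
  have \<psi>z: "\<psi> j n x = 0" if "1 / e j < \<bar>x\<bar>" for j n x
  proof -
    have "1 < \<bar>0 + e j * x\<bar>" using that e[of j] by (simp add: abs_mult divide_less_eq mult.commute)
    then show ?thesis unfolding \<psi>_def by (simp add: \<beta>(2))
  qed
  define gk where "gk j = iftc (\<psi> j 0)" for j
  have good_gk: "good (gk j)" for j unfolding gk_def by (rule good_iftc[OF \<psi> \<psi>z])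
  have gk_eq: "gk j \<xi> = (LINT z|lborel. g (\<xi> - e j * z) * X z)" for j \<xi>
  proof -
    have "\<psi> j 0 = (\<lambda>x. ?b 0 (e j * x) * (LINT \<eta>|lborel. cis (- (2 * pi * \<eta>) * x) * g \<eta>))"
      by (simp add: \<psi>_def gh_def fun_eq_iff)
    then show ?thesis unfolding gk_def X_def using iftc_cutoff[OF e(1)[of j] ig ib, of \<xi>] by simp
  qed
  have gkm [measurable]: "gk j \<in> borel_measurable borel" for j
    using good_gk[of j] unfolding good_def by (auto dest: Hs_measurable)
  define D where "D = 4 * G * C * (LINT z|lborel. wt (-1) z)"
  have D0: "0 \<le> D" unfolding D_def using G0 C(1) by (intro mult_nonneg_nonneg Bochner_Integration.integral_nonneg) auto
  have gk_le: "cmod (gk j \<xi>) \<le> D * wt (-2) \<xi>" for j \<xi>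
  proof -
    have "cmod (gk j \<xi>) \<le> (LINT z|lborel. (4 * G * C * wt (-2) \<xi>) * wt (-1) z)"
      unfolding gk_eq
    proof (rule norm_integral_le_integral)
      show "integrable lborel (\<lambda>z. (4 * G * C * wt (-2) \<xi>) * wt (-1) z)"
        by (intro integrable_mult_right integrable_wt) simp
      fix z
      have "cmod (g (\<xi> - e j * z)) * cmod (X z) \<le> (G * (4 * wt (-2) \<xi> * wt 2 z)) * (C * wt (-3) z)"
      proof (intro mult_mono C(2))
        have "cmod (g (\<xi> - e j * z)) \<le> G * wt (-2) (\<xi> - e j * z)" by (rule Gd)
        also have "\<dots> \<le> G * (4 * wt (-2) \<xi> * wt 2 z)" using e[of j] G0 by (intro mult_left_mono wt_Peetre) auto
        finally show "cmod (g (\<xi> - e j * z)) \<le> G * (4 * wt (-2) \<xi> * wt 2 z)" .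
      qed (use G0 in auto)
      also have "\<dots> = (4 * G * C * wt (-2) \<xi>) * (wt 2 z * wt (-3) z)" by (simp only: ac_simps)
      also have "wt 2 z * wt (-3) z = wt (-1) z" by (simp add: wt_add)
      finally show "norm (g (\<xi> - e j * z) * X z) \<le> (4 * G * C * wt (-2) \<xi>) * wt (-1) z" by (simp add: norm_mult)
    qed
    then show ?thesis by (simp add: D_def ac_simps)
  qed
  have gk_lim: "(\<lambda>j. gk j \<xi>) \<longlonglongrightarrow> k * g \<xi>" for \<xi>
  proof -
    have "(\<lambda>j. LINT z|lborel. g (\<xi> - e j * z) * X z) \<longlonglongrightarrow> (LINT z|lborel. g \<xi> * X z)"
    proof (rule integral_dominated_convergence[where w="\<lambda>z. B * cmod (X z)"])
      show "AE z in lborel. (\<lambda>j. g (\<xi> - e j * z) * X z) \<longlonglongrightarrow> g \<xi> * X z"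
      proof (rule AE_I2)
        fix z
        have "(\<lambda>j. \<xi> - e j * z) \<longlonglongrightarrow> \<xi> - 0 * z" by (intro tendsto_intros e0)
        moreover have "isCont g (\<xi> - 0 * z)" using c by (simp add: continuous_on_eq_continuous_at)
        ultimately have "(\<lambda>j. g (\<xi> - e j * z)) \<longlonglongrightarrow> g (\<xi> - 0 * z)" by (rule isCont_tendsto_compose[rotated])
        then show "(\<lambda>j. g (\<xi> - e j * z) * X z) \<longlonglongrightarrow> g \<xi> * X z" by (intro tendsto_intros) simp
      qed
    qed (use iX B in \<open>auto simp: norm_mult intro!: mult_right_mono\<close>)
    then show ?thesis by (simp add: gk_eq k_def mult.commute)
  qed
  have "good (\<lambda>\<xi>. k * g \<xi>)"
  proof (rule good_limit[OF good_gk])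
    have gH: "g \<in> Hs (2 - s) UNIV" by (rule decay_Hs[OF _ Gd]) (use s in auto)
    then show "(\<lambda>\<xi>. k * g \<xi>) \<in> Hs (2 - s) UNIV" by (rule Hs_cmult)
    obtain E where E: "bd (2 - s) (\<lambda>x. ennreal (wt (-2) x)) E" using bd_decay2 by blast
    show "(\<lambda>j. hsnorm (2 - s) (\<lambda>\<xi>. gk j \<xi> - k * g \<xi>)) \<longlonglongrightarrow> 0"
    proof (rule hsnorm_tendsto_0[OF _ bd_cmult[OF E, of "D + cmod k * G"]])
      show "AE x in lborel. cn (\<lambda>\<xi>. gk j \<xi> - k * g \<xi>) x \<le> ennreal (D + cmod k * G) * ennreal (wt (-2) x)" for j
      proof (rule AE_I2)
        fix x
        have "cmod (gk j x - k * g x) \<le> D * wt (-2) x + cmod k * (G * wt (-2) x)"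
          by (rule order_trans[OF norm_triangle_ineq4], unfold norm_mult, intro add_mono gk_le mult_left_mono Gd) auto
        then have "cmod (gk j x - k * g x) \<le> (D + cmod k * G) * wt (-2) x" by (simp add: algebra_simps)
        then have "cn (\<lambda>\<xi>. gk j \<xi> - k * g \<xi>) x \<le> ennreal ((D + cmod k * G) * wt (-2) x)"
          unfolding cn_def by (rule ennreal_leI)
        also have "\<dots> = ennreal (D + cmod k * G) * ennreal (wt (-2) x)"
          using D0 G0 by (intro ennreal_mult) auto
        finally show "cn (\<lambda>\<xi>. gk j \<xi> - k * g \<xi>) x \<le> ennreal (D + cmod k * G) * ennreal (wt (-2) x)" .
      qed
      show "AE x in lborel. (\<lambda>j. gk j x - k * g x) \<longlonglongrightarrow> 0" by (intro AE_I2 LIM_zero gk_lim)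
    qed (use D0 G0 in auto)
  qed
  from good_cmult[OF this, of "1 / k"] show ?thesis using k0 by simp
qed

text \<open>Measurable multipliers are needed because the extremal functions in
  \<open>hsnorm_duality\<close> are built from a function known only up to null sets. Continuous
  functions converging almost everywhere are clipped in value and cut off in frequency, which gives
  them a common majorant.\<close>

lemma good_bounded:
  fixes g :: "real \<Rightarrow> complex"
  assumes m [measurable]: "g \<in> borel_measurable borel" and B: "\<And>x. cmod (g x) \<le> B" and z: "\<And>x. \<rho> < \<bar>x\<bar> \<Longrightarrow> g x = 0"
  shows "good g"
proof -
  have "g \<in> borel_measurable (lebesgue_on UNIV)"
    by (intro measurable_restrict_space1 measurable_completion) (simp add: m)
  then have "g measurable_on UNIV" by (subst measurable_on_iff_borel_measurable) auto
  then obtain N f where N: "negligible N" and f: "\<And>n. continuous_on UNIV (f n)"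
    and lim: "\<And>x. x \<notin> N \<Longrightarrow> (\<lambda>n. f n x) \<longlonglongrightarrow> g x"
    by (auto simp: measurable_on_def)
  have "AE x in lebesgue. x \<notin> N" using N by (intro AE_not_in) (simp add: negligible_iff_null_sets)
  then have AE_N: "AE x in lborel. x \<notin> N" by (simp add: AE_completion_iff)
  define B' where "B' = max B 1"
  have B': "0 < B'" "\<And>x. cmod (g x) \<le> B'" using B by (auto simp: B'_def le_max_iff_disj)
  \<comment> \<open>Radial projection onto the disc of radius \<open>B'\<close>; it is continuous
    because \<open>B' \<ge> 1\<close> keeps the denominator positive, and it fixes the values of
    \<open>g\<close>, so the limit is unchanged.\<close>
  define clip :: "complex \<Rightarrow> complex" where "clip w = complex_of_real (B' / max B' (cmod w)) * w" for w
  have clip_cont: "continuous_on UNIV clip"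
    unfolding clip_def using B'(1) by (intro continuous_intros) (auto simp: max_def)
  have clip_le: "cmod (clip w) \<le> B'" for w
  proof -
    have "cmod (clip w) = B' / max B' (cmod w) * cmod w"
      unfolding clip_def norm_mult norm_of_real using B'(1) by simp
    also have "\<dots> \<le> B' / max B' (cmod w) * max B' (cmod w)" using B'(1) by (intro mult_left_mono) auto
    also have "\<dots> = B'" using B'(1) by simp
    finally show ?thesis .
  qed
  have clip_id: "clip w = w" if "cmod w \<le> B'" for w
    using that B'(1) by (simp add: clip_def max_def)
  define cut :: "real \<Rightarrow> real" where "cut x = max 0 (min 1 (\<rho> + 1 - \<bar>x\<bar>))" for x
  have cut_cont: "continuous_on UNIV cut" unfolding cut_def by (intro continuous_intros)
  have cut: "0 \<le> cut x" "cut x \<le> 1" "\<rho> + 1 < \<bar>x\<bar> \<Longrightarrow> cut x = 0" "\<bar>x\<bar> \<le> \<rho> \<Longrightarrow> cut x = 1" for x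
    by (auto simp: cut_def)
  define gk where "gk n x = complex_of_real (cut x) * clip (f n x)" for n x
  have gkc: "continuous_on UNIV (gk n)" for n
    unfolding gk_def by (intro continuous_intros cut_cont continuous_on_compose2[OF clip_cont f]) auto
  have gkz: "gk n x = 0" if "\<rho> + 1 < \<bar>x\<bar>" for n x using cut(3)[OF that] by (simp add: gk_def)
  have gkB: "cmod (gk n x) \<le> B'" for n x
  proof -
    have "cmod (gk n x) \<le> 1 * B'" unfolding gk_def norm_mult using cut(1,2)[of x] clip_le by (intro mult_mono) auto
    then show ?thesis by simp
  qed
  have gm [measurable]: "gk n \<in> borel_measurable borel" for n by (rule borel_measurable_continuous_onI[OF gkc])
  have good_gk: "good (gk n)" for n by (rule good_Cc[OF gkc gkz])
  have gk_lim: "AE x in lborel. (\<lambda>n. gk n x - g x) \<longlonglongrightarrow> 0"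
    using AE_N
  proof eventually_elim
    case (elim x)
    have "isCont clip (g x)" using clip_cont by (simp add: continuous_on_eq_continuous_at)
    from isCont_tendsto_compose[OF this lim[OF elim]]
    have "(\<lambda>n. gk n x) \<longlonglongrightarrow> complex_of_real (cut x) * clip (g x)"
      unfolding gk_def by (intro tendsto_intros)
    also have "complex_of_real (cut x) * clip (g x) = g x"
      using clip_id[OF B'(2)[of x]] cut(4)[of x] z[of x] by (cases "\<rho> < \<bar>x\<bar>") auto
    finally show ?case by (rule LIM_zero)
  qed
  obtain E where E: "bd (2 - s) (\<lambda>x. ennreal (wt (-2) x)) E" using bd_decay2 by blast
  have gd: "cmod (g x) \<le> B' * wt 2 (\<rho> + 1) * wt (-2) x" for x
    by (rule compact_support_decay[OF B'(2)]) (use z in auto)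
  have gkd: "cmod (gk n x) \<le> B' * wt 2 (\<rho> + 1) * wt (-2) x" for n x
    by (rule compact_support_decay[OF gkB gkz])
  show ?thesis
  proof (rule good_limit[OF good_gk])
    show "g \<in> Hs (2 - s) UNIV" by (rule decay_Hs[OF m gd]) (use s in auto)
    show "(\<lambda>n. hsnorm (2 - s) (\<lambda>\<xi>. gk n \<xi> - g \<xi>)) \<longlonglongrightarrow> 0"
    proof (rule hsnorm_tendsto_0[OF _ bd_cmult[OF E, of "2 * (B' * wt 2 (\<rho> + 1))"] _ gk_lim])
      show "AE x in lborel. cn (\<lambda>\<xi>. gk n \<xi> - g \<xi>) x \<le> ennreal (2 * (B' * wt 2 (\<rho> + 1))) * ennreal (wt (-2) x)" for n
      proof (rule AE_I2)
        fix x
        have "cmod (gk n x - g x) \<le> 2 * (B' * wt 2 (\<rho> + 1)) * wt (-2) x"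
          using norm_triangle_ineq4[of "gk n x" "g x"] gkd[of n x] gd[of x] by simp
        then show "cn (\<lambda>\<xi>. gk n \<xi> - g \<xi>) x \<le> ennreal (2 * (B' * wt 2 (\<rho> + 1))) * ennreal (wt (-2) x)"
          using B'(1) by (simp add: cn_def ennreal_leI flip: ennreal_mult)
      qed
    qed (use B' in auto)
  qed
qed

text \<open>For a fixed multiplier all the functions of time involved are continuous, so the weak
  equation becomes a classical derivative on the closed interval.\<close>

lemma V_pr_deriv:
  assumes g: "good g" and t: "t \<in> I"
  shows "((\<lambda>t. pr (V t) g) has_vector_derivative h g t) (at t within I)"
proof -
  have gH: "g \<in> Hs (2 - s) UNIV" using g by (simp add: good_def)
  show ?thesis
  proof (rule weak_second_derivative[OF T _ _ h_cont[OF gH] _ t])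
    show "((\<lambda>t. pr (U t) g) has_vector_derivative pr (V t) g) (at t within I)" if "t \<in> I" for t
      by (rule U_pr_deriv[OF that Hs2(3)[OF gH]])
    show "continuous_on I (\<lambda>t. pr (V t) g)" by (rule pr_continuous[OF VH V_cont Hs2(2)[OF gH]])
    show "(LINT t|lborel. indicator I t *\<^sub>R (complex_of_real (\<theta> 2 t) * pr (U t) g - complex_of_real (\<theta> 0 t) * h g t)) = 0"
      if "time_test T \<theta>" for \<theta>
      using g that by (simp add: good_def J_def)
  qed
qed

end

section \<open>Energy inequality by duality\<close>

text \<open>Keeping the support away from the origin allows division by the frequency.\<close>

definition nice :: "(real \<Rightarrow> complex) \<Rightarrow> bool" where
  "nice g \<longleftrightarrow> g \<in> borel_measurable borel
     \<and> (\<exists>B \<rho> \<delta>. 0 < \<delta> \<and> (\<forall>x. cmod (g x) \<le> B) \<and> (\<forall>x. g x \<noteq> 0 \<longrightarrow> \<delta> \<le> \<bar>x\<bar> \<and> \<bar>x\<bar> \<le> \<rho>))"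

lemma nice_measurable: "nice g \<Longrightarrow> g \<in> borel_measurable borel"
  by (simp add: nice_def)

lemma nice_decay: "nice g \<Longrightarrow> \<exists>C\<ge>0. \<forall>x. cmod (g x) \<le> C * wt (-2) x"
proof -
  assume "nice g"
  then obtain B \<rho> where B: "\<And>x. cmod (g x) \<le> B" and z: "\<And>x. g x \<noteq> 0 \<Longrightarrow> \<bar>x\<bar> \<le> \<rho>" by (auto simp: nice_def)
  have "0 \<le> B * wt 2 \<rho>" using order_trans[OF norm_ge_zero B] by simp
  moreover have "cmod (g x) \<le> B * wt 2 \<rho> * wt (-2) x" for x
    by (rule compact_support_decay[OF B]) (use z in force)
  ultimately show ?thesis by blast
qed

lemma nice_Hs: "nice g \<Longrightarrow> r < 7/2 \<Longrightarrow> g \<in> Hs r UNIV"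
  using nice_decay[of g] nice_measurable[of g] decay_Hs by blast

lemma nice_mult:
  assumes g: "nice g" and [measurable]: "m \<in> borel_measurable borel"
    and b: "\<And>\<delta> \<rho>. 0 < \<delta> \<Longrightarrow> \<exists>C. \<forall>x. \<delta> \<le> \<bar>x\<bar> \<longrightarrow> \<bar>x\<bar> \<le> \<rho> \<longrightarrow> cmod (m x) \<le> C"
  shows "nice (\<lambda>x. m x * g x)"
proof -
  note [measurable] = nice_measurable[OF g]
  from g obtain B \<rho> \<delta> where \<delta>: "0 < \<delta>" and B: "\<And>x. cmod (g x) \<le> B" and z: "\<And>x. g x \<noteq> 0 \<Longrightarrow> \<delta> \<le> \<bar>x\<bar> \<and> \<bar>x\<bar> \<le> \<rho>"
    by (auto simp: nice_def)
  obtain C where C: "\<And>x. \<delta> \<le> \<bar>x\<bar> \<Longrightarrow> \<bar>x\<bar> \<le> \<rho> \<Longrightarrow> cmod (m x) \<le> C" using b[OF \<delta>] by blast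
  have B0: "0 \<le> B" using order_trans[OF norm_ge_zero B] .
  have "cmod (m x * g x) \<le> \<bar>C\<bar> * B" for x
  proof (cases "g x = 0")
    case False
    then have "cmod (m x) \<le> \<bar>C\<bar>" using C[of x] z[of x] by auto
    then show ?thesis unfolding norm_mult by (intro mult_mono B) auto
  qed (use B0 in auto)
  moreover have "m x * g x \<noteq> 0 \<longrightarrow> \<delta> \<le> \<bar>x\<bar> \<and> \<bar>x\<bar> \<le> \<rho>" for x using z[of x] by auto
  moreover have "(\<lambda>x. m x * g x) \<in> borel_measurable borel" by measurable
  ultimately show ?thesis unfolding nice_def using \<delta> by blast
qed

lemma nice_add:
  assumes "nice f" "nice g"
  shows "nice (\<lambda>x. f x + g x)"
proof -
  note [measurable] = assms[THEN nice_measurable]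
  from assms(1) obtain B \<rho> \<delta> where f: "0 < \<delta>" "\<And>x. cmod (f x) \<le> B" "\<And>x. f x \<noteq> 0 \<Longrightarrow> \<delta> \<le> \<bar>x\<bar> \<and> \<bar>x\<bar> \<le> \<rho>"
    by (auto simp: nice_def)
  from assms(2) obtain B' \<rho>' \<delta>' where g: "0 < \<delta>'" "\<And>x. cmod (g x) \<le> B'" "\<And>x. g x \<noteq> 0 \<Longrightarrow> \<delta>' \<le> \<bar>x\<bar> \<and> \<bar>x\<bar> \<le> \<rho>'"
    by (auto simp: nice_def)
  have "cmod (f x + g x) \<le> B + B'" for x using norm_triangle_mono[OF f(2) g(2)] .
  moreover have "f x + g x \<noteq> 0 \<longrightarrow> min \<delta> \<delta>' \<le> \<bar>x\<bar> \<and> \<bar>x\<bar> \<le> max \<rho> \<rho>'" for x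
    using f(3)[of x] g(3)[of x] by (cases "f x = 0"; cases "g x = 0") auto
  moreover have "(\<lambda>x. f x + g x) \<in> borel_measurable borel" by measurable
  moreover have "0 < min \<delta> \<delta>'" using f(1) g(1) by simp
  ultimately show ?thesis unfolding nice_def by blast
qed

lemma nice_bounded_mult:
  assumes "nice g" "m \<in> borel_measurable borel" "\<And>x. cmod (m x) \<le> C"
  shows "nice (\<lambda>x. m x * g x)"
  by (rule nice_mult[OF assms(1,2)]) (use assms(3) in blast)

lemma nice_freq: "nice g \<Longrightarrow> nice (\<lambda>x. complex_of_real (2 * pi * x) * g x)"
proof (rule nice_mult)
  fix \<delta> \<rho> :: real
  have "cmod (complex_of_real (2 * pi * x)) \<le> 2 * pi * \<rho>" if "\<bar>x\<bar> \<le> \<rho>" for x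
    unfolding norm_of_real abs_mult using that by (intro mult_mono) auto
  then show "\<exists>C. \<forall>x. \<delta> \<le> \<bar>x\<bar> \<longrightarrow> \<bar>x\<bar> \<le> \<rho> \<longrightarrow> cmod (complex_of_real (2 * pi * x)) \<le> C" by blast
qed auto

lemma nice_inverse_freq: "nice g \<Longrightarrow> nice (\<lambda>x. complex_of_real (1 / (2 * pi * x)) * g x)"
proof (rule nice_mult)
  fix \<delta> \<rho> :: real assume \<delta>: "0 < \<delta>"
  have "cmod (complex_of_real (1 / (2 * pi * x))) \<le> 1 / (2 * pi * \<delta>)" if "\<delta> \<le> \<bar>x\<bar>" for x
    unfolding norm_of_real abs_divide abs_mult using that \<delta> by (intro frac_le mult_mono) auto
  then show "\<exists>C. \<forall>x. \<delta> \<le> \<bar>x\<bar> \<longrightarrow> \<bar>x\<bar> \<le> \<rho> \<longrightarrow> cmod (complex_of_real (1 / (2 * pi * x))) \<le> C" by blast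
qed auto

text \<open>The extremal multiplier is the conjugate of \<open>F\<close> times the weight, truncated
  to \<open>S n\<close> so as to be nice. For it the pairing is \<open>a n\<close> and the dual norm
  its square root, so division gives the bound on \<open>a n\<close>. The sets \<open>S n\<close>
  exhaust all frequencies except 0.\<close>

lemma hsnorm_duality:
  assumes F: "F \<in> Hs r \<Gamma>" and B: "0 \<le> B"
    and le: "\<And>g. nice g \<Longrightarrow> cmod (pr F g) \<le> B * hsnorm (-r) g"
  shows "hsnorm r F \<le> B"
proof -
  note [measurable] = Hs_measurable[OF F]
  have iF: "integrable lborel (\<lambda>\<xi>. wt r \<xi> * (cmod (F \<xi>))\<^sup>2)"
    using F by (simp add: Hs_def wt_def)
  define S where "S n = {\<xi>. 1 / real (Suc n) \<le> \<bar>\<xi>\<bar> \<and> \<bar>\<xi>\<bar> \<le> real (Suc n) \<and> wt r \<xi> * cmod (F \<xi>) \<le> real (Suc n)}" for n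
  have [measurable]: "S n \<in> sets borel" for n unfolding S_def by measurable
  define a where "a n = (LINT \<xi>|lborel. indicator (S n) \<xi> * (wt r \<xi> * (cmod (F \<xi>))\<^sup>2))" for n
  have a0: "0 \<le> a n" for n unfolding a_def by (intro Bochner_Integration.integral_nonneg) auto
  have an: "a n \<le> B\<^sup>2" for n
  proof -
    define g where "g \<xi> = complex_of_real (indicator (S n) \<xi> * wt r \<xi>) * cnj (F \<xi>)" for \<xi>
    have [measurable]: "cnj \<in> borel_measurable borel"
      by (intro borel_measurable_continuous_onI continuous_intros)
    have "g \<in> borel_measurable borel" unfolding g_def by measurable
    moreover have "\<forall>x. cmod (g x) \<le> real (Suc n)"
      by (auto simp: g_def norm_mult indicator_def S_def abs_mult)
    moreover have "\<forall>x. g x \<noteq> 0 \<longrightarrow> 1 / real (Suc n) \<le> \<bar>x\<bar> \<and> \<bar>x\<bar> \<le> real (Suc n)"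
      by (auto simp: g_def indicator_def S_def split: if_splits)
    moreover have "0 < 1 / real (Suc n)" by simp
    ultimately have "nice g" unfolding nice_def by blast
    have "F \<xi> * g \<xi> = complex_of_real (indicator (S n) \<xi> * (wt r \<xi> * (cmod (F \<xi>))\<^sup>2))" for \<xi>
      unfolding g_def by (simp add: complex_norm_square[symmetric] mult.left_commute mult.commute)
    then have "pr F g = complex_of_real (a n)"
      unfolding pr_def a_def by (simp only: integral_complex_of_real)
    moreover have "hsnorm (-r) g = sqrt (a n)"
    proof -
      have "(1 + \<xi>\<^sup>2) powr - r * (cmod (g \<xi>))\<^sup>2 = indicator (S n) \<xi> * (wt r \<xi> * (cmod (F \<xi>))\<^sup>2)" for \<xi>
      proof -
        have 1: "(cmod (g \<xi>))\<^sup>2 = indicator (S n) \<xi> * ((wt r \<xi> * wt r \<xi>) * (cmod (F \<xi>))\<^sup>2)"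
          by (auto simp: g_def norm_mult indicator_def power_mult_distrib power2_eq_square)
        have 2: "wt (-r) \<xi> * (wt r \<xi> * wt r \<xi>) = wt r \<xi>" by (simp add: wt_add)
        have "wt (-r) \<xi> * (cmod (g \<xi>))\<^sup>2 = indicator (S n) \<xi> * ((wt (-r) \<xi> * (wt r \<xi> * wt r \<xi>)) * (cmod (F \<xi>))\<^sup>2)"
          unfolding 1 by (simp only: ac_simps)
        from this[unfolded 2] show ?thesis unfolding wt_def .
      qed
      then show ?thesis unfolding hsnorm_def a_def by simp
    qed
    ultimately have "a n \<le> B * sqrt (a n)" using le[OF \<open>nice g\<close>] a0[of n] by simp
    then have "sqrt (a n) * sqrt (a n) \<le> B * sqrt (a n)" using a0[of n] by simp
    have "sqrt (a n) \<le> B"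
    proof (cases "a n = 0")
      case False
      then have "0 < sqrt (a n)" using a0[of n] by simp
      then show ?thesis
        using \<open>sqrt (a n) * sqrt (a n) \<le> B * sqrt (a n)\<close> by (rule mult_right_le_imp_le[rotated])
    qed (simp add: B)
    then show ?thesis using a0[of n] by (simp add: sqrt_le_D)
  qed
  have "a \<longlonglongrightarrow> (LINT \<xi>|lborel. wt r \<xi> * (cmod (F \<xi>))\<^sup>2)"
    unfolding a_def
  proof (rule integral_dominated_convergence[OF _ _ iF])
    have "AE \<xi> in lborel. \<xi> \<noteq> (0::real)" by (rule AE_lborel_singleton)
    then show "AE \<xi> in lborel. (\<lambda>n. indicator (S n) \<xi> * (wt r \<xi> * (cmod (F \<xi>))\<^sup>2)) \<longlonglongrightarrow> wt r \<xi> * (cmod (F \<xi>))\<^sup>2"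
    proof eventually_elim
      case (elim \<xi>)
      obtain k :: nat where k: "1 / \<bar>\<xi>\<bar> + \<bar>\<xi>\<bar> + wt r \<xi> * cmod (F \<xi>) \<le> real k" using real_arch_simple by blast
      have "\<xi> \<in> S n" if "k \<le> n" for n
      proof -
        have p: "0 \<le> 1 / \<bar>\<xi>\<bar>" "0 \<le> \<bar>\<xi>\<bar>" "0 \<le> wt r \<xi> * cmod (F \<xi>)" "real k \<le> real (Suc n)" using that by auto
        then have "1 / \<bar>\<xi>\<bar> \<le> real (Suc n)" using k by linarith
        then have "1 / real (Suc n) \<le> \<bar>\<xi>\<bar>" using elim by (simp add: field_simps)
        moreover have "\<bar>\<xi>\<bar> \<le> real (Suc n)" "wt r \<xi> * cmod (F \<xi>) \<le> real (Suc n)" using k p by linarith+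
        ultimately show ?thesis unfolding S_def by blast
      qed
      then have "\<forall>\<^sub>F n in sequentially. wt r \<xi> * (cmod (F \<xi>))\<^sup>2 = indicator (S n) \<xi> * (wt r \<xi> * (cmod (F \<xi>))\<^sup>2)"
        unfolding eventually_sequentially by (intro exI[of _ k]) auto
      then show ?case by (rule Lim_transform_eventually[OF tendsto_const])
    qed
    show "AE \<xi> in lborel. norm (indicator (S n) \<xi> * (wt r \<xi> * (cmod (F \<xi>))\<^sup>2)) \<le> wt r \<xi> * (cmod (F \<xi>))\<^sup>2" for n
      by (auto simp: indicator_def)
  qed measurable
  then have "(LINT \<xi>|lborel. wt r \<xi> * (cmod (F \<xi>))\<^sup>2) \<le> B\<^sup>2"
    by (rule LIMSEQ_le_const2) (use an in auto)
  then show ?thesis unfolding hsnorm_def wt_def using B by (intro real_le_lsqrt) auto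
qed

lemma pr_product_deriv:
  assumes t: "t \<in> S" and W: "\<And>\<tau>. \<tau> \<in> S \<Longrightarrow> W \<tau> \<in> Hs r \<Gamma>"
    and c: "\<And>t. t \<in> S \<Longrightarrow> ((\<lambda>\<tau>. hsnorm r (\<lambda>\<xi>. W \<tau> \<xi> - W t \<xi>)) \<longlongrightarrow> 0) (at t within S)"
    and P: "\<And>\<tau>. P \<tau> \<in> Hs (-r) UNIV" and P': "P' \<in> Hs (-r) UNIV"
    and q: "((\<lambda>\<tau>. hsnorm (-r) (\<lambda>\<xi>. complex_of_real (1 / (\<tau> - t)) * (P \<tau> \<xi> - P t \<xi>) - P' \<xi>)) \<longlongrightarrow> 0) (at t within S)"
    and d: "((\<lambda>\<tau>. pr (W \<tau>) (P t)) has_vector_derivative D) (at t within S)"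
  shows "((\<lambda>\<tau>. pr (W \<tau>) (P \<tau>)) has_vector_derivative D + pr (W t) P') (at t within S)"
proof -
  define Q where "Q \<tau> = (\<lambda>\<xi>. complex_of_real (1 / (\<tau> - t)) * (P \<tau> \<xi> - P t \<xi>))" for \<tau>
  have Q: "Q \<tau> \<in> Hs (-r) UNIV" for \<tau> unfolding Q_def by (rule Hs_cmult[OF Hs_diff[OF P P]])
  have "((\<lambda>\<tau>. hsnorm r (W \<tau>)) \<longlongrightarrow> hsnorm r (W t)) (at t within S)"
    using hsnorm_continuous[OF W c] t by (auto simp: continuous_on_def)
  from tendsto_mult[OF this q[folded Q_def]]
  have "((\<lambda>\<tau>. hsnorm r (W \<tau>) * hsnorm (-r) (\<lambda>\<xi>. Q \<tau> \<xi> - P' \<xi>)) \<longlongrightarrow> 0) (at t within S)"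
    by (simp add: Q_def)
  then have "((\<lambda>\<tau>. pr (W \<tau>) (\<lambda>\<xi>. Q \<tau> \<xi> - P' \<xi>)) \<longlongrightarrow> 0) (at t within S)"
  proof (rule Lim_null_comparison[rotated])
    show "\<forall>\<^sub>F \<tau> in at t within S. cmod (pr (W \<tau>) (\<lambda>\<xi>. Q \<tau> \<xi> - P' \<xi>)) \<le> hsnorm r (W \<tau>) * hsnorm (-r) (\<lambda>\<xi>. Q \<tau> \<xi> - P' \<xi>)"
      unfolding eventually_at_filter using pr_le[OF W Hs_diff[OF Q P']] by (intro always_eventually allI impI)
  qed
  moreover have "((\<lambda>\<tau>. pr (W \<tau>) P') \<longlongrightarrow> pr (W t) P') (at t within S)"
    using pr_continuous[OF W c P'] t by (auto simp: continuous_on_def)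
  moreover have "((\<lambda>\<tau>. (1 / (\<tau> - t)) *\<^sub>R (pr (W \<tau>) (P t) - pr (W t) (P t))) \<longlongrightarrow> D) (at t within S)"
    using d unfolding has_vector_derivative_iff_quotient .
  ultimately have "((\<lambda>\<tau>. (1 / (\<tau> - t)) *\<^sub>R (pr (W \<tau>) (P t) - pr (W t) (P t)) + (pr (W \<tau>) (\<lambda>\<xi>. Q \<tau> \<xi> - P' \<xi>) + pr (W \<tau>) P'))
     \<longlongrightarrow> D + (0 + pr (W t) P')) (at t within S)"
    by (intro tendsto_add)
  then have lim: "((\<lambda>\<tau>. (1 / (\<tau> - t)) *\<^sub>R (pr (W \<tau>) (P t) - pr (W t) (P t)) + (pr (W \<tau>) (\<lambda>\<xi>. Q \<tau> \<xi> - P' \<xi>) + pr (W \<tau>) P'))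
     \<longlongrightarrow> D + pr (W t) P') (at t within S)" by simp
  have eq: "(1 / (\<tau> - t)) *\<^sub>R (pr (W \<tau>) (P t) - pr (W t) (P t)) + (pr (W \<tau>) (\<lambda>\<xi>. Q \<tau> \<xi> - P' \<xi>) + pr (W \<tau>) P')
      = (1 / (\<tau> - t)) *\<^sub>R (pr (W \<tau>) (P \<tau>) - pr (W t) (P t))" if \<tau>: "\<tau> \<in> S" for \<tau>
  proof -
    have "pr (W \<tau>) (\<lambda>\<xi>. Q \<tau> \<xi> - P' \<xi>) + pr (W \<tau>) P' = complex_of_real (1 / (\<tau> - t)) * (pr (W \<tau>) (P \<tau>) - pr (W \<tau>) (P t))"
      unfolding pr_diff_right[OF W[OF \<tau>] Q P'] by (simp only: diff_add_cancel Q_def pr_cmult_right pr_diff_right[OF W[OF \<tau>] P P])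
    then show ?thesis by (simp add: scaleR_conv_of_real algebra_simps)
  qed
  show ?thesis unfolding has_vector_derivative_iff_quotient
    by (rule Lim_transform_eventually[OF lim])
       (use eq in \<open>auto simp: eventually_at_filter intro!: always_eventually\<close>)
qed

section \<open>Solutions of the dual free wave equation\<close>

definition rot :: "(real \<Rightarrow> complex) \<Rightarrow> (real \<Rightarrow> complex) \<Rightarrow> real \<Rightarrow> real \<Rightarrow> complex" where
  "rot \<alpha> \<beta> \<tau> \<xi> = complex_of_real (cos (2 * pi * \<xi> * \<tau>)) * \<alpha> \<xi> + complex_of_real (sin (2 * pi * \<xi> * \<tau>)) * \<beta> \<xi>"

definition freq :: "(real \<Rightarrow> complex) \<Rightarrow> real \<Rightarrow> complex" where
  "freq g \<xi> = complex_of_real (2 * pi * \<xi>) * g \<xi>"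

lemma nice_freq': "nice g \<Longrightarrow> nice (freq g)"
  using nice_freq[of g] by (simp add: freq_def[abs_def])

lemma nice_rot: "nice \<alpha> \<Longrightarrow> nice \<beta> \<Longrightarrow> nice (rot \<alpha> \<beta> \<tau>)"
  unfolding rot_def[abs_def]
  by (intro nice_add nice_bounded_mult[where C=1]) auto

lemma nice_uminus: "nice g \<Longrightarrow> nice (\<lambda>\<xi>. - g \<xi>)"
  using nice_bounded_mult[of g "\<lambda>_. -1" 1] by simp

text \<open>Differentiation in time stays within the family and only changes the coefficients, so
  two applications give the free oscillator equation by computation.\<close>

lemma rot_deriv:
  "((\<lambda>\<tau>. rot \<alpha> \<beta> \<tau> \<xi>) has_vector_derivative rot (freq \<beta>) (\<lambda>\<xi>. - freq \<alpha> \<xi>) \<tau> \<xi>) (at \<tau> within S)"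
proof -
  have c: "((\<lambda>\<tau>. complex_of_real (cos (2 * pi * \<xi> * \<tau>))) has_vector_derivative complex_of_real (- (2 * pi * \<xi> * sin (2 * pi * \<xi> * \<tau>)))) (at \<tau> within S)"
    by (rule of_real_vector_derivative) (auto intro!: derivative_eq_intros)
  have d: "((\<lambda>\<tau>. complex_of_real (sin (2 * pi * \<xi> * \<tau>))) has_vector_derivative complex_of_real (2 * pi * \<xi> * cos (2 * pi * \<xi> * \<tau>))) (at \<tau> within S)"
    by (rule of_real_vector_derivative) (auto intro!: derivative_eq_intros)
  have "((\<lambda>\<tau>. rot \<alpha> \<beta> \<tau> \<xi>) has_vector_derivative
     (complex_of_real (- (2 * pi * \<xi> * sin (2 * pi * \<xi> * \<tau>))) * \<alpha> \<xi> + complex_of_real (2 * pi * \<xi> * cos (2 * pi * \<xi> * \<tau>)) * \<beta> \<xi>)) (at \<tau> within S)"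
    unfolding rot_def by (intro has_vector_derivative_add has_vector_derivative_mult_left c d)
  then show ?thesis by (simp add: rot_def freq_def algebra_simps)
qed

lemma rot_bound: "cmod (rot \<alpha> \<beta> \<tau> \<xi>) \<le> cmod (\<alpha> \<xi>) + cmod (\<beta> \<xi>)"
proof -
  have "cmod (rot \<alpha> \<beta> \<tau> \<xi>) \<le> 1 * cmod (\<alpha> \<xi>) + 1 * cmod (\<beta> \<xi>)"
    unfolding rot_def
    by (rule order_trans[OF norm_triangle_ineq], unfold norm_mult norm_of_real, intro add_mono mult_right_mono) auto
  then show ?thesis by simp
qed

lemma rot_quotient:
  assumes \<alpha>: "nice \<alpha>" and \<beta>: "nice \<beta>" and r: "r < 7/2"
  shows "((\<lambda>\<tau>. hsnorm r (\<lambda>\<xi>. complex_of_real (1 / (\<tau> - t)) * (rot \<alpha> \<beta> \<tau> \<xi> - rot \<alpha> \<beta> t \<xi>) - rot (freq \<beta>) (\<lambda>\<xi>. - freq \<alpha> \<xi>) t \<xi>)) \<longlongrightarrow> 0) (at t within S)"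
proof -
  let ?P = "rot \<alpha> \<beta>" and ?D = "rot (freq \<beta>) (\<lambda>\<xi>. - freq \<alpha> \<xi>)"
  have D: "nice (freq \<beta>)" "nice (\<lambda>\<xi>. - freq \<alpha> \<xi>)" using \<alpha> \<beta> by (auto intro: nice_freq' nice_uminus)
  note [measurable] = nice_measurable[OF nice_rot[OF \<alpha> \<beta>]] nice_measurable[OF nice_rot[OF D]]
  obtain C1 where C1: "C1 \<ge> 0" "\<And>x. cmod (freq \<beta> x) \<le> C1 * wt (-2) x" using nice_decay[OF D(1)] by blast
  obtain C2 where C2: "C2 \<ge> 0" "\<And>x. cmod (- freq \<alpha> x) \<le> C2 * wt (-2) x" using nice_decay[OF D(2)] by blast
  have Db: "cmod (?D \<tau> \<xi>) \<le> (C1 + C2) * wt (-2) \<xi>" for \<tau> \<xi>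
    using rot_bound[of "freq \<beta>" "\<lambda>\<xi>. - freq \<alpha> \<xi>" \<tau> \<xi>] C1(2)[of \<xi>] C2(2)[of \<xi>] unfolding distrib_right by linarith
  obtain E where E: "bd r (\<lambda>x. ennreal (wt (-2) x)) E" using bd_wt[of 2 r] r by auto
  show ?thesis
  proof (rule hsnorm_tendsto_0_within[OF _ bd_cmult[OF E, of "2 * (C1 + C2)"]])
    show "(\<lambda>\<xi>. complex_of_real (1 / (\<tau> - t)) * (?P \<tau> \<xi> - ?P t \<xi>) - ?D t \<xi>) \<in> borel_measurable borel" for \<tau>
      by measurable
    show "0 \<le> 2 * (C1 + C2)" using C1 C2 by simp
    show "AE \<xi> in lborel. cn (\<lambda>\<xi>. complex_of_real (1 / (\<tau> - t)) * (?P \<tau> \<xi> - ?P t \<xi>) - ?D t \<xi>) \<xi> \<le> ennreal (2 * (C1 + C2)) * ennreal (wt (-2) \<xi>)"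
      if "\<tau> \<in> S - {t}" for \<tau>
    proof (rule AE_I2)
      fix \<xi>
      have "cmod (?P \<tau> \<xi> - ?P t \<xi>) \<le> ((C1 + C2) * wt (-2) \<xi>) * \<bar>\<tau> - t\<bar>"
        by (rule has_vector_derivative_norm_bound[of UNIV "\<lambda>\<tau>. ?P \<tau> \<xi>" "\<lambda>\<tau>. ?D \<tau> \<xi>"]) (auto intro: rot_deriv Db)
      then have "\<bar>1 / (\<tau> - t)\<bar> * cmod (?P \<tau> \<xi> - ?P t \<xi>) \<le> \<bar>1 / (\<tau> - t)\<bar> * (((C1 + C2) * wt (-2) \<xi>) * \<bar>\<tau> - t\<bar>)"
        by (rule mult_left_mono) simp
      also have "\<dots> = (C1 + C2) * wt (-2) \<xi>" using that by (simp add: abs_divide)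
      finally have "cmod (complex_of_real (1 / (\<tau> - t)) * (?P \<tau> \<xi> - ?P t \<xi>)) \<le> (C1 + C2) * wt (-2) \<xi>"
        unfolding norm_mult norm_of_real .
      then have "cmod (complex_of_real (1 / (\<tau> - t)) * (?P \<tau> \<xi> - ?P t \<xi>) - ?D t \<xi>) \<le> 2 * (C1 + C2) * wt (-2) \<xi>"
        using Db[of t \<xi>] norm_triangle_ineq4[of "complex_of_real (1 / (\<tau> - t)) * (?P \<tau> \<xi> - ?P t \<xi>)" "?D t \<xi>"] by linarith
      then have "cn (\<lambda>\<xi>. complex_of_real (1 / (\<tau> - t)) * (?P \<tau> \<xi> - ?P t \<xi>) - ?D t \<xi>) \<xi> \<le> ennreal (2 * (C1 + C2) * wt (-2) \<xi>)"
        unfolding cn_def by (rule ennreal_leI)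
      also have "\<dots> = ennreal (2 * (C1 + C2)) * ennreal (wt (-2) \<xi>)"
        using C1 C2 by (intro ennreal_mult) auto
      finally show "cn (\<lambda>\<xi>. complex_of_real (1 / (\<tau> - t)) * (?P \<tau> \<xi> - ?P t \<xi>) - ?D t \<xi>) \<xi> \<le> ennreal (2 * (C1 + C2)) * ennreal (wt (-2) \<xi>)" .
    qed
    show "AE \<xi> in lborel. ((\<lambda>\<tau>. complex_of_real (1 / (\<tau> - t)) * (?P \<tau> \<xi> - ?P t \<xi>) - ?D t \<xi>) \<longlongrightarrow> 0) (at t within S)"
    proof (rule AE_I2)
      fix \<xi>
      show "((\<lambda>\<tau>. complex_of_real (1 / (\<tau> - t)) * (?P \<tau> \<xi> - ?P t \<xi>) - ?D t \<xi>) \<longlongrightarrow> 0) (at t within S)"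
        using rot_deriv[of \<alpha> \<beta> \<xi> t S] unfolding has_vector_derivative_iff_quotient scaleR_conv_of_real by (rule LIM_zero)
    qed
  qed
qed

lemma hsnorm_le_weight:
  assumes g: "g \<in> Hs r \<Delta>" and [measurable]: "f \<in> borel_measurable borel" and "0 \<le> c"
    and le: "\<And>\<xi>. cmod (f \<xi>) \<le> c * (wt w \<xi> * cmod (g \<xi>))"
  shows "hsnorm (r - 2 * w) f \<le> c * hsnorm r g"
proof (rule hsnorm_le)
  show "bd (r - 2 * w) (cn f) (c * hsnorm r g)"
  proof (rule bd_mono[OF bd_cmult[OF bd_weight[OF bd_hsnorm[OF g], of w] \<open>0 \<le> c\<close>]])
    show "AE \<xi> in lborel. cn f \<xi> \<le> ennreal c * (ennreal (wt w \<xi>) * cn g \<xi>)"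
      using le \<open>0 \<le> c\<close> by (intro AE_I2) (simp add: cn_def ennreal_leI flip: ennreal_mult)
  qed auto
qed measurable

text \<open>Covers both a single solution with its nonlinearity as forcing and the difference of two
  solutions. The equations are assumed only after pairing with nice multipliers, as that is all an
  arbitrary solution offers.\<close>

locale forced_wave =
  fixes \<Gamma> :: "real set" and s T :: real and W Z F :: "real \<Rightarrow> real \<Rightarrow> complex"
  assumes s: "s > -1/2" and T: "0 < T" "T \<le> 1"
    and WH: "\<And>t. t \<in> {-T..T} \<Longrightarrow> W t \<in> Hs s \<Gamma>" and ZH: "\<And>t. t \<in> {-T..T} \<Longrightarrow> Z t \<in> Hs (s - 1) \<Gamma>"
    and FH: "\<And>t. t \<in> {-T..T} \<Longrightarrow> F t \<in> Hs (s - 1) \<Gamma>"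
    and Wc: "\<And>t. t \<in> {-T..T} \<Longrightarrow> ((\<lambda>\<tau>. hsnorm s (\<lambda>\<xi>. W \<tau> \<xi> - W t \<xi>)) \<longlongrightarrow> 0) (at t within {-T..T})"
    and Zc: "\<And>t. t \<in> {-T..T} \<Longrightarrow> ((\<lambda>\<tau>. hsnorm (s - 1) (\<lambda>\<xi>. Z \<tau> \<xi> - Z t \<xi>)) \<longlongrightarrow> 0) (at t within {-T..T})"
    and Wd: "\<And>t g. t \<in> {-T..T} \<Longrightarrow> nice g \<Longrightarrow> ((\<lambda>t. pr (W t) g) has_vector_derivative pr (Z t) g) (at t within {-T..T})"
    and Zd: "\<And>t g. t \<in> {-T..T} \<Longrightarrow> nice g \<Longrightarrow> ((\<lambda>t. pr (Z t) g) has_vector_derivative (pr (F t) g - pr (W t) (wsq g))) (at t within {-T..T})"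
begin

lemma nice_dual: "nice g \<Longrightarrow> g \<in> Hs (- s) UNIV" "nice g \<Longrightarrow> g \<in> Hs (- (s - 1)) UNIV"
  using nice_Hs[of g] s by auto

text \<open>Pairing with a solution of the dual wave equation removes \<open>W\<close> and \<open>Z\<close> from the derivative.\<close>

lemma dual_deriv:
  assumes \<alpha>: "nice \<alpha>" and \<beta>: "nice \<beta>" and t: "t \<in> {-T..T}"
  shows "((\<lambda>\<tau>. pr (Z \<tau>) (rot \<alpha> \<beta> \<tau>) + pr (W \<tau>) (rot (\<lambda>\<xi>. - freq \<beta> \<xi>) (freq \<alpha>) \<tau>))
     has_vector_derivative pr (F t) (rot \<alpha> \<beta> t)) (at t within {-T..T})"
proof -
  let ?P = "rot \<alpha> \<beta>" and ?P' = "rot (freq \<beta>) (\<lambda>\<xi>. - freq \<alpha> \<xi>)"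
  let ?Q = "rot (\<lambda>\<xi>. - freq \<beta> \<xi>) (freq \<alpha>)" and ?Q' = "rot (freq (freq \<alpha>)) (\<lambda>\<xi>. - freq (\<lambda>\<xi>. - freq \<beta> \<xi>) \<xi>)"
  have n: "nice (freq \<alpha>)" "nice (freq \<beta>)" "nice (\<lambda>\<xi>. - freq \<alpha> \<xi>)" "nice (\<lambda>\<xi>. - freq \<beta> \<xi>)"
    "nice (freq (freq \<alpha>))" "nice (\<lambda>\<xi>. - freq (\<lambda>\<xi>. - freq \<beta> \<xi>) \<xi>)"
    using \<alpha> \<beta> by (auto intro!: nice_freq' nice_uminus)
  have nP: "nice (?P \<tau>)" "nice (?P' \<tau>)" "nice (?Q \<tau>)" "nice (?Q' \<tau>)" for \<tau>
    using n \<alpha> \<beta> by (auto intro!: nice_rot)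
  have 1: "((\<lambda>\<tau>. pr (Z \<tau>) (?P \<tau>)) has_vector_derivative (pr (F t) (?P t) - pr (W t) (wsq (?P t))) + pr (Z t) (?P' t)) (at t within {-T..T})"
    by (rule pr_product_deriv[OF t ZH Zc nice_dual(2)[OF nP(1)] nice_dual(2)[OF nP(2)] rot_quotient[OF \<alpha> \<beta>] Zd[OF t nP(1)]])
       (use s in auto)
  have 2: "((\<lambda>\<tau>. pr (W \<tau>) (?Q \<tau>)) has_vector_derivative pr (Z t) (?Q t) + pr (W t) (?Q' t)) (at t within {-T..T})"
    by (rule pr_product_deriv[OF t WH Wc nice_dual(1)[OF nP(3)] nice_dual(1)[OF nP(4)] rot_quotient[OF n(4,1)] Wd[OF t nP(3)]])
       (use s in auto)
  \<comment> \<open>The two identities say that \<open>?P\<close> solves the free wave equation with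
    velocity \<open>- ?Q\<close>; they cancel the terms with \<open>W\<close> and with
    \<open>Z\<close> respectively.\<close>
  have Q': "?Q' t = wsq (?P t)"
    by (simp add: fun_eq_iff rot_def freq_def wsq_def power2_eq_square algebra_simps)
  have P': "?P' t = (\<lambda>\<xi>. (-1) * ?Q t \<xi>)"
    by (simp add: fun_eq_iff rot_def freq_def algebra_simps)
  have "pr (Z t) (?P' t) = - pr (Z t) (?Q t)" unfolding P' pr_cmult_right by simp
  then show ?thesis using has_vector_derivative_add[OF 1 2] unfolding Q' by simp
qed

lemma dual_estimate:
  assumes \<alpha>: "nice \<alpha>" and \<beta>: "nice \<beta>" and t: "t \<in> {-T..T}" and "0 \<le> \<Phi>" "0 \<le> c"
    and \<Phi>: "\<And>\<tau>. \<bar>\<tau>\<bar> \<le> \<bar>t\<bar> \<Longrightarrow> hsnorm (s - 1) (F \<tau>) \<le> \<Phi>"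
    and c: "\<And>\<tau>. \<bar>\<tau>\<bar> \<le> \<bar>t\<bar> \<Longrightarrow> hsnorm (- (s - 1)) (rot \<alpha> \<beta> \<tau>) \<le> c"
    and c': "hsnorm (- s) (rot (\<lambda>\<xi>. - freq \<beta> \<xi>) (freq \<alpha>) 0) \<le> c'"
  shows "cmod (pr (Z t) (rot \<alpha> \<beta> t) + pr (W t) (rot (\<lambda>\<xi>. - freq \<beta> \<xi>) (freq \<alpha>) t))
     \<le> hsnorm (s - 1) (Z 0) * c + hsnorm s (W 0) * c' + T * (\<Phi> * c)"
proof -
  let ?P = "rot \<alpha> \<beta>" and ?Q = "rot (\<lambda>\<xi>. - freq \<beta> \<xi>) (freq \<alpha>)"
  let ?f = "\<lambda>\<tau>. pr (Z \<tau>) (?P \<tau>) + pr (W \<tau>) (?Q \<tau>)"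
  \<comment> \<open>A symmetric interval treats positive and negative \<open>t\<close> at
    once.\<close>
  have sub: "{-\<bar>t\<bar>..\<bar>t\<bar>} \<subseteq> {-T..T}" using t by auto
  have nP: "nice (?P \<tau>)" "nice (?Q \<tau>)" for \<tau> using \<alpha> \<beta> by (auto intro!: nice_rot nice_freq' nice_uminus)
  have "cmod (?f t - ?f 0) \<le> (\<Phi> * c) * \<bar>t - 0\<bar>"
  proof (rule has_vector_derivative_norm_bound[of "{-\<bar>t\<bar>..\<bar>t\<bar>}" ?f "\<lambda>\<tau>. pr (F \<tau>) (?P \<tau>)"])
    fix \<tau> assume \<tau>: "\<tau> \<in> {-\<bar>t\<bar>..\<bar>t\<bar>}"
    then have \<tau>': "\<tau> \<in> {-T..T}" "\<bar>\<tau>\<bar> \<le> \<bar>t\<bar>" using sub by auto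
    show "(?f has_vector_derivative pr (F \<tau>) (?P \<tau>)) (at \<tau> within {-\<bar>t\<bar>..\<bar>t\<bar>})"
      by (rule has_vector_derivative_within_subset[OF dual_deriv[OF \<alpha> \<beta> \<tau>'(1)] sub])
    show "cmod (pr (F \<tau>) (?P \<tau>)) \<le> \<Phi> * c"
      by (rule order_trans[OF pr_le[OF FH[OF \<tau>'(1)] nice_dual(2)[OF nP(1)]]])
         (intro mult_mono \<Phi>[OF \<tau>'(2)] c[OF \<tau>'(2)], use \<open>0 \<le> \<Phi>\<close> in auto)
  qed auto
  also have "\<dots> \<le> (\<Phi> * c) * T" using t \<open>0 \<le> \<Phi>\<close> \<open>0 \<le> c\<close> by (intro mult_left_mono) auto
  finally have 1: "cmod (?f t - ?f 0) \<le> T * (\<Phi> * c)" by (simp add: mult.commute)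
  have 0: "0 \<in> {-T..T}" using T by simp
  have c'0: "0 \<le> c'" using order_trans[OF hsnorm_nonneg c'] .
  have "cmod (pr (Z 0) (?P 0)) \<le> hsnorm (s - 1) (Z 0) * c"
    by (rule order_trans[OF pr_le[OF ZH[OF 0] nice_dual(2)[OF nP(1)]]]) (intro mult_left_mono c, auto)
  moreover have "cmod (pr (W 0) (?Q 0)) \<le> hsnorm s (W 0) * c'"
    by (rule order_trans[OF pr_le[OF WH[OF 0] nice_dual(1)[OF nP(2)]]]) (intro mult_left_mono c', auto)
  ultimately have "cmod (?f 0) \<le> hsnorm (s - 1) (Z 0) * c + hsnorm s (W 0) * c'"
    using norm_triangle_mono by blast
  then show ?thesis using 1 norm_triangle_sub[of "?f t" "?f 0"] by linarith
qed

text \<open>The dual solution is prescribed at the terminal time \<open>t\<close>. To isolate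
  \<open>W t\<close> it is the one with value 0 and companion \<open>g\<close>, namely the
  propagator at time \<open>t - \<tau>\<close> applied to \<open>g\<close>; to isolate
  \<open>Z t\<close> it has value \<open>g\<close> and companion 0. Duality then converts the bounds
  on pairings into norms.\<close>

lemma energy:
  assumes t: "t \<in> {-T..T}" and \<Phi>: "0 \<le> \<Phi>" "\<And>\<tau>. \<bar>\<tau>\<bar> \<le> \<bar>t\<bar> \<Longrightarrow> hsnorm (s - 1) (F \<tau>) \<le> \<Phi>"
  shows "hsnorm s (W t) \<le> 3 * (hsnorm s (W 0) + hsnorm (s - 1) (Z 0)) + 3 * T * \<Phi>"
    and "hsnorm (s - 1) (Z t) \<le> 7 * (hsnorm s (W 0) + hsnorm (s - 1) (Z 0)) + T * \<Phi>"
proof -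
  let ?d = "hsnorm s (W 0) + hsnorm (s - 1) (Z 0)"
  have d0: "0 \<le> hsnorm s (W 0)" "0 \<le> hsnorm (s - 1) (Z 0)" by auto
  show "hsnorm s (W t) \<le> 3 * ?d + 3 * T * \<Phi>"
  proof (rule hsnorm_duality[OF WH[OF t]])
    show "0 \<le> 3 * ?d + 3 * T * \<Phi>" using d0 T \<Phi>(1) by (intro add_nonneg_nonneg mult_nonneg_nonneg) auto
    fix g assume g: "nice g"
    let ?n = "hsnorm (- s) g"
    note [measurable] = nice_measurable[OF g]
    from g obtain \<delta> where \<delta>: "0 < \<delta>" "\<And>x. g x \<noteq> 0 \<Longrightarrow> \<delta> \<le> \<bar>x\<bar>" by (auto simp: nice_def)
    have g0: "g 0 = 0" using \<delta>(2)[of 0] \<delta>(1) by auto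
    \<comment> \<open>Coefficients of the propagator at \<open>t - \<tau>\<close> when expanded in
      cosine and sine of \<open>\<tau>\<close>. Division by the frequency is harmless since
      \<open>g\<close> vanishes near the origin.\<close>
    define \<alpha> where "\<alpha> \<xi> = complex_of_real (1 / (2 * pi * \<xi>)) * (complex_of_real (sin (2 * pi * \<xi> * t)) * g \<xi>)" for \<xi>
    define \<beta> where "\<beta> \<xi> = complex_of_real (1 / (2 * pi * \<xi>)) * (complex_of_real (- cos (2 * pi * \<xi> * t)) * g \<xi>)" for \<xi>
    have \<alpha>: "nice \<alpha>" and \<beta>: "nice \<beta>"
      unfolding \<alpha>_def[abs_def] \<beta>_def[abs_def] by (intro nice_inverse_freq nice_bounded_mult[OF g, where C=1]; auto)+
    have P: "rot \<alpha> \<beta> \<tau> \<xi> = complex_of_real (sprop (t - \<tau>) \<xi>) * g \<xi>" for \<tau> \<xi>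
    proof (cases "\<xi> = 0")
      case False
      have "rot \<alpha> \<beta> \<tau> \<xi> = complex_of_real ((sin (2 * pi * \<xi> * t) * cos (2 * pi * \<xi> * \<tau>) - cos (2 * pi * \<xi> * t) * sin (2 * pi * \<xi> * \<tau>)) / (2 * pi * \<xi>)) * g \<xi>"
        by (simp add: rot_def \<alpha>_def \<beta>_def diff_divide_distrib algebra_simps)
      then show ?thesis using False by (simp only: sin_diff[symmetric] right_diff_distrib[symmetric] sprop_def if_False)
    qed (simp add: rot_def \<alpha>_def \<beta>_def g0)
    have Q: "rot (\<lambda>\<xi>. - freq \<beta> \<xi>) (freq \<alpha>) \<tau> \<xi> = complex_of_real (cos (2 * pi * \<xi> * (t - \<tau>))) * g \<xi>" for \<tau> \<xi>
    proof (cases "\<xi> = 0")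
      case False
      have "rot (\<lambda>\<xi>. - freq \<beta> \<xi>) (freq \<alpha>) \<tau> \<xi> = complex_of_real (cos (2 * pi * \<xi> * t) * cos (2 * pi * \<xi> * \<tau>) + sin (2 * pi * \<xi> * t) * sin (2 * pi * \<xi> * \<tau>)) * g \<xi>"
        using False by (simp add: rot_def \<alpha>_def \<beta>_def freq_def algebra_simps)
      then show ?thesis by (simp only: cos_diff[symmetric] right_diff_distrib[symmetric])
    qed (simp add: rot_def \<alpha>_def \<beta>_def freq_def g0)
    have "rot \<alpha> \<beta> t = (\<lambda>_. 0)" by (simp add: fun_eq_iff P sprop_def)
    moreover have "rot (\<lambda>\<xi>. - freq \<beta> \<xi>) (freq \<alpha>) t = g" by (simp add: fun_eq_iff Q)
    moreover have "cmod (pr (Z t) (rot \<alpha> \<beta> t) + pr (W t) (rot (\<lambda>\<xi>. - freq \<beta> \<xi>) (freq \<alpha>) t))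
       \<le> hsnorm (s - 1) (Z 0) * (3 * ?n) + hsnorm s (W 0) * ?n + T * (\<Phi> * (3 * ?n))"
    proof (rule dual_estimate[OF \<alpha> \<beta> t \<Phi>(1) _ \<Phi>(2)])
      show "hsnorm (- (s - 1)) (rot \<alpha> \<beta> \<tau>) \<le> 3 * ?n" if "\<bar>\<tau>\<bar> \<le> \<bar>t\<bar>" for \<tau>
      proof -
        have "hsnorm (- s - 2 * (-1/2)) (rot \<alpha> \<beta> \<tau>) \<le> 3 * ?n"
        proof (rule hsnorm_le_weight[OF nice_dual(1)[OF g] nice_measurable[OF nice_rot[OF \<alpha> \<beta>]]])
          fix \<xi>
          \<comment> \<open>Both times lie in [-1, 1], so |t - \<tau>| + 1 \<le> 3: the origin of
            the constant 3.\<close>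
          have "\<bar>t - \<tau>\<bar> \<le> 2" using that t T by auto
          then have "(\<bar>t - \<tau>\<bar> + 1) * wt (-1/2) \<xi> \<le> 3 * wt (-1/2) \<xi>" by (intro mult_right_mono) auto
          then have "\<bar>sprop (t - \<tau>) \<xi>\<bar> \<le> 3 * wt (-1/2) \<xi>"
            using abs_sprop_weight[of "t - \<tau>" \<xi>] by linarith
          then show "cmod (rot \<alpha> \<beta> \<tau> \<xi>) \<le> 3 * (wt (-1/2) \<xi> * cmod (g \<xi>))"
            unfolding P norm_mult norm_of_real mult.assoc[symmetric] by (rule mult_right_mono) simp
        qed simp
        then show ?thesis by simp
      qed
      have "hsnorm (- s - 2 * 0) (rot (\<lambda>\<xi>. - freq \<beta> \<xi>) (freq \<alpha>) 0) \<le> 1 * ?n"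
      proof (rule hsnorm_le_weight[OF nice_dual(1)[OF g]])
        show "rot (\<lambda>\<xi>. - freq \<beta> \<xi>) (freq \<alpha>) 0 \<in> borel_measurable borel"
          using \<alpha> \<beta> by (intro nice_measurable nice_rot nice_freq' nice_uminus)
        show "cmod (rot (\<lambda>\<xi>. - freq \<beta> \<xi>) (freq \<alpha>) 0 \<xi>) \<le> 1 * (wt 0 \<xi> * cmod (g \<xi>))" for \<xi>
          unfolding Q norm_mult norm_of_real by (simp add: mult_left_le_one_le)
      qed simp
      then show "hsnorm (- s) (rot (\<lambda>\<xi>. - freq \<beta> \<xi>) (freq \<alpha>) 0) \<le> ?n" by simp
    qed simp
    ultimately have "cmod (pr (W t) g) \<le> hsnorm (s - 1) (Z 0) * (3 * ?n) + hsnorm s (W 0) * ?n + T * (\<Phi> * (3 * ?n))"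
      by (simp add: pr_def)
    also have "\<dots> \<le> (3 * ?d + 3 * T * \<Phi>) * ?n"
      using mult_nonneg_nonneg[OF d0(1), of ?n] by (simp add: algebra_simps)
    finally show "cmod (pr (W t) g) \<le> (3 * ?d + 3 * T * \<Phi>) * ?n" .
  qed
  show "hsnorm (s - 1) (Z t) \<le> 7 * ?d + T * \<Phi>"
  proof (rule hsnorm_duality[OF ZH[OF t]])
    show "0 \<le> 7 * ?d + T * \<Phi>" using d0 T \<Phi>(1) by (intro add_nonneg_nonneg mult_nonneg_nonneg) auto
    fix g assume g: "nice g"
    let ?n = "hsnorm (- (s - 1)) g"
    note [measurable] = nice_measurable[OF g]
    define \<alpha> where "\<alpha> \<xi> = complex_of_real (cos (2 * pi * \<xi> * t)) * g \<xi>" for \<xi>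
    define \<beta> where "\<beta> \<xi> = complex_of_real (sin (2 * pi * \<xi> * t)) * g \<xi>" for \<xi>
    have \<alpha>: "nice \<alpha>" and \<beta>: "nice \<beta>"
      unfolding \<alpha>_def[abs_def] \<beta>_def[abs_def] by (intro nice_bounded_mult[OF g, where C=1]; auto)+
    have P: "rot \<alpha> \<beta> \<tau> \<xi> = complex_of_real (cos (2 * pi * \<xi> * (t - \<tau>))) * g \<xi>" for \<tau> \<xi>
    proof -
      have "rot \<alpha> \<beta> \<tau> \<xi> = complex_of_real (cos (2 * pi * \<xi> * t) * cos (2 * pi * \<xi> * \<tau>) + sin (2 * pi * \<xi> * t) * sin (2 * pi * \<xi> * \<tau>)) * g \<xi>"
        by (simp add: rot_def \<alpha>_def \<beta>_def algebra_simps)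
      then show ?thesis by (simp only: cos_diff[symmetric] right_diff_distrib[symmetric])
    qed
    have Q: "rot (\<lambda>\<xi>. - freq \<beta> \<xi>) (freq \<alpha>) \<tau> \<xi> = complex_of_real (- (2 * pi * \<xi> * sin (2 * pi * \<xi> * (t - \<tau>)))) * g \<xi>" for \<tau> \<xi>
    proof -
      have "rot (\<lambda>\<xi>. - freq \<beta> \<xi>) (freq \<alpha>) \<tau> \<xi> = complex_of_real (- (2 * pi * \<xi> * (sin (2 * pi * \<xi> * t) * cos (2 * pi * \<xi> * \<tau>) - cos (2 * pi * \<xi> * t) * sin (2 * pi * \<xi> * \<tau>)))) * g \<xi>"
        by (simp add: rot_def \<alpha>_def \<beta>_def freq_def algebra_simps)
      then show ?thesis by (simp only: sin_diff[symmetric] right_diff_distrib[symmetric])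
    qed
    have "rot \<alpha> \<beta> t = g" by (simp add: fun_eq_iff P)
    moreover have "rot (\<lambda>\<xi>. - freq \<beta> \<xi>) (freq \<alpha>) t = (\<lambda>_. 0)" by (simp add: fun_eq_iff Q)
    moreover have "cmod (pr (Z t) (rot \<alpha> \<beta> t) + pr (W t) (rot (\<lambda>\<xi>. - freq \<beta> \<xi>) (freq \<alpha>) t))
       \<le> hsnorm (s - 1) (Z 0) * ?n + hsnorm s (W 0) * (7 * ?n) + T * (\<Phi> * ?n)"
    proof (rule dual_estimate[OF \<alpha> \<beta> t \<Phi>(1) _ \<Phi>(2)])
      show "hsnorm (- (s - 1)) (rot \<alpha> \<beta> \<tau>) \<le> ?n" for \<tau>
      proof -
        have "hsnorm (- (s - 1) - 2 * 0) (rot \<alpha> \<beta> \<tau>) \<le> 1 * ?n"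
        proof (rule hsnorm_le_weight[OF nice_dual(2)[OF g] nice_measurable[OF nice_rot[OF \<alpha> \<beta>]]])
          show "cmod (rot \<alpha> \<beta> \<tau> \<xi>) \<le> 1 * (wt 0 \<xi> * cmod (g \<xi>))" for \<xi>
            unfolding P norm_mult norm_of_real by (simp add: mult_left_le_one_le)
        qed simp
        then show ?thesis by simp
      qed
      have "hsnorm (- (s - 1) - 2 * (1/2)) (rot (\<lambda>\<xi>. - freq \<beta> \<xi>) (freq \<alpha>) 0) \<le> 7 * ?n"
      proof (rule hsnorm_le_weight[OF nice_dual(2)[OF g]])
        show "rot (\<lambda>\<xi>. - freq \<beta> \<xi>) (freq \<alpha>) 0 \<in> borel_measurable borel"
          using \<alpha> \<beta> by (intro nice_measurable nice_rot nice_freq' nice_uminus)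
        fix \<xi>
        have "\<bar>2 * pi * \<xi> * sin (2 * pi * \<xi> * t)\<bar> \<le> (2 * pi * \<bar>\<xi>\<bar>) * 1"
          unfolding abs_mult by (intro mult_mono) auto
        \<comment> \<open>The constant 7 is an upper bound for 2 \<pi>.\<close>
        also have "\<dots> \<le> (7 * wt (1/2) \<xi>) * 1"
          using pi_less_4 pi_approx abs_le_wt_half[of \<xi>] by (intro mult_mono) auto
        finally show "cmod (rot (\<lambda>\<xi>. - freq \<beta> \<xi>) (freq \<alpha>) 0 \<xi>) \<le> 7 * (wt (1/2) \<xi> * cmod (g \<xi>))"
          unfolding Q norm_mult norm_of_real mult.assoc[symmetric] by (intro mult_right_mono) auto
      qed simp
      then show "hsnorm (- s) (rot (\<lambda>\<xi>. - freq \<beta> \<xi>) (freq \<alpha>) 0) \<le> 7 * ?n" by simp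
    qed simp
    ultimately have "cmod (pr (Z t) g) \<le> hsnorm (s - 1) (Z 0) * ?n + hsnorm s (W 0) * (7 * ?n) + T * (\<Phi> * ?n)"
      by (simp add: pr_def)
    also have "\<dots> \<le> (7 * ?d + T * \<Phi>) * ?n"
      using mult_nonneg_nonneg[OF d0(2), of ?n] by (simp add: algebra_simps)
    finally show "cmod (pr (Z t) g) \<le> (7 * ?d + T * \<Phi>) * ?n" .
  qed
qed

end

section \<open>Uniqueness and Lipschitz dependence\<close>

lemma hsnorm_cont_diff:
  assumes W: "\<And>t. t \<in> S \<Longrightarrow> W t \<in> Hs r \<Gamma>" and W': "\<And>t. t \<in> S \<Longrightarrow> W' t \<in> Hs r \<Gamma>"
    and c: "((\<lambda>\<tau>. hsnorm r (\<lambda>\<xi>. W \<tau> \<xi> - W t \<xi>)) \<longlongrightarrow> 0) (at t within S)"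
    and c': "((\<lambda>\<tau>. hsnorm r (\<lambda>\<xi>. W' \<tau> \<xi> - W' t \<xi>)) \<longlongrightarrow> 0) (at t within S)" and t: "t \<in> S"
  shows "((\<lambda>\<tau>. hsnorm r (\<lambda>\<xi>. (W \<tau> \<xi> - W' \<tau> \<xi>) - (W t \<xi> - W' t \<xi>))) \<longlongrightarrow> 0) (at t within S)"
proof (rule Lim_null_comparison)
  show "((\<lambda>\<tau>. hsnorm r (\<lambda>\<xi>. W \<tau> \<xi> - W t \<xi>) + hsnorm r (\<lambda>\<xi>. W' \<tau> \<xi> - W' t \<xi>)) \<longlongrightarrow> 0) (at t within S)"
    using tendsto_add[OF c c'] by simp
  show "\<forall>\<^sub>F \<tau> in at t within S. norm (hsnorm r (\<lambda>\<xi>. (W \<tau> \<xi> - W' \<tau> \<xi>) - (W t \<xi> - W' t \<xi>)))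
     \<le> hsnorm r (\<lambda>\<xi>. W \<tau> \<xi> - W t \<xi>) + hsnorm r (\<lambda>\<xi>. W' \<tau> \<xi> - W' t \<xi>)"
    unfolding eventually_at_filter
  proof (intro always_eventually allI impI)
    fix \<tau> assume \<tau>: "\<tau> \<in> S"
    have "(\<lambda>\<xi>. (W \<tau> \<xi> - W' \<tau> \<xi>) - (W t \<xi> - W' t \<xi>)) = (\<lambda>\<xi>. (W \<tau> \<xi> - W t \<xi>) - (W' \<tau> \<xi> - W' t \<xi>))"
      by (simp add: fun_eq_iff)
    then show "norm (hsnorm r (\<lambda>\<xi>. (W \<tau> \<xi> - W' \<tau> \<xi>) - (W t \<xi> - W' t \<xi>)))
     \<le> hsnorm r (\<lambda>\<xi>. W \<tau> \<xi> - W t \<xi>) + hsnorm r (\<lambda>\<xi>. W' \<tau> \<xi> - W' t \<xi>)"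
      using hsnorm_diff_le[OF Hs_diff[OF W[OF \<tau>] W[OF t]] Hs_diff[OF W'[OF \<tau>] W'[OF t]]] by simp
  qed
qed

section \<open>A priori bound for an arbitrary solution\<close>

context wsol
begin

lemma nice_good: "nice g \<Longrightarrow> good g"
proof -
  assume g: "nice g"
  then obtain B \<rho> where "\<And>x. cmod (g x) \<le> B" "\<And>x. g x \<noteq> 0 \<Longrightarrow> \<bar>x\<bar> \<le> \<rho>" by (auto simp: nice_def)
  then show ?thesis using good_bounded[OF nice_measurable[OF g], of B \<rho>] by force
qed

lemma U_pr_deriv_nice:
  assumes "t \<in> I" "nice g"
  shows "((\<lambda>\<tau>. pr (U \<tau>) g) has_vector_derivative pr (V t) g) (at t within I)"
  using U_pr_deriv[OF assms(1) nice_Hs[OF assms(2)]] s by simp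

lemma forced_wave_self:
  assumes "T \<le> 1"
  shows "forced_wave \<Gamma> s T U V (\<lambda>t \<xi>. complex_of_real \<sigma> * N t \<xi>)"
proof
  fix t assume t: "t \<in> I"
  show "(\<lambda>\<xi>. complex_of_real \<sigma> * N t \<xi>) \<in> Hs (s - 1) \<Gamma>" by (rule Hs_cmult[OF NH[OF t]])
  fix g assume g: "nice g"
  show "((\<lambda>t. pr (V t) g) has_vector_derivative (pr (\<lambda>\<xi>. complex_of_real \<sigma> * N t \<xi>) g - pr (U t) (wsq g))) (at t within I)"
    using V_pr_deriv[OF nice_good[OF g] t] by (simp add: h_def pr_cmult_left)
qed (use s T assms UH VH U_cont V_cont U_pr_deriv_nice in auto)

lemma U_0_AE: "v0 \<in> Hs s \<Gamma> \<Longrightarrow> AE \<xi> in lborel. U 0 \<xi> = v0 \<xi>"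
  and V_0_AE: "v1 \<in> Hs (s - 1) \<Gamma> \<Longrightarrow> AE \<xi> in lborel. V 0 \<xi> = v1 \<xi>"
proof -
  have 0: "0 \<in> I" using T by simp
  show "AE \<xi> in lborel. U 0 \<xi> = v0 \<xi>" if "v0 \<in> Hs s \<Gamma>"
    using hsnorm_zero_AE[OF Hs_diff[OF UH[OF 0] that] U_0] by simp
  show "AE \<xi> in lborel. V 0 \<xi> = v1 \<xi>" if "v1 \<in> Hs (s - 1) \<Gamma>"
    using hsnorm_zero_AE[OF Hs_diff[OF VH[OF 0] that] V_0] by simp
qed

text \<open>Continuity argument: at a time \<open>u\<close> of smallest modulus where the norm
  reaches \<open>R\<close>, the bound \<open>R\<close> holds at all times of smaller modulus, so the
  energy inequality gives 3 D + 1/2 there and, by continuity, at \<open>u\<close>. The gap to R = 3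
  D + 1 is the contradiction.\<close>

lemma a_priori:
  assumes T1: "T \<le> 1" and \<sigma>: "\<bar>\<sigma>\<bar> \<le> 1" and D: "hsnorm s (U 0) + hsnorm (s - 1) (V 0) \<le> D"
    and R: "R = 3 * D + 1" and small: "3 * T * (K * R ^ Suc q) \<le> 1/2" and t: "t \<in> I"
  shows "hsnorm s (U t) \<le> R"
proof (rule ccontr)
  interpret forced_wave \<Gamma> s T U V "\<lambda>t \<xi>. complex_of_real \<sigma> * N t \<xi>" by (rule forced_wave_self[OF T1])
  have D0: "0 \<le> D" using D hsnorm_nonneg[of s "U 0"] hsnorm_nonneg[of "s - 1" "V 0"] by linarith
  have R0: "0 \<le> R" using D0 R by simp
  have step: "hsnorm s (U u) \<le> 3 * D + 1/2" if u: "u \<in> I" and le: "\<And>\<tau>. \<bar>\<tau>\<bar> \<le> \<bar>u\<bar> \<Longrightarrow> hsnorm s (U \<tau>) \<le> R" for u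
  proof -
    have "hsnorm (s - 1) (\<lambda>\<xi>. complex_of_real \<sigma> * N \<tau> \<xi>) \<le> K * R ^ Suc q" if "\<bar>\<tau>\<bar> \<le> \<bar>u\<bar>" for \<tau>
    proof -
      have \<tau>: "\<tau> \<in> I" using that u by auto
      have "hsnorm (s - 1) (\<lambda>\<xi>. complex_of_real \<sigma> * N \<tau> \<xi>) \<le> \<bar>\<sigma>\<bar> * hsnorm (s - 1) (N \<tau>)"
        using hsnorm_cmult_le[OF NH[OF \<tau>], of "complex_of_real \<sigma>"] by simp
      also have "\<dots> \<le> 1 * hsnorm (s - 1) (N \<tau>)" using \<sigma> by (intro mult_right_mono) auto
      also have "\<dots> \<le> K * hsnorm s (U \<tau>) ^ Suc q" unfolding N_def using conv_power_Hs(2)[OF UH[OF \<tau>]] by simp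
      also have "\<dots> \<le> K * R ^ Suc q" using K0 le[OF that] by (intro mult_left_mono power_mono) auto
      finally show ?thesis .
    qed
    moreover have "0 \<le> K * R ^ Suc q" using K0 R0 by simp
    ultimately have "hsnorm s (U u) \<le> 3 * (hsnorm s (U 0) + hsnorm (s - 1) (V 0)) + 3 * T * (K * R ^ Suc q)"
      by (intro energy(1)[OF u]) auto
    moreover have "3 * (hsnorm s (U 0) + hsnorm (s - 1) (V 0)) \<le> 3 * D" using D by (intro mult_left_mono) auto
    ultimately show ?thesis using small by (intro order_trans[OF _ add_mono[of _ "3 * D" _ "1/2"]])
  qed
  define f where "f u = hsnorm s (U u)" for u
  have cf: "continuous_on I f" unfolding f_def by (rule hsnorm_continuous[OF UH U_cont])
  define S where "S = {u \<in> I. R \<le> f u}"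
  assume "\<not> hsnorm s (U t) \<le> R"
  then have "t \<in> S" using t by (simp add: S_def f_def)
  have "compact S"
  proof -
    have "closed S" unfolding S_def
      using continuous_closed_preimage[OF cf _ closed_atLeast[of R]] by (simp add: vimage_def Int_def)
    then show ?thesis using compact_Int_closed[of I S] by (simp add: S_def Int_def conj_commute cong: conj_cong)
  qed
  then obtain u where u: "u \<in> S" "\<And>v. v \<in> S \<Longrightarrow> \<bar>u\<bar> \<le> \<bar>v\<bar>"
    using continuous_attains_inf[of S "\<lambda>u. \<bar>u\<bar>"] \<open>t \<in> S\<close> continuous_on_rabs[OF continuous_on_id, of S] by auto
  have uI: "u \<in> I" using u by (simp add: S_def)
  \<comment> \<open>Points approaching \<open>u\<close> from the side of the origin. Their modulus
    is strictly smaller than that of \<open>u\<close>, so no time up to that modulus lies in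
    \<open>S\<close>.\<close>
  define x where "x n = u * (1 - 1 / real (Suc n))" for n
  have x: "x \<longlonglongrightarrow> u * (1 - 0)" unfolding x_def by (intro tendsto_intros LIMSEQ_Suc[OF lim_1_over_n])
  have u0: "u \<noteq> 0"
  proof
    assume "u = 0"
    then have "R \<le> hsnorm s (U 0)" using u(1) by (simp add: S_def f_def)
    then show False using D R D0 hsnorm_nonneg[of "s - 1" "V 0"] by linarith
  qed
  have xlt: "\<bar>x n\<bar> < \<bar>u\<bar>" for n
  proof -
    have "\<bar>1 - 1 / real (Suc n)\<bar> < 1" by (simp add: abs_less_iff)
    then have "\<bar>u\<bar> * \<bar>1 - 1 / real (Suc n)\<bar> < \<bar>u\<bar> * 1" using u0 by (intro mult_strict_left_mono) auto
    then show ?thesis by (simp add: x_def abs_mult)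
  qed
  have xI: "x n \<in> I" for n using xlt[of n] uI by auto
  have "f (x n) \<le> 3 * D + 1/2" for n
    unfolding f_def
  proof (rule step[OF xI])
    fix \<tau> assume "\<bar>\<tau>\<bar> \<le> \<bar>x n\<bar>"
    then have "\<bar>\<tau>\<bar> < \<bar>u\<bar>" using xlt[of n] by linarith
    then have "\<tau> \<notin> S" "\<tau> \<in> I" using u(2)[of \<tau>] uI by auto
    then show "hsnorm s (U \<tau>) \<le> R" by (simp add: S_def f_def)
  qed
  moreover have "(\<lambda>n. f (x n)) \<longlonglongrightarrow> f u"
    using cf x xI uI unfolding continuous_on_sequentially by (auto simp: o_def)
  ultimately have "f u \<le> 3 * D + 1/2" by (intro LIMSEQ_le_const2) auto
  then show False using u(1) R by (simp add: S_def)
qed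

end

text \<open>The difference of two solutions in the ball of radius \<open>R\<close> is a wave forced
  by at most K R^q times the largest value of the difference over the interval. That maximum is
  attained by continuity, and for short times the forcing is absorbed into the left-hand side, so no
  Gronwall argument is needed.\<close>

lemma wave_lipschitz:
  assumes A: "wsol \<Gamma> s \<sigma> T K q v0 v1 U V" and B: "wsol \<Gamma> s \<sigma> T K q w0 w1 U' V'"
    and T1: "T \<le> 1" and \<sigma>: "\<bar>\<sigma>\<bar> \<le> 1" and R0: "0 \<le> R"
    and RU: "\<And>t. t \<in> {-T..T} \<Longrightarrow> hsnorm s (U t) \<le> R" and RU': "\<And>t. t \<in> {-T..T} \<Longrightarrow> hsnorm s (U' t) \<le> R"
    and small: "3 * T * (K * R ^ q) \<le> 1/2" and t: "t \<in> {-T..T}"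
  shows "hsnorm s (\<lambda>\<xi>. U t \<xi> - U' t \<xi>) + hsnorm (s - 1) (\<lambda>\<xi>. V t \<xi> - V' t \<xi>)
     \<le> 14 * (hsnorm s (\<lambda>\<xi>. U 0 \<xi> - U' 0 \<xi>) + hsnorm (s - 1) (\<lambda>\<xi>. V 0 \<xi> - V' 0 \<xi>))"
proof -
  interpret A: wsol \<Gamma> s \<sigma> T K q v0 v1 U V by (rule A)
  interpret B: wsol \<Gamma> s \<sigma> T K q w0 w1 U' V' by (rule B)
  define W where "W t = (\<lambda>\<xi>. U t \<xi> - U' t \<xi>)" for t
  define Z where "Z t = (\<lambda>\<xi>. V t \<xi> - V' t \<xi>)" for t
  define F where "F t = (\<lambda>\<xi>. complex_of_real \<sigma> * (A.N t \<xi> - B.N t \<xi>))" for t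
  interpret F: forced_wave \<Gamma> s T W Z F
  proof
    fix t assume t: "t \<in> {-T..T}"
    show "W t \<in> Hs s \<Gamma>" unfolding W_def by (rule Hs_diff[OF A.UH[OF t] B.UH[OF t]])
    show "Z t \<in> Hs (s - 1) \<Gamma>" unfolding Z_def by (rule Hs_diff[OF A.VH[OF t] B.VH[OF t]])
    show "F t \<in> Hs (s - 1) \<Gamma>" unfolding F_def by (rule Hs_cmult[OF Hs_diff[OF A.NH[OF t] B.NH[OF t]]])
    show "((\<lambda>\<tau>. hsnorm s (\<lambda>\<xi>. W \<tau> \<xi> - W t \<xi>)) \<longlongrightarrow> 0) (at t within {-T..T})"
      unfolding W_def by (rule hsnorm_cont_diff[OF A.UH B.UH A.U_cont[OF t] B.U_cont[OF t] t])
    show "((\<lambda>\<tau>. hsnorm (s - 1) (\<lambda>\<xi>. Z \<tau> \<xi> - Z t \<xi>)) \<longlongrightarrow> 0) (at t within {-T..T})"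
      unfolding Z_def by (rule hsnorm_cont_diff[OF A.VH B.VH A.V_cont[OF t] B.V_cont[OF t] t])
    fix g assume g: "nice g"
    have g1: "g \<in> Hs (- s) UNIV" "g \<in> Hs (- (s - 1)) UNIV" "g \<in> Hs (2 - s) UNIV" using nice_Hs[OF g] A.s by auto
    have prW: "pr (W u) g = pr (U u) g - pr (U' u) g" if "u \<in> {-T..T}" for u
      unfolding W_def by (rule pr_diff_left[OF A.UH[OF that] B.UH[OF that] g1(1)])
    have prZ: "pr (Z u) g = pr (V u) g - pr (V' u) g" if "u \<in> {-T..T}" for u
      unfolding Z_def by (rule pr_diff_left[OF A.VH[OF that] B.VH[OF that] g1(2)])
    have "((\<lambda>t. pr (U t) g - pr (U' t) g) has_vector_derivative pr (V t) g - pr (V' t) g) (at t within {-T..T})"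
      by (intro has_vector_derivative_diff A.U_pr_deriv_nice[OF t g] B.U_pr_deriv_nice[OF t g])
    then show "((\<lambda>t. pr (W t) g) has_vector_derivative pr (Z t) g) (at t within {-T..T})"
      unfolding prZ[OF t] by (rule has_vector_derivative_transform[rotated -1]) (use t prW in auto)
    have "((\<lambda>t. pr (V t) g - pr (V' t) g) has_vector_derivative A.h g t - B.h g t) (at t within {-T..T})"
      by (intro has_vector_derivative_diff A.V_pr_deriv[OF A.nice_good[OF g] t] B.V_pr_deriv[OF B.nice_good[OF g] t])
    moreover have "A.h g t - B.h g t = pr (F t) g - pr (W t) (wsq g)"
      unfolding A.h_def B.h_def F_def W_def pr_cmult_left
        pr_diff_left[OF A.NH[OF t] B.NH[OF t] g1(2)] pr_diff_left[OF A.UH[OF t] B.UH[OF t] wsq_Hs[OF g1(3)]]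
      by (simp add: algebra_simps)
    ultimately have "((\<lambda>t. pr (V t) g - pr (V' t) g) has_vector_derivative pr (F t) g - pr (W t) (wsq g)) (at t within {-T..T})"
      by simp
    then show "((\<lambda>t. pr (Z t) g) has_vector_derivative pr (F t) g - pr (W t) (wsq g)) (at t within {-T..T})"
      by (rule has_vector_derivative_transform[rotated -1]) (use t prZ in auto)
  qed (use A.s A.T T1 in auto)
  let ?d = "hsnorm s (W 0) + hsnorm (s - 1) (Z 0)"
  have "continuous_on {-T..T} (\<lambda>t. hsnorm s (W t))" by (rule hsnorm_continuous[OF F.WH F.Wc])
  moreover have "{-T..T} \<noteq> {}" using A.T by simp
  ultimately obtain u where u: "u \<in> {-T..T}" "\<And>v. v \<in> {-T..T} \<Longrightarrow> hsnorm s (W v) \<le> hsnorm s (W u)"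
    using continuous_attains_sup[of "{-T..T}" "\<lambda>t. hsnorm s (W t)"] by auto
  let ?S = "hsnorm s (W u)"
  let ?\<Phi> = "K * R ^ q * ?S"
  have \<Phi>: "hsnorm (s - 1) (F \<tau>) \<le> ?\<Phi>" if \<tau>: "\<tau> \<in> {-T..T}" for \<tau>
  proof -
    have "hsnorm (s - 1) (F \<tau>) \<le> \<bar>\<sigma>\<bar> * hsnorm (s - 1) (\<lambda>\<xi>. A.N \<tau> \<xi> - B.N \<tau> \<xi>)"
      unfolding F_def using hsnorm_cmult_le[OF Hs_diff[OF A.NH[OF \<tau>] B.NH[OF \<tau>]], of "complex_of_real \<sigma>"] by simp
    also have "\<dots> \<le> 1 * hsnorm (s - 1) (\<lambda>\<xi>. A.N \<tau> \<xi> - B.N \<tau> \<xi>)" using \<sigma> by (intro mult_right_mono) auto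
    also have "\<dots> \<le> K * R ^ q * hsnorm s (W \<tau>)"
      unfolding A.N_def B.N_def W_def using A.KL[OF A.UH[OF \<tau>] B.UH[OF \<tau>] RU[OF \<tau>] RU'[OF \<tau>]] by simp
    also have "\<dots> \<le> ?\<Phi>" using A.K0 R0 by (intro mult_left_mono u(2)[OF \<tau>]) auto
    finally show ?thesis .
  qed
  have \<Phi>0: "0 \<le> ?\<Phi>" using A.K0 R0 by simp
  have T\<Phi>: "3 * T * ?\<Phi> \<le> ?S / 2"
    using mult_right_mono[OF small, of ?S] by (simp add: mult.assoc)
  have sub: "hsnorm (s - 1) (F \<tau>) \<le> ?\<Phi>" if "\<bar>\<tau>\<bar> \<le> \<bar>v\<bar>" "v \<in> {-T..T}" for \<tau> v
    by (rule \<Phi>) (use that in auto)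
  have "?S \<le> 3 * ?d + 3 * T * ?\<Phi>" by (rule F.energy(1)[OF u(1) \<Phi>0 sub[OF _ u(1)]])
  then have S: "?S \<le> 6 * ?d" using T\<Phi> by linarith
  have "hsnorm (s - 1) (Z t) \<le> 7 * ?d + T * ?\<Phi>" by (rule F.energy(2)[OF t \<Phi>0 sub[OF _ t]])
  moreover have "hsnorm s (W t) \<le> ?S" by (rule u(2)[OF t])
  \<comment> \<open>Absorption gives 6 for \<open>W\<close>; for \<open>Z\<close> it is 7 plus one
    sixth of the 6, and the total is 14.\<close>
  ultimately have "hsnorm s (W t) + hsnorm (s - 1) (Z t) \<le> 14 * ?d" using S T\<Phi> by linarith
  then show ?thesis by (simp add: W_def Z_def)
qed

text \<open>Existence at the given data is the case of distance 0 from (u0, u1), and uniqueness is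
  the Lipschitz bound for equal data, where the difference has norm 0 at every time. The bound
  concerns all solutions with data in the neighbourhood, and \<open>T\<close> and \<open>L\<close>
  are common to that neighbourhood.\<close>

theorem theorem6p1:
  fixes \<Gamma> :: "real set" and p :: nat and s \<sigma> :: real and u0 u1 :: "real \<Rightarrow> complex"
  assumes "\<Gamma> = {0..} \<or> \<Gamma> = {..0}"
    and "2 \<le> p"
    and "(p = 2 \<and> s > -1/2) \<or> (p \<ge> 3 \<and> s > 1/2 - 1 / (2 * real p - 4))"
    and "\<sigma> = 1 \<or> \<sigma> = -1"
    and "u0 \<in> Hs s \<Gamma>" and "u1 \<in> Hs (s - 1) \<Gamma>"
  shows "\<exists>T>0. \<exists>r>0. \<exists>L.
     (\<forall>v0 v1. v0 \<in> Hs s \<Gamma> \<longrightarrow> v1 \<in> Hs (s - 1) \<Gamma>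
        \<longrightarrow> hsnorm s (\<lambda>\<xi>. v0 \<xi> - u0 \<xi>) + hsnorm (s - 1) (\<lambda>\<xi>. v1 \<xi> - u1 \<xi>) < r
        \<longrightarrow> (\<exists>U V. wave_sol \<Gamma> p \<sigma> s T v0 v1 U V))
   \<and> (\<forall>v0 v1 w0 w1 U V U' V'.
        v0 \<in> Hs s \<Gamma> \<longrightarrow> v1 \<in> Hs (s - 1) \<Gamma> \<longrightarrow> w0 \<in> Hs s \<Gamma> \<longrightarrow> w1 \<in> Hs (s - 1) \<Gamma>
        \<longrightarrow> hsnorm s (\<lambda>\<xi>. v0 \<xi> - u0 \<xi>) + hsnorm (s - 1) (\<lambda>\<xi>. v1 \<xi> - u1 \<xi>) < r
        \<longrightarrow> hsnorm s (\<lambda>\<xi>. w0 \<xi> - u0 \<xi>) + hsnorm (s - 1) (\<lambda>\<xi>. w1 \<xi> - u1 \<xi>) < r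
        \<longrightarrow> wave_sol \<Gamma> p \<sigma> s T v0 v1 U V \<longrightarrow> wave_sol \<Gamma> p \<sigma> s T w0 w1 U' V'
        \<longrightarrow> (\<forall>t\<in>{-T..T}. hsnorm s (\<lambda>\<xi>. U t \<xi> - U' t \<xi>) + hsnorm (s - 1) (\<lambda>\<xi>. V t \<xi> - V' t \<xi>)
               \<le> L * (hsnorm s (\<lambda>\<xi>. v0 \<xi> - w0 \<xi>) + hsnorm (s - 1) (\<lambda>\<xi>. v1 \<xi> - w1 \<xi>))))"
proof -
  have \<Gamma>: "half_line \<Gamma>" using assms(1) by (simp add: half_line_def)
  define q where "q = p - 1"
  have q: "1 \<le> q" and p: "p = Suc q" using assms(2) by (auto simp: q_def)
  have \<sigma>: "\<bar>\<sigma>\<bar> \<le> 1" using assms(4) by auto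
  have sq: "s > 1/2 - 1 / real q"
  proof (cases "p = 2")
    case True
    then show ?thesis using assms(3) by (simp add: q_def)
  next
    case False
    then have p3: "p \<ge> 3" "s > 1/2 - 1 / (2 * real p - 4)" using assms(2,3) by auto
    \<comment> \<open>For \<open>p \<ge> 3\<close> one has 2 p - 4 \<ge> p - 1.\<close>
    have "1 / (2 * real p - 4) \<le> 1 / real q"
      using p3(1) by (intro divide_left_mono) (auto simp: q_def of_nat_diff)
    then show ?thesis using p3(2) by linarith
  qed
  have s: "s > -1/2"
  proof -
    have "1 / real q \<le> 1" using q by simp
    then show ?thesis using sq by linarith
  qed
  obtain K where K0: "1 \<le> K"
    and K: "\<And>f B. bd s f B \<Longrightarrow> supp_in \<Gamma> f \<Longrightarrow> bd (s - 1) (npow f q) (K * B ^ Suc q)"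
    and KL: "\<And>F G R. F \<in> Hs s \<Gamma> \<Longrightarrow> G \<in> Hs s \<Gamma> \<Longrightarrow> hsnorm s F \<le> R \<Longrightarrow> hsnorm s G \<le> R
        \<Longrightarrow> hsnorm (s - 1) (\<lambda>x. conv_power F q x - conv_power G q x) \<le> K * R ^ q * hsnorm s (\<lambda>x. F x - G x)"
    using nonlinear_estimates[OF \<Gamma> q sq] by blast
  \<comment> \<open>The summand 1 is the radius of the neighbourhood, so \<open>D\<close> bounds all
    data considered; \<open>R\<close> below is the radius from \<open>a_priori\<close>.\<close>
  define D where "D = hsnorm s u0 + hsnorm (s - 1) u1 + 1"
  define R where "R = 3 * D + 1"
  \<comment> \<open>Chosen so that T K R^(q+1) = 1/6. This gives 1/2 in the smallness conditions of
    the a priori and, since \<open>R \<ge> 1\<close>, of the Lipschitz estimate, and adds only 1/3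
    to the linear part in the Picard ball.\<close>
  define T where "T = 1 / (6 * (K * R ^ Suc q))"
  have D1: "1 \<le> D" by (simp add: D_def)
  then have R1: "1 \<le> R" by (simp add: R_def)
  have KR: "1 \<le> K * R ^ Suc q" using mult_mono[OF K0 one_le_power[OF R1, of "Suc q"]] K0 by simp
  have T: "0 < T" "T \<le> 1" using KR by (auto simp: T_def divide_le_eq)
  have TK: "T * (K * R ^ Suc q) = 1/6"
  proof -
    have "K * R ^ Suc q \<noteq> 0" using KR by linarith
    then show ?thesis unfolding T_def by (simp del: power_Suc)
  qed
  have TK': "3 * T * (K * R ^ q) \<le> 1/2"
  proof -
    have "K * R ^ q \<le> K * R ^ Suc q" using K0 R1 by (intro mult_left_mono power_increasing) auto
    then have "T * (K * R ^ q) \<le> T * (K * R ^ Suc q)" by (rule mult_left_mono) (use T in simp)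
    then show ?thesis unfolding TK by simp
  qed
  have near: "hsnorm s v0 + hsnorm (s - 1) v1 \<le> D"
    if "v0 \<in> Hs s \<Gamma>" "v1 \<in> Hs (s - 1) \<Gamma>" "hsnorm s (\<lambda>\<xi>. v0 \<xi> - u0 \<xi>) + hsnorm (s - 1) (\<lambda>\<xi>. v1 \<xi> - u1 \<xi>) < 1" for v0 v1
    using hsnorm_le_diff[OF that(1) assms(5)] hsnorm_le_diff[OF that(2) assms(6)] that(3) unfolding D_def by linarith
  have ex: "\<exists>U V. wave_sol \<Gamma> p \<sigma> s T v0 v1 U V"
    if v: "v0 \<in> Hs s \<Gamma>" "v1 \<in> Hs (s - 1) \<Gamma>" "hsnorm s (\<lambda>\<xi>. v0 \<xi> - u0 \<xi>) + hsnorm (s - 1) (\<lambda>\<xi>. v1 \<xi> - u1 \<xi>) < 1" for v0 v1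
  proof -
    interpret picard \<Gamma> s \<sigma> T R K q v0 v1
    proof
      show "hsnorm s v0 + 2 * hsnorm (s - 1) v1 + 2 * T * (K * R ^ Suc q) \<le> R"
        using near[OF v] TK hsnorm_nonneg[of s v0] hsnorm_nonneg[of "s - 1" v1] D1 unfolding R_def mult.assoc by linarith
    qed (use \<Gamma> q T \<sigma> v K R1 in auto)
    show ?thesis unfolding p using picard_wave_sol[OF s] by blast
  qed
  have lip: "hsnorm s (\<lambda>\<xi>. U t \<xi> - U' t \<xi>) + hsnorm (s - 1) (\<lambda>\<xi>. V t \<xi> - V' t \<xi>)
      \<le> 14 * (hsnorm s (\<lambda>\<xi>. v0 \<xi> - w0 \<xi>) + hsnorm (s - 1) (\<lambda>\<xi>. v1 \<xi> - w1 \<xi>))"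
    if v: "v0 \<in> Hs s \<Gamma>" "v1 \<in> Hs (s - 1) \<Gamma>" and w: "w0 \<in> Hs s \<Gamma>" "w1 \<in> Hs (s - 1) \<Gamma>"
      and vn: "hsnorm s (\<lambda>\<xi>. v0 \<xi> - u0 \<xi>) + hsnorm (s - 1) (\<lambda>\<xi>. v1 \<xi> - u1 \<xi>) < 1"
      and wn: "hsnorm s (\<lambda>\<xi>. w0 \<xi> - u0 \<xi>) + hsnorm (s - 1) (\<lambda>\<xi>. w1 \<xi> - u1 \<xi>) < 1"
      and sol: "wave_sol \<Gamma> p \<sigma> s T v0 v1 U V" "wave_sol \<Gamma> p \<sigma> s T w0 w1 U' V'" and t: "t \<in> {-T..T}"
    for v0 v1 w0 w1 U V U' V' t
  proof -
    have A: "wsol \<Gamma> s \<sigma> T K q v0 v1 U V"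
      by unfold_locales (rule \<Gamma> q T(1) s sol(1)[unfolded p] K0 K KL; assumption)+
    have B: "wsol \<Gamma> s \<sigma> T K q w0 w1 U' V'"
      by unfold_locales (rule \<Gamma> q T(1) s sol(2)[unfolded p] K0 K KL; assumption)+
    interpret A: wsol \<Gamma> s \<sigma> T K q v0 v1 U V by (rule A)
    interpret B: wsol \<Gamma> s \<sigma> T K q w0 w1 U' V' by (rule B)
    have 0: "0 \<in> {-T..T}" using T by simp
    note [measurable] = Hs_measurable[OF A.UH[OF 0]] Hs_measurable[OF A.VH[OF 0]] Hs_measurable[OF B.UH[OF 0]] Hs_measurable[OF B.VH[OF 0]]
      Hs_measurable[OF v(1)] Hs_measurable[OF v(2)] Hs_measurable[OF w(1)] Hs_measurable[OF w(2)]
    have small: "3 * T * (K * R ^ Suc q) \<le> 1/2" using TK by simp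
    have nU: "hsnorm s (U 0) = hsnorm s v0" "hsnorm (s - 1) (V 0) = hsnorm (s - 1) v1"
      by (intro hsnorm_cong_AE A.U_0_AE A.V_0_AE v; measurable)+
    have nU': "hsnorm s (U' 0) = hsnorm s w0" "hsnorm (s - 1) (V' 0) = hsnorm (s - 1) w1"
      by (intro hsnorm_cong_AE B.U_0_AE B.V_0_AE w; measurable)+
    have RU: "hsnorm s (U \<tau>) \<le> R" if "\<tau> \<in> {-T..T}" for \<tau>
      by (rule A.a_priori[OF T(2) \<sigma> _ R_def small that]) (use near[OF v vn] nU in simp)
    have RU': "hsnorm s (U' \<tau>) \<le> R" if "\<tau> \<in> {-T..T}" for \<tau>
      by (rule B.a_priori[OF T(2) \<sigma> _ R_def small that]) (use near[OF w wn] nU' in simp)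
    have "hsnorm s (\<lambda>\<xi>. U 0 \<xi> - U' 0 \<xi>) = hsnorm s (\<lambda>\<xi>. v0 \<xi> - w0 \<xi>)"
    proof (rule hsnorm_cong_AE)
      show "AE \<xi> in lborel. U 0 \<xi> - U' 0 \<xi> = v0 \<xi> - w0 \<xi>"
        using A.U_0_AE[OF v(1)] B.U_0_AE[OF w(1)] by eventually_elim simp
    qed measurable
    moreover have "hsnorm (s - 1) (\<lambda>\<xi>. V 0 \<xi> - V' 0 \<xi>) = hsnorm (s - 1) (\<lambda>\<xi>. v1 \<xi> - w1 \<xi>)"
    proof (rule hsnorm_cong_AE)
      show "AE \<xi> in lborel. V 0 \<xi> - V' 0 \<xi> = v1 \<xi> - w1 \<xi>"
        using A.V_0_AE[OF v(2)] B.V_0_AE[OF w(2)] by eventually_elim simp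
    qed measurable
    ultimately show ?thesis
      using wave_lipschitz[OF A B T(2) \<sigma> _ RU RU' TK' t] R1 by simp
  qed
  show ?thesis
    by (intro exI[of _ T] exI[of _ 1] exI[of _ 14] conjI allI impI ballI T(1) zero_less_one ex lip) assumption+
qed

end
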